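(* For every uniformly absorbing atomless MDP with bounded measurable reward vector-function with values in $\mathbb R^N$, $$\mathcal V^{\mathbb F}=\mathcal V ,$$ that is, the set of performance vectors of all deterministic policies coincides with the set of performance vectors of all policies.
   Context: A standard Borel space is a measurable space isomorphic to a Borel subset of a Polish space. An MDP consists of: a standard Borel state space $\bar{\mathbb X}$; a standard Borel action space $(\mathbb A,\mathcal A)$; nonempty sets $A(x)\in\mathcal A$ of available actions, $x\in\bar{\mathbb X}$, such that $\{(x,a):x\in\bar{\mathbb X},a\in A(x)\}$ is measurable; a transition probability $p$ from $\bar{\mathbb X}\times\mathbb A$ to $\bar{\mathbb X}$; a fixed initial probability distribution $\mu$ on $\bar{\mathbb X}$; a bounded measurable reward vector-function $r=(r^{(1)},\ldots,r^{(N)}):\bar{\mathbb X}\times\mathbb A\to\mathbb R^N$, $N\ge1$. It is always assumed that there is at least one selector, i.e. a measurable map $\phi$ from the state space to $\mathbb A$ with $\phi(x)\in A(x)$ for all $x$. A policy $\pi$ is a sequence of transition probabilities $\pi_t$, $t=0,1,\ldots$, from the set of histories $h_t=(x_0,a_0,x_1,\ldots,x_t)$ to $\mathbb A$ with $\pi_t(A(x_t)|h_t)=1$; $\Pi$ is the set of all policies. A policy is nonrandomized if every $\pi_t(\cdot|h_t)$ is concentrated at one point, Markov if each $\pi_t(\cdot|h_t)$ depends only on $x_t$, and stationary if it is Markov and $\pi_t(\cdot|x)$ does not depend on $t$. $\mathbb M$ is the set of nonrandomized Markov policies and $\mathbb F$ is the set of deterministic (nonrandomized stationary) policies, identified with selectors.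 $P^\pi,E^\pi$ are the probability and expectation on trajectories determined by $\mu,\pi,p$. For a state $x$ let $T^{x}=\inf\{t=0,1,\ldots: x_t=x\}$. The MDP is absorbing if there is a state $\bar x\in\bar{\mathbb X}$ (fixed) such that: (i) $\mu(\{\bar x\})=0$; (ii) $A(\bar x)=\{\bar a\}$ for some $\bar a\in\mathbb A$, $p(\{\bar x\}|\bar x,\bar a)=1$, $r(\bar x,\bar a)=0$; (iii) there is a finite constant $L$ with $E^\pi T^{\bar x}\le L$ for all $\pi\in\Pi$. Put $\mathbb X=\bar{\mathbb X}\setminus\{\bar x\}$. An absorbing MDP is uniformly absorbing if $\lim_{n\to\infty}\sup_{\pi\in\mathbb M}E^\pi\sum_{t=n}^\infty I\{t<T^{\bar x}\}=0$ ($I$ denotes the indicator). An absorbing MDP is atomless if $\mu(\{x\})=0$ and $p(\{y\}|x,a)=0$ for all $x,y\in\mathbb X$ and $a\in A(x)$. The performance vector of $\pi$ is $v^\pi=E^\pi\sum_{t=0}^{T^{\bar x}-1}r(x_t,a_t)=E^\pi\sum_{t=0}^\infty r(x_t,a_t)\in\mathbb R^N$. For $\Delta\subset\Pi$, $\mathcal V^\Delta=\{v^\pi:\pi\in\Delta\}$, and $\mathcal V=\mathcal V^\Pi$. *)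

theory Defs
  imports "HOL-Probability.Probability"
begin

definition polish_topology :: "'a topology \<Rightarrow> bool" where
  "polish_topology Y \<longleftrightarrow> completely_metrizable_space Y \<and> second_countable Y"

definition borel_measure_of :: "'a topology \<Rightarrow> 'a measure" where
  "borel_measure_of Y = sigma (topspace Y) {U. openin Y U}"

definition measurable_isomorphic :: "'a measure \<Rightarrow> 'b measure \<Rightarrow> bool" where
  "measurable_isomorphic M N \<longleftrightarrow>
     (\<exists>f \<in> M \<rightarrow>\<^sub>M N. \<exists>g \<in> N \<rightarrow>\<^sub>M M.
        (\<forall>x\<in>space M. g (f x) = x) \<and> (\<forall>y\<in>space N. f (g y) = y))"

text \<open>A Polish space has at most continuum many points, so up to homeomorphism its underlying
  set is a set of reals. Letting \<open>Y\<close> range over all Polish topologies whose points are reals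
  (the topology itself is arbitrary and unrelated to that of the real line, and
  \<open>topspace Y\<close> is an arbitrary set of reals) therefore covers all Polish spaces
  without quantifying over types.\<close>

definition standard_borel :: "'a measure \<Rightarrow> bool" where
  "standard_borel M \<longleftrightarrow>
     (\<exists>(Y :: real topology) B. polish_topology Y \<and> B \<in> sets (borel_measure_of Y) \<and>
        measurable_isomorphic M (restrict_space (borel_measure_of Y) B))"

text \<open>\<open>X\<close> and \<open>A\<close> serve as measurable spaces only: their measures play no role.
  Since \<^term>\<open>prob_algebra N\<close> is the space of probability measures on \<open>N\<close>, a
  transition probability from \<open>M\<close> to \<open>N\<close> is an element of \<^term>\<open>M \<rightarrow>\<^sub>M prob_algebra N\<close>.\<close>

locale mdp =
  fixes X :: "'x measure" and A :: "'a measure" and Act :: "'x \<Rightarrow> 'a set"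
    and p :: "'x \<times> 'a \<Rightarrow> 'x measure" and \<mu> :: "'x measure"
    and r :: "'x \<times> 'a \<Rightarrow> real ^ 'n"
  assumes standard_borel_states: "standard_borel X"
    and standard_borel_actions: "standard_borel A"
    and Act_sets: "\<And>x. x \<in> space X \<Longrightarrow> Act x \<in> sets A"
    and Act_nonempty: "\<And>x. x \<in> space X \<Longrightarrow> Act x \<noteq> {}"
    and Act_graph: "{(x, a). x \<in> space X \<and> a \<in> Act x} \<in> sets (X \<Otimes>\<^sub>M A)"
    and transition: "p \<in> X \<Otimes>\<^sub>M A \<rightarrow>\<^sub>M prob_algebra X"
    and initial: "\<mu> \<in> space (prob_algebra X)"
    and reward_measurable: "r \<in> borel_measurable (X \<Otimes>\<^sub>M A)"
    and reward_bounded: "\<exists>C. \<forall>x\<in>space X. \<forall>a\<in>space A. norm (r (x, a)) \<le> C"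
    and selector_exists: "\<exists>\<phi> \<in> X \<rightarrow>\<^sub>M A. \<forall>x\<in>space X. \<phi> x \<in> Act x"
begin

text \<open>The history \<open>(x_0, a_0, \<dots>, x_(t-1), a_(t-1), x_t)\<close> is encoded as
  \<open>(h, x_t)\<close> with \<open>h i = (x_i, a_i)\<close> for \<open>i < t\<close>.\<close>

definition histories :: "nat \<Rightarrow> ((nat \<Rightarrow> 'x \<times> 'a) \<times> 'x) measure" where
  "histories t = (\<Pi>\<^sub>M i\<in>{0..<t}. X \<Otimes>\<^sub>M A) \<Otimes>\<^sub>M X"

definition policies :: "(nat \<Rightarrow> (nat \<Rightarrow> 'x \<times> 'a) \<times> 'x \<Rightarrow> 'a measure) set" where
  "policies = {\<pi>. \<forall>t. \<pi> t \<in> histories t \<rightarrow>\<^sub>M prob_algebra A \<and>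
     (\<forall>(h, x)\<in>space (histories t). measure (\<pi> t (h, x)) (Act x) = 1)}"

definition nonrandomized :: "(nat \<Rightarrow> (nat \<Rightarrow> 'x \<times> 'a) \<times> 'x \<Rightarrow> 'a measure) \<Rightarrow> bool" where
  "nonrandomized \<pi> \<longleftrightarrow>
     (\<forall>t. \<forall>hx\<in>space (histories t). \<exists>a\<in>space A. measure (\<pi> t hx) {a} = 1)"

definition markov :: "(nat \<Rightarrow> (nat \<Rightarrow> 'x \<times> 'a) \<times> 'x \<Rightarrow> 'a measure) \<Rightarrow> bool" where
  "markov \<pi> \<longleftrightarrow>
     (\<forall>t h h' x. (h, x) \<in> space (histories t) \<longrightarrow> (h', x) \<in> space (histories t) \<longrightarrow>
        \<pi> t (h, x) = \<pi> t (h', x))"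

definition stationary :: "(nat \<Rightarrow> (nat \<Rightarrow> 'x \<times> 'a) \<times> 'x \<Rightarrow> 'a measure) \<Rightarrow> bool" where
  "stationary \<pi> \<longleftrightarrow> markov \<pi> \<and>
     (\<forall>s t h h' x. (h, x) \<in> space (histories s) \<longrightarrow> (h', x) \<in> space (histories t) \<longrightarrow>
        \<pi> s (h, x) = \<pi> t (h', x))"

definition nonrandomized_markov_policies where
  "nonrandomized_markov_policies = {\<pi> \<in> policies. nonrandomized \<pi> \<and> markov \<pi>}"

definition deterministic_policies where
  "deterministic_policies = {\<pi> \<in> policies. nonrandomized \<pi> \<and> stationary \<pi>}"

text \<open>Conditional law of \<open>(x_t, a_t)\<close> given \<open>h = (x_0, a_0, \<dots>, x_(t-1), a_(t-1))\<close>.\<close>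

definition step_kernel where
  "step_kernel \<pi> t h =
     (if t = 0 then \<mu> else p (h (t - 1))) \<bind>
       (\<lambda>x. \<pi> t (h, x) \<bind> (\<lambda>a. return (X \<Otimes>\<^sub>M A) (x, a)))"

text \<open>The law of the trajectory \<open>(x_0, a_0), (x_1, a_1), \<dots>\<close>, as given by the
  Ionescu-Tulcea theorem.\<close>

definition trajectory_law ::
    "(nat \<Rightarrow> (nat \<Rightarrow> 'x \<times> 'a) \<times> 'x \<Rightarrow> 'a measure) \<Rightarrow> (nat \<Rightarrow> 'x \<times> 'a) measure" where
  "trajectory_law \<pi> = projective_family.lim UNIV
     (Ionescu_Tulcea.CI (step_kernel \<pi>) (\<lambda>_. X \<Otimes>\<^sub>M A)) (\<lambda>_. X \<Otimes>\<^sub>M A)"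

lemma Ionescu_Tulcea_step_kernel:
  assumes "\<pi> \<in> policies"
  shows "Ionescu_Tulcea (step_kernel \<pi>) (\<lambda>_. X \<Otimes>\<^sub>M A)"
proof -
  have \<pi>[measurable]: "\<pi> t \<in> (\<Pi>\<^sub>M i\<in>{0..<t}. X \<Otimes>\<^sub>M A) \<Otimes>\<^sub>M X \<rightarrow>\<^sub>M prob_algebra A" for t
    using assms by (auto simp: policies_def histories_def)
  note [measurable] = transition
  have *: "step_kernel \<pi> t \<in> (\<Pi>\<^sub>M i\<in>{0..<t}. X \<Otimes>\<^sub>M A) \<rightarrow>\<^sub>M prob_algebra (X \<Otimes>\<^sub>M A)" for t
  proof -
    have 1: "(\<lambda>h. if t = 0 then \<mu> else p (h (t - 1))) \<in> (\<Pi>\<^sub>M i\<in>{0..<t}. X \<Otimes>\<^sub>M A) \<rightarrow>\<^sub>M prob_algebra X"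
    proof (cases "t = 0")
      case True
      then show ?thesis
        using initial by simp
    next
      case False
      then have "(\<lambda>h. p (h (t - 1))) \<in> (\<Pi>\<^sub>M i\<in>{0..<t}. X \<Otimes>\<^sub>M A) \<rightarrow>\<^sub>M prob_algebra X"
        by (intro measurable_compose[OF _ transition] measurable_component_singleton) auto
      with False show ?thesis by simp
    qed
    have 2: "(\<lambda>(h, x). \<pi> t (h, x) \<bind> (\<lambda>a. return (X \<Otimes>\<^sub>M A) (x, a)))
        \<in> (\<Pi>\<^sub>M i\<in>{0..<t}. X \<Otimes>\<^sub>M A) \<Otimes>\<^sub>M X \<rightarrow>\<^sub>M prob_algebra (X \<Otimes>\<^sub>M A)"
      by measurable
    show ?thesis
      unfolding step_kernel_def[abs_def] by (rule measurable_bind_prob_space2[OF 1 2])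
  qed
  show ?thesis
    unfolding Ionescu_Tulcea_def
    using measurable_prob_algebraD[OF *] measurable_space[OF *] by (auto simp: space_prob_algebra)
qed

end

definition hitting_time :: "'x \<Rightarrow> (nat \<Rightarrow> 'x \<times> 'a) \<Rightarrow> enat" where
  "hitting_time y \<omega> = Inf {enat t | t. fst (\<omega> t) = y}"

locale absorbing_mdp = mdp X A Act p \<mu> r
  for X :: "'x measure" and A :: "'a measure" and Act p \<mu> and r :: "'x \<times> 'a \<Rightarrow> real ^ 'n" +
  fixes xbar :: 'x
  assumes xbar_state: "xbar \<in> space X"
    and initial_xbar: "measure \<mu> {xbar} = 0"
    and absorbing: "\<exists>abar\<in>space A. Act xbar = {abar} \<and> measure (p (xbar, abar)) {xbar} = 1 \<and>
          r (xbar, abar) = 0"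
    and finite_lifetime: "\<exists>L::real. \<forall>\<pi>\<in>policies.
          (\<integral>\<^sup>+ \<omega>. ennreal_of_enat (hitting_time xbar \<omega>) \<partial>trajectory_law \<pi>) \<le> ennreal L"
begin

text \<open>Almost every trajectory hits \<open>xbar\<close> (by \<open>finite_lifetime\<close>), so the series below is
  almost surely the finite sum over \<open>t < hitting_time xbar \<omega>\<close>.\<close>

definition performance :: "(nat \<Rightarrow> (nat \<Rightarrow> 'x \<times> 'a) \<times> 'x \<Rightarrow> 'a measure) \<Rightarrow> real ^ 'n" where
  "performance \<pi> =
     (\<integral>\<omega>. (\<Sum>t. if enat t < hitting_time xbar \<omega> then r (\<omega> t) else 0) \<partial>trajectory_law \<pi>)"

definition performance_set ::
    "(nat \<Rightarrow> (nat \<Rightarrow> 'x \<times> 'a) \<times> 'x \<Rightarrow> 'a measure) set \<Rightarrow> (real ^ 'n) set" where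
  "performance_set \<Delta> = {performance \<pi> | \<pi>. \<pi> \<in> \<Delta>}"

end

locale uniformly_absorbing_mdp = absorbing_mdp X A Act p \<mu> r xbar
  for X :: "'x measure" and A :: "'a measure" and Act p \<mu>
    and r :: "'x \<times> 'a \<Rightarrow> real ^ 'n" and xbar +
  assumes uniformly_absorbing:
    "(\<lambda>n. SUP \<pi>\<in>nonrandomized_markov_policies.
        \<integral>\<^sup>+ \<omega>. (\<Sum>t. if n \<le> t \<and> enat t < hitting_time xbar \<omega> then 1 else 0) \<partial>trajectory_law \<pi>)
      \<longlonglongrightarrow> (0::ennreal)"

locale atomless_mdp = absorbing_mdp X A Act p \<mu> r xbar
  for X :: "'x measure" and A :: "'a measure" and Act p \<mu>
    and r :: "'x \<times> 'a \<Rightarrow> real ^ 'n" and xbar +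
  assumes initial_atomless: "\<And>x. x \<in> space X - {xbar} \<Longrightarrow> measure \<mu> {x} = 0"
    and transition_atomless:
      "\<And>x y a. x \<in> space X - {xbar} \<Longrightarrow> y \<in> space X - {xbar} \<Longrightarrow> a \<in> Act x \<Longrightarrow>
         measure (p (x, a)) {y} = 0"

end

theory Submission
  imports Defs
begin

text \<open>
  The proof replaces policies by simpler objects, in four moves.

  \<^bold>\<open>Policies to plans.\<close> Performance depends on a policy only through the laws of the pairs
  \<open>(x_t, a_t)\<close>. Each of these laws disintegrates: the action may be drawn as \<open>c_t (x_t, u)\<close> from a
  uniform seed \<open>u\<close> (\<open>disintegration\<close>). A sequence of such maps \<open>c_t\<close> is called a plan
  here; plans and policies realize the same laws (\<open>plan_of_policy\<close>,
  \<open>coord_law_policy_of\<close>).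

  \<^bold>\<open>Plans to finite mixtures.\<close> If all seeds are drawn before the start, a plan becomes a random
  nonrandomized Markov plan, so its value vector is a mean of value vectors of nonrandomized
  Markov plans. In a finite-dimensional space the mean of a random vector lies in the convex hull
  of its values, whether or not that hull is closed (\<open>integral_in_convex_hull\<close>). Hence the
  vector is a finite convex combination.

  \<^bold>\<open>Mixtures to a stationary control.\<close> The same convex combination of occupation measures is
  finite and satisfies the balance equation, and such a measure is the occupation measure of
  a stationary randomized control \<open>\<sigma>\<close> (\<open>realize_balanced\<close>). At each state, \<open>\<sigma>\<close> mixes only
  countably many actions, and after a change on a null set it gives positive probability to every
  action that it can use (\<open>atomic_version\<close>).

  \<^bold>\<open>Stationary control to selector.\<close> Let \<open>v\<close> be the value vector of \<open>\<sigma>\<close>. By atomlessness the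
  state space splits into small cells. Using one seed for each whole cell yields a random selector
  whose values are close to those of \<open>\<sigma>\<close>, by a second moment estimate (\<open>purification\<close>). To
  reach \<open>v\<close> exactly, consider the convex set \<open>C\<close> of vectors of controls whose occupation measure
  has a bounded density with respect to that of \<open>\<sigma>\<close>. Then \<open>v\<close> lies in the relative interior of \<open>C\<close>, and
  since \<open>\<sigma>\<close> is atomic, every selector has its vector in the affine hull of \<open>C\<close>. So if the vector
  of a selector \<open>\<phi>\<close> is very close to \<open>v\<close>, then \<open>v\<close> is a mixture of it, with weight \<open>1 - \<lambda>\<close>, and a
  point of \<open>C\<close>, with weight \<open>\<lambda>\<close>. Purifying the control that realizes this mixture gives a new
  selector that is still closer to \<open>v\<close> and differs from \<open>\<phi>\<close> only on a set that it rarely visits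
  (\<open>improve_selector\<close>). With \<open>\<lambda>\<close> halved in each round, the selectors converge to a selector whose
  vector is exactly \<open>v\<close> (\<open>selectors_limit\<close>, \<open>atomic_attained\<close>).

  Uniform absorption enters as a bound, common to all plans, on the expected time spent outside the
  absorbing state after time \<open>n\<close>. It makes the interchanges of limits and infinite sums valid.
\<close>

section \<open>Standard Borel spaces inside the real line\<close>

text \<open>Digits 0 and 1 in base 3: unlike in base 2, no two digit sequences get the same code, and each
  digit is a Borel function of the code.\<close>

definition ternary_code :: "(nat \<Rightarrow> bool) \<Rightarrow> real" where
  "ternary_code b = (\<Sum>i. of_bool (b i) * (1/3) ^ Suc i)"

definition ternary_digit :: "nat \<Rightarrow> real \<Rightarrow> bool" where
  "ternary_digit i z \<longleftrightarrow> \<lfloor>3 ^ Suc i * z\<rfloor> mod 3 \<noteq> 0"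

lemma summable_ternary: "summable (\<lambda>i. of_bool (b i) * (1/3::real) ^ Suc i)"
  by (rule summable_comparison_test[of _ "\<lambda>i. (1/3::real) ^ Suc i"])
     (auto simp: summable_geometric intro!: summable_mult)

lemma ternary_code_shift: "3 * ternary_code b = of_bool (b 0) + ternary_code (\<lambda>i. b (Suc i))"
proof -
  have "ternary_code b = of_bool (b 0) / 3 + (\<Sum>i. of_bool (b (Suc i)) * (1/3::real) ^ Suc (Suc i))"
    using suminf_split_head[OF summable_ternary[of b]] by (simp add: ternary_code_def)
  also have "(\<Sum>i. of_bool (b (Suc i)) * (1/3::real) ^ Suc (Suc i)) = ternary_code (\<lambda>i. b (Suc i)) / 3"
    using suminf_mult[OF summable_ternary[of "\<lambda>i. b (Suc i)"], of "1/3"]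
    by (simp add: ternary_code_def mult_ac)
  finally show ?thesis by simp
qed

lemma ternary_code_bounds: "0 \<le> ternary_code b" "ternary_code b < 1"
proof -
  show "0 \<le> ternary_code b"
    unfolding ternary_code_def by (intro suminf_nonneg summable_ternary) auto
  have "ternary_code b \<le> (\<Sum>i. (1/3::real) ^ Suc i)"
    unfolding ternary_code_def
    by (intro suminf_le summable_ternary) (auto simp: summable_geometric intro!: summable_mult)
  also have "\<dots> = 1/2"
    using suminf_mult[OF summable_geometric[of "1/3::real"], of "1/3"] suminf_geometric[of "1/3::real"]
    by simp
  finally show "ternary_code b < 1" by simp
qed

lemma ternary_digit_code: "ternary_digit i (ternary_code b) = b i"
proof (induction i arbitrary: b)
  case 0
  have "\<lfloor>3 ^ Suc 0 * ternary_code b\<rfloor> = of_bool (b 0)"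
    using ternary_code_bounds[of "\<lambda>i. b (Suc i)"] ternary_code_shift[of b]
    by (intro floor_unique) (auto simp: of_bool_def)
  then show ?case by (auto simp: ternary_digit_def)
next
  case (Suc i)
  have "3 ^ Suc (Suc i) * ternary_code b = 3 ^ Suc i * (3 * ternary_code b)" by simp
  also have "\<dots> = of_int (3 ^ Suc i * of_bool (b 0)) + 3 ^ Suc i * ternary_code (\<lambda>i. b (Suc i))"
    unfolding ternary_code_shift by (simp add: distrib_left)
  finally have "\<lfloor>3 ^ Suc (Suc i) * ternary_code b\<rfloor> =
      3 ^ Suc i * of_bool (b 0) + \<lfloor>3 ^ Suc i * ternary_code (\<lambda>i. b (Suc i))\<rfloor>"
    by (metis floor_add_int add.commute)
  then have "\<lfloor>3 ^ Suc (Suc i) * ternary_code b\<rfloor> mod 3 = \<lfloor>3 ^ Suc i * ternary_code (\<lambda>i. b (Suc i))\<rfloor> mod 3"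
    by (simp add: mod_add_left_eq[symmetric, of "3 * _"] mult.assoc)
  then show ?case
    using Suc[of "\<lambda>i. b (Suc i)"] by (simp add: ternary_digit_def)
qed

lemma measurable_ternary_digit [measurable]: "Measurable.pred borel (ternary_digit i)"
  unfolding ternary_digit_def by measurable

lemma measurable_ternary_code:
  assumes "\<And>i. Measurable.pred M (\<lambda>x. b x i)"
  shows "(\<lambda>x. ternary_code (b x)) \<in> borel_measurable M"
proof -
  note [measurable] = assms
  show ?thesis unfolding ternary_code_def by measurable
qed

text \<open>\<open>M\<close> is isomorphic to a measurable retract of the real line. The left inverse
  \<open>d\<close> is defined on all reals, so that measurable maps into \<open>M\<close> can be
  built as real functions and sent back.\<close>

definition real_retract :: "'a measure \<Rightarrow> bool" where
  "real_retract M \<longleftrightarrow> (\<exists>e \<in> M \<rightarrow>\<^sub>M (borel :: real measure). \<exists>d \<in> borel \<rightarrow>\<^sub>M M. \<forall>x\<in>space M. d (e x) = x)"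

lemma real_retractE:
  assumes "real_retract M"
  obtains e d where "e \<in> M \<rightarrow>\<^sub>M (borel :: real measure)" "d \<in> borel \<rightarrow>\<^sub>M M"
    "\<And>x. x \<in> space M \<Longrightarrow> d (e x) = x"
  using assms unfolding real_retract_def by auto

text \<open>A point is determined by the answers to the questions \<open>d (y k) x < 2^-n\<close> for a
  dense sequence \<open>y\<close>. These countably many bits are coded as one real. To decode,
  take for each \<open>n\<close> the first \<open>y k\<close> that the bits place within
  \<open>2^-n\<close>; these points converge to \<open>x\<close>.\<close>

lemma real_retract_polish:
  fixes Y :: "'a topology"
  assumes "polish_topology Y" "topspace Y \<noteq> {}"
  shows "real_retract (borel_measure_of Y)"
proof -
  obtain M d where "Metric_space M d" "Metric_space.mcomplete M d" and Y: "Y = Metric_space.mtopology M d"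
    using assms by (auto simp: polish_topology_def completely_metrizable_space_def)
  interpret Metric_space M d by fact
  have topY: "topspace Y = M" by (simp add: Y)
  have "separable_space Y"
    using assms by (auto simp: polish_topology_def intro: second_countable_imp_separable_space)
  then obtain S where S: "countable S" "S \<subseteq> M" "Y closure_of S = M"
    by (auto simp: separable_space_def topY)
  with assms have "S \<noteq> {}" using topY by auto
  define y where "y = from_nat_into S"
  have y_M: "y k \<in> M" for k
    using S \<open>S \<noteq> {}\<close> by (auto simp: y_def from_nat_into subset_iff)
  have dense: "\<exists>k. d x (y k) < r" if "x \<in> M" "r > 0" for x r
  proof -
    have "x \<in> Y closure_of S" using that S by simp
    then have "\<exists>z\<in>S. z \<in> mball x r"
      using that unfolding Y metric_closure_of by blast
    then obtain z where "z \<in> S" "z \<in> mball x r" by blast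
    then show ?thesis
      using S \<open>S \<noteq> {}\<close> by (auto simp: y_def dest: from_nat_into_surj)
  qed
  let ?B = "borel_measure_of Y"
  have openB: "W \<in> sets ?B" if "openin Y W" for W
    using that openin_subset[of Y] by (auto simp: borel_measure_of_def intro: sigma_sets.Basic)
  have space_B: "space ?B = M"
    by (simp add: borel_measure_of_def topY openin_subset space_measure_of_conv)
  define bit where "bit x i = (case prod_decode i of (n, k) \<Rightarrow> d (y k) x < 1 / 2 ^ n)" for x i
  define e where "e x = ternary_code (bit x)" for x
  have e: "e \<in> ?B \<rightarrow>\<^sub>M borel"
    unfolding e_def
  proof (rule measurable_ternary_code)
    fix i
    obtain n k where nk: "prod_decode i = (n, k)" by force
    have "{x \<in> space ?B. bit x i} = mball (y k) (1 / 2 ^ n)"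
      using y_M by (auto simp: bit_def nk space_B)
    moreover have "openin Y (mball (y k) (1 / 2 ^ n))" by (simp add: Y)
    ultimately show "Measurable.pred ?B (\<lambda>x. bit x i)"
      unfolding pred_def using openB by metis
  qed
  \<comment> \<open>the first point of the dense sequence that the code declares to be near\<close>
  define K where "K n z = (LEAST k. ternary_digit (prod_encode (n, k)) z)" for n z
  have K[measurable]: "K n \<in> borel \<rightarrow>\<^sub>M count_space UNIV" for n
    unfolding K_def by measurable
  define f where "f n z = y (K n z)" for n z
  have f_M: "f n z \<in> M" for n z by (simp add: f_def y_M)
  define Good where "Good z \<longleftrightarrow> (\<forall>j. \<exists>N. \<forall>m\<ge>N. \<forall>n\<ge>N. d (f m z) (f n z) < 1 / real (Suc j))" for z
  have Good[measurable]: "Measurable.pred borel Good"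
    unfolding Good_def f_def by measurable
  have "\<exists>l. l \<in> M \<and> limitin Y (\<lambda>n. f n z) l sequentially" if "Good z" for z
  proof -
    have "MCauchy (\<lambda>n. f n z)"
      unfolding MCauchy_def
    proof safe
      show "\<And>x. f x z \<in> M" by (rule f_M)
      fix \<epsilon> :: real assume "\<epsilon> > 0"
      then obtain j where j: "inverse (real (Suc j)) < \<epsilon>" using reals_Archimedean by blast
      obtain N where "\<forall>m\<ge>N. \<forall>n\<ge>N. d (f m z) (f n z) < 1 / real (Suc j)"
        using \<open>Good z\<close> unfolding Good_def by meson
      then have "d (f n z) (f n' z) < \<epsilon>" if "N \<le> n" "N \<le> n'" for n n'
        using j that by (metis inverse_eq_divide less_trans)
      then show "\<exists>N. \<forall>n n'. N \<le> n \<longrightarrow> N \<le> n' \<longrightarrow> d (f n z) (f n' z) < \<epsilon>" by blast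
    qed
    then obtain l where "limitin mtopology (\<lambda>n. f n z) l sequentially"
      using \<open>mcomplete\<close> unfolding mcomplete_def by auto
    then show ?thesis using limitin_mspace unfolding Y by blast
  qed
  then obtain L where L: "\<And>z. Good z \<Longrightarrow> L z \<in> M \<and> limitin Y (\<lambda>n. f n z) (L z) sequentially"
    by metis
  define g where "g z = (if Good z then L z else y 0)" for z
  have g: "g \<in> borel \<rightarrow>\<^sub>M ?B"
    unfolding borel_measure_of_def
  proof (rule measurable_measure_of)
    show "{U. openin Y U} \<subseteq> Pow (topspace Y)" using openin_subset by auto
    show "g \<in> space borel \<rightarrow> topspace Y" using L y_M by (auto simp: g_def topY)
    fix W assume "W \<in> {U. openin Y U}"
    then have W: "openin Y W" by simp
    have iff: "L z \<in> W \<longleftrightarrow> (\<exists>j N. \<forall>m\<ge>N. mball (f m z) (1 / real (Suc j)) \<subseteq> W)" if z: "Good z" for z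
    proof
      assume "L z \<in> W"
      then obtain r where r: "r > 0" "mball (L z) r \<subseteq> W"
        using W unfolding Y openin_mtopology by auto
      obtain j where j: "inverse (real (Suc j)) < r / 2" using reals_Archimedean[of "r/2"] r by auto
      obtain N where N: "\<And>n. n \<ge> N \<Longrightarrow> f n z \<in> M \<and> d (f n z) (L z) < r / 2"
        using L[OF z] r unfolding Y limitin_metric eventually_sequentially by (metis half_gt_zero)
      have "mball (f m z) (1 / real (Suc j)) \<subseteq> W" if "m \<ge> N" for m
      proof
        fix w assume w: "w \<in> mball (f m z) (1 / real (Suc j))"
        have "d (L z) w \<le> d (L z) (f m z) + d (f m z) w"
          using w L[OF z] by (intro triangle) auto
        then have "d (L z) w < r"
          using w N[OF that] j by (auto simp: commute inverse_eq_divide)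
        then show "w \<in> W" using r w L[OF z] by auto
      qed
      then show "\<exists>j N. \<forall>m\<ge>N. mball (f m z) (1 / real (Suc j)) \<subseteq> W" by blast
    next
      assume "\<exists>j N. \<forall>m\<ge>N. mball (f m z) (1 / real (Suc j)) \<subseteq> W"
      then obtain j N where jN: "\<And>m. m \<ge> N \<Longrightarrow> mball (f m z) (1 / real (Suc j)) \<subseteq> W" by blast
      have "0 < 1 / real (Suc j)" by simp
      then obtain N' where N': "\<And>n. n \<ge> N' \<Longrightarrow> d (f n z) (L z) < 1 / real (Suc j)"
        using L[OF z] unfolding Y limitin_metric eventually_sequentially by metis
      show "L z \<in> W"
        using jN[of "max N N'"] N'[of "max N N'"] L[OF z] f_M by auto
    qed
    have "g -` W \<inter> space borel =
      {z. if Good z then (\<exists>j N. \<forall>m\<ge>N. mball (y (K m z)) (1 / real (Suc j)) \<subseteq> W) else y 0 \<in> W}"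
    proof (rule set_eqI)
      fix z
      show "z \<in> g -` W \<inter> space borel \<longleftrightarrow> z \<in> {z. if Good z
          then (\<exists>j N. \<forall>m\<ge>N. mball (y (K m z)) (1 / real (Suc j)) \<subseteq> W) else y 0 \<in> W}"
        using iff[of z] by (cases "Good z") (simp_all add: g_def f_def)
    qed
    also have "\<dots> \<in> sets borel"
    proof -
      have [measurable]: "Measurable.pred borel (\<lambda>z. mball (y (K m z)) c \<subseteq> W)" for m c
        by (rule measurable_compose[OF K]) simp
      show ?thesis by measurable
    qed
    finally show "g -` W \<inter> space borel \<in> sets borel" .
  qed
  have "g (e x) = x" if x: "x \<in> M" for x
  proof -
    have dx: "d (f n (e x)) x < 1 / 2 ^ n" for n
    proof -
      have "\<exists>k. ternary_digit (prod_encode (n, k)) (e x)"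
        using dense[OF x, of "1 / 2 ^ n"] by (auto simp: e_def ternary_digit_code bit_def commute)
      then have "ternary_digit (prod_encode (n, K n (e x))) (e x)"
        unfolding K_def by (rule LeastI_ex)
      then show ?thesis by (simp add: e_def ternary_digit_code bit_def f_def)
    qed
    have lim: "limitin Y (\<lambda>n. f n (e x)) x sequentially"
      unfolding Y limitin_metric eventually_sequentially
    proof safe
      fix \<epsilon> :: real assume "\<epsilon> > 0"
      then obtain N where N: "(1/2::real) ^ N < \<epsilon>" using real_arch_pow_inv[of \<epsilon> "1/2"] by auto
      have "f n (e x) \<in> M \<and> d (f n (e x)) x < \<epsilon>" if "n \<ge> N" for n
      proof -
        have "(1/2::real) ^ n \<le> (1/2) ^ N" using that by (intro power_decreasing) auto
        then show ?thesis using dx[of n] N f_M by (auto simp: power_divide)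
      qed
      then show "\<exists>N. \<forall>n\<ge>N. f n (e x) \<in> M \<and> d (f n (e x)) x < \<epsilon>" by blast
    qed (rule x)
    have "Good (e x)"
    proof -
      have "MCauchy (\<lambda>n. f n (e x))"
        using lim f_M unfolding Y by (intro convergent_imp_MCauchy) auto
      then have "\<exists>N. \<forall>n n'. N \<le> n \<longrightarrow> N \<le> n' \<longrightarrow> d (f n (e x)) (f n' (e x)) < 1 / real (Suc j)" for j
        unfolding MCauchy_def by simp
      then show ?thesis
        unfolding Good_def by meson
    qed
    then have "limitin Y (\<lambda>n. f n (e x)) (L (e x)) sequentially" using L by auto
    then have "L (e x) = x"
      using lim unfolding Y by (auto intro: limitin_metric_unique)
    then show ?thesis using \<open>Good (e x)\<close> by (simp add: g_def)
  qed
  then show ?thesis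
    unfolding real_retract_def using e g space_B by auto
qed

lemma real_retract_standard_borel:
  assumes "standard_borel M" "space M \<noteq> {}"
  shows "real_retract M"
proof -
  obtain Y :: "real topology" and B where Y: "polish_topology Y" "B \<in> sets (borel_measure_of Y)"
    "measurable_isomorphic M (restrict_space (borel_measure_of Y) B)"
    using assms unfolding standard_borel_def by blast
  let ?B = "borel_measure_of Y"
  obtain f g where f: "f \<in> M \<rightarrow>\<^sub>M restrict_space ?B B" and g[measurable]: "g \<in> restrict_space ?B B \<rightarrow>\<^sub>M M"
    and gf: "\<And>x. x \<in> space M \<Longrightarrow> g (f x) = x"
    using Y unfolding measurable_isomorphic_def by blast
  obtain a where a: "a \<in> space M" using assms by auto
  have B: "B \<subseteq> space ?B" using sets.sets_into_space[OF Y(2)] .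
  have fB: "f x \<in> B" if "x \<in> space M" for x
    using measurable_space[OF f that] by (simp add: space_restrict_space)
  have f': "f \<in> M \<rightarrow>\<^sub>M ?B" using f by (simp add: measurable_restrict_space2_iff)
  have "topspace Y \<noteq> {}"
    using fB[OF a] B by (auto simp: borel_measure_of_def space_measure_of_conv)
  then have B_retract: "real_retract ?B" by (intro real_retract_polish Y(1))
  obtain e d where e: "e \<in> ?B \<rightarrow>\<^sub>M (borel::real measure)" and d: "d \<in> borel \<rightarrow>\<^sub>M ?B"
    and de: "\<And>x. x \<in> space ?B \<Longrightarrow> d (e x) = x"
    by (rule real_retractE[OF B_retract that])
  have g': "(\<lambda>y. if y \<in> B then g y else a) \<in> ?B \<rightarrow>\<^sub>M M"
    using Y(2) a by (intro measurable_If_restrict_space_iff[THEN iffD2]) auto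
  have 1: "(\<lambda>x. e (f x)) \<in> M \<rightarrow>\<^sub>M borel"
    and 2: "(\<lambda>z. (if d z \<in> B then g (d z) else a)) \<in> borel \<rightarrow>\<^sub>M M"
    using measurable_compose[OF f' e] measurable_compose[OF d g'] by auto
  have 3: "(if d (e (f x)) \<in> B then g (d (e (f x))) else a) = x" if "x \<in> space M" for x
  proof -
    have "f x \<in> space ?B" using fB[OF that] B by blast
    then show ?thesis using fB[OF that] gf[OF that] de[of "f x"] by simp
  qed
  show ?thesis unfolding real_retract_def
    by (intro bexI[OF _ 1] bexI[OF _ 2] ballI 3)
qed

section \<open>Convex hulls, and random actions driven by a uniform seed\<close>

definition unif :: "real measure" where
  "unif = uniform_measure lborel {0..1}"

lemma prob_space_unif: "prob_space unif"
  unfolding unif_def by (rule prob_space_uniform_measure) auto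

lemma sets_unif [simp, measurable_cong]: "sets unif = sets borel"
  by (simp add: unif_def)

lemma space_unif [simp]: "space unif = UNIV"
  by (simp add: unif_def)

interpretation unif: prob_space unif
  by (rule prob_space_unif)

lemma unif_in_prob_algebra [simp]: "unif \<in> space (prob_algebra borel)"
  by (simp add: space_prob_algebra prob_space_unif)

lemma emeasure_unif_atMost: "0 \<le> g \<Longrightarrow> g \<le> 1 \<Longrightarrow> emeasure unif {u. u \<le> g} = ennreal g"
proof -
  assume "0 \<le> g" "g \<le> 1"
  then have "{0..1} \<inter> {u. u \<le> g} = {0..g}" by auto
  with \<open>0 \<le> g\<close> show ?thesis
    by (simp add: unif_def divide_ennreal_def)
qed

definition act_law :: "'x measure \<Rightarrow> 'a measure \<Rightarrow> 'x measure \<Rightarrow> ('x \<times> real \<Rightarrow> 'a) \<Rightarrow> ('x \<times> 'a) measure" where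
  "act_law X A \<nu> c = distr (\<nu> \<Otimes>\<^sub>M unif) (X \<Otimes>\<^sub>M A) (\<lambda>z. (fst z, c z))"

text \<open>On the set where \<open>g < f\<close>, the integral of \<open>f - g\<close> would be positive
  unless this set is null.\<close>

lemma AE_le_of_nn_integral_le:
  assumes [measurable]: "f \<in> borel_measurable M" "g \<in> borel_measurable M"
    and fin: "(\<integral>\<^sup>+x. g x \<partial>M) \<noteq> \<infinity>"
    and le: "\<And>B. B \<in> sets M \<Longrightarrow> (\<integral>\<^sup>+x. f x * indicator B x \<partial>M) \<le> (\<integral>\<^sup>+x. g x * indicator B x \<partial>M)"
  shows "AE x in M. f x \<le> g x"
proof -
  define B where "B = {x\<in>space M. g x < f x}"
  have B[measurable]: "B \<in> sets M" unfolding B_def by measurable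
  have gfin: "(\<integral>\<^sup>+x. g x * indicator B x \<partial>M) \<noteq> \<infinity>"
  proof -
    have "(\<integral>\<^sup>+x. g x * indicator B x \<partial>M) \<le> (\<integral>\<^sup>+x. g x \<partial>M)"
      by (intro nn_integral_mono) (auto simp: indicator_def)
    then show ?thesis using fin neq_top_trans by auto
  qed
  have "(\<integral>\<^sup>+x. (f x * indicator B x - g x * indicator B x) \<partial>M) =
      (\<integral>\<^sup>+x. f x * indicator B x \<partial>M) - (\<integral>\<^sup>+x. g x * indicator B x \<partial>M)"
    by (intro nn_integral_diff gfin AE_I2) (auto simp: B_def indicator_def)
  also have "\<dots> = 0"
    using le[OF B] neq_top_trans[OF gfin[unfolded infinity_ennreal_def] le[OF B]]
    by (simp add: diff_eq_0_iff_ennreal less_top[symmetric])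
  finally have "AE x in M. f x * indicator B x - g x * indicator B x = 0"
    by (subst (asm) nn_integral_0_iff_AE) auto
  then show ?thesis
    using AE_space
  proof eventually_elim
    case (elim x)
    then show ?case
      by (cases "g x < f x") (auto simp: B_def diff_eq_0_iff_ennreal)
  qed
qed

text \<open>Induction on dimension. If the mean \<open>E\<close> is not in the hull, a hyperplane through
  \<open>E\<close> has the whole set on one side. The integral of the signed distance vanishes,
  so almost all values lie in the hyperplane, where the dimension is smaller.\<close>

lemma integral_in_convex_hull:
  fixes f :: "'w \<Rightarrow> 'b::euclidean_space"
  assumes "prob_space M" "integrable M f" "AE \<omega> in M. f \<omega> \<in> S"
  shows "(\<integral>\<omega>. f \<omega> \<partial>M) \<in> convex hull S"
  using assms(3)
proof (induction "dim ((\<lambda>s. s - (\<integral>\<omega>. f \<omega> \<partial>M)) ` S)" arbitrary: S rule: less_induct)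
  case (less S)
  interpret prob_space M by fact
  note [measurable] = borel_measurable_integrable[OF assms(2)]
  define E where "E = (\<integral>\<omega>. f \<omega> \<partial>M)"
  define D where "D T = (\<lambda>s. s - E) ` T" for T
  show ?case
  proof (rule ccontr)
    assume "(\<integral>\<omega>. f \<omega> \<partial>M) \<notin> convex hull S"
    then have E: "E \<notin> convex hull S" by (simp add: E_def)
    have hull: "convex hull (D S) = D (convex hull S)"
      using convex_hull_translation[of "-E" S] by (simp add: D_def image_def algebra_simps)
    have "S \<noteq> {}" using less.prems AE_False by (auto simp: emeasure_space_1)
    then have "convex hull (D S) \<noteq> {}" by (simp add: D_def)
    moreover have "0 \<notin> convex hull (D S)" using E unfolding hull by (auto simp: D_def)
    ultimately obtain a where a: "a \<in> span (convex hull (D S))" "a \<noteq> 0"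
      and pos: "\<And>x. x \<in> convex hull (D S) \<Longrightarrow> 0 \<le> a \<bullet> x"
      using separating_hyperplane_set_0_inspan[OF convex_convex_hull[of "D S"]] by metis
    have "AE \<omega> in M. 0 \<le> a \<bullet> (f \<omega> - E)"
      using less.prems by eventually_elim (intro pos hull_inc, auto simp: D_def)
    moreover have int: "integrable M (\<lambda>\<omega>. a \<bullet> (f \<omega> - E))"
      using assms(2) by auto
    moreover have "(\<integral>\<omega>. a \<bullet> (f \<omega> - E) \<partial>M) = 0"
      using assms(2) by (simp add: E_def prob_space)
    ultimately have "AE \<omega> in M. a \<bullet> (f \<omega> - E) = 0"
      using integral_nonneg_eq_0_iff_AE by blast
    then have AE': "AE \<omega> in M. f \<omega> \<in> S \<inter> {s. a \<bullet> (s - E) = 0}"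
      using less.prems by eventually_elim auto
    have "span (D (S \<inter> {s. a \<bullet> (s - E) = 0})) \<subseteq> {x. a \<bullet> x = 0}"
      by (intro span_minimal subspace_hyperplane) (auto simp: D_def)
    moreover have "span (D (S \<inter> {s. a \<bullet> (s - E) = 0})) \<subseteq> span (D S)"
      by (intro span_mono) (auto simp: D_def)
    moreover have "a \<in> span (D S)"
      using a span_mono[OF convex_hull_subset_span[of "D S"]] by (auto simp: span_span)
    moreover have "a \<notin> {x. a \<bullet> x = 0}"
      using a by auto
    ultimately have "span (D (S \<inter> {s. a \<bullet> (s - E) = 0})) \<subset> span (D S)"
      by blast
    then have "dim (D (S \<inter> {s. a \<bullet> (s - E) = 0})) < dim (D S)"
      by (rule dim_psubset)
    then have "E \<in> convex hull (S \<inter> {s. a \<bullet> (s - E) = 0})"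
      using less.hyps[OF _ AE'] by (simp add: D_def E_def)
    then show False using E hull_mono[of "S \<inter> {s. a \<bullet> (s - E) = 0}" S convex] by auto
  qed
qed

text \<open>The conditional quantile transform: \<open>g c x\<close> is the conditional probability of a
  second component above \<open>c\<close>, obtained as a Radon-Nikodym derivative and used for
  rational \<open>c\<close> only, and \<open>F\<close> is its generalized inverse in the seed.\<close>

lemma disintegration_real:
  assumes "finite_measure Q" and sets_Q[measurable_cong]: "sets Q = sets (X \<Otimes>\<^sub>M (borel :: real measure))"
    and range: "AE z in Q. snd z \<in> {0..1}"
  shows "\<exists>F \<in> borel_measurable (X \<Otimes>\<^sub>M borel). act_law X borel (distr Q X fst) F = Q"
proof -
  interpret Q: finite_measure Q by fact
  define q where "q = distr Q X fst"
  have sets_q[measurable_cong, simp]: "sets q = sets X" and space_q[simp]: "space q = space X" by (simp_all add: q_def)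
  interpret q: finite_measure q
    unfolding q_def by (rule Q.finite_measure_distr) measurable
  have space_Q: "space Q = space X \<times> UNIV"
    using sets_eq_imp_space_eq[OF sets_Q] by (simp add: space_pair_measure)
  define Qc where "Qc c = distr (density Q (\<lambda>z. indicator {c<..} (snd z))) X fst" for c :: real
  have Qc: "emeasure (Qc c) B = emeasure Q (B \<times> {c<..})" if [measurable]: "B \<in> sets X" for B c
  proof -
    have "emeasure (Qc c) B = (\<integral>\<^sup>+z. indicator {c<..} (snd z) * indicator (fst -` B \<inter> space Q) z \<partial>Q)"
      unfolding Qc_def by (subst emeasure_distr) (simp_all add: emeasure_density)
    also have "\<dots> = (\<integral>\<^sup>+z. indicator (B \<times> {c<..}) z \<partial>Q)"
      by (intro nn_integral_cong) (auto simp: indicator_def)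
    also have "\<dots> = emeasure Q (B \<times> {c<..})" by (simp add: sets_Q)
    finally show ?thesis .
  qed
  have qB: "emeasure q B = emeasure Q (B \<times> UNIV)" if "B \<in> sets X" for B
    using that sets.sets_into_space[OF that]
    by (auto simp: q_def emeasure_distr space_Q intro!: arg_cong2[where f=emeasure])
  have le_q: "emeasure (Qc c) B \<le> emeasure q B" if "B \<in> sets X" for B c
    unfolding Qc[OF that] qB[OF that] using that by (intro emeasure_mono) (auto simp: sets_Q)
  define G where "G c = RN_deriv q (Qc c)" for c
  have G[measurable]: "G c \<in> borel_measurable X" for c
    unfolding G_def using borel_measurable_RN_deriv[of q] by simp
  have densG: "density q (G c) = Qc c" for c
    unfolding G_def
  proof (rule q.density_RN_deriv)
    show "absolutely_continuous q (Qc c)"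
      using le_q by (auto simp: absolutely_continuous_def null_sets_def Qc_def)
         (metis le_zero_eq)
  qed (simp add: Qc_def)
  have intG: "(\<integral>\<^sup>+x. G c x * indicator B x \<partial>q) = emeasure Q (B \<times> {c<..})" if "B \<in> sets X" for c B
  proof -
    have "emeasure (density q (G c)) B = (\<integral>\<^sup>+x. G c x * indicator B x \<partial>q)"
      using that by (intro emeasure_density) simp_all
    then show ?thesis using Qc[OF that] by (simp add: densG)
  qed
  have finG: "(\<integral>\<^sup>+x. G c x \<partial>q) \<noteq> \<infinity>" for c
  proof -
    have "(\<integral>\<^sup>+x. G c x \<partial>q) = (\<integral>\<^sup>+x. G c x * indicator (space X) x \<partial>q)"
      by (intro nn_integral_cong) simp
    then show ?thesis by (simp add: intG)
  qed
  have G_le_1: "AE x in q. G c x \<le> 1" for c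
  proof (rule AE_le_of_nn_integral_le)
    fix B assume B: "B \<in> sets q"
    show "(\<integral>\<^sup>+x. G c x * indicator B x \<partial>q) \<le> (\<integral>\<^sup>+x. 1 * indicator B x \<partial>q)"
      using B le_q[of B c] Qc[of B c] intG[of B c] by simp
  qed auto
  have G_mono: "AE x in q. G d x \<le> G c x" if "c \<le> d" for c d
  proof (rule AE_le_of_nn_integral_le)
    fix B assume "B \<in> sets q"
    then show "(\<integral>\<^sup>+x. G d x * indicator B x \<partial>q) \<le> (\<integral>\<^sup>+x. G c x * indicator B x \<partial>q)"
      using that by (auto simp: intG sets_Q intro!: emeasure_mono)
  qed (simp_all add: finG[unfolded infinity_ennreal_def])
  define g where "g c x = min 1 (enn2real (G c x))" for c x
  have g[measurable]: "g c \<in> borel_measurable X" for c unfolding g_def by measurable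
  have g_G: "AE x in q. ennreal (g c x) = G c x" for c
    using G_le_1[of c]
  proof eventually_elim
    case (elim x)
    then show ?case by (cases "G c x") (auto simp: g_def min_def top_unique)
  qed
  have g01: "0 \<le> g c x" "g c x \<le> 1" for c x by (auto simp: g_def)
  \<comment> \<open>rational levels: countably many null sets may be discarded together\<close>
  define I where "I = \<rat> \<inter> {0..1::real}"
  have I: "countable I" "I \<noteq> {}" "0 \<in> I" "I \<subseteq> {0..1}"
    by (auto simp: I_def countable_rat)
  define F where "F z = (SUP c\<in>I. if snd z \<le> g c (fst z) then c else 0)" for z :: "_ \<times> real"
  have bdd: "bdd_above ((\<lambda>c. if snd z \<le> g c (fst z) then c else 0) ` I)" for z :: "_ \<times> real"
    by (intro bdd_aboveI[of _ 1]) (use I(4) in \<open>force split: if_splits\<close>)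
  have F_gt: "w < F z \<longleftrightarrow> (\<exists>c\<in>I. w < (if snd z \<le> g c (fst z) then c else 0))" for w z
    unfolding F_def using I bdd by (intro less_cSUP_iff)
  have F[measurable]: "F \<in> borel_measurable (X \<Otimes>\<^sub>M borel)"
    unfolding F_def using I by (intro borel_measurable_cSUP bdd) measurable
  have F_gt': "w < F z \<longleftrightarrow> (\<exists>c\<in>I. w < c \<and> snd z \<le> g c (fst z))" if "w \<ge> 0" for w z
    unfolding F_gt using that by (intro bex_cong refl) (simp split: if_split)
  have F_nonneg: "0 \<le> F z" for z
    unfolding F_def using I by (intro cSUP_upper2[OF bdd, of 0]) auto
  define D where "D = act_law X borel q F"
  have sets_D[measurable_cong]: "sets D = sets (X \<Otimes>\<^sub>M borel)" by (simp add: D_def act_law_def)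
  interpret qU: pair_sigma_finite q unif ..
  have D: "emeasure D (B \<times> W) = (\<integral>\<^sup>+x. emeasure unif {u. F (x, u) \<in> W} * indicator B x \<partial>q)"
    if [measurable]: "B \<in> sets X" "W \<in> sets borel" for B W
  proof -
    have [measurable_cong]: "sets (q \<Otimes>\<^sub>M unif) = sets (X \<Otimes>\<^sub>M borel)" by (intro sets_pair_measure_cong) auto
    have "emeasure D (B \<times> W) = (\<integral>\<^sup>+z. indicator (B \<times> W) z \<partial>D)" by (simp add: sets_D)
    also have "\<dots> = (\<integral>\<^sup>+z. indicator (B \<times> W) (fst z, F z) \<partial>(q \<Otimes>\<^sub>M unif))"
      unfolding D_def act_law_def by (subst nn_integral_distr) auto
    also have "\<dots> = (\<integral>\<^sup>+x. \<integral>\<^sup>+u. indicator (B \<times> W) (x, F (x, u)) \<partial>unif \<partial>q)"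
      by (subst unif.nn_integral_fst[symmetric]) auto
    also have "\<dots> = (\<integral>\<^sup>+x. emeasure unif {u. F (x, u) \<in> W} * indicator B x \<partial>q)"
    proof (intro nn_integral_cong)
      fix x assume "x \<in> space q"
      then have [measurable]: "x \<in> space X" by simp
      have "(\<integral>\<^sup>+u. indicator (B \<times> W) (x, F (x, u)) \<partial>unif) =
          (\<integral>\<^sup>+u. indicator {u\<in>space unif. F (x, u) \<in> W} u * indicator B x \<partial>unif)"
        by (intro nn_integral_cong) (auto simp: indicator_def)
      also have "\<dots> = emeasure unif {u\<in>space unif. F (x, u) \<in> W} * indicator B x"
      proof -
        have "{u\<in>space unif. F (x, u) \<in> W} \<in> sets unif" by measurable
        then show ?thesis by (simp add: nn_integral_multc)
      qed
      finally show "(\<integral>\<^sup>+u. indicator (B \<times> W) (x, F (x, u)) \<partial>unif) = emeasure unif {u. F (x, u) \<in> W} * indicator B x"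
        by simp
    qed
    finally show ?thesis .
  qed
  have Q_le1: "emeasure Q (B \<times> {w<..}) = 0" if "w \<ge> 1" "B \<in> sets X" for w B
  proof -
    have "AE z in Q. z \<notin> B \<times> {w<..}" using range by eventually_elim (use that in auto)
    then show ?thesis using that by (subst (asm) AE_iff_null_sets[symmetric]) (auto simp: sets_Q)
  qed
  have Q_ge0: "emeasure Q (B \<times> {w<..}) = emeasure Q (B \<times> UNIV)" if "w < 0" "B \<in> sets X" for w B
    using range that by (intro emeasure_eq_AE) (auto simp: sets_Q elim!: eventually_mono)
  have main: "emeasure D (B \<times> {w<..}) = emeasure Q (B \<times> {w<..})" if [measurable]: "B \<in> sets X" for B w
  proof -
    consider "w < 0" | "w \<ge> 1" | "0 \<le> w" "w < 1" by linarith
    then show ?thesis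
    proof cases
      case 1
      then have "{u. F (x, u) \<in> {w<..}} = space unif" for x
        using F_nonneg[of "(x, _)"] by (auto intro: less_le_trans)
      then have "emeasure D (B \<times> {w<..}) = emeasure q B"
        by (subst D) (auto simp: unif.emeasure_space_1 simp del: space_unif)
      then show ?thesis using 1 by (simp add: Q_ge0 qB)
    next
      case 2
      then have "{u. F (x, u) \<in> {w<..}} = {}" for x
        using I by (auto simp: F_gt')
      then show ?thesis using 2 by (subst D) (auto simp: Q_le1)
    next
      case 3
      have "\<exists>c. c \<in> I \<and> w < c \<and> c < w + 1 / Suc n" for n :: nat
        using Rats_dense_in_real[of w "min 1 (w + 1 / Suc n)"] 3 by (auto simp: I_def)
      then obtain c0 where c0: "\<And>n::nat. c0 n \<in> I \<and> w < c0 n \<and> c0 n < w + 1 / Suc n" by metis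
      define c where "c n = Min (c0 ` {..n})" for n
      have c_in: "c n \<in> c0 ` {..n}" for n unfolding c_def by (intro Min_in) auto
      have c: "c n \<in> I" "w < c n" for n using c_in[of n] c0 by auto
      have c_less: "c n < w + 1 / Suc n" for n
      proof -
        have "c n \<le> c0 n" unfolding c_def by (intro Min_le) auto
        then show ?thesis using c0[of n] by linarith
      qed
      have c_dec: "c (Suc n) \<le> c n" for n
        unfolding c_def by (intro Min_antimono) auto
      have c_lim: "\<exists>n. c n < d" if wd: "w < d" for d
      proof -
        obtain n where "inverse (real (Suc n)) < d - w" using reals_Archimedean[of "d - w"] wd by auto
        then show ?thesis using c_less[of n] by (auto simp: inverse_eq_divide intro!: exI[of _ n])
      qed
      have mono: "AE x in q. \<forall>d\<in>I. \<forall>n. c n \<le> d \<longrightarrow> g d x \<le> g (c n) x"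
      proof -
        have g_mono: "AE x in q. c n \<le> d \<longrightarrow> g d x \<le> g (c n) x" for d n
        proof (cases "c n \<le> d")
          case True
          show ?thesis using G_mono[OF True] g_G[of d] g_G[of "c n"]
          proof eventually_elim
            case (elim x)
            then have "ennreal (g d x) \<le> ennreal (g (c n) x)" by simp
            then show ?case using g01 by (simp add: ennreal_le_iff)
          qed
        qed simp
        show ?thesis
          unfolding AE_ball_countable[OF I(1)] AE_all_countable using g_mono by blast
      qed
      have decseq: "AE x in q. \<forall>n. g (c n) x \<le> g (c (Suc n)) x"
        using mono by eventually_elim (use c c_dec in auto)
      have "emeasure D (B \<times> {w<..}) = (\<integral>\<^sup>+x. emeasure unif {u. F (x, u) \<in> {w<..}} * indicator B x \<partial>q)"
        by (rule D) auto
      also have "\<dots> = (\<integral>\<^sup>+x. (SUP n. ennreal (g (c n) x)) * indicator B x \<partial>q)"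
      proof (rule nn_integral_cong_AE)
        show "AE x in q. emeasure unif {u. F (x, u) \<in> {w<..}} * indicator B x =
            (SUP n. ennreal (g (c n) x)) * indicator B x"
          using mono decseq
        proof eventually_elim
          case (elim x)
          have "{u. F (x, u) \<in> {w<..}} = (\<Union>n. {u. u \<le> g (c n) x})"
          proof (intro set_eqI iffI)
            fix u assume "u \<in> {u. F (x, u) \<in> {w<..}}"
            then obtain d where d: "d \<in> I" "w < d" "u \<le> g d x" using 3 by (auto simp: F_gt')
            obtain n where "c n < d" using c_lim[OF d(2)] by auto
            then have "g d x \<le> g (c n) x" using elim(1) d(1) by (simp add: less_imp_le)
            then have "u \<le> g (c n) x" using d(3) by simp
            then show "u \<in> (\<Union>n. {u. u \<le> g (c n) x})" by auto
          next
            fix u assume "u \<in> (\<Union>n. {u. u \<le> g (c n) x})"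
            then obtain n where "u \<le> g (c n) x" by auto
            then show "u \<in> {u. F (x, u) \<in> {w<..}}" using 3 c[of n] by (auto simp: F_gt')
          qed
          also have "emeasure unif \<dots> = (SUP n. emeasure unif {u. u \<le> g (c n) x})"
            using elim(2) by (intro SUP_emeasure_incseq[symmetric] incseq_SucI) (auto intro: order_trans)
          finally show ?case by (simp add: emeasure_unif_atMost g01)
        qed
      qed
      also have "\<dots> = (\<integral>\<^sup>+x. (SUP n. ennreal (g (c n) x) * indicator B x) \<partial>q)"
        by (simp add: SUP_mult_right_ennreal)
      also have "\<dots> = (SUP n. \<integral>\<^sup>+x. ennreal (g (c n) x) * indicator B x \<partial>q)"
        using decseq by (intro nn_integral_monotone_convergence_SUP_AE)
          (auto elim!: eventually_mono intro!: mult_right_mono ennreal_leI)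
      also have "\<dots> = (SUP n. \<integral>\<^sup>+x. G (c n) x * indicator B x \<partial>q)"
      proof -
        have "AE x in q. ennreal (g (c n) x) * indicator B x = G (c n) x * indicator B x" for n
          using g_G[of "c n"] by eventually_elim simp
        then show ?thesis by (intro SUP_cong refl nn_integral_cong_AE)
      qed
      also have "\<dots> = (SUP n. emeasure Q (B \<times> {c n<..}))"
        by (simp add: intG)
      also have "\<dots> = emeasure Q (\<Union>n. B \<times> {c n<..})"
        using c_dec by (intro SUP_emeasure_incseq incseq_SucI) (auto simp: sets_Q intro: le_less_trans)
      also have "(\<Union>n. B \<times> {c n<..}) = B \<times> {w<..}"
        using c c_lim by (auto intro: less_trans)
      finally show ?thesis .
    qed
  qed
  have "D = Q"
  proof (rule measure_eqI_generator_eq[OF Int_stable_pair_measure_generator[of X borel]])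
    show "sets D = sigma_sets (space X \<times> space borel) {a \<times> b |a b. a \<in> sets X \<and> b \<in> sets borel}"
      "sets Q = sigma_sets (space X \<times> space borel) {a \<times> b |a b. a \<in> sets X \<and> b \<in> sets borel}"
      by (simp_all add: sets_D sets_Q sets_pair_measure)
    show "{a \<times> b |a b. a \<in> sets X \<and> b \<in> sets borel} \<subseteq> Pow (space X \<times> space borel)"
      using sets.sets_into_space by auto
    show "range (\<lambda>i::nat. space X \<times> space borel) \<subseteq> {a \<times> b |a b. a \<in> sets X \<and> b \<in> sets (borel::real measure)}"
      by (intro image_subsetI CollectI exI[of _ "space X"] exI[of _ UNIV]) simp
    show "emeasure D (space X \<times> space borel) \<noteq> \<infinity>" for i :: nat
    proof -
      have "emeasure D (space X \<times> UNIV) = (\<integral>\<^sup>+x. emeasure unif (space unif) * indicator (space X) x \<partial>q)"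
        by (subst D) simp_all
      also have "\<dots> = emeasure q (space q)"
        by (simp add: unif.emeasure_space_1 del: space_unif)
      finally show ?thesis by simp
    qed
    fix E assume "E \<in> {a \<times> b |a b. a \<in> sets X \<and> b \<in> sets (borel :: real measure)}"
    then obtain B W where E: "E = B \<times> W" and [measurable]: "B \<in> sets X" "W \<in> sets borel" by auto
    define R where "R P = distr (density P (\<lambda>z. indicator B (fst z))) borel snd" for P :: "('a \<times> real) measure"
    have R: "emeasure (R P) W = emeasure P (B \<times> W)"
      if P: "sets P = sets (X \<Otimes>\<^sub>M borel)" and [measurable]: "W \<in> sets borel" for P W
    proof -
      note [measurable_cong] = P
      have "emeasure (R P) W = (\<integral>\<^sup>+z. indicator B (fst z) * indicator (snd -` W \<inter> space P) z \<partial>P)"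
        unfolding R_def by (subst emeasure_distr) (simp_all add: emeasure_density)
      also have "\<dots> = (\<integral>\<^sup>+z. indicator (B \<times> W) z \<partial>P)"
        by (intro nn_integral_cong) (auto simp: indicator_def)
      also have "\<dots> = emeasure P (B \<times> W)" by (simp add: P)
      finally show ?thesis .
    qed
    have "R D = R Q"
    proof (rule measure_eqI_lessThan)
      show "sets (R D) = sets borel" "sets (R Q) = sets borel" by (simp_all add: R_def)
      show "emeasure (R D) {x<..} < \<infinity>" for x
        by (subst R[OF sets_D]) (auto simp: main less_top[symmetric])
      show "emeasure (R D) {x<..} = emeasure (R Q) {x<..}" for x
        by (subst R[OF sets_D], simp, subst R[OF sets_Q]) (auto simp: main)
    qed
    then show "emeasure D E = emeasure Q E"
      unfolding E using R[OF sets_D, of W] R[OF sets_Q, of W] by simp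
  qed auto
  then show ?thesis using F unfolding D_def q_def by blast
qed

lemma real_retract_unit_interval:
  assumes "real_retract M"
  obtains e d where "e \<in> borel_measurable M" "d \<in> borel \<rightarrow>\<^sub>M M"
    "\<And>x. x \<in> space M \<Longrightarrow> d (e x) = x" "\<And>x. e x \<in> {0<..<1::real}"
proof -
  obtain e d where e[measurable]: "e \<in> M \<rightarrow>\<^sub>M (borel :: real measure)"
    and d[measurable]: "d \<in> borel \<rightarrow>\<^sub>M M" and de: "\<And>x. x \<in> space M \<Longrightarrow> d (e x) = x"
    by (rule real_retractE[OF assms that])
  \<comment> \<open>a homeomorphism of the line onto the open unit interval\<close>
  define sq :: "real \<Rightarrow> real" where "sq z = 1 / 2 + arctan z / pi" for z
  define usq :: "real \<Rightarrow> real" where "usq w = tan ((w - 1 / 2) * pi)" for w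
  have usq: "usq (sq z) = z" for z by (simp add: usq_def sq_def tan_arctan)
  have sq: "sq z \<in> {0<..<1}" for z
    using arctan_bounded[of z] pi_gt_zero by (auto simp: sq_def field_simps)
  have [measurable]: "sq \<in> borel_measurable borel"
    unfolding sq_def by (intro borel_measurable_continuous_onI continuous_intros) auto
  have [measurable]: "usq \<in> borel_measurable borel"
    unfolding usq_def tan_def by measurable
  show ?thesis
  proof
    show "(\<lambda>x. sq (e x)) \<in> borel_measurable M" by measurable
    show "(\<lambda>w. d (usq w)) \<in> borel \<rightarrow>\<^sub>M M" by measurable
    show "sq (e x) \<in> {0<..<1}" for x by (rule sq)
  qed (simp add: usq de)
qed

text \<open>Code actions as reals, use the quantile transform there, and decode. Where the outcome leaves
  the graph, which happens with probability zero, the selector \<open>s\<close> takes over.\<close>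

lemma disintegration:
  assumes fin: "finite_measure Q" and sets_Q[measurable_cong]: "sets Q = sets (X \<Otimes>\<^sub>M A)"
    and A: "real_retract A"
    and Gr[measurable]: "Gr \<in> sets (X \<Otimes>\<^sub>M A)" and Q_Gr: "AE z in Q. z \<in> Gr"
    and s[measurable]: "s \<in> X \<rightarrow>\<^sub>M A" and s_Gr: "\<And>x. x \<in> space X \<Longrightarrow> (x, s x) \<in> Gr"
  shows "\<exists>c \<in> X \<Otimes>\<^sub>M borel \<rightarrow>\<^sub>M A.
    (\<forall>x\<in>space X. \<forall>u. (x, c (x, u)) \<in> Gr) \<and> act_law X A (distr Q X fst) c = Q"
proof -
  interpret Q: finite_measure Q by fact
  obtain e d where [measurable]: "e \<in> borel_measurable A" "d \<in> borel \<rightarrow>\<^sub>M A"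
    and de: "\<And>a. a \<in> space A \<Longrightarrow> d (e a) = a" and e01: "\<And>a. e a \<in> {0<..<1::real}"
    by (rule real_retract_unit_interval[OF A that])
  define Q' where "Q' = distr Q (X \<Otimes>\<^sub>M borel) (\<lambda>z. (fst z, e (snd z)))"
  have [measurable_cong]: "sets Q' = sets (X \<Otimes>\<^sub>M borel)" by (simp add: Q'_def)
  have space_Q: "space Q = space X \<times> space A"
    using sets_eq_imp_space_eq[OF sets_Q] by (simp add: space_pair_measure)
  define q where "q = distr Q X fst"
  have [measurable_cong]: "sets q = sets X" by (simp add: q_def)
  have q': "distr Q' X fst = q"
    unfolding Q'_def q_def by (subst distr_distr) (auto simp: comp_def)
  have "\<exists>F \<in> borel_measurable (X \<Otimes>\<^sub>M borel). act_law X borel (distr Q' X fst) F = Q'"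
  proof (rule disintegration_real)
    show "finite_measure Q'" unfolding Q'_def by (rule Q.finite_measure_distr) measurable
    show "AE z in Q'. snd z \<in> {0..1}"
      unfolding Q'_def using e01 by (subst AE_distr_iff) (auto simp: less_imp_le)
  qed (simp add: Q'_def)
  then obtain F where F[measurable]: "F \<in> borel_measurable (X \<Otimes>\<^sub>M borel)" and F_Q: "act_law X borel q F = Q'"
    unfolding q' by blast
  have [measurable_cong]: "sets (q \<Otimes>\<^sub>M unif) = sets (X \<Otimes>\<^sub>M borel)" by (intro sets_pair_measure_cong) (auto simp: q_def)
  have dF: "act_law X A q (\<lambda>z. d (F z)) = Q"
  proof -
    have "act_law X A q (\<lambda>z. d (F z)) = distr (act_law X borel q F) (X \<Otimes>\<^sub>M A) (\<lambda>z. (fst z, d (snd z)))"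
      unfolding act_law_def by (subst distr_distr) (auto simp: comp_def)
    also have "\<dots> = distr Q (X \<Otimes>\<^sub>M A) (\<lambda>z. (fst z, d (e (snd z))))"
      unfolding F_Q Q'_def by (subst distr_distr) (auto simp: comp_def)
    also have "\<dots> = distr Q Q (\<lambda>z. z)"
      by (intro distr_cong) (auto simp: sets_Q space_Q de)
    finally show ?thesis by simp
  qed
  have AE_dF: "AE z in q \<Otimes>\<^sub>M unif. (fst z, d (F z)) \<in> Gr"
  proof -
    have "AE z in act_law X A q (\<lambda>z. d (F z)). z \<in> Gr" unfolding dF by fact
    then show ?thesis unfolding act_law_def by (subst (asm) AE_distr_iff) auto
  qed
  define c where "c z = (if (fst z, d (F z)) \<in> Gr then d (F z) else s (fst z))" for z
  have c[measurable]: "c \<in> X \<Otimes>\<^sub>M borel \<rightarrow>\<^sub>M A" unfolding c_def by measurable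
  have "act_law X A q c = act_law X A q (\<lambda>z. d (F z))"
    unfolding act_law_def
    by (intro distr_cong_AE) (use AE_dF in \<open>auto simp: c_def elim!: eventually_mono\<close>)
  then have "act_law X A q c = Q" by (simp add: dF)
  moreover have "\<forall>x\<in>space X. \<forall>u. (x, c (x, u)) \<in> Gr" using s_Gr by (auto simp: c_def)
  ultimately show ?thesis using c unfolding q_def by blast
qed

section \<open>Controlled Markov chains\<close>

primrec chain :: "'x measure \<Rightarrow> (nat \<Rightarrow> 'x \<Rightarrow> 'x measure) \<Rightarrow> nat \<Rightarrow> 'x measure" where
  "chain \<nu> K 0 = \<nu>"
| "chain \<nu> K (Suc t) = chain \<nu> K t \<bind> K t"

lemma chain_shift: "chain \<nu> K (Suc t) = chain (\<nu> \<bind> K 0) (\<lambda>n. K (Suc n)) t"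
  by (induction t) simp_all

lemma measurable_chain:
  assumes "\<nu> \<in> M \<rightarrow>\<^sub>M prob_algebra X"
    and "\<And>t. (\<lambda>(\<omega>, x). K \<omega> t x) \<in> M \<Otimes>\<^sub>M X \<rightarrow>\<^sub>M prob_algebra X"
  shows "(\<lambda>\<omega>. chain (\<nu> \<omega>) (K \<omega>) t) \<in> M \<rightarrow>\<^sub>M prob_algebra X"
proof (induction t)
  case (Suc t)
  then show ?case
    using measurable_bind_prob_space2[OF Suc assms(2)] by simp
qed (use assms in simp)

lemma chain_in_prob_algebra:
  assumes "\<nu> \<in> space (prob_algebra X)" "\<And>t. K t \<in> X \<rightarrow>\<^sub>M prob_algebra X"
  shows "chain \<nu> K t \<in> space (prob_algebra X)"
proof (induction t)
  case (Suc t)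
  then show ?case
    using prob_space_bind'[OF Suc assms(2)] sets_bind'[OF Suc assms(2)] by (simp add: space_prob_algebra)
qed (use assms in simp)

lemma chain_cong:
  assumes "\<And>t x. x \<in> space X \<Longrightarrow> K t x = K' t x" "\<And>t. K t \<in> X \<rightarrow>\<^sub>M prob_algebra X"
    "\<nu> \<in> space (prob_algebra X)"
  shows "chain \<nu> K t = chain \<nu> K' t"
proof (induction t)
  case (Suc t)
  have "space (chain \<nu> K t) = space X"
    using chain_in_prob_algebra[where t=t and K=K, OF assms(3,2)] by (auto simp: space_prob_algebra dest: sets_eq_imp_space_eq)
  then show ?case using Suc assms(1) by (simp cong: bind_cong_simp)
qed simp

lemma chain_bind:
  assumes f: "f \<in> M \<rightarrow>\<^sub>M prob_algebra X" and K: "\<And>t. K t \<in> X \<rightarrow>\<^sub>M prob_algebra X"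
  shows "chain (M \<bind> f) K t = M \<bind> (\<lambda>u. chain (f u) K t)"
proof (induction t)
  case (Suc t)
  have "(\<lambda>u. chain (f u) K t) \<in> M \<rightarrow>\<^sub>M prob_algebra X"
    by (rule measurable_chain[OF f]) (auto simp: split_beta' intro: measurable_compose[OF measurable_snd K])
  then show ?case
    using Suc by (simp add: bind_assoc[OF measurable_prob_algebraD measurable_prob_algebraD[OF K]])
qed simp

lemma nn_integral_bind_prob:
  assumes "h \<in> borel_measurable X" "K \<in> M \<rightarrow>\<^sub>M prob_algebra X"
  shows "(\<integral>\<^sup>+y. h y \<partial>(M \<bind> K)) = (\<integral>\<^sup>+x. \<integral>\<^sup>+y. h y \<partial>K x \<partial>M)"
  by (rule nn_integral_bind[OF assms(1) measurable_prob_algebraD[OF assms(2)]])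

lemma integral_bind_prob:
  fixes h :: "_ \<Rightarrow> real"
  assumes h: "h \<in> borel_measurable X" "\<And>y. y \<in> space X \<Longrightarrow> \<bar>h y\<bar> \<le> B"
    and K: "K \<in> M \<rightarrow>\<^sub>M prob_algebra X" and "prob_space M"
  shows "(\<integral>y. h y \<partial>(M \<bind> K)) = (\<integral>x. \<integral>y. h y \<partial>K x \<partial>M)"
proof (rule integral_bind[OF h measurable_prob_algebraD[OF K], where B'=1])
  interpret prob_space M by fact
  show "finite_measure M" by (rule finite_measure_axioms)
  show "AE x in M. emeasure (K x) (space (K x)) \<le> ennreal 1"
    using measurable_space[OF K] by (auto simp: space_prob_algebra prob_space.emeasure_space_1)
qed

text \<open>Randomization is made explicit: a control chooses the action \<open>c (x, u)\<close> from the
  state and a uniform seed. A set-up with controls \<open>X \<times> real \<Rightarrow>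
  A\<close> instead of kernels makes it possible to fix seeds, to share them, and to draw them
  in advance.\<close>

locale control_base =
  fixes X :: "'x measure" and A :: "'a measure" and Act :: "'x \<Rightarrow> 'a set"
    and p :: "'x \<times> 'a \<Rightarrow> 'x measure" and \<mu> :: "'x measure" and xb :: 'x
  assumes X_retract: "real_retract X"
    and A_retract: "real_retract A"
    and graph: "{(x, a). x \<in> space X \<and> a \<in> Act x} \<in> sets (X \<Otimes>\<^sub>M A)"
    and selector: "\<exists>s \<in> X \<rightarrow>\<^sub>M A. \<forall>x\<in>space X. s x \<in> Act x"
    and p[measurable]: "p \<in> X \<Otimes>\<^sub>M A \<rightarrow>\<^sub>M prob_algebra X"
    and \<mu>[simp]: "\<mu> \<in> space (prob_algebra X)"
    and xb[simp]: "xb \<in> space X"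
    and absorb: "a \<in> Act xb \<Longrightarrow> emeasure (p (xb, a)) {xb} = 1"
begin

definition controls :: "('x \<times> real \<Rightarrow> 'a) set" where
  "controls = {c \<in> X \<Otimes>\<^sub>M borel \<rightarrow>\<^sub>M A. \<forall>x\<in>space X. \<forall>u. c (x, u) \<in> Act x}"

definition step :: "('x \<times> real \<Rightarrow> 'a) \<Rightarrow> 'x \<Rightarrow> 'x measure" where
  "step c x = unif \<bind> (\<lambda>u. p (x, c (x, u)))"

definition law :: "(nat \<Rightarrow> 'x \<times> real \<Rightarrow> 'a) \<Rightarrow> nat \<Rightarrow> 'x measure" where
  "law c = chain \<mu> (\<lambda>t. step (c t))"

abbreviation pure :: "('x \<Rightarrow> 'a) \<Rightarrow> 'x \<times> real \<Rightarrow> 'a" where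
  "pure \<phi> \<equiv> \<lambda>z. \<phi> (fst z)"

definition selectors :: "('x \<Rightarrow> 'a) set" where
  "selectors = {\<phi> \<in> X \<rightarrow>\<^sub>M A. \<forall>x\<in>space X. \<phi> x \<in> Act x}"

lemma controls_measurable[measurable_dest]: "c \<in> controls \<Longrightarrow> c \<in> X \<Otimes>\<^sub>M borel \<rightarrow>\<^sub>M A"
  by (simp add: controls_def)

lemma controls_Act: "c \<in> controls \<Longrightarrow> x \<in> space X \<Longrightarrow> c (x, u) \<in> Act x"
  by (simp add: controls_def)

lemma selectors_measurable[measurable_dest]: "\<phi> \<in> selectors \<Longrightarrow> \<phi> \<in> X \<rightarrow>\<^sub>M A"
  by (simp add: selectors_def)

definition plans :: "(nat \<Rightarrow> 'x \<times> real \<Rightarrow> 'a) set" where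
  "plans = {c. \<forall>t. c t \<in> controls}"

lemma plansD: "c \<in> plans \<Longrightarrow> c t \<in> controls"
  by (simp add: plans_def)

lemma plansI: "(\<And>t. c t \<in> controls) \<Longrightarrow> c \<in> plans"
  by (simp add: plans_def)

lemma plans_const[simp]: "(\<lambda>_. c) \<in> plans \<longleftrightarrow> c \<in> controls"
  by (simp add: plans_def)

lemma plans_measurable[measurable_dest]: "c \<in> plans \<Longrightarrow> c t \<in> X \<Otimes>\<^sub>M borel \<rightarrow>\<^sub>M A"
  by (simp add: plans_def controls_measurable)

lemma plans_Act: "c \<in> plans \<Longrightarrow> x \<in> space X \<Longrightarrow> c t (x, u) \<in> Act x"
  by (simp add: plans_def controls_Act)

lemma pure_control: "\<phi> \<in> selectors \<Longrightarrow> pure \<phi> \<in> controls"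
  by (auto simp: controls_def selectors_def)

lemma singleton_xb[measurable]: "{xb} \<in> sets X"
proof -
  obtain e d where [measurable]: "e \<in> X \<rightarrow>\<^sub>M (borel :: real measure)" "d \<in> borel \<rightarrow>\<^sub>M X"
    and de: "\<And>x. x \<in> space X \<Longrightarrow> d (e x) = x"
    by (rule real_retractE[OF X_retract that])
  have "{x\<in>space X. e x = e xb} \<in> sets X" by measurable
  also have "{x\<in>space X. e x = e xb} = {xb}" using de by (auto, metis xb)
  finally show ?thesis .
qed

lemma Act_space: "x \<in> space X \<Longrightarrow> a \<in> Act x \<Longrightarrow> a \<in> space A"
  using sets.sets_into_space[OF graph] by (auto simp: space_pair_measure)

lemma p_prob: "x \<in> space X \<Longrightarrow> a \<in> space A \<Longrightarrow> p (x, a) \<in> space (prob_algebra X)"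
  by (rule measurable_space[OF p]) (simp add: space_pair_measure)

lemma measurable_step[measurable]:
  assumes [measurable]: "c \<in> X \<Otimes>\<^sub>M borel \<rightarrow>\<^sub>M A"
  shows "step c \<in> X \<rightarrow>\<^sub>M prob_algebra X"
proof -
  have 1: "(\<lambda>x. unif) \<in> X \<rightarrow>\<^sub>M prob_algebra borel" by simp
  have 2: "(\<lambda>(x, u). p (x, c (x, u))) \<in> X \<Otimes>\<^sub>M borel \<rightarrow>\<^sub>M prob_algebra X" by measurable
  show ?thesis
    unfolding step_def[abs_def] by (rule measurable_bind_prob_space2[OF 1 2])
qed

lemma step_pure:
  assumes "\<phi> x \<in> space A" "x \<in> space X"
  shows "step (pure \<phi>) x = p (x, \<phi> x)"
  using p_prob[OF assms(2,1)]
  by (auto simp: step_def space_prob_algebra prob_space_imp_subprob_space intro!: bind_const' prob_space_unif)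

lemma law_prob: "c \<in> plans \<Longrightarrow> law c t \<in> space (prob_algebra X)"
  unfolding law_def by (rule chain_in_prob_algebra) (auto dest: plansD)

lemma law_0[simp]: "law c 0 = \<mu>"
  by (simp add: law_def)

lemma law_Suc: "law c (Suc t) = law c t \<bind> step (c t)"
  by (simp add: law_def)

lemma law_prob_space: "c \<in> plans \<Longrightarrow> prob_space (law c t)"
  and sets_law: "c \<in> plans \<Longrightarrow> sets (law c t) = sets X"
  and space_law: "c \<in> plans \<Longrightarrow> space (law c t) = space X"
  using law_prob[of c t] by (auto simp: space_prob_algebra dest: sets_eq_imp_space_eq)

text \<open>The nonrandomized plan that results from fixing the seed of each period in advance.\<close>

definition freeze :: "(nat \<Rightarrow> 'x \<times> real \<Rightarrow> 'a) \<Rightarrow> (nat \<Rightarrow> real) \<Rightarrow> nat \<Rightarrow> 'x \<times> real \<Rightarrow> 'a" where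
  "freeze c \<omega> t = pure (\<lambda>x. c t (x, \<omega> t))"

abbreviation seeds :: "(nat \<Rightarrow> real) measure" where
  "seeds \<equiv> PiM UNIV (\<lambda>_. unif)"

lemma freeze_controls: "c \<in> plans \<Longrightarrow> freeze c \<omega> \<in> plans"
proof -
  assume c: "c \<in> plans"
  note [measurable] = plans_measurable[OF c]
  have "(\<lambda>x. c t (x, \<omega> t)) \<in> X \<rightarrow>\<^sub>M A" for t by measurable
  then show ?thesis
    using c by (intro plansI) (auto simp: freeze_def[abs_def] selectors_def plans_Act intro!: pure_control)
qed

lemma step_freeze:
  assumes "c \<in> plans" "x \<in> space X"
  shows "step (freeze c \<omega> t) x = p (x, c t (x, \<omega> t))"
  unfolding freeze_def using assms by (intro step_pure) (auto intro: Act_space plans_Act)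

lemma measurable_chain_freeze:
  assumes c: "c \<in> plans" and \<nu>: "\<nu> \<in> M \<rightarrow>\<^sub>M prob_algebra X" and s[measurable]: "s \<in> M \<rightarrow>\<^sub>M seeds"
  shows "(\<lambda>\<omega>. chain (\<nu> \<omega>) (\<lambda>t. step (freeze c (s \<omega>) t)) t) \<in> M \<rightarrow>\<^sub>M prob_algebra X"
proof (rule measurable_chain[OF \<nu>])
  fix t
  note [measurable] = plans_measurable[OF c]
  have [measurable]: "(\<lambda>\<omega>. s \<omega> t) \<in> borel_measurable M"
    using measurable_compose[OF s measurable_component_singleton[of t UNIV "\<lambda>_. unif"]]
    by (simp add: measurable_cong_sets[OF refl sets_unif])
  have "(\<lambda>(\<omega>, x). step (freeze c (s \<omega>) t) x) \<in> M \<Otimes>\<^sub>M X \<rightarrow>\<^sub>M prob_algebra X \<longleftrightarrow>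
    (\<lambda>(\<omega>, x). p (x, c t (x, s \<omega> t))) \<in> M \<Otimes>\<^sub>M X \<rightarrow>\<^sub>M prob_algebra X"
    by (intro measurable_cong) (auto simp: space_pair_measure step_freeze c)
  also have "\<dots>" by measurable
  finally show "(\<lambda>(\<omega>, x). step (freeze c (s \<omega>) t) x) \<in> M \<Otimes>\<^sub>M X \<rightarrow>\<^sub>M prob_algebra X" .
qed

text \<open>The first seed splits off from an independent sequence of seeds.\<close>

lemma nn_integral_seeds:
  assumes f: "f \<in> borel_measurable seeds"
  shows "(\<integral>\<^sup>+\<omega>. f \<omega> \<partial>seeds) = (\<integral>\<^sup>+u. \<integral>\<^sup>+\<omega>. f (case_nat u \<omega>) \<partial>seeds \<partial>unif)"
proof -
  interpret S: sequence_space unif ..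
  have "(\<integral>\<^sup>+\<omega>. f \<omega> \<partial>seeds) = (\<integral>\<^sup>+\<omega>. f \<omega> \<partial>distr (unif \<Otimes>\<^sub>M seeds) seeds (\<lambda>(s, \<omega>). case_nat s \<omega>))"
    using S.PiM_iter by simp
  also have "\<dots> = (\<integral>\<^sup>+z. f (case_nat (fst z) (snd z)) \<partial>(unif \<Otimes>\<^sub>M seeds))"
    using f by (subst nn_integral_distr) (auto simp: split_beta')
  also have "\<dots> = (\<integral>\<^sup>+u. \<integral>\<^sup>+\<omega>. f (case_nat u \<omega>) \<partial>seeds \<partial>unif)"
    using f by (subst S.P.nn_integral_fst[symmetric]) auto
  finally show ?thesis .
qed

end

section \<open>Occupation measures and the balance equation\<close>

lemma ennreal_suminf_finite_tendsto_0:
  fixes f :: "nat \<Rightarrow> ennreal"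
  assumes "(\<Sum>n. f n) < \<infinity>"
  shows "f \<longlonglongrightarrow> 0"
proof -
  define r where "r n = enn2real (f n)" for n
  have r: "f n = ennreal (r n)" for n
    using ennreal_suminf_lessD[OF assms, of n] by (simp add: r_def less_top)
  have "(\<Sum>n. ennreal (r n)) \<noteq> \<top>"
    using assms by (simp add: r[symmetric])
  then have "summable r"
    by (intro summable_suminf_not_top) (auto simp: r_def)
  then have "(\<lambda>n. ennreal (r n)) \<longlonglongrightarrow> ennreal 0"
    by (intro tendsto_ennrealI summable_LIMSEQ_zero)
  then show ?thesis by (simp add: r[symmetric])
qed

lemma nn_integral_act_law:
  assumes [measurable_cong]: "sets \<nu> = sets X" and [measurable]: "c \<in> X \<Otimes>\<^sub>M borel \<rightarrow>\<^sub>M A" "g \<in> borel_measurable (X \<Otimes>\<^sub>M A)"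
  shows "(\<integral>\<^sup>+z. g z \<partial>act_law X A \<nu> c) = (\<integral>\<^sup>+x. \<integral>\<^sup>+u. g (x, c (x, u)) \<partial>unif \<partial>\<nu>)"
proof -
  have "(\<integral>\<^sup>+z. g z \<partial>act_law X A \<nu> c) = (\<integral>\<^sup>+z. g (fst z, c z) \<partial>(\<nu> \<Otimes>\<^sub>M unif))"
    unfolding act_law_def by (rule nn_integral_distr) measurable
  also have "\<dots> = (\<integral>\<^sup>+x. \<integral>\<^sup>+u. g (x, c (x, u)) \<partial>unif \<partial>\<nu>)"
    by (subst unif.nn_integral_fst[symmetric]) (simp_all, measurable)
  finally show ?thesis .
qed

lemma prob_space_act_law:
  assumes "prob_space \<nu>" and [measurable_cong]: "sets \<nu> = sets X" and [measurable]: "c \<in> X \<Otimes>\<^sub>M borel \<rightarrow>\<^sub>M A"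
  shows "prob_space (act_law X A \<nu> c)"
proof -
  interpret pair_prob_space \<nu> unif
    using assms(1) prob_space_unif by (simp add: pair_prob_space_def pair_sigma_finite_def prob_space_imp_sigma_finite)
  show ?thesis unfolding act_law_def by (rule prob_space_distr) measurable
qed

lemma integral_act_law:
  fixes g :: "_ \<Rightarrow> real"
  assumes "prob_space \<nu>" and [measurable_cong]: "sets \<nu> = sets X" and [measurable]: "c \<in> X \<Otimes>\<^sub>M borel \<rightarrow>\<^sub>M A"
    "g \<in> borel_measurable (X \<Otimes>\<^sub>M A)" and B: "\<And>z. z \<in> space (X \<Otimes>\<^sub>M A) \<Longrightarrow> \<bar>g z\<bar> \<le> B"
  shows "(\<integral>z. g z \<partial>act_law X A \<nu> c) = (\<integral>x. \<integral>u. g (x, c (x, u)) \<partial>unif \<partial>\<nu>)"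
proof -
  interpret \<nu>U: pair_prob_space \<nu> unif
    using assms(1) prob_space_unif by (simp add: pair_prob_space_def pair_sigma_finite_def prob_space_imp_sigma_finite)
  have m: "(\<lambda>z. (fst z, c z)) \<in> \<nu> \<Otimes>\<^sub>M unif \<rightarrow>\<^sub>M X \<Otimes>\<^sub>M A" by measurable
  have "(\<integral>z. g z \<partial>act_law X A \<nu> c) = (\<integral>z. g (fst z, c z) \<partial>(\<nu> \<Otimes>\<^sub>M unif))"
    unfolding act_law_def by (rule integral_distr) measurable
  also have "\<dots> = (\<integral>x. \<integral>u. g (x, c (x, u)) \<partial>unif \<partial>\<nu>)"
  proof (subst \<nu>U.integral_fst'[symmetric])
    show "integrable (\<nu> \<Otimes>\<^sub>M unif) (\<lambda>z. g (fst z, c z))"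
      by (rule \<nu>U.integrable_const_bound[where B=B]) (auto intro!: B measurable_space[OF m])
  qed simp
  finally show ?thesis .
qed

context control_base begin

definition Gr :: "('x \<times> 'a) set" where
  "Gr = {(x, a). x \<in> space X \<and> a \<in> Act x}"

lemma Gr_sets[measurable]: "Gr \<in> sets (X \<Otimes>\<^sub>M A)"
  unfolding Gr_def by (rule graph)

lemma space_X_ne[simp]: "space X \<noteq> {}"
  by (metis xb empty_iff)

lemma measurable_nn_integral_p[measurable]:
  "h \<in> borel_measurable X \<Longrightarrow> (\<lambda>z. \<integral>\<^sup>+y. h y \<partial>p z) \<in> borel_measurable (X \<Otimes>\<^sub>M A)"
  by (rule measurable_compose[OF measurable_prob_algebraD[OF p] nn_integral_measurable_subprob_algebra])

lemma measurable_integral_p[measurable]: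
  fixes h :: "'x \<Rightarrow> real"
  shows "h \<in> borel_measurable X \<Longrightarrow> (\<lambda>z. \<integral>y. h y \<partial>p z) \<in> borel_measurable (X \<Otimes>\<^sub>M A)"
  by (rule measurable_compose[OF measurable_prob_algebraD[OF p] integral_measurable_subprob_algebra])

definition pair_law :: "(nat \<Rightarrow> 'x \<times> real \<Rightarrow> 'a) \<Rightarrow> nat \<Rightarrow> ('x \<times> 'a) measure" where
  "pair_law c t = act_law X A (law c t) (c t)"

lemma sets_pair_law[simp, measurable_cong]: "sets (pair_law c t) = sets (X \<Otimes>\<^sub>M A)"
  by (simp add: pair_law_def act_law_def)

lemma space_pair_law[simp]: "space (pair_law c t) = space (X \<Otimes>\<^sub>M A)"
  by (simp add: pair_law_def act_law_def)

lemma prob_space_pair_law: "c \<in> plans \<Longrightarrow> prob_space (pair_law c t)"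
  unfolding pair_law_def by (intro prob_space_act_law law_prob_space sets_law plans_measurable)

lemma nn_integral_pair_law:
  assumes "c \<in> plans" "g \<in> borel_measurable (X \<Otimes>\<^sub>M A)"
  shows "(\<integral>\<^sup>+z. g z \<partial>pair_law c t) = (\<integral>\<^sup>+x. \<integral>\<^sup>+u. g (x, c t (x, u)) \<partial>unif \<partial>law c t)"
  unfolding pair_law_def using assms by (intro nn_integral_act_law sets_law plans_measurable)

lemma integral_pair_law:
  fixes g :: "_ \<Rightarrow> real"
  assumes "c \<in> plans" "g \<in> borel_measurable (X \<Otimes>\<^sub>M A)" "\<And>z. z \<in> space (X \<Otimes>\<^sub>M A) \<Longrightarrow> \<bar>g z\<bar> \<le> B"
  shows "(\<integral>z. g z \<partial>pair_law c t) = (\<integral>x. \<integral>u. g (x, c t (x, u)) \<partial>unif \<partial>law c t)"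
  unfolding pair_law_def using assms
  by (intro integral_act_law[where B=B] law_prob_space sets_law plans_measurable) auto

lemma nn_integral_step:
  assumes [measurable]: "c \<in> X \<Otimes>\<^sub>M borel \<rightarrow>\<^sub>M A" "h \<in> borel_measurable X" and x[simp]: "x \<in> space X"
  shows "(\<integral>\<^sup>+y. h y \<partial>step c x) = (\<integral>\<^sup>+u. \<integral>\<^sup>+y. h y \<partial>p (x, c (x, u)) \<partial>unif)"
  unfolding step_def by (rule nn_integral_bind_prob) measurable

lemma integral_step:
  fixes h :: "'x \<Rightarrow> real"
  assumes [measurable]: "c \<in> X \<Otimes>\<^sub>M borel \<rightarrow>\<^sub>M A" "h \<in> borel_measurable X" and x[simp]: "x \<in> space X"
    and B: "\<And>y. y \<in> space X \<Longrightarrow> \<bar>h y\<bar> \<le> B"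
  shows "(\<integral>y. h y \<partial>step c x) = (\<integral>u. \<integral>y. h y \<partial>p (x, c (x, u)) \<partial>unif)"
  unfolding step_def
proof (rule integral_bind_prob[where X=X])
  show "(\<lambda>u. p (x, c (x, u))) \<in> unif \<rightarrow>\<^sub>M prob_algebra X" by measurable
qed (use B prob_space_unif in auto)

lemma absorb_nn:
  assumes "c \<in> controls" and [measurable]: "h \<in> borel_measurable X" and "h xb = 0"
  shows "(\<integral>\<^sup>+y. h y \<partial>step c xb) = 0"
proof -
  have "(\<integral>\<^sup>+y. h y \<partial>p (xb, c (xb, u))) = 0" for u
  proof -
    have a: "c (xb, u) \<in> Act xb" using assms by (intro controls_Act) auto
    have P: "p (xb, c (xb, u)) \<in> space (prob_algebra X)"
      using Act_space[OF xb a] by (intro p_prob) auto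
    then have [measurable_cong]: "sets (p (xb, c (xb, u))) = sets X" by (simp add: space_prob_algebra)
    interpret P: prob_space "p (xb, c (xb, u))" using P by (simp add: space_prob_algebra)
    have "AE y in p (xb, c (xb, u)). y \<in> {xb}"
      using absorb[OF a] by (subst P.AE_in_set_eq_1) (auto simp: P.emeasure_eq_measure)
    then have "AE y in p (xb, c (xb, u)). h y = 0"
      by eventually_elim (use assms in simp)
    then show ?thesis by (subst nn_integral_0_iff_AE) auto
  qed
  then show ?thesis using assms by (subst nn_integral_step) auto
qed

lemma law_Suc_pair_law:
  assumes c: "c \<in> plans"
  shows "law c (Suc t) = pair_law c t \<bind> p"
proof -
  note [measurable] = plans_measurable[OF c]
  note [measurable_cong] = sets_law[OF c]
  have "pair_law c t \<bind> p = (law c t \<Otimes>\<^sub>M unif) \<bind> (\<lambda>z. p (fst z, c t z))"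
    unfolding pair_law_def act_law_def
    by (rule bind_distr[where K=X]) (auto simp: space_pair_measure space_law[OF c] intro!: measurable_prob_algebraD exI[of _ xb])
  also have "\<dots> = law c t \<bind> step (c t)"
  proof (rule measure_eqI)
    have S: "(\<lambda>z. p (fst z, c t z)) \<in> law c t \<Otimes>\<^sub>M unif \<rightarrow>\<^sub>M prob_algebra X" by measurable
    have S': "step (c t) \<in> law c t \<rightarrow>\<^sub>M prob_algebra X" by measurable
    have ne: "space (law c t \<Otimes>\<^sub>M unif) \<noteq> {}" "space (law c t) \<noteq> {}"
      using xb by (auto simp: space_pair_measure space_law[OF c])
    show "sets ((law c t \<Otimes>\<^sub>M unif) \<bind> (\<lambda>z. p (fst z, c t z))) = sets (law c t \<bind> step (c t))"
      using sets_bind_measurable[OF measurable_prob_algebraD[OF S] ne(1)]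
        sets_bind_measurable[OF measurable_prob_algebraD[OF S'] ne(2)] by simp
    fix E assume "E \<in> sets ((law c t \<Otimes>\<^sub>M unif) \<bind> (\<lambda>z. p (fst z, c t z)))"
    then have [measurable]: "E \<in> sets X"
      using sets_bind_measurable[OF measurable_prob_algebraD[OF S] ne(1)] by simp
    have "emeasure ((law c t \<Otimes>\<^sub>M unif) \<bind> (\<lambda>z. p (fst z, c t z))) E =
        (\<integral>\<^sup>+z. emeasure (p (fst z, c t z)) E \<partial>(law c t \<Otimes>\<^sub>M unif))"
      by (rule emeasure_bind[OF ne(1) measurable_prob_algebraD[OF S]]) simp
    also have "\<dots> = (\<integral>\<^sup>+x. \<integral>\<^sup>+u. emeasure (p (x, c t (x, u))) E \<partial>unif \<partial>law c t)"
      using measurable_compose[OF measurable_prob_algebraD[OF S] measurable_emeasure_subprob_algebra[OF \<open>E \<in> sets X\<close>]]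
      by (subst unif.nn_integral_fst[symmetric]) simp_all
    also have "\<dots> = (\<integral>\<^sup>+x. emeasure (step (c t) x) E \<partial>law c t)"
      unfolding step_def
      by (intro nn_integral_cong emeasure_bind[symmetric, where N=X]) (auto simp: space_law[OF c] intro!: measurable_prob_algebraD)
    also have "\<dots> = emeasure (law c t \<bind> step (c t)) E"
      by (rule emeasure_bind[OF ne(2) measurable_prob_algebraD[OF S'], symmetric]) simp
    finally show "emeasure ((law c t \<Otimes>\<^sub>M unif) \<bind> (\<lambda>z. p (fst z, c t z))) E = emeasure (law c t \<bind> step (c t)) E" .
  qed
  finally show ?thesis by (simp add: law_Suc)
qed

lemma AE_pair_law_graph:
  assumes c: "c \<in> plans"
  shows "AE z in pair_law c t. z \<in> Gr"
proof -
  note [measurable] = plans_measurable[OF c] graph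
  note [measurable_cong] = sets_law[OF c]
  have "AE z in law c t \<Otimes>\<^sub>M unif. (fst z, c t z) \<in> Gr"
    using plans_Act[OF c] by (intro AE_I2) (auto simp: Gr_def space_pair_measure space_law[OF c])
  then show ?thesis
    unfolding pair_law_def act_law_def by (subst AE_distr_iff) auto
qed

abbreviation live :: "'x set" where "live \<equiv> space X - {xb}"

text \<open>Expected number of visits to state-action pairs. Visits to the absorbing state \<open>xb\<close>
  are discarded, since there would be infinitely many.\<close>

definition occ :: "(nat \<Rightarrow> 'x \<times> real \<Rightarrow> 'a) \<Rightarrow> ('x \<times> 'a) measure" where
  "occ c = density (count_space UNIV \<bind> pair_law c) (\<lambda>z. indicator (- {xb}) (fst z))"

lemma measurable_pair_law: "c \<in> plans \<Longrightarrow> pair_law c \<in> count_space UNIV \<rightarrow>\<^sub>M subprob_algebra (X \<Otimes>\<^sub>M A)"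
  using prob_space_pair_law[of c] by (auto simp: space_subprob_algebra prob_space_imp_subprob_space)

lemma sets_occ: "c \<in> plans \<Longrightarrow> sets (occ c) = sets (X \<Otimes>\<^sub>M A)"
  unfolding occ_def using sets_bind_measurable[OF measurable_pair_law] by simp

lemma measurable_fst_live[measurable]: "(\<lambda>z. indicator (- {xb}) (fst z)) \<in> borel_measurable (X \<Otimes>\<^sub>M A)"
proof -
  have "(\<lambda>z. indicator live (fst z)) \<in> borel_measurable (X \<Otimes>\<^sub>M A)" by measurable
  then show ?thesis
    by (rule measurable_cong[THEN iffD1, rotated]) (auto simp: space_pair_measure indicator_def)
qed

lemma nn_integral_occ:
  assumes c: "c \<in> plans" and [measurable]: "g \<in> borel_measurable (X \<Otimes>\<^sub>M A)"
  shows "(\<integral>\<^sup>+z. g z \<partial>occ c) = (\<Sum>t. \<integral>\<^sup>+z. indicator (- {xb}) (fst z) * g z \<partial>pair_law c t)"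
proof -
  have [measurable_cong]: "sets (count_space UNIV \<bind> pair_law c) = sets (X \<Otimes>\<^sub>M A)"
    using sets_bind_measurable[OF measurable_pair_law[OF c]] by simp
  have "(\<integral>\<^sup>+z. g z \<partial>occ c) = (\<integral>\<^sup>+z. indicator (- {xb}) (fst z) * g z \<partial>(count_space UNIV \<bind> pair_law c))"
    unfolding occ_def by (rule nn_integral_density) measurable
  also have "\<dots> = (\<integral>\<^sup>+t. \<integral>\<^sup>+z. indicator (- {xb}) (fst z) * g z \<partial>pair_law c t \<partial>count_space UNIV)"
    by (rule nn_integral_bind[OF _ measurable_pair_law[OF c]]) measurable
  finally show ?thesis by (simp add: nn_integral_count_space_nat)
qed

lemma nn_integral_occ_step:
  assumes c: "c \<in> plans" and [measurable]: "g \<in> borel_measurable (X \<Otimes>\<^sub>M A)"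
  shows "(\<integral>\<^sup>+z. g z \<partial>occ c) =
    (\<Sum>t. \<integral>\<^sup>+x. indicator (- {xb}) x * (\<integral>\<^sup>+u. g (x, c t (x, u)) \<partial>unif) \<partial>law c t)"
proof -
  note [measurable] = plans_measurable[OF c]
  show ?thesis
    unfolding nn_integral_occ[OF assms]
    by (subst nn_integral_pair_law[OF c])
       (auto intro!: suminf_cong nn_integral_cong nn_integral_cmult simp: space_law[OF c], measurable)
qed

definition stay :: "('x \<times> real \<Rightarrow> 'a) \<Rightarrow> nat \<Rightarrow> 'x \<Rightarrow> ennreal" where
  "stay c n x = emeasure (chain (return X x) (\<lambda>_. step c) n) live"

lemma measurable_chain_return:
  assumes "c \<in> controls"
  shows "(\<lambda>x. chain (return X x) (\<lambda>_. step c) n) \<in> X \<rightarrow>\<^sub>M prob_algebra X"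
  using assms by (intro measurable_chain)
    (auto simp: split_beta' intro!: measurable_compose[OF measurable_snd])

lemma measurable_stay[measurable]: "c \<in> controls \<Longrightarrow> stay c n \<in> borel_measurable X"
  unfolding stay_def[abs_def]
  by (intro measurable_compose[OF measurable_prob_algebraD[OF measurable_chain_return]
      measurable_emeasure_subprob_algebra]) auto

lemma chain_from:
  assumes "c \<in> controls" "\<nu> \<in> space (prob_algebra X)"
  shows "chain \<nu> (\<lambda>_. step c) n = \<nu> \<bind> (\<lambda>x. chain (return X x) (\<lambda>_. step c) n)"
proof -
  have sets: "sets \<nu> = sets X" using assms by (simp add: space_prob_algebra)
  have "\<nu> \<bind> (\<lambda>x. chain (return X x) (\<lambda>_. step c) n) = chain (\<nu> \<bind> return X) (\<lambda>_. step c) n"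
    using assms sets by (intro chain_bind[where X=X, symmetric]) (auto simp: measurable_cong_sets[OF sets refl])
  also have "\<nu> \<bind> return X = \<nu>" using bind_return''[OF sets] by simp
  finally show ?thesis by simp
qed

text \<open>Each stationary control is absorbed in finite expected time from almost every state. Occupation
  measures have transient state marginals, and transience excludes recurrent mass that would
  satisfy the balance equation without ever being fed from \<open>\<mu>\<close>.\<close>

definition transient :: "'x measure \<Rightarrow> bool" where
  "transient q \<longleftrightarrow> (\<forall>c\<in>controls. AE x in q. (\<Sum>n. stay c n x) < \<infinity>)"

text \<open>Flow conservation outside \<open>xb\<close>: what leaves a set of states enters it initially or
  through a transition. Test functions bounded by 1 suffice and keep all integrals finite.\<close>

definition balanced :: "('x \<times> 'a) measure \<Rightarrow> bool" where
  "balanced R \<longleftrightarrow> (\<forall>h\<in>borel_measurable X. h xb = 0 \<longrightarrow> (\<forall>x\<in>space X. h x \<le> 1) \<longrightarrow>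
    (\<integral>\<^sup>+z. h (fst z) \<partial>R) = (\<integral>\<^sup>+x. h x \<partial>\<mu>) + (\<integral>\<^sup>+z. \<integral>\<^sup>+y. h y \<partial>p z \<partial>R))"

text \<open>Iterate the balance equation \<open>n\<close> times: the marginal \<open>q\<close> equals the
  visits of the chain before time \<open>n\<close> plus the part of \<open>q\<close> that is
  still alive after \<open>n\<close> steps. By transience the remainder tends to zero.\<close>

lemma occ_eq_if_balanced:
  assumes fin: "finite_measure R" and sets_R[measurable_cong]: "sets R = sets (X \<Otimes>\<^sub>M A)"
    and R_live: "AE z in R. fst z \<noteq> xb"
    and bal: "balanced R" and trans: "transient (distr R X fst)"
    and c: "c \<in> controls" and c_R: "act_law X A (distr R X fst) c = R"
  shows "occ (\<lambda>_. c) = R"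
proof -
  interpret R: finite_measure R by fact
  define q where "q = distr R X fst"
  note c_R = c_R[folded q_def]
  have sets_q[measurable_cong]: "sets q = sets X" and space_q: "space q = space X" by (simp_all add: q_def)
  interpret q: finite_measure q
    unfolding q_def by (rule R.finite_measure_distr) measurable
  have c_meas[measurable]: "c \<in> X \<Otimes>\<^sub>M borel \<rightarrow>\<^sub>M A" by (rule controls_measurable[OF c])
  have cp: "(\<lambda>_. c) \<in> plans" using c by simp
  have q_bal: "(\<integral>\<^sup>+x. h x \<partial>q) = (\<integral>\<^sup>+x. h x \<partial>\<mu>) + (\<integral>\<^sup>+x. \<integral>\<^sup>+y. h y \<partial>step c x \<partial>q)"
    if [measurable]: "h \<in> borel_measurable X" and "h xb = 0" and "\<And>x. x \<in> space X \<Longrightarrow> h x \<le> 1" for h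
  proof -
    have "(\<integral>\<^sup>+x. h x \<partial>q) = (\<integral>\<^sup>+z. h (fst z) \<partial>R)" unfolding q_def by (rule nn_integral_distr) measurable
    also have "\<dots> = (\<integral>\<^sup>+x. h x \<partial>\<mu>) + (\<integral>\<^sup>+z. \<integral>\<^sup>+y. h y \<partial>p z \<partial>R)"
      using bal that by (simp add: balanced_def)
    also have "(\<integral>\<^sup>+z. \<integral>\<^sup>+y. h y \<partial>p z \<partial>R) = (\<integral>\<^sup>+z. \<integral>\<^sup>+y. h y \<partial>p z \<partial>act_law X A q c)" by (simp add: c_R)
    also have "\<dots> = (\<integral>\<^sup>+x. \<integral>\<^sup>+u. \<integral>\<^sup>+y. h y \<partial>p (x, c (x, u)) \<partial>unif \<partial>q)"
      by (rule nn_integral_act_law[OF sets_q c_meas measurable_nn_integral_p]) measurable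
    also have "\<dots> = (\<integral>\<^sup>+x. \<integral>\<^sup>+y. h y \<partial>step c x \<partial>q)"
      by (intro nn_integral_cong) (simp add: nn_integral_step space_q)
    finally show ?thesis .
  qed
  have main: "(\<integral>\<^sup>+x. h x \<partial>q) = (\<Sum>t. \<integral>\<^sup>+x. h x \<partial>law (\<lambda>_. c) t)"
    if h[measurable]: "h \<in> borel_measurable X" and h0: "h xb = 0" and h1: "\<And>x. h x \<le> 1" for h
  proof -
    define H where "H n x = (\<integral>\<^sup>+y. h y \<partial>chain (return X x) (\<lambda>_. step c) n)" for n x
    have H[measurable]: "H n \<in> borel_measurable X" for n
      unfolding H_def[abs_def]
      by (intro measurable_compose[OF measurable_prob_algebraD[OF measurable_chain_return[OF c]]
          nn_integral_measurable_subprob_algebra[OF h]])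
    have H_chain: "(\<integral>\<^sup>+x. H n x \<partial>\<nu>) = (\<integral>\<^sup>+y. h y \<partial>chain \<nu> (\<lambda>_. step c) n)"
      if \<nu>: "\<nu> \<in> space (prob_algebra X)" for \<nu> n
    proof -
      have "(\<lambda>x. chain (return X x) (\<lambda>_. step c) n) \<in> \<nu> \<rightarrow>\<^sub>M prob_algebra X"
      proof -
        have s: "sets \<nu> = sets X" using \<nu> by (simp add: space_prob_algebra)
        show ?thesis
          using measurable_chain_return[OF c] by (simp add: measurable_cong_sets[OF s refl])
      qed
      then show ?thesis
        unfolding H_def chain_from[OF c \<nu>] by (intro nn_integral_bind_prob[OF h, symmetric])
    qed
    have step_prob: "step c x \<in> space (prob_algebra X)" if "x \<in> space X" for x
      using measurable_space[OF measurable_step[OF c_meas] that] .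
    have H_Suc: "(\<integral>\<^sup>+y. H n y \<partial>step c x) = H (Suc n) x" if x: "x \<in> space X" for n x
    proof -
      have "return X x \<bind> step c = step c x"
        using x by (intro bind_return[where N=X] measurable_prob_algebraD) auto
      then show ?thesis
        by (simp add: H_chain[OF step_prob[OF x]] H_def[of "Suc n"] chain_shift del: chain.simps)
    qed
    have H_xb: "H n xb = 0" for n
    proof (induction n)
      case 0
      show ?case using h0 by (simp add: H_def nn_integral_return)
    next
      case (Suc n)
      then show ?case using absorb_nn[OF c H[of n] Suc] H_Suc[OF xb, of n] by simp
    qed
    have H_le_1: "H n x \<le> 1" if "x \<in> space X" for n x
    proof -
      have P: "chain (return X x) (\<lambda>_. step c) n \<in> space (prob_algebra X)"
        by (rule measurable_space[OF measurable_chain_return[OF c] that])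
      then interpret P: prob_space "chain (return X x) (\<lambda>_. step c) n" by (simp add: space_prob_algebra)
      show ?thesis unfolding H_def using h1 by (intro P.nn_integral_le_const) auto
    qed
    have iter: "(\<integral>\<^sup>+x. h x \<partial>q) = (\<Sum>t<n. \<integral>\<^sup>+x. h x \<partial>law (\<lambda>_. c) t) + (\<integral>\<^sup>+x. H n x \<partial>q)" for n
    proof (induction n)
      case 0
      have "(\<integral>\<^sup>+x. H 0 x \<partial>q) = (\<integral>\<^sup>+x. h x \<partial>q)"
        by (intro nn_integral_cong) (simp add: H_def nn_integral_return space_q)
      then show ?case by simp
    next
      case (Suc n)
      have "(\<integral>\<^sup>+x. H n x \<partial>q) = (\<integral>\<^sup>+x. H n x \<partial>\<mu>) + (\<integral>\<^sup>+x. \<integral>\<^sup>+y. H n y \<partial>step c x \<partial>q)"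
        by (rule q_bal[OF H H_xb H_le_1])
      also have "(\<integral>\<^sup>+x. \<integral>\<^sup>+y. H n y \<partial>step c x \<partial>q) = (\<integral>\<^sup>+x. H (Suc n) x \<partial>q)"
        by (intro nn_integral_cong) (simp add: H_Suc space_q)
      also have "(\<integral>\<^sup>+x. H n x \<partial>\<mu>) = (\<integral>\<^sup>+x. h x \<partial>law (\<lambda>_. c) n)"
        by (simp add: H_chain law_def)
      finally show ?case using Suc by (simp add: add_ac)
    qed
    have H_stay: "H n x \<le> stay c n x" if x: "x \<in> space X" for n x
    proof -
      have P: "chain (return X x) (\<lambda>_. step c) n \<in> space (prob_algebra X)"
        by (rule measurable_space[OF measurable_chain_return[OF c] x])
      then have s: "sets (chain (return X x) (\<lambda>_. step c) n) = sets X" by (simp add: space_prob_algebra)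
      have "H n x \<le> (\<integral>\<^sup>+y. indicator live y \<partial>chain (return X x) (\<lambda>_. step c) n)"
        unfolding H_def using h0 h1 sets_eq_imp_space_eq[OF s]
        by (intro nn_integral_mono) (auto simp: indicator_def)
      also have "\<dots> = stay c n x"
        unfolding stay_def by (rule nn_integral_indicator) (simp add: s)
      finally show ?thesis .
    qed
    have "(\<lambda>n. \<integral>\<^sup>+x. H n x \<partial>q) \<longlonglongrightarrow> (\<integral>\<^sup>+x. 0 \<partial>q)"
    proof (rule nn_integral_dominated_convergence[where w="\<lambda>_. 1"])
      show "(\<integral>\<^sup>+x. 1 \<partial>q) < \<infinity>" by (simp add: less_top[symmetric])
      have "AE x in q. (\<Sum>n. stay c n x) < \<infinity>"
        using trans c unfolding transient_def q_def by blast
      then show "AE x in q. (\<lambda>n. H n x) \<longlonglongrightarrow> 0"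
        using AE_space
      proof eventually_elim
        case (elim x)
        have "(\<lambda>n. stay c n x) \<longlonglongrightarrow> 0"
          by (rule ennreal_suminf_finite_tendsto_0[OF elim(1)])
        moreover have "H n x \<le> stay c n x" for n
          using H_stay elim(2) by (simp add: space_q)
        ultimately show ?case
          by (intro tendsto_sandwich[of "\<lambda>_. 0" "\<lambda>n. H n x" sequentially "\<lambda>n. stay c n x"] always_eventually) auto
      qed
    qed (use H_le_1 in \<open>auto simp: space_q intro!: AE_I2\<close>)
    then have "(\<lambda>n. \<integral>\<^sup>+x. H n x \<partial>q) \<longlonglongrightarrow> 0" by simp
    moreover have "(\<lambda>n. \<Sum>t<n. \<integral>\<^sup>+x. h x \<partial>law (\<lambda>_. c) t) \<longlonglongrightarrow> (\<Sum>t. \<integral>\<^sup>+x. h x \<partial>law (\<lambda>_. c) t)"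
      by (intro summable_LIMSEQ) simp
    ultimately have "(\<lambda>n. (\<Sum>t<n. \<integral>\<^sup>+x. h x \<partial>law (\<lambda>_. c) t) + (\<integral>\<^sup>+x. H n x \<partial>q)) \<longlonglongrightarrow>
        (\<Sum>t. \<integral>\<^sup>+x. h x \<partial>law (\<lambda>_. c) t) + 0"
      by (rule tendsto_add[rotated])
    then have "(\<lambda>n::nat. \<integral>\<^sup>+x. h x \<partial>q) \<longlonglongrightarrow> (\<Sum>t. \<integral>\<^sup>+x. h x \<partial>law (\<lambda>_. c) t) + 0"
      by (simp only: iter[symmetric])
    then have "(\<Sum>t. \<integral>\<^sup>+x. h x \<partial>law (\<lambda>_. c) t) + 0 = (\<integral>\<^sup>+x. h x \<partial>q)"
      by (rule LIMSEQ_unique[OF _ tendsto_const])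
    then show ?thesis by simp
  qed
  show ?thesis
  proof (rule measure_eqI)
    show "sets (occ (\<lambda>_. c)) = sets R" by (simp add: sets_occ[OF cp] sets_R)
    fix E assume "E \<in> sets (occ (\<lambda>_. c))"
    then have [measurable]: "E \<in> sets (X \<Otimes>\<^sub>M A)" by (simp add: sets_occ[OF cp])
    define k where "k x = indicator live x * (\<integral>\<^sup>+u. indicator E (x, c (x, u)) \<partial>unif)" for x
    have k[measurable]: "k \<in> borel_measurable X" unfolding k_def by measurable
    have k1: "k x \<le> 1" for x
    proof -
      have "(\<integral>\<^sup>+u. indicator E (x, c (x, u)) \<partial>unif) \<le> (1::ennreal)"
        by (intro unif.nn_integral_le_const) (auto simp: indicator_def)
      then show ?thesis by (auto simp: k_def indicator_def)
    qed
    have "emeasure (occ (\<lambda>_. c)) E = (\<integral>\<^sup>+z. indicator E z \<partial>occ (\<lambda>_. c))"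
      by (simp add: sets_occ[OF cp])
    also have "\<dots> = (\<Sum>t. \<integral>\<^sup>+x. k x \<partial>law (\<lambda>_. c) t)"
      using c by (subst nn_integral_occ_step[OF cp])
        (auto simp: k_def space_law[OF cp] indicator_def intro!: suminf_cong nn_integral_cong)
    also have "\<dots> = (\<integral>\<^sup>+x. k x \<partial>q)"
      using k1 by (intro main[symmetric]) (auto simp: k_def)
    also have "\<dots> = (\<integral>\<^sup>+x. \<integral>\<^sup>+u. indicator live x * indicator E (x, c (x, u)) \<partial>unif \<partial>q)"
      unfolding k_def by (intro nn_integral_cong nn_integral_cmult[symmetric]) (auto simp: space_q)
    also have "\<dots> = (\<integral>\<^sup>+z. indicator live (fst z) * indicator E z \<partial>act_law X A q c)"
      by (subst nn_integral_act_law[OF sets_q c_meas]) simp_all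
    also have "\<dots> = (\<integral>\<^sup>+z. indicator E z \<partial>R)"
      unfolding c_R
    proof (rule nn_integral_cong_AE)
      show "AE z in R. indicator live (fst z) * indicator E z = (indicator E z :: ennreal)"
        using R_live AE_space
        by eventually_elim (auto simp: indicator_def sets_eq_imp_space_eq[OF sets_R] space_pair_measure)
    qed
    finally show "emeasure (occ (\<lambda>_. c)) E = emeasure R E" by simp
  qed
qed

text \<open>The control is read off from \<open>R\<close> by disintegration over its state marginal.\<close>

lemma realize_balanced:
  assumes fin: "finite_measure R" and sets_R[measurable_cong]: "sets R = sets (X \<Otimes>\<^sub>M A)"
    and R_graph: "AE z in R. z \<in> Gr"
    and R_live: "AE z in R. fst z \<noteq> xb"
    and bal: "balanced R" and trans: "transient (distr R X fst)"
  shows "\<exists>c\<in>controls. act_law X A (distr R X fst) c = R \<and> occ (\<lambda>_. c) = R"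
proof -
  obtain s where s_meas: "s \<in> X \<rightarrow>\<^sub>M A" and s: "\<And>x. x \<in> space X \<Longrightarrow> s x \<in> Act x"
    using selector by blast
  have "\<exists>c \<in> X \<Otimes>\<^sub>M borel \<rightarrow>\<^sub>M A. (\<forall>x\<in>space X. \<forall>u. (x, c (x, u)) \<in> Gr) \<and> act_law X A (distr R X fst) c = R"
  proof (rule disintegration[OF fin sets_R A_retract Gr_sets R_graph s_meas])
    show "(x, s x) \<in> Gr" if "x \<in> space X" for x using s[OF that] that by (simp add: Gr_def)
  qed
  then obtain c where c_meas: "c \<in> X \<Otimes>\<^sub>M borel \<rightarrow>\<^sub>M A"
    and c_Gr: "\<forall>x\<in>space X. \<forall>u. (x, c (x, u)) \<in> Gr" and c_R: "act_law X A (distr R X fst) c = R"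
    by blast
  have c: "c \<in> controls" using c_Gr c_meas by (auto simp: controls_def Gr_def)
  show ?thesis
    using occ_eq_if_balanced[OF fin sets_R R_live bal trans c c_R] c c_R by blast
qed

end

section \<open>Values and uniform tails\<close>

context control_base begin

lemma integral_law_Suc:
  fixes h :: "'x \<Rightarrow> real"
  assumes c: "c \<in> plans" and h: "h \<in> borel_measurable X" "\<And>y. y \<in> space X \<Longrightarrow> \<bar>h y\<bar> \<le> B"
  shows "(\<integral>x. h x \<partial>law c (Suc t)) = (\<integral>x. \<integral>y. h y \<partial>step (c t) x \<partial>law c t)"
  unfolding law_Suc
proof (rule integral_bind_prob[OF h _ law_prob_space[OF c]])
  show "step (c t) \<in> law c t \<rightarrow>\<^sub>M prob_algebra X"
    using plansD[OF c] by (simp add: measurable_cong_sets[OF sets_law[OF c] refl] measurable_step controls_measurable)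
qed

lemma measurable_integral_step[measurable]:
  fixes h :: "'x \<Rightarrow> real"
  assumes "c \<in> controls" "h \<in> borel_measurable X"
  shows "(\<lambda>x. \<integral>y. h y \<partial>step c x) \<in> borel_measurable X"
  using assms
  by (intro measurable_compose[OF measurable_prob_algebraD[OF measurable_step] integral_measurable_subprob_algebra]) auto

lemma step_prob: "c \<in> controls \<Longrightarrow> x \<in> space X \<Longrightarrow> step c x \<in> space (prob_algebra X)"
  by (rule measurable_space[OF measurable_step]) auto

lemma integral_bound:
  fixes h :: "'b \<Rightarrow> real"
  assumes "prob_space P" "\<And>y. y \<in> space P \<Longrightarrow> \<bar>h y\<bar> \<le> B" "0 \<le> B"
  shows "\<bar>\<integral>y. h y \<partial>P\<bar> \<le> B"
proof -
  interpret prob_space P by fact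
  have "\<bar>\<integral>y. h y \<partial>P\<bar> \<le> (\<integral>y. \<bar>h y\<bar> \<partial>P)" by (rule integral_abs_bound)
  also have "\<dots> \<le> B"
  proof (cases "integrable P (\<lambda>y. \<bar>h y\<bar>)")
    case True
    then have "(\<integral>y. \<bar>h y\<bar> \<partial>P) \<le> (\<integral>y. B \<partial>P)" using assms by (intro integral_mono) auto
    then show ?thesis by (simp add: prob_space)
  qed (simp add: not_integrable_integral_eq assms)
  finally show ?thesis .
qed

lemma AE_p_xb:
  assumes a: "a \<in> Act xb"
  shows "AE y in p (xb, a). y = xb"
proof -
  have P: "p (xb, a) \<in> space (prob_algebra X)"
    using Act_space[OF xb a] by (intro p_prob) auto
  interpret P: prob_space "p (xb, a)" using P by (simp add: space_prob_algebra)
  have "AE y in p (xb, a). y \<in> {xb}"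
    using absorb[OF a] P by (subst P.AE_in_set_eq_1) (auto simp: P.emeasure_eq_measure space_prob_algebra)
  then show ?thesis by simp
qed

definition rew :: "(nat \<Rightarrow> 'x \<times> real \<Rightarrow> 'a) \<Rightarrow> ('x \<times> 'a \<Rightarrow> real) \<Rightarrow> nat \<Rightarrow> real" where
  "rew c g t = (\<integral>z. indicator (- {xb}) (fst z) * g z \<partial>pair_law c t)"

definition val :: "(nat \<Rightarrow> 'x \<times> real \<Rightarrow> 'a) \<Rightarrow> ('x \<times> 'a \<Rightarrow> real) \<Rightarrow> real" where
  "val c g = (\<Sum>t. rew c g t)"

definition alive :: "(nat \<Rightarrow> 'x \<times> real \<Rightarrow> 'a) \<Rightarrow> nat \<Rightarrow> real" where
  "alive c t = measure (law c t) live"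

definition bfun :: "real \<Rightarrow> ('x \<times> 'a \<Rightarrow> real) set" where
  "bfun B = {g \<in> borel_measurable (X \<Otimes>\<^sub>M A). \<forall>z\<in>space (X \<Otimes>\<^sub>M A). \<bar>g z\<bar> \<le> B}"

lemma bfun_measurable[measurable_dest]: "g \<in> bfun B \<Longrightarrow> g \<in> borel_measurable (X \<Otimes>\<^sub>M A)"
  by (simp add: bfun_def)

lemma bfun_bound: "g \<in> bfun B \<Longrightarrow> x \<in> space X \<Longrightarrow> a \<in> space A \<Longrightarrow> \<bar>g (x, a)\<bar> \<le> B"
  by (auto simp: bfun_def space_pair_measure)

lemma bfun_bound': "g \<in> bfun B \<Longrightarrow> z \<in> space (X \<Otimes>\<^sub>M A) \<Longrightarrow> \<bar>g z\<bar> \<le> B"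
  by (auto simp: bfun_def)

lemma bfun_nonneg: "g \<in> bfun B \<Longrightarrow> 0 \<le> B"
proof -
  assume g: "g \<in> bfun B"
  obtain s where "\<forall>x\<in>space X. s x \<in> Act x" using selector by blast
  then have "s xb \<in> space A" using xb Act_space by blast
  then show ?thesis using bfun_bound[OF g xb] abs_ge_zero order_trans by blast
qed

lemma alive_eq:
  assumes c: "c \<in> plans"
  shows "alive c t = (\<integral>z. indicator (- {xb}) (fst z) \<partial>pair_law c t)"
proof -
  interpret P: prob_space "law c t" by (rule law_prob_space[OF c])
  have "unif.prob UNIV = 1" using unif.prob_space by simp
  then have "(\<integral>z. indicat_real (- {xb}) (fst z) \<partial>pair_law c t) = P.prob (- {xb} \<inter> space (law c t))"
    using integral_pair_law[OF c, of "\<lambda>z. indicat_real (- {xb}) (fst z)" 1 t] by simp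
  also have "- {xb} \<inter> space (law c t) = live" by (auto simp: space_law[OF c])
  finally show ?thesis by (simp add: alive_def)
qed

lemma ennreal_alive:
  assumes c: "c \<in> plans"
  shows "ennreal (alive c t) = (\<integral>\<^sup>+z. indicator (- {xb}) (fst z) \<partial>pair_law c t)"
proof -
  interpret P: prob_space "pair_law c t" by (rule prob_space_pair_law[OF c])
  have "(\<integral>\<^sup>+z. indicator (- {xb}) (fst z) \<partial>pair_law c t) = (\<integral>\<^sup>+z. ennreal (indicator (- {xb}) (fst z)) \<partial>pair_law c t)"
    by (intro nn_integral_cong) (auto simp: indicator_def)
  also have "\<dots> = ennreal (alive c t)"
    unfolding alive_eq[OF c]
    by (intro nn_integral_eq_integral P.integrable_const_bound[where B=1]) (auto simp: indicator_def)
  finally show ?thesis by simp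
qed

lemma rew_integrable:
  assumes c: "c \<in> plans" and g: "g \<in> bfun B"
  shows "integrable (pair_law c t) (\<lambda>z. indicator (- {xb}) (fst z) * g z)"
proof -
  interpret P: prob_space "pair_law c t" by (rule prob_space_pair_law[OF c])
  note [measurable] = bfun_measurable[OF g]
  show ?thesis
    using bfun_bound'[OF g] bfun_nonneg[OF g]
    by (intro P.integrable_const_bound[where B=B]) (auto simp: indicator_def)
qed

lemma rew_bound:
  assumes c: "c \<in> plans" and g: "g \<in> bfun B"
  shows "\<bar>rew c g t\<bar> \<le> B * alive c t"
proof -
  interpret P: prob_space "pair_law c t" by (rule prob_space_pair_law[OF c])
  note [measurable] = bfun_measurable[OF g]
  have "\<bar>rew c g t\<bar> \<le> (\<integral>z. \<bar>indicator (- {xb}) (fst z) * g z\<bar> \<partial>pair_law c t)"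
    unfolding rew_def by (rule integral_abs_bound)
  also have "\<dots> \<le> (\<integral>z. B * indicator (- {xb}) (fst z) \<partial>pair_law c t)"
  proof (rule integral_mono)
    show "integrable (pair_law c t) (\<lambda>z. \<bar>indicator (- {xb}) (fst z) * g z\<bar>)"
      using rew_integrable[OF assms] by (rule integrable_abs)
    show "integrable (pair_law c t) (\<lambda>z. B * indicator (- {xb}) (fst z))"
      by (intro P.integrable_const_bound[where B="\<bar>B\<bar>"]) (auto simp: indicator_def)
    show "\<bar>indicator (- {xb}) (fst z) * g z\<bar> \<le> B * indicator (- {xb}) (fst z)" if "z \<in> space (pair_law c t)" for z
      using bfun_bound'[OF g, of z] that by (auto simp: indicator_def)
  qed
  also have "\<dots> = B * alive c t" by (simp add: alive_eq[OF c])
  finally show ?thesis .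
qed

lemma rew_step:
  assumes c: "c \<in> plans" and g: "g \<in> bfun B"
  shows "rew c g t = (\<integral>x. \<integral>u. indicator (- {xb}) x * g (x, c t (x, u)) \<partial>unif \<partial>law c t)"
proof -
  note [measurable] = bfun_measurable[OF g]
  show ?thesis
    unfolding rew_def using bfun_bound'[OF g] bfun_nonneg[OF g]
    by (subst integral_pair_law[OF c, where B=B]) (auto simp: indicator_def)
qed

text \<open>Dominated convergence, one transition at a time: if the actions agree eventually for each state
  and seed, the state laws converge on bounded test functions, even on test functions that
  converge only pointwise.\<close>

lemma law_eventually_equal:
  fixes h :: "nat \<Rightarrow> 'x \<Rightarrow> real"
  assumes cs: "\<And>n. cs n \<in> plans" and c: "c \<in> plans"
    and ev: "\<And>t x u. x \<in> space X \<Longrightarrow> \<forall>\<^sub>F n in sequentially. cs n t (x, u) = c t (x, u)"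
    and h: "\<And>n. h n \<in> borel_measurable X" "h' \<in> borel_measurable X"
    and B: "\<And>n x. x \<in> space X \<Longrightarrow> \<bar>h n x\<bar> \<le> B" "\<And>x. x \<in> space X \<Longrightarrow> \<bar>h' x\<bar> \<le> B"
    and lim: "\<And>x. x \<in> space X \<Longrightarrow> (\<lambda>n. h n x) \<longlonglongrightarrow> h' x"
  shows "(\<lambda>n. \<integral>x. h n x \<partial>law (cs n) t) \<longlonglongrightarrow> (\<integral>x. h' x \<partial>law c t)"
  using h B lim
proof (induction t arbitrary: h h')
  case 0
  have [measurable_cong]: "sets \<mu> = sets X" and "prob_space \<mu>" using \<mu> by (auto simp: space_prob_algebra)
  then interpret prob_space \<mu> by simp
  have sp: "space \<mu> = space X" by (rule sets_eq_imp_space_eq) fact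
  note [measurable] = 0(1,2)
  show ?case
    unfolding law_0
    by (rule integral_dominated_convergence[where w="\<lambda>_. B"]) (use 0 in \<open>auto simp: sp\<close>)
next
  case (Suc t)
  have B0: "0 \<le> B" using Suc.prems(4)[OF xb] by linarith
  note [measurable] = Suc.prems(1,2)
  have "(\<lambda>n. \<integral>x. \<integral>y. h n y \<partial>step (cs n t) x \<partial>law (cs n) t) \<longlonglongrightarrow> (\<integral>x. \<integral>y. h' y \<partial>step (c t) x \<partial>law c t)"
  proof (rule Suc.IH)
    show "(\<lambda>x. \<integral>y. h n y \<partial>step (cs n t) x) \<in> borel_measurable X" for n
      using plansD[OF cs] Suc.prems(1) by (intro measurable_integral_step) auto
    show "(\<lambda>x. \<integral>y. h' y \<partial>step (c t) x) \<in> borel_measurable X"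
      using plansD[OF c] Suc.prems(2) by (intro measurable_integral_step) auto
    fix x assume x: "x \<in> space X"
    show "\<bar>\<integral>y. h n y \<partial>step (cs n t) x\<bar> \<le> B" for n
      using step_prob[OF plansD[OF cs] x, of n t] Suc.prems(3) B0
      by (intro integral_bound) (auto simp: space_prob_algebra dest: sets_eq_imp_space_eq)
    show "\<bar>\<integral>y. h' y \<partial>step (c t) x\<bar> \<le> B"
      using step_prob[OF plansD[OF c] x, of t] Suc.prems(4) B0
      by (intro integral_bound) (auto simp: space_prob_algebra dest: sets_eq_imp_space_eq)
    have P: "p (x, a) \<in> space (prob_algebra X)" if "a \<in> Act x" for a
      using that x by (intro p_prob) (auto intro: Act_space)
    have "(\<lambda>n. \<integral>u. \<integral>y. h n y \<partial>p (x, cs n t (x, u)) \<partial>unif) \<longlonglongrightarrow> (\<integral>u. \<integral>y. h' y \<partial>p (x, c t (x, u)) \<partial>unif)"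
    proof (rule integral_dominated_convergence[where w="\<lambda>_. B"])
      note [measurable] = plans_measurable[OF cs] plans_measurable[OF c] x
      show "(\<lambda>u. \<integral>y. h' y \<partial>p (x, c t (x, u))) \<in> borel_measurable unif"
        "(\<lambda>u. \<integral>y. h n y \<partial>p (x, cs n t (x, u))) \<in> borel_measurable unif" for n
        by measurable
      show "AE u in unif. (\<lambda>n. \<integral>y. h n y \<partial>p (x, cs n t (x, u))) \<longlonglongrightarrow> (\<integral>y. h' y \<partial>p (x, c t (x, u)))"
      proof (rule AE_I2)
        fix u
        let ?P = "p (x, c t (x, u))"
        have [measurable_cong]: "sets ?P = sets X" and "prob_space ?P"
          using P[OF plans_Act[OF c x]] by (auto simp: space_prob_algebra)
        then interpret P: prob_space ?P by simp
        have sp: "space ?P = space X" by (rule sets_eq_imp_space_eq) fact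
        have "(\<lambda>n. \<integral>y. h n y \<partial>?P) \<longlonglongrightarrow> (\<integral>y. h' y \<partial>?P)"
          by (rule integral_dominated_convergence[where w="\<lambda>_. B"]) (use Suc.prems in \<open>auto simp: sp\<close>)
        then show "(\<lambda>n. \<integral>y. h n y \<partial>p (x, cs n t (x, u))) \<longlonglongrightarrow> (\<integral>y. h' y \<partial>?P)"
          by (rule Lim_transform_eventually) (use ev[OF x, of t u] in \<open>auto elim!: eventually_mono\<close>)
      qed
      show "AE u in unif. norm (\<integral>y. h n y \<partial>p (x, cs n t (x, u))) \<le> B" for n
      proof (rule AE_I2)
        fix u
        show "norm (\<integral>y. h n y \<partial>p (x, cs n t (x, u))) \<le> B"
          using P[OF plans_Act[OF cs x], of n t u] Suc.prems(3) B0
          unfolding real_norm_def by (intro integral_bound) (auto simp: space_prob_algebra dest: sets_eq_imp_space_eq)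
      qed
    qed simp
    then show "(\<lambda>n. \<integral>y. h n y \<partial>step (cs n t) x) \<longlonglongrightarrow> (\<integral>y. h' y \<partial>step (c t) x)"
      using x plans_measurable[OF cs] plans_measurable[OF c] Suc.prems by (subst (1 2) integral_step[where B=B]) auto
  qed
  then show ?case
    using Suc.prems cs c by (subst (1 2) integral_law_Suc[where B=B]) auto
qed

lemma rew_eventually_equal:
  assumes cs: "\<And>n. cs n \<in> plans" and c: "c \<in> plans"
    and ev: "\<And>t x u. x \<in> space X \<Longrightarrow> \<forall>\<^sub>F n in sequentially. cs n t (x, u) = c t (x, u)"
    and g: "g \<in> bfun B"
  shows "(\<lambda>n. rew (cs n) g t) \<longlonglongrightarrow> rew c g t"
proof -
  note [measurable] = bfun_measurable[OF g] plans_measurable[OF cs] plans_measurable[OF c]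
  have B0: "0 \<le> B" by (rule bfun_nonneg[OF g])
  have bd: "\<bar>indicator (- {xb}) x * g (x, d (x, u))\<bar> \<le> B" if "x \<in> space X" "d \<in> controls" for x u d
    using bfun_bound[OF g that(1) Act_space[OF that(1) controls_Act[OF that(2,1)]]] B0 by (auto simp: indicator_def)
  have [measurable]: "(indicator (- {xb}) :: 'x \<Rightarrow> real) \<in> borel_measurable X"
    using measurable_cong[THEN iffD1, of X "indicator live" "indicator (- {xb})" borel] by (auto simp: indicator_def)
  show ?thesis
    unfolding rew_step[OF cs g] rew_step[OF c g]
  proof (rule law_eventually_equal[where B=B, OF cs c ev])
    fix x assume x: "x \<in> space X"
    show "(\<lambda>n. \<integral>u. indicator (- {xb}) x * g (x, cs n t (x, u)) \<partial>unif) \<longlonglongrightarrow>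
        (\<integral>u. indicator (- {xb}) x * g (x, c t (x, u)) \<partial>unif)"
    proof (rule integral_dominated_convergence[where w="\<lambda>_. B"])
      note [measurable] = x
      show "(\<lambda>u. indicator (- {xb}) x * g (x, c t (x, u))) \<in> borel_measurable unif"
        "(\<lambda>u. indicator (- {xb}) x * g (x, cs n t (x, u))) \<in> borel_measurable unif" for n
        by measurable
      show "AE u in unif. (\<lambda>n. indicator (- {xb}) x * g (x, cs n t (x, u))) \<longlonglongrightarrow> indicator (- {xb}) x * g (x, c t (x, u))"
      proof (rule AE_I2)
        fix u
        have "\<forall>\<^sub>F n in sequentially. indicator (- {xb}) x * g (x, cs n t (x, u)) = indicator (- {xb}) x * g (x, c t (x, u))"
          using ev[OF x, of t u] by (rule eventually_mono) simp
        then show "(\<lambda>n. indicator (- {xb}) x * g (x, cs n t (x, u))) \<longlonglongrightarrow> indicator (- {xb}) x * g (x, c t (x, u))"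
          by (rule tendsto_eventually)
      qed
      show "AE u in unif. norm (indicator (- {xb}) x * g (x, cs n t (x, u))) \<le> B" for n
        using bd[OF x plansD[OF cs]] by simp
    qed simp
    show "\<bar>\<integral>u. indicator (- {xb}) x * g (x, cs n t (x, u)) \<partial>unif\<bar> \<le> B" for n
      using bd[OF x plansD[OF cs]] B0 prob_space_unif by (intro integral_bound) auto
    show "\<bar>\<integral>u. indicator (- {xb}) x * g (x, c t (x, u)) \<partial>unif\<bar> \<le> B"
      using bd[OF x plansD[OF c]] B0 prob_space_unif by (intro integral_bound) auto
  qed measurable
qed

lemma AE_occI:
  assumes c: "c \<in> plans" and [measurable]: "Measurable.pred (X \<Otimes>\<^sub>M A) P"
    and P: "\<And>t. AE z in pair_law c t. fst z \<noteq> xb \<longrightarrow> P z"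
  shows "AE z in occ c. P z"
proof -
    note [measurable_cong] = sets_occ[OF c]
    have sp: "space (occ c) = space X \<times> space A"
      using sets_eq_imp_space_eq[OF sets_occ[OF c]] by (simp add: space_pair_measure)
    have "(\<integral>\<^sup>+z. indicator {z\<in>space (X \<Otimes>\<^sub>M A). \<not> P z} z \<partial>occ c) =
        (\<Sum>t. \<integral>\<^sup>+z. indicator (- {xb}) (fst z) * indicator {z\<in>space (X \<Otimes>\<^sub>M A). \<not> P z} z \<partial>pair_law c t)"
      by (rule nn_integral_occ[OF c]) measurable
    also have "\<dots> = (\<Sum>t. 0)"
    proof (rule suminf_cong)
      fix t
      show "(\<integral>\<^sup>+z. indicator (- {xb}) (fst z) * indicator {z\<in>space (X \<Otimes>\<^sub>M A). \<not> P z} z \<partial>pair_law c t) = 0"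
        by (subst nn_integral_0_iff_AE) (use P[of t] in \<open>auto simp: indicator_def elim!: eventually_mono\<close>)
    qed
    finally have "emeasure (occ c) {z\<in>space (X \<Otimes>\<^sub>M A). \<not> P z} = 0" by (simp add: sets_occ[OF c])
    then show ?thesis
      by (intro AE_I[where N="{z\<in>space (X \<Otimes>\<^sub>M A). \<not> P z}"]) (auto simp: sp space_pair_measure sets_occ[OF c])
qed

lemma AE_occ_graph:
  assumes c: "c \<in> plans"
  shows "AE z in occ c. z \<in> Gr" "AE z in occ c. fst z \<noteq> xb"
proof -
  show "AE z in occ c. z \<in> Gr"
  proof (rule AE_occI[OF c])
    show "AE z in pair_law c t. fst z \<noteq> xb \<longrightarrow> z \<in> Gr" for t
      using AE_pair_law_graph[OF c, of t] by eventually_elim simp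
  qed measurable
  show "AE z in occ c. fst z \<noteq> xb"
    by (rule AE_occI[OF c]) auto
qed

text \<open>The visits at time 0 contribute \<open>\<mu>\<close>, those at time \<open>t + 1\<close> come
  from a transition at time \<open>t\<close>.\<close>

lemma balanced_occ:
  assumes c: "c \<in> plans"
  shows "balanced (occ c)"
  unfolding balanced_def
proof (intro ballI impI)
  fix h :: "'x \<Rightarrow> ennreal" assume h[measurable]: "h \<in> borel_measurable X" and h0: "h xb = 0"
    and "\<forall>x\<in>space X. h x \<le> 1"
  have eq1: "(\<integral>\<^sup>+z. indicator (- {xb}) (fst z) * h (fst z) \<partial>pair_law c t) = (\<integral>\<^sup>+x. h x \<partial>law c t)" for t
  proof -
    have "(\<integral>\<^sup>+z. indicator (- {xb}) (fst z) * h (fst z) \<partial>pair_law c t) = (\<integral>\<^sup>+z. h (fst z) \<partial>pair_law c t)"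
      using h0 by (intro nn_integral_cong) (auto simp: indicator_def)
    also have "\<dots> = (\<integral>\<^sup>+x. h x \<partial>law c t)"
      by (subst nn_integral_pair_law[OF c]) (simp_all add: unif.emeasure_space_1[simplified])
    finally show ?thesis .
  qed
  have eq2: "(\<integral>\<^sup>+z. indicator (- {xb}) (fst z) * (\<integral>\<^sup>+y. h y \<partial>p z) \<partial>pair_law c t) = (\<integral>\<^sup>+x. h x \<partial>law c (Suc t))" for t
  proof -
    have "(\<integral>\<^sup>+z. indicator (- {xb}) (fst z) * (\<integral>\<^sup>+y. h y \<partial>p z) \<partial>pair_law c t) = (\<integral>\<^sup>+z. \<integral>\<^sup>+y. h y \<partial>p z \<partial>pair_law c t)"
    proof (rule nn_integral_cong_AE)
      show "AE z in pair_law c t. indicator (- {xb}) (fst z) * (\<integral>\<^sup>+y. h y \<partial>p z) = (\<integral>\<^sup>+y. h y \<partial>p z)"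
        using AE_pair_law_graph[OF c, of t]
      proof eventually_elim
        case (elim z)
        show ?case
        proof (cases "fst z = xb")
          case True
          then have "snd z \<in> Act xb" using elim by (auto simp: Gr_def)
          then have "AE y in p (xb, snd z). h y = 0"
            by (rule eventually_mono[OF AE_p_xb]) (simp add: h0)
          then have "(\<integral>\<^sup>+y. h y \<partial>p (xb, snd z)) = (\<integral>\<^sup>+y. 0 \<partial>p (xb, snd z))"
            by (rule nn_integral_cong_AE)
          then show ?thesis using True by (metis mult_zero_right nn_integral_const prod.collapse mult_zero_left)
        qed simp
      qed
    qed
    also have "\<dots> = (\<integral>\<^sup>+x. h x \<partial>(pair_law c t \<bind> p))"
      by (rule nn_integral_bind_prob[OF h, symmetric]) measurable
    finally show ?thesis by (simp add: law_Suc_pair_law[OF c])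
  qed
  have "(\<integral>\<^sup>+z. h (fst z) \<partial>occ c) = (\<Sum>t. \<integral>\<^sup>+x. h x \<partial>law c t)"
    by (subst nn_integral_occ[OF c]) (simp_all add: eq1)
  also have "\<dots> = (\<integral>\<^sup>+x. h x \<partial>law c 0) + (\<Sum>t. \<integral>\<^sup>+x. h x \<partial>law c (Suc t))"
    using suminf_offset[of "\<lambda>t. \<integral>\<^sup>+x. h x \<partial>law c t" 1] by (simp add: add.commute)
  also have "(\<Sum>t. \<integral>\<^sup>+x. h x \<partial>law c (Suc t)) = (\<integral>\<^sup>+z. \<integral>\<^sup>+y. h y \<partial>p z \<partial>occ c)"
    by (subst nn_integral_occ[OF c]) (simp_all add: eq2)
  finally show "(\<integral>\<^sup>+z. h (fst z) \<partial>occ c) = (\<integral>\<^sup>+x. h x \<partial>\<mu>) + (\<integral>\<^sup>+z. \<integral>\<^sup>+y. h y \<partial>p z \<partial>occ c)" by simp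
qed

end

text \<open>The number \<open>tail n\<close> bounds, for all plans at once, the expected time spent outside
  \<open>xb\<close> after time \<open>n\<close>. Finite expected lifetimes and their uniformity
  are both contained in these bounds.\<close>

locale control_model = control_base X A Act p \<mu> xb
  for X :: "'x measure" and A :: "'a measure" and Act p \<mu> and xb :: 'x +
  fixes tail :: "nat \<Rightarrow> real"
  assumes tail_lim: "tail \<longlonglongrightarrow> 0"
    and tail_bound: "\<And>c n N. c \<in> plans \<Longrightarrow> (\<Sum>t\<in>{n..<N}. alive c t) \<le> tail n"
    and init_atomless: "\<And>x. x \<in> live \<Longrightarrow> emeasure \<mu> {x} = 0"
    and step_atomless: "\<And>x y a. x \<in> live \<Longrightarrow> y \<in> live \<Longrightarrow> a \<in> Act x \<Longrightarrow> emeasure (p (x, a)) {y} = 0"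
begin

lemma alive_nonneg: "0 \<le> alive c t"
  by (simp add: alive_def)

lemma summable_alive: "c \<in> plans \<Longrightarrow> summable (alive c)"
  using tail_bound[of c 0]
  by (intro summableI_nonneg_bounded[where x="tail 0"]) (auto simp: alive_nonneg atLeast0LessThan)

lemma suminf_alive_tail:
  assumes "c \<in> plans"
  shows "(\<Sum>t. alive c (t + n)) \<le> tail n"
proof (rule suminf_le_const)
  show "summable (\<lambda>t. alive c (t + n))" using summable_alive[OF assms] by (rule summable_ignore_initial_segment)
  show "(\<Sum>t<N. alive c (t + n)) \<le> tail n" for N
    using tail_bound[OF assms, of n "N + n"] sum.shift_bounds_nat_ivl[of "alive c" 0 n N]
    by (simp add: atLeast0LessThan)
qed

lemma suminf_alive: "c \<in> plans \<Longrightarrow> (\<Sum>t. alive c t) \<le> tail 0"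
  using suminf_alive_tail[of c 0] by simp

lemma summable_rew:
  assumes "c \<in> plans" "g \<in> bfun B"
  shows "summable (rew c g)"
  by (rule summable_comparison_test'[where g="\<lambda>t. B * alive c t" and N=0])
     (auto intro!: summable_mult summable_alive rew_bound assms)

lemma val_tail:
  assumes c: "c \<in> plans" and g: "g \<in> bfun B"
  shows "\<bar>val c g - (\<Sum>t<n. rew c g t)\<bar> \<le> B * tail n"
proof -
  have s: "summable (\<lambda>t. rew c g (t + n))" and sa: "summable (\<lambda>t. B * alive c (t + n))"
    by (intro summable_ignore_initial_segment summable_rew[OF assms])
       (intro summable_mult summable_ignore_initial_segment summable_alive[OF c])
  have "val c g - (\<Sum>t<n. rew c g t) = (\<Sum>t. rew c g (t + n))"
    unfolding val_def using suminf_split_initial_segment[OF summable_rew[OF assms], of n] by simp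
  also have "\<bar>\<dots>\<bar> \<le> (\<Sum>t. B * alive c (t + n))"
    using norm_suminf_le[of "\<lambda>t. rew c g (t + n)" "\<lambda>t. B * alive c (t + n)"] rew_bound[OF assms] sa by simp
  also have "\<dots> = B * (\<Sum>t. alive c (t + n))"
    by (intro suminf_mult summable_ignore_initial_segment summable_alive[OF c])
  also have "\<dots> \<le> B * tail n"
    by (intro mult_left_mono suminf_alive_tail c bfun_nonneg[OF g])
  finally show ?thesis .
qed

text \<open>Periodwise convergence suffices, because the tails are uniformly small.\<close>

lemma val_tendsto:
  assumes cs: "\<And>n. cs n \<in> plans" and c: "c \<in> plans" and g: "g \<in> bfun B"
    and lim: "\<And>t. (\<lambda>n. rew (cs n) g t) \<longlonglongrightarrow> rew c g t"
  shows "(\<lambda>n. val (cs n) g) \<longlonglongrightarrow> val c g"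
proof (rule LIMSEQ_I)
  fix e :: real assume e: "0 < e"
  have "(\<lambda>n. B * tail n) \<longlonglongrightarrow> B * 0" by (intro tendsto_mult tail_lim tendsto_const)
  then have "\<forall>\<^sub>F n in sequentially. B * tail n < e / 3"
    using e by (intro order_tendstoD(2)) auto
  then obtain N where N: "B * tail N < e / 3" by (auto simp: eventually_sequentially)
  have "(\<lambda>n. \<Sum>t<N. rew (cs n) g t) \<longlonglongrightarrow> (\<Sum>t<N. rew c g t)"
    by (intro tendsto_sum lim)
  then obtain n0 where n0: "\<And>n. n \<ge> n0 \<Longrightarrow> \<bar>(\<Sum>t<N. rew (cs n) g t) - (\<Sum>t<N. rew c g t)\<bar> < e / 3"
    using LIMSEQ_D[of _ _ "e / 3"] e by (metis real_norm_def zero_less_divide_iff zero_less_numeral)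
  show "\<exists>n0. \<forall>n\<ge>n0. norm (val (cs n) g - val c g) < e"
  proof (intro exI allI impI)
    fix n assume "n0 \<le> n"
    then show "norm (val (cs n) g - val c g) < e"
      using n0[of n] val_tail[where c="cs n" and n=N, OF cs g] val_tail[where n=N, OF c g] N unfolding real_norm_def by linarith
  qed
qed

lemma val_eventually_equal:
  assumes "\<And>n. cs n \<in> plans" "c \<in> plans"
    and "\<And>t x u. x \<in> space X \<Longrightarrow> \<forall>\<^sub>F n in sequentially. cs n t (x, u) = c t (x, u)"
    and "g \<in> bfun B"
  shows "(\<lambda>n. val (cs n) g) \<longlonglongrightarrow> val c g"
  by (rule val_tendsto[OF assms(1,2,4) rew_eventually_equal[OF assms]])

lemma emeasure_occ_space:
  assumes c: "c \<in> plans"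
  shows "emeasure (occ c) (space (occ c)) \<le> ennreal (tail 0)"
proof -
  have "emeasure (occ c) (space (occ c)) = (\<integral>\<^sup>+z. 1 \<partial>occ c)" by simp
  also have "\<dots> = (\<Sum>t. \<integral>\<^sup>+z. indicator (- {xb}) (fst z) * 1 \<partial>pair_law c t)"
    by (rule nn_integral_occ[OF c]) simp
  also have "\<dots> = (\<Sum>t. ennreal (alive c t))" by (simp add: ennreal_alive[OF c])
  also have "\<dots> = ennreal (\<Sum>t. alive c t)"
    by (intro suminf_ennreal2 alive_nonneg summable_alive[OF c])
  also have "\<dots> \<le> ennreal (tail 0)" by (intro ennreal_leI suminf_alive[OF c])
  finally show ?thesis .
qed

lemma finite_measure_occ: "c \<in> plans \<Longrightarrow> finite_measure (occ c)"
  using emeasure_occ_space[of c] by (intro finite_measureI) (auto simp: top_unique)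

lemma measure_occ_space: "c \<in> plans \<Longrightarrow> measure (occ c) (space (occ c)) \<le> tail 0"
  using emeasure_occ_space[of c] suminf_alive[of c] suminf_nonneg[OF summable_alive[of c]] alive_nonneg
  by (auto simp: measure_def intro!: enn2real_leI)

lemma integrable_occ:
  assumes c: "c \<in> plans" and g: "g \<in> bfun B"
  shows "integrable (occ c) g"
proof -
  interpret finite_measure "occ c" by (rule finite_measure_occ[OF c])
  note [measurable] = bfun_measurable[OF g]
  note [measurable_cong] = sets_occ[OF c]
  show ?thesis
    using bfun_bound'[OF g] by (intro integrable_const_bound[where B=B]) (auto simp: sets_eq_imp_space_eq[OF sets_occ[OF c]])
qed

lemma val_eq_integral_occ:
  assumes c: "c \<in> plans" and g: "g \<in> bfun B"
  shows "val c g = (\<integral>z. g z \<partial>occ c)"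
proof -
  have pos: "val c f = (\<integral>z. f z \<partial>occ c)" if f: "f \<in> bfun D" and f0: "\<And>z. z \<in> space (X \<Otimes>\<^sub>M A) \<Longrightarrow> 0 \<le> f z" for f D
  proof -
    note [measurable] = bfun_measurable[OF f]
    note [measurable_cong] = sets_occ[OF c]
    have sp: "space (occ c) = space (X \<Otimes>\<^sub>M A)" by (rule sets_eq_imp_space_eq[OF sets_occ[OF c]])
    have rew0: "0 \<le> rew c f t" for t
      unfolding rew_def by (intro integral_nonneg_AE AE_I2) (auto simp: f0)
    have "(\<integral>\<^sup>+z. ennreal (f z) \<partial>occ c) = (\<Sum>t. \<integral>\<^sup>+z. indicator (- {xb}) (fst z) * ennreal (f z) \<partial>pair_law c t)"
      by (rule nn_integral_occ[OF c]) measurable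
    also have "\<dots> = (\<Sum>t. ennreal (rew c f t))"
    proof (rule suminf_cong)
      fix t
      have "(\<integral>\<^sup>+z. indicator (- {xb}) (fst z) * ennreal (f z) \<partial>pair_law c t) =
          (\<integral>\<^sup>+z. ennreal (indicator (- {xb}) (fst z) * f z) \<partial>pair_law c t)"
        by (intro nn_integral_cong) (auto simp: indicator_def)
      also have "\<dots> = ennreal (rew c f t)"
        unfolding rew_def using f0 by (intro nn_integral_eq_integral rew_integrable[OF c f]) auto
      finally show "(\<integral>\<^sup>+z. indicator (- {xb}) (fst z) * ennreal (f z) \<partial>pair_law c t) = ennreal (rew c f t)" .
    qed
    also have "\<dots> = ennreal (val c f)"
      unfolding val_def by (intro suminf_ennreal2 rew0 summable_rew[OF c f])
    finally have "(\<integral>\<^sup>+z. ennreal (f z) \<partial>occ c) = ennreal (val c f)" .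
    moreover have "0 \<le> val c f" unfolding val_def by (intro suminf_nonneg rew0 summable_rew[OF c f])
    ultimately show ?thesis
      using f0 by (subst integral_eq_nn_integral) (auto simp: sp)
  qed
  have g1: "(\<lambda>z. g z + B) \<in> bfun (2 * B)"
    using g by (force simp: bfun_def)
  have g2: "(\<lambda>z. B) \<in> bfun (2 * B)"
    using bfun_nonneg[OF g] by (auto simp: bfun_def)
  have "rew c (\<lambda>z. g z + B) t = rew c g t + rew c (\<lambda>z. B) t" for t
    unfolding rew_def distrib_left
    by (intro Bochner_Integration.integral_add rew_integrable[OF c g] rew_integrable[OF c g2])
  then have "val c (\<lambda>z. g z + B) = val c g + val c (\<lambda>z. B)"
    unfolding val_def suminf_add[OF summable_rew[OF c g] summable_rew[OF c g2]] by (intro suminf_cong)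
  moreover have "val c (\<lambda>z. g z + B) = (\<integral>z. g z + B \<partial>occ c)"
    using bfun_bound'[OF g] by (intro pos[OF g1]) (smt (verit))
  moreover have "val c (\<lambda>z. B) = (\<integral>z. B \<partial>occ c)"
    using bfun_nonneg[OF g] by (intro pos[OF g2]) auto
  moreover have "(\<integral>z. g z + B \<partial>occ c) = (\<integral>z. g z \<partial>occ c) + (\<integral>z. B \<partial>occ c)"
    by (intro Bochner_Integration.integral_add integrable_occ[OF c g] integrable_occ[OF c g2])
  ultimately show ?thesis by simp
qed

text \<open>Follow \<open>d\<close> up to time \<open>t\<close> and the stationary control \<open>c\<close>
  afterwards: this is a plan, so its expected lifetime is finite.\<close>

lemma transient_law:
  assumes d: "d \<in> plans"
  shows "transient (law d t)"
  unfolding transient_def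
proof
  fix c assume c: "c \<in> controls"
  define s where "s n = (if n < t then d n else c)" for n
  have s: "s \<in> plans" using plansD[OF d] c by (auto simp: s_def[abs_def] intro!: plansI)
  note [measurable] = measurable_stay[OF c]
  note [measurable_cong] = sets_law[OF d]
  have law_lt: "n \<le> t \<Longrightarrow> law s n = law d n" for n
  proof (induction n)
    case (Suc n)
    then have "s n = d n" by (simp add: s_def)
    with Suc show ?case by (simp add: law_Suc)
  qed simp
  have law_add: "law s (t + n) = chain (law d t) (\<lambda>_. step c) n" for n
  proof (induction n)
    case (Suc n)
    have "s (t + n) = c" by (simp add: s_def)
    with Suc show ?case by (simp add: law_Suc)
  qed (simp add: law_lt)
  have "(\<integral>\<^sup>+x. stay c n x \<partial>law d t) = ennreal (alive s (n + t))" for n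
  proof -
    interpret P: prob_space "law s (n + t)" by (rule law_prob_space[OF s])
    have "(\<integral>\<^sup>+x. stay c n x \<partial>law d t) =
        emeasure (law d t \<bind> (\<lambda>x. chain (return X x) (\<lambda>_. step c) n)) live"
      unfolding stay_def using measurable_chain_return[OF c, of n]
      by (intro emeasure_bind_prob_algebra[symmetric, where N=X and L=X] law_prob[OF d]) auto
    also have "\<dots> = emeasure (law s (t + n)) live"
      by (simp add: law_add chain_from[OF c law_prob[OF d], of t n, symmetric])
    finally show ?thesis by (simp add: alive_def P.emeasure_eq_measure add.commute)
  qed
  then have "(\<integral>\<^sup>+x. (\<Sum>n. stay c n x) \<partial>law d t) = (\<Sum>n. ennreal (alive s (n + t)))"
    by (subst nn_integral_suminf) auto
  also have "\<dots> = ennreal (\<Sum>n. alive s (n + t))"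
    by (intro suminf_ennreal2 alive_nonneg summable_ignore_initial_segment summable_alive[OF s])
  finally have "(\<integral>\<^sup>+x. (\<Sum>n. stay c n x) \<partial>law d t) \<noteq> \<infinity>" by simp
  then show "AE x in law d t. (\<Sum>n. stay c n x) < \<infinity>"
    using nn_integral_PInf_AE[of "\<lambda>x. \<Sum>n. stay c n x" "law d t"] by (auto simp: less_top elim!: eventually_mono)
qed

lemma transient_occ:
  assumes d: "d \<in> plans"
  shows "transient (distr (occ d) X fst)"
  unfolding transient_def
proof
  fix c assume c: "c \<in> controls"
  note [measurable] = measurable_stay[OF c]
  note [measurable_cong] = sets_occ[OF d]
  have "AE z in occ d. (\<Sum>n. stay c n (fst z)) < \<infinity>"
  proof (rule AE_occI[OF d])
    show "AE z in pair_law d t. fst z \<noteq> xb \<longrightarrow> (\<Sum>n. stay c n (fst z)) < \<infinity>" for t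
    proof -
      note [measurable_cong] = sets_law[OF d]
      note [measurable] = plans_measurable[OF d]
      interpret P: prob_space "law d t" by (rule law_prob_space[OF d])
      interpret PU: pair_prob_space "law d t" unif ..
      have "AE x in law d t. (\<Sum>n. stay c n x) < \<infinity>"
        using transient_law[OF d, of t] c unfolding transient_def by blast
      then have "AE z in law d t \<Otimes>\<^sub>M unif. (\<Sum>n. stay c n (fst z)) < \<infinity>"
      proof (intro PU.AE_pair_measure)
        show "{z \<in> space (law d t \<Otimes>\<^sub>M unif). (\<Sum>n. stay c n (fst z)) < \<infinity>} \<in> sets (law d t \<Otimes>\<^sub>M unif)"
          using c by measurable
      qed (auto elim!: eventually_mono)
      then show ?thesis
        unfolding pair_law_def act_law_def by (subst AE_distr_iff) (auto elim!: eventually_mono)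
    qed
  qed measurable
  then show "AE x in distr (occ d) X fst. (\<Sum>n. stay c n x) < \<infinity>"
    by (subst AE_distr_iff) auto
qed

end

section \<open>One seed per cell: second moments\<close>

lemma measurable_integral_kernel:
  fixes f :: "'b \<times> 'x \<Rightarrow> real"
  assumes L[measurable]: "L \<in> S \<rightarrow>\<^sub>M prob_algebra X" and f[measurable]: "f \<in> borel_measurable (S \<Otimes>\<^sub>M X)"
  shows "(\<lambda>\<omega>. \<integral>x. f (\<omega>, x) \<partial>L \<omega>) \<in> borel_measurable S"
proof -
  have "(\<lambda>\<omega>. distr (L \<omega>) (S \<Otimes>\<^sub>M X) (Pair \<omega>)) \<in> S \<rightarrow>\<^sub>M prob_algebra (S \<Otimes>\<^sub>M X)"
    by measurable
  then have "(\<lambda>\<omega>. \<integral>z. f z \<partial>distr (L \<omega>) (S \<Otimes>\<^sub>M X) (Pair \<omega>)) \<in> borel_measurable S"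
    by (intro measurable_compose[OF measurable_prob_algebraD integral_measurable_subprob_algebra[OF f]])
  also have "(\<lambda>\<omega>. \<integral>z. f z \<partial>distr (L \<omega>) (S \<Otimes>\<^sub>M X) (Pair \<omega>)) \<in> borel_measurable S \<longleftrightarrow> ?thesis"
  proof (rule measurable_cong)
    fix \<omega> assume \<omega>: "\<omega> \<in> space S"
    have [measurable_cong]: "sets (L \<omega>) = sets X"
      using measurable_space[OF L \<omega>] by (simp add: space_prob_algebra)
    show "(\<integral>z. f z \<partial>distr (L \<omega>) (S \<Otimes>\<^sub>M X) (Pair \<omega>)) = (\<integral>x. f (\<omega>, x) \<partial>L \<omega>)"
      using \<omega> by (intro integral_distr) measurable
  qed
  finally show ?thesis .
qed

lemma (in prob_space) expectation_abs_le_sqrt: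
  fixes Y :: "'a \<Rightarrow> real"
  assumes [measurable]: "random_variable borel Y" and B: "\<And>\<omega>. \<omega> \<in> space M \<Longrightarrow> \<bar>Y \<omega>\<bar> \<le> B"
    and b: "expectation (\<lambda>\<omega>. (Y \<omega>)\<^sup>2) \<le> b"
  shows "expectation (\<lambda>\<omega>. \<bar>Y \<omega>\<bar>) \<le> sqrt b"
proof -
  have "integrable M (\<lambda>\<omega>. \<bar>Y \<omega>\<bar>)" using B by (intro integrable_const_bound[where B=B]) auto
  moreover have "integrable M (\<lambda>\<omega>. \<bar>Y \<omega>\<bar>\<^sup>2)"
    using power_mono[OF B, of _ 2] by (intro integrable_const_bound[where B="B\<^sup>2"]) auto
  ultimately have "variance (\<lambda>\<omega>. \<bar>Y \<omega>\<bar>) = expectation (\<lambda>\<omega>. (Y \<omega>)\<^sup>2) - (expectation (\<lambda>\<omega>. \<bar>Y \<omega>\<bar>))\<^sup>2"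
    by (subst variance_eq) auto
  moreover have "0 \<le> variance (\<lambda>\<omega>. \<bar>Y \<omega>\<bar>)" by (rule variance_positive)
  ultimately have "(expectation (\<lambda>\<omega>. \<bar>Y \<omega>\<bar>))\<^sup>2 \<le> b" using b by linarith
  then show ?thesis by (rule real_le_rsqrt)
qed

text \<open>All states of one cell share a seed: \<open>\<omega> k\<close> is the seed of cell
  \<open>k\<close>, drawn once and used at every visit. For fixed \<open>\<omega>\<close> this
  yields the selector \<open>\<phi> \<omega>\<close>.\<close>

locale cells = control_base X A Act p \<mu> xb
  for X :: "'x measure" and A :: "'a measure" and Act p \<mu> and xb :: 'x +
  fixes c :: "'x \<times> real \<Rightarrow> 'a" and cell :: "'x \<Rightarrow> nat" and N :: nat
  assumes c: "c \<in> controls"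
    and cell[measurable]: "cell \<in> X \<rightarrow>\<^sub>M count_space UNIV"
    and cell_less: "\<And>x. x \<in> space X \<Longrightarrow> cell x < N"
begin

definition \<phi> :: "(nat \<Rightarrow> real) \<Rightarrow> 'x \<Rightarrow> 'a" where "\<phi> \<omega> x = c (x, \<omega> (cell x))"
definition K :: "(nat \<Rightarrow> real) \<Rightarrow> 'x \<Rightarrow> 'x measure" where "K \<omega> x = p (x, \<phi> \<omega> x)"
text \<open>The chain that is killed (sent to \<open>xb\<close>) when it is about to act in cell
  \<open>k\<close>. It does not depend on the seed of cell \<open>k\<close>
  (\<open>mk_upd\<close>), which provides the independence needed below.\<close>

definition Kk :: "nat \<Rightarrow> (nat \<Rightarrow> real) \<Rightarrow> 'x \<Rightarrow> 'x measure" where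
  "Kk k \<omega> x = (if cell x = k then return X xb else K \<omega> x)"
definition m :: "(nat \<Rightarrow> real) \<Rightarrow> nat \<Rightarrow> 'x measure" where "m \<omega> = chain \<mu> (\<lambda>_. K \<omega>)"
definition mk :: "nat \<Rightarrow> (nat \<Rightarrow> real) \<Rightarrow> nat \<Rightarrow> 'x measure" where "mk k \<omega> = chain \<mu> (\<lambda>_. Kk k \<omega>)"
definition \<Omega> :: "(nat \<Rightarrow> real) measure" where "\<Omega> = PiM {..<N} (\<lambda>_. unif)"

lemmas [measurable] = controls_measurable[OF c]

lemma prob_space_\<Omega>: "prob_space \<Omega>"
  unfolding \<Omega>_def by (intro prob_space_PiM prob_space_unif)

sublocale W: prob_space \<Omega> by (rule prob_space_\<Omega>)

lemma \<phi>_selector: "\<phi> \<omega> \<in> selectors"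
proof -
  have "\<phi> \<omega> \<in> X \<rightarrow>\<^sub>M A" unfolding \<phi>_def by measurable
  then show ?thesis using controls_Act[OF c] by (auto simp: selectors_def \<phi>_def)
qed

lemma \<phi>_Act: "x \<in> space X \<Longrightarrow> \<phi> \<omega> x \<in> Act x"
  using \<phi>_selector by (auto simp: selectors_def)

lemma \<phi>_measurable[measurable]: "\<phi> \<omega> \<in> X \<rightarrow>\<^sub>M A"
  using \<phi>_selector by (auto simp: selectors_def)

lemma measurable_coord: "k < N \<Longrightarrow> (\<lambda>\<omega>. \<omega> k) \<in> borel_measurable \<Omega>"
  using measurable_component_singleton[of k "{..<N}" "\<lambda>_. unif"]
  by (simp add: \<Omega>_def measurable_cong_sets[OF refl sets_unif])

lemma \<phi>_joint[measurable]: "(\<lambda>z. \<phi> (fst z) (snd z)) \<in> \<Omega> \<Otimes>\<^sub>M X \<rightarrow>\<^sub>M A"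
proof -
  define v where "v k \<omega> = (if k < N then \<omega> k else 0)" for k :: nat and \<omega> :: "nat \<Rightarrow> real"
  have [measurable]: "v k \<in> borel_measurable \<Omega>" for k
    using measurable_coord[of k] by (cases "k < N") (auto simp: v_def[abs_def])
  have "(\<lambda>z. c (snd z, v (cell (snd z)) (fst z))) \<in> \<Omega> \<Otimes>\<^sub>M X \<rightarrow>\<^sub>M A" by measurable
  then show ?thesis
    by (rule measurable_cong[THEN iffD1, rotated]) (auto simp: v_def \<phi>_def cell_less space_pair_measure)
qed

lemma K_joint: "(\<lambda>(\<omega>, x). K \<omega> x) \<in> \<Omega> \<Otimes>\<^sub>M X \<rightarrow>\<^sub>M prob_algebra X"
  unfolding K_def split_beta' by measurable

lemma Kk_joint: "(\<lambda>(\<omega>, x). Kk k \<omega> x) \<in> \<Omega> \<Otimes>\<^sub>M X \<rightarrow>\<^sub>M prob_algebra X"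
proof -
  note [measurable] = K_joint[unfolded split_beta']
  have [measurable]: "(\<lambda>_. return X xb) \<in> \<Omega> \<Otimes>\<^sub>M X \<rightarrow>\<^sub>M prob_algebra X"
    by (simp add: space_prob_algebra prob_space_return)
  show ?thesis unfolding Kk_def split_beta' by measurable
qed

lemma K_meas[measurable]: "K \<omega> \<in> X \<rightarrow>\<^sub>M prob_algebra X"
  unfolding K_def[abs_def] by measurable

lemma Kk_meas[measurable]: "Kk k \<omega> \<in> X \<rightarrow>\<^sub>M prob_algebra X"
proof -
  have [measurable]: "(\<lambda>_. return X xb) \<in> X \<rightarrow>\<^sub>M prob_algebra X"
    by (simp add: space_prob_algebra prob_space_return)
  show ?thesis unfolding Kk_def[abs_def] by measurable
qed

lemma m_prob: "m \<omega> j \<in> space (prob_algebra X)" and mk_prob: "mk k \<omega> j \<in> space (prob_algebra X)"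
  unfolding m_def mk_def by (intro chain_in_prob_algebra \<mu> K_meas Kk_meas)+

lemma m_joint: "(\<lambda>\<omega>. m \<omega> j) \<in> \<Omega> \<rightarrow>\<^sub>M prob_algebra X" and mk_joint: "(\<lambda>\<omega>. mk k \<omega> j) \<in> \<Omega> \<rightarrow>\<^sub>M prob_algebra X"
  unfolding m_def mk_def by (intro measurable_chain K_joint Kk_joint; simp)+

lemma m_law: "m \<omega> j = law (\<lambda>_. pure (\<phi> \<omega>)) j"
proof -
  have "step (pure (\<phi> \<omega>)) x = K \<omega> x" if "x \<in> space X" for x
    using that \<phi>_Act[OF that] Act_space by (auto simp: K_def intro!: step_pure)
  then show ?thesis
    unfolding m_def law_def by (intro chain_cong[where X=X]) auto
qed

text \<open>Bounded test functions that vanish at the absorbing state, so that killed mass does not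
  contribute.\<close>

definition bh :: "real \<Rightarrow> ('x \<Rightarrow> real) set" where
  "bh B = {h \<in> borel_measurable X. h xb = 0 \<and> (\<forall>x\<in>space X. \<bar>h x\<bar> \<le> B)}"

lemma bh_nonneg: "h \<in> bh B \<Longrightarrow> 0 \<le> B"
  by (auto simp: bh_def dest: bspec[OF _ xb])

lemma bh_measurable[measurable_dest]: "h \<in> bh B \<Longrightarrow> h \<in> borel_measurable X"
  by (simp add: bh_def)

lemma bh_restrict: "h \<in> bh B \<Longrightarrow> (\<lambda>x. of_bool (P (cell x)) * h x) \<in> bh B"
  by (auto simp: bh_def intro: order_trans[OF abs_ge_zero])

lemma bh_integrable:
  assumes "P \<in> space (prob_algebra X)" "h \<in> bh B"
  shows "integrable P h"
proof -
  interpret prob_space P using assms by (simp add: space_prob_algebra)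
  have s: "sets P = sets X" using assms by (simp add: space_prob_algebra)
  show ?thesis using assms(2) sets_eq_imp_space_eq[OF s]
    by (intro integrable_const_bound[where B=B]) (auto simp: bh_def measurable_cong_sets[OF s refl])
qed

lemma bh_bound:
  assumes "P \<in> space (prob_algebra X)" "h \<in> bh B"
  shows "\<bar>\<integral>x. h x \<partial>P\<bar> \<le> B"
  using assms bh_nonneg[OF assms(2)]
  by (intro integral_bound) (auto simp: space_prob_algebra bh_def dest: sets_eq_imp_space_eq)

definition T :: "(nat \<Rightarrow> real) \<Rightarrow> ('x \<Rightarrow> real) \<Rightarrow> 'x \<Rightarrow> real" where
  "T \<omega> h x = (\<integral>y. h y \<partial>K \<omega> x)"

lemma K_prob: "x \<in> space X \<Longrightarrow> K \<omega> x \<in> space (prob_algebra X)"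
  by (rule measurable_space[OF K_meas])

lemma T_bh:
  assumes h: "h \<in> bh B"
  shows "T \<omega> h \<in> bh B"
  unfolding bh_def
proof (intro CollectI conjI ballI)
  show "T \<omega> h \<in> borel_measurable X"
    unfolding T_def[abs_def] using bh_measurable[OF h]
    by (intro measurable_compose[OF measurable_prob_algebraD[OF K_meas] integral_measurable_subprob_algebra])
  have "AE y in K \<omega> xb. h y = 0"
    unfolding K_def by (rule eventually_mono[OF AE_p_xb[OF \<phi>_Act[OF xb]]]) (use h in \<open>auto simp: bh_def\<close>)
  then show "T \<omega> h xb = 0" unfolding T_def by (simp cong: integral_cong_AE add: integral_eq_zero_AE)
  show "\<bar>T \<omega> h x\<bar> \<le> B" if "x \<in> space X" for x
    unfolding T_def by (rule bh_bound[OF K_prob[OF that] h])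
qed

lemma T_nonneg:
  assumes "x \<in> space X" "\<And>x. x \<in> space X \<Longrightarrow> 0 \<le> h x"
  shows "0 \<le> T \<omega> h x"
proof -
  have s: "sets (K \<omega> x) = sets X" using K_prob[OF assms(1)] by (simp add: space_prob_algebra)
  show ?thesis unfolding T_def using assms sets_eq_imp_space_eq[OF s]
    by (intro integral_nonneg_AE AE_I2) auto
qed

definition I :: "(nat \<Rightarrow> real) \<Rightarrow> nat \<Rightarrow> ('x \<Rightarrow> real) \<Rightarrow> real" where
  "I \<omega> j h = (\<integral>x. h x \<partial>m \<omega> j)"

definition Ik :: "nat \<Rightarrow> (nat \<Rightarrow> real) \<Rightarrow> nat \<Rightarrow> ('x \<Rightarrow> real) \<Rightarrow> real" where
  "Ik k \<omega> j h = (\<integral>x. h x \<partial>mk k \<omega> j)"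

text \<open>Mass that is lost at time \<open>j\<close> by killing in cell \<open>k\<close>.\<close>

definition D :: "nat \<Rightarrow> (nat \<Rightarrow> real) \<Rightarrow> nat \<Rightarrow> ('x \<Rightarrow> real) \<Rightarrow> real" where
  "D k \<omega> j h = I \<omega> j h - Ik k \<omega> j h"

lemma space_m: "space (m \<omega> j) = space X" and space_mk: "space (mk k \<omega> j) = space X"
  using m_prob[of \<omega> j] mk_prob[of k \<omega> j] by (auto simp: space_prob_algebra dest: sets_eq_imp_space_eq)

lemma I_add: "h \<in> bh B \<Longrightarrow> h' \<in> bh B' \<Longrightarrow> I \<omega> j (\<lambda>x. h x + h' x) = I \<omega> j h + I \<omega> j h'"
  unfolding I_def Ik_def
  by (intro Bochner_Integration.integral_add bh_integrable m_prob mk_prob; assumption)+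

lemma I_diff: "h \<in> bh B \<Longrightarrow> h' \<in> bh B' \<Longrightarrow> I \<omega> j (\<lambda>x. h x - h' x) = I \<omega> j h - I \<omega> j h'"
  and Ik_diff: "h \<in> bh B \<Longrightarrow> h' \<in> bh B' \<Longrightarrow> Ik k \<omega> j (\<lambda>x. h x - h' x) = Ik k \<omega> j h - Ik k \<omega> j h'"
  unfolding I_def Ik_def
  by (intro Bochner_Integration.integral_diff bh_integrable m_prob mk_prob; assumption)+

lemma D_diff: "h \<in> bh B \<Longrightarrow> h' \<in> bh B' \<Longrightarrow> D k \<omega> j (\<lambda>x. h x - h' x) = D k \<omega> j h - D k \<omega> j h'"
  by (simp add: D_def I_diff Ik_diff)

lemma I_cong: "(\<And>x. x \<in> space X \<Longrightarrow> h x = h' x) \<Longrightarrow> I \<omega> j h = I \<omega> j h'"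
  unfolding I_def Ik_def by (intro Bochner_Integration.integral_cong refl; simp add: space_m space_mk)+

lemma I_nonneg: "(\<And>x. x \<in> space X \<Longrightarrow> 0 \<le> h x) \<Longrightarrow> 0 \<le> I \<omega> j h"
  and Ik_nonneg: "(\<And>x. x \<in> space X \<Longrightarrow> 0 \<le> h x) \<Longrightarrow> 0 \<le> Ik k \<omega> j h"
  unfolding I_def Ik_def by (intro integral_nonneg_AE AE_I2; simp add: space_m space_mk)+

lemma I_mono: "h \<in> bh B \<Longrightarrow> h' \<in> bh B' \<Longrightarrow> (\<And>x. x \<in> space X \<Longrightarrow> h x \<le> h' x) \<Longrightarrow> I \<omega> j h \<le> I \<omega> j h'"
  using I_nonneg[of "\<lambda>x. h' x - h x" \<omega> j] I_diff[of h' B' h B \<omega> j] by auto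

lemma Ik_mono: "h \<in> bh B \<Longrightarrow> h' \<in> bh B' \<Longrightarrow> (\<And>x. x \<in> space X \<Longrightarrow> h x \<le> h' x) \<Longrightarrow> Ik k \<omega> j h \<le> Ik k \<omega> j h'"
  using Ik_nonneg[of "\<lambda>x. h' x - h x" k \<omega> j] Ik_diff[of h' B' h B k \<omega> j] by auto

lemma I_bound: "h \<in> bh B \<Longrightarrow> \<bar>I \<omega> j h\<bar> \<le> B" and Ik_bound: "h \<in> bh B \<Longrightarrow> \<bar>Ik k \<omega> j h\<bar> \<le> B"
  unfolding I_def Ik_def by (intro bh_bound m_prob mk_prob; assumption)+

lemma I_Suc:
  assumes h: "h \<in> bh B"
  shows "I \<omega> (Suc j) h = I \<omega> j (T \<omega> h)"
proof -
  have s: "sets (m \<omega> j) = sets X" and P: "prob_space (m \<omega> j)" using m_prob[of \<omega> j] by (auto simp: space_prob_algebra)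
  have "(\<integral>x. h x \<partial>(m \<omega> j \<bind> K \<omega>)) = (\<integral>x. \<integral>y. h y \<partial>K \<omega> x \<partial>m \<omega> j)"
    using h K_meas by (intro integral_bind_prob[where X=X and B=B] P) (auto simp: bh_def measurable_cong_sets[OF s refl])
  then show ?thesis by (simp add: I_def T_def m_def)
qed

lemma Ik_Suc:
  assumes h: "h \<in> bh B"
  shows "Ik k \<omega> (Suc j) h = Ik k \<omega> j (\<lambda>x. of_bool (cell x \<noteq> k) * T \<omega> h x)"
proof -
  have s: "sets (mk k \<omega> j) = sets X" and P: "prob_space (mk k \<omega> j)" using mk_prob[of k \<omega> j] by (auto simp: space_prob_algebra)
  have "(\<integral>x. h x \<partial>(mk k \<omega> j \<bind> Kk k \<omega>)) = (\<integral>x. \<integral>y. h y \<partial>Kk k \<omega> x \<partial>mk k \<omega> j)"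
    using h Kk_meas by (intro integral_bind_prob[where X=X and B=B] P) (auto simp: bh_def measurable_cong_sets[OF s refl])
  also have "\<dots> = Ik k \<omega> j (\<lambda>x. of_bool (cell x \<noteq> k) * T \<omega> h x)"
    unfolding Ik_def using h
    by (intro Bochner_Integration.integral_cong refl) (auto simp: Kk_def T_def bh_def integral_return)
  finally show ?thesis by (simp add: Ik_def mk_def)
qed

lemma D_0: "D k \<omega> 0 h = 0"
  by (simp add: D_def I_def Ik_def m_def mk_def)

lemma I_split: "h \<in> bh B \<Longrightarrow> I \<omega> j h = I \<omega> j (\<lambda>x. of_bool (cell x \<noteq> k) * h x) + I \<omega> j (\<lambda>x. of_bool (cell x = k) * h x)"
  by (subst I_add[symmetric, where B=B and B'=B])
     (auto intro!: bh_restrict[of h B "\<lambda>i. i \<noteq> k"] bh_restrict[of h B "\<lambda>i. i = k"] I_cong)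

lemma D_Suc:
  assumes h: "h \<in> bh B"
  shows "D k \<omega> (Suc j) h = D k \<omega> j (\<lambda>x. of_bool (cell x \<noteq> k) * T \<omega> h x) + I \<omega> j (\<lambda>x. of_bool (cell x = k) * T \<omega> h x)"
  unfolding D_def I_Suc[OF h] Ik_Suc[OF h] I_split[OF T_bh[OF h], of \<omega> j \<omega> k] by simp

lemma D_nonneg: "h \<in> bh B \<Longrightarrow> (\<And>x. x \<in> space X \<Longrightarrow> 0 \<le> h x) \<Longrightarrow> 0 \<le> D k \<omega> j h"
proof (induction j arbitrary: h)
  case (Suc j)
  have "0 \<le> D k \<omega> j (\<lambda>x. of_bool (cell x \<noteq> k) * T \<omega> h x)"
    using Suc.prems by (intro Suc.IH bh_restrict[of _ B "\<lambda>i. i \<noteq> k"] T_bh) (auto intro: T_nonneg)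
  moreover have "0 \<le> I \<omega> j (\<lambda>x. of_bool (cell x = k) * T \<omega> h x)"
    using Suc.prems by (intro I_nonneg) (auto intro: T_nonneg)
  ultimately show ?case by (simp add: D_Suc[OF Suc.prems(1)])
qed (simp add: D_0)

lemma D_mono: "h \<in> bh B \<Longrightarrow> h' \<in> bh B' \<Longrightarrow> (\<And>x. x \<in> space X \<Longrightarrow> h x \<le> h' x) \<Longrightarrow> D k \<omega> j h \<le> D k \<omega> j h'"
proof -
  assume h: "h \<in> bh B" "h' \<in> bh B'" "\<And>x. x \<in> space X \<Longrightarrow> h x \<le> h' x"
  have "(\<lambda>x. h' x - h x) \<in> bh (B' + B)"
  proof -
    have "\<bar>h' x - h x\<bar> \<le> B' + B" if "x \<in> space X" for x
    proof -
      have "\<bar>h x\<bar> \<le> B" "\<bar>h' x\<bar> \<le> B'" using h that by (auto simp: bh_def)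
      then show ?thesis by linarith
    qed
    then show ?thesis using h by (auto simp: bh_def)
  qed
  from D_nonneg[OF this, of k \<omega> j] show ?thesis using h by (simp add: D_diff[OF h(2,1)])
qed

lemma D_abs: "h \<in> bh B \<Longrightarrow> h' \<in> bh B' \<Longrightarrow> (\<And>x. x \<in> space X \<Longrightarrow> \<bar>h x\<bar> \<le> h' x) \<Longrightarrow> \<bar>D k \<omega> j h\<bar> \<le> D k \<omega> j h'"
proof -
  assume h: "h \<in> bh B" "h' \<in> bh B'" "\<And>x. x \<in> space X \<Longrightarrow> \<bar>h x\<bar> \<le> h' x"
  have n: "(\<lambda>x. - h x) \<in> bh B" and z: "(\<lambda>x. 0) \<in> bh 0" using h(1) by (auto simp: bh_def)
  have "D k \<omega> j (\<lambda>x. - h x) = - D k \<omega> j h"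
    using D_diff[OF z h(1), of k \<omega> j] by (simp add: D_def I_def Ik_def)
  moreover have "D k \<omega> j h \<le> D k \<omega> j h'" using h(3) by (intro D_mono[OF h(1,2)]) (auto simp: abs_le_iff)
  moreover have "D k \<omega> j (\<lambda>x. - h x) \<le> D k \<omega> j h'" using h(3) by (intro D_mono[OF n h(2)]) (auto simp: abs_le_iff)
  ultimately show ?thesis by linarith
qed

lemma sum_cells_I:
  assumes h: "h \<in> bh B"
  shows "(\<Sum>k<N. I \<omega> j (\<lambda>x. of_bool (cell x = k) * h x)) = I \<omega> j h"
proof -
  have "(\<Sum>k<N. I \<omega> j (\<lambda>x. of_bool (cell x = k) * h x)) = I \<omega> j (\<lambda>x. \<Sum>k<N. of_bool (cell x = k) * h x)"
    unfolding I_def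
    by (intro Bochner_Integration.integral_sum[symmetric] bh_integrable[OF m_prob])
       (rule bh_restrict[OF h, of "\<lambda>i. i = _"])
  also have "\<dots> = I \<omega> j h"
  proof (rule I_cong)
    fix x assume "x \<in> space X"
    then have "cell x < N" by (rule cell_less)
    have "(\<Sum>k<N. of_bool (cell x = k) * h x) = (\<Sum>k<N. if k = cell x then h x else 0)"
      by (intro sum.cong) auto
    also have "\<dots> = h x" using \<open>cell x < N\<close> by simp
    finally show "(\<Sum>k<N. of_bool (cell x = k) * h x) = h x" .
  qed
  finally show ?thesis .
qed

text \<open>A trajectory visits at most \<open>j\<close> cells before time \<open>j\<close>, so it is killed
  for at most \<open>j\<close> choices of \<open>k\<close>.\<close>

lemma sum_D:
  assumes "h \<in> bh B" "\<And>x. x \<in> space X \<Longrightarrow> 0 \<le> h x"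
  shows "(\<Sum>k<N. D k \<omega> j h) \<le> real j * I \<omega> j h"
  using assms
proof (induction j arbitrary: h)
  case (Suc j)
  note T = T_bh[OF Suc.prems(1), of \<omega>]
  have T0: "0 \<le> T \<omega> h x" if "x \<in> space X" for x by (rule T_nonneg[OF that Suc.prems(2)])
  have "(\<Sum>k<N. D k \<omega> (Suc j) h) \<le> (\<Sum>k<N. D k \<omega> j (T \<omega> h) + I \<omega> j (\<lambda>x. of_bool (cell x = k) * T \<omega> h x))"
  proof (rule sum_mono)
    fix k
    have "D k \<omega> j (\<lambda>x. of_bool (cell x \<noteq> k) * T \<omega> h x) \<le> D k \<omega> j (T \<omega> h)"
      using T0 by (intro D_mono[OF bh_restrict[OF T, of "\<lambda>i. i \<noteq> k"] T]) auto
    then show "D k \<omega> (Suc j) h \<le> D k \<omega> j (T \<omega> h) + I \<omega> j (\<lambda>x. of_bool (cell x = k) * T \<omega> h x)"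
      by (simp add: D_Suc[OF Suc.prems(1)])
  qed
  also have "\<dots> \<le> real j * I \<omega> j (T \<omega> h) + I \<omega> j (T \<omega> h)"
    unfolding sum.distrib sum_cells_I[OF T] using Suc.IH[OF T T0] by simp
  also have "\<dots> = real (Suc j) * I \<omega> (Suc j) h"
    by (simp add: I_Suc[OF Suc.prems(1)] algebra_simps)
  finally show ?case .
qed (simp add: D_0)

definition one :: "nat \<Rightarrow> 'x \<Rightarrow> real" where
  "one k x = of_bool (cell x = k) * of_bool (x \<noteq> xb)"

lemma bh_live: "(\<lambda>x. of_bool (x \<noteq> xb)) \<in> bh 1"
proof -
  have "(\<lambda>x. of_bool (x \<noteq> xb) :: real) \<in> borel_measurable X \<longleftrightarrow> (indicator live :: _ \<Rightarrow> real) \<in> borel_measurable X"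
    by (intro measurable_cong) (auto simp: indicator_def)
  then show ?thesis by (auto simp: bh_def)
qed

lemma one_bh: "one k \<in> bh 1"
  unfolding one_def[abs_def] by (rule bh_restrict[OF bh_live])

text \<open>Only trajectories that visited cell \<open>k\<close> before time \<open>j\<close> are affected
  by the killing.\<close>

lemma D_visit:
  assumes "h \<in> bh 1" "\<And>x. x \<in> space X \<Longrightarrow> 0 \<le> h x"
  shows "D k \<omega> j h \<le> (\<Sum>i<j. I \<omega> i (one k))"
  using assms
proof (induction j arbitrary: h)
  case (Suc j)
  note T = T_bh[OF Suc.prems(1), of \<omega>]
  have T0: "0 \<le> T \<omega> h x" if "x \<in> space X" for x by (rule T_nonneg[OF that Suc.prems(2)])
  have "D k \<omega> j (\<lambda>x. of_bool (cell x \<noteq> k) * T \<omega> h x) \<le> (\<Sum>i<j. I \<omega> i (one k))"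
    using T0 by (intro Suc.IH bh_restrict[OF T, of "\<lambda>i. i \<noteq> k"]) auto
  moreover have "I \<omega> j (\<lambda>x. of_bool (cell x = k) * T \<omega> h x) \<le> I \<omega> j (one k)"
    using T by (intro I_mono[OF bh_restrict[OF T] one_bh]) (auto simp: one_def bh_def abs_le_iff)
  ultimately show ?case by (simp add: D_Suc[OF Suc.prems(1)])
qed (simp add: D_0)

text \<open>Drawing the seed of cell \<open>k\<close> afresh does not change the law of the seeds.\<close>

lemma resample:
  fixes f :: "(nat \<Rightarrow> real) \<Rightarrow> real"
  assumes k: "k < N" and [measurable]: "f \<in> borel_measurable \<Omega>" and B: "\<And>\<omega>. \<bar>f \<omega>\<bar> \<le> B"
  shows "(\<integral>\<omega>. f \<omega> \<partial>\<Omega>) = (\<integral>\<omega>. \<integral>u. f (fun_upd \<omega> k u) \<partial>unif \<partial>\<Omega>)"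
proof -
  define J where "J = {..<N} - {k}"
  have J: "finite J" "k \<notin> J" "insert k J = {..<N}" using k by (auto simp: J_def)
  interpret PS: product_sigma_finite "\<lambda>_::nat. unif" ..
  have \<Omega>': "\<Omega> = PiM (insert k J) (\<lambda>_. unif)" by (simp add: \<Omega>_def J)
  have upd: "(\<lambda>z. (fst z)(k := snd z)) \<in> \<Omega> \<Otimes>\<^sub>M unif \<rightarrow>\<^sub>M \<Omega>"
    unfolding \<Omega>' by (rule measurable_fun_upd[where J="insert k J"]) auto
  have [measurable]: "(\<lambda>z. f ((fst z)(k := snd z))) \<in> borel_measurable (\<Omega> \<Otimes>\<^sub>M unif)"
    by (rule measurable_compose[OF upd]) measurable
  have B0: "0 \<le> B" using B[of undefined] by linarith
  have i1: "integrable \<Omega> f" using B by (intro W.integrable_const_bound[where B=B]) auto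
  have "(\<lambda>\<omega>. \<integral>u. f (fun_upd \<omega> k u) \<partial>unif) \<in> borel_measurable \<Omega>"
    using unif.borel_measurable_lebesgue_integral[of "\<lambda>\<omega> u. f (fun_upd \<omega> k u)" \<Omega>] by (simp add: split_beta')
  then have i2: "integrable \<Omega> (\<lambda>\<omega>. \<integral>u. f (fun_upd \<omega> k u) \<partial>unif)"
    using B B0 prob_space_unif by (intro W.integrable_const_bound[where B=B]) (auto intro!: integral_bound)
  have "(\<integral>\<omega>. \<integral>u. f (fun_upd \<omega> k u) \<partial>unif \<partial>\<Omega>) = (\<integral>\<omega>. \<integral>v. \<integral>u. f (fun_upd (fun_upd \<omega> k v) k u) \<partial>unif \<partial>unif \<partial>PiM J (\<lambda>_. unif))"
    using PS.product_integral_insert[OF J(1,2) i2[unfolded \<Omega>']] by (simp add: \<Omega>')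
  also have "\<dots> = (\<integral>\<omega>. \<integral>u. f (fun_upd \<omega> k u) \<partial>unif \<partial>PiM J (\<lambda>_. unif))"
    using unif.prob_space by simp
  also have "\<dots> = (\<integral>\<omega>. f \<omega> \<partial>\<Omega>)"
    using PS.product_integral_insert[OF J(1,2) i1[unfolded \<Omega>']] by (simp add: \<Omega>')
  finally show ?thesis by simp
qed

lemma mk_upd: "mk k (fun_upd \<omega> k u) j = mk k \<omega> j"
  unfolding mk_def
  by (intro chain_cong[where X=X]) (auto simp: Kk_def K_def \<phi>_def)

lemma measurable_I:
  assumes "(\<lambda>z. h (fst z) (snd z)) \<in> borel_measurable (\<Omega> \<Otimes>\<^sub>M X)"
  shows "(\<lambda>\<omega>. I \<omega> j (h \<omega>)) \<in> borel_measurable \<Omega>" "(\<lambda>\<omega>. Ik k \<omega> j (h \<omega>)) \<in> borel_measurable \<Omega>"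
  unfolding I_def Ik_def
  using measurable_integral_kernel[OF m_joint assms] measurable_integral_kernel[OF mk_joint assms] by simp_all

text \<open>Split \<open>Y = I \<omega> j (g \<omega>)\<close> into the contributions \<open>y k\<close> of
  the cells, so that \<open>Y^2\<close> is the sum of the products \<open>Y * y k\<close>. In
  the chain killed at cell \<open>k\<close>, the counterparts \<open>Z k\<close> and \<open>a
  k\<close> of \<open>Y\<close> and \<open>y k\<close> satisfy \<open>E (a k * Z k) = 0\<close>:
  \<open>Z k\<close> does not involve the seed of cell \<open>k\<close>, and \<open>a k\<close>
  is centered in this seed. The error \<open>R k\<close> of passing to the killed chain is
  bounded by the mass lost and by products of visit probabilities; summed over \<open>k\<close>,
  it is small when all cells are.\<close>

lemma second_moment:
  assumes G: "G \<in> bfun 1" and G_xb: "\<And>a. G (xb, a) = 0"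
    and centered: "\<And>x. x \<in> space X \<Longrightarrow> (\<integral>u. G (x, c (x, u)) \<partial>unif) = 0"
    and M[measurable]: "(\<lambda>\<omega>. M \<omega>) \<in> borel_measurable \<Omega>" and M_bound: "\<And>\<omega>. \<bar>M \<omega>\<bar> \<le> 1"
    and M1: "\<And>\<omega> k. k < N \<Longrightarrow> I \<omega> j (one k) \<le> M \<omega>"
    and M2: "\<And>\<omega>. (\<Sum>k<N. D k \<omega> j (one k)) \<le> real j * M \<omega>"
  shows "W.expectation (\<lambda>\<omega>. (I \<omega> j (\<lambda>x. G (x, \<phi> \<omega> x)))\<^sup>2) \<le> (2 * real j + 1) * W.expectation M"
proof -
  note [measurable] = bfun_measurable[OF G]
  define g where "g \<omega> x = G (x, \<phi> \<omega> x)" for \<omega> x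
  have [measurable]: "g \<omega> \<in> borel_measurable X" for \<omega>
    unfolding g_def[abs_def] by measurable
  have g_bh: "g \<omega> \<in> bh 1" for \<omega>
    using bfun_bound[OF G] G_xb \<phi>_Act Act_space by (auto simp: bh_def g_def)
  have g_joint[measurable]: "(\<lambda>z. g (fst z) (snd z)) \<in> borel_measurable (\<Omega> \<Otimes>\<^sub>M X)"
    unfolding g_def by measurable
  define Y where "Y \<omega> = I \<omega> j (g \<omega>)" for \<omega>
  define y where "y k \<omega> = I \<omega> j (\<lambda>x. of_bool (cell x = k) * g \<omega> x)" for k \<omega>
  define a where "a k \<omega> = Ik k \<omega> j (\<lambda>x. of_bool (cell x = k) * g \<omega> x)" for k \<omega>
  define Z where "Z k \<omega> = Ik k \<omega> j (\<lambda>x. of_bool (cell x \<noteq> k) * g \<omega> x)" for k \<omega>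
  have [measurable]: "Y \<in> borel_measurable \<Omega>" "y k \<in> borel_measurable \<Omega>" "a k \<in> borel_measurable \<Omega>" "Z k \<in> borel_measurable \<Omega>" for k
    unfolding Y_def[abs_def] y_def[abs_def] a_def[abs_def] Z_def[abs_def]
    by (rule measurable_I; measurable)+
  have bd: "\<bar>Y \<omega>\<bar> \<le> 1" "\<bar>y k \<omega>\<bar> \<le> 1" "\<bar>a k \<omega>\<bar> \<le> 1" "\<bar>Z k \<omega>\<bar> \<le> 1" for k \<omega>
    unfolding Y_def y_def a_def Z_def
    using g_bh bh_restrict[OF g_bh, of "\<lambda>i. i = k" \<omega>] bh_restrict[OF g_bh, of "\<lambda>i. i \<noteq> k" \<omega>]
    by (auto intro: I_bound Ik_bound)
  have restr: "(\<lambda>x. of_bool (cell x = k) * g \<omega> x) \<in> bh 1" "(\<lambda>x. of_bool (cell x \<noteq> k) * g \<omega> x) \<in> bh 1" for k \<omega>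
    using bh_restrict[OF g_bh, of "\<lambda>i. i = k" \<omega>] bh_restrict[OF g_bh, of "\<lambda>i. i \<noteq> k" \<omega>] by auto
  have restr_le: "\<bar>of_bool (cell x = k) * g \<omega> x\<bar> \<le> one k x" "\<bar>of_bool (cell x \<noteq> k) * g \<omega> x\<bar> \<le> of_bool (x \<noteq> xb)"
    if "x \<in> space X" for x k \<omega>
    using g_bh[of \<omega>] that by (auto simp: bh_def one_def)
  have om_int: "f \<in> borel_measurable \<Omega> \<Longrightarrow> (\<And>\<omega>. \<bar>f \<omega>\<bar> \<le> bnd) \<Longrightarrow> integrable \<Omega> f"
    for f :: "(nat \<Rightarrow> real) \<Rightarrow> real" and bnd :: real
    by (intro W.integrable_const_bound[where B=bnd]) auto
  have prod1: "\<bar>r * s\<bar> \<le> 1" if "\<bar>r\<bar> \<le> 1" "\<bar>s\<bar> \<le> 1" for r s :: real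
    using that mult_le_one[of "\<bar>r\<bar>" "\<bar>s\<bar>"] by (simp add: abs_mult)
  have indep: "W.expectation (\<lambda>\<omega>. a k \<omega> * Z k \<omega>) = 0" if k: "k < N" for k
  proof -
    have "W.expectation (\<lambda>\<omega>. a k \<omega> * Z k \<omega>) = W.expectation (\<lambda>\<omega>. \<integral>u. a k (fun_upd \<omega> k u) * Z k (fun_upd \<omega> k u) \<partial>unif)"
      by (rule resample[OF k, where B=1]) (auto intro!: prod1 bd)
    also have "\<dots> = W.expectation (\<lambda>\<omega>. 0)"
    proof (rule Bochner_Integration.integral_cong[OF refl])
      fix \<omega> :: "nat \<Rightarrow> real"
      have Zu: "Z k (fun_upd \<omega> k u) = Z k \<omega>" for u
        unfolding Z_def Ik_def mk_upd
        by (intro Bochner_Integration.integral_cong refl) (auto simp: g_def \<phi>_def)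
      have au: "a k (fun_upd \<omega> k u) = (\<integral>x. of_bool (cell x = k) * G (x, c (x, u)) \<partial>mk k \<omega> j)" for u
        unfolding a_def Ik_def mk_upd
        by (intro Bochner_Integration.integral_cong refl) (auto simp: g_def \<phi>_def)
      have P: "prob_space (mk k \<omega> j)" and s[measurable_cong]: "sets (mk k \<omega> j) = sets X"
        using mk_prob[of k \<omega> j] by (auto simp: space_prob_algebra)
      interpret P: pair_prob_space "mk k \<omega> j" unif
        using P prob_space_unif by (simp add: pair_prob_space_def pair_sigma_finite_def prob_space_imp_sigma_finite)
      have "integrable (mk k \<omega> j \<Otimes>\<^sub>M unif) (\<lambda>(x, u). of_bool (cell x = k) * G (x, c (x, u)))"
        using bfun_bound[OF G] Act_space controls_Act[OF c]
        by (intro P.integrable_const_bound[where B=1]) (auto simp: space_pair_measure space_mk intro!: AE_I2)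
      from P.Fubini_integral[OF this]
      have "(\<integral>u. a k (fun_upd \<omega> k u) \<partial>unif) = (\<integral>x. \<integral>u. of_bool (cell x = k) * G (x, c (x, u)) \<partial>unif \<partial>mk k \<omega> j)"
        unfolding au by simp
      also have "\<dots> = (\<integral>x. 0 \<partial>mk k \<omega> j)"
        by (intro Bochner_Integration.integral_cong refl) (simp add: space_mk centered)
      finally show "(\<integral>u. a k (fun_upd \<omega> k u) * Z k (fun_upd \<omega> k u) \<partial>unif) = 0" by (simp add: Zu)
    qed
    finally show ?thesis by simp
  qed
  define R where "R k \<omega> = D k \<omega> j (one k) + I \<omega> j (one k) * (\<Sum>i\<le>j. I \<omega> i (one k))" for k \<omega>
  have one_joint[measurable]: "(\<lambda>z. one k (snd z)) \<in> borel_measurable (\<Omega> \<Otimes>\<^sub>M X)" for k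
    by (rule measurable_compose[OF measurable_snd bh_measurable[OF one_bh]])
  have one_I: "0 \<le> I \<omega> i (one k)" "I \<omega> i (one k) \<le> 1" for \<omega> i k
    using I_bound[OF one_bh, of \<omega> i k] I_nonneg[of "one k" \<omega> i] by (auto simp: one_def)
  have pw: "Y \<omega> * y k \<omega> \<le> a k \<omega> * Z k \<omega> + R k \<omega>" for k \<omega>
  proof -
    have 1: "\<bar>y k \<omega> - a k \<omega>\<bar> \<le> D k \<omega> j (one k)"
      using D_abs[OF restr(1)[of k \<omega>] one_bh[of k] restr_le(1)[of _ k \<omega>], of k \<omega> j] by (simp add: D_def y_def a_def)
    have 2: "\<bar>a k \<omega>\<bar> \<le> I \<omega> j (one k)"
    proof -
      have n: "(\<lambda>x. - (of_bool (cell x = k) * g \<omega> x)) \<in> bh 1" using restr(1)[of k \<omega>] by (auto simp: bh_def)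
      have "a k \<omega> \<le> Ik k \<omega> j (one k)"
        unfolding a_def using restr_le(1) by (intro Ik_mono[OF restr(1) one_bh]) (auto simp: abs_le_iff)
      moreover have "- a k \<omega> \<le> Ik k \<omega> j (one k)"
        using Ik_mono[OF n one_bh, of k k \<omega> j] restr_le(1)[of _ k \<omega>] by (auto simp: a_def Ik_def abs_le_iff)
      moreover have "Ik k \<omega> j (one k) \<le> I \<omega> j (one k)"
        using D_nonneg[OF one_bh, of k k \<omega> j] by (auto simp: D_def one_def)
      ultimately show ?thesis by linarith
    qed
    have 3: "\<bar>Y \<omega> - Z k \<omega>\<bar> \<le> (\<Sum>i\<le>j. I \<omega> i (one k))"
    proof -
      have "Y \<omega> = I \<omega> j (\<lambda>x. of_bool (cell x \<noteq> k) * g \<omega> x) + y k \<omega>"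
        unfolding Y_def y_def by (rule I_split[OF g_bh])
      then have "Y \<omega> - Z k \<omega> = D k \<omega> j (\<lambda>x. of_bool (cell x \<noteq> k) * g \<omega> x) + y k \<omega>"
        by (simp add: D_def Z_def)
      moreover have "\<bar>D k \<omega> j (\<lambda>x. of_bool (cell x \<noteq> k) * g \<omega> x)\<bar> \<le> D k \<omega> j (\<lambda>x. of_bool (x \<noteq> xb))"
        by (rule D_abs[OF restr(2) bh_live restr_le(2)])
      moreover have "D k \<omega> j (\<lambda>x. of_bool (x \<noteq> xb)) \<le> (\<Sum>i<j. I \<omega> i (one k))"
        by (rule D_visit[OF bh_live]) simp
      moreover have "\<bar>y k \<omega>\<bar> \<le> I \<omega> j (one k)"
      proof -
        have n: "(\<lambda>x. - (of_bool (cell x = k) * g \<omega> x)) \<in> bh 1" using restr(1)[of k \<omega>] by (auto simp: bh_def)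
        have "y k \<omega> \<le> I \<omega> j (one k)"
          unfolding y_def using restr_le(1) by (intro I_mono[OF restr(1) one_bh]) (auto simp: abs_le_iff)
        moreover have "- y k \<omega> \<le> I \<omega> j (one k)"
          using I_mono[OF n one_bh, of k \<omega> j] restr_le(1)[of _ k \<omega>] by (auto simp: y_def I_def abs_le_iff)
        ultimately show ?thesis by linarith
      qed
      ultimately show ?thesis by (simp add: lessThan_Suc_atMost[symmetric])
    qed
    have "Y \<omega> * y k \<omega> - a k \<omega> * Z k \<omega> = Y \<omega> * (y k \<omega> - a k \<omega>) + a k \<omega> * (Y \<omega> - Z k \<omega>)"
      by (simp add: algebra_simps)
    also have "\<dots> \<le> \<bar>Y \<omega>\<bar> * \<bar>y k \<omega> - a k \<omega>\<bar> + \<bar>a k \<omega>\<bar> * \<bar>Y \<omega> - Z k \<omega>\<bar>"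
      unfolding abs_mult[symmetric] by (intro add_mono abs_ge_self)
    also have "\<dots> \<le> 1 * D k \<omega> j (one k) + I \<omega> j (one k) * (\<Sum>i\<le>j. I \<omega> i (one k))"
      using 1 2 3 bd(1)[of \<omega>] one_I by (intro add_mono mult_mono) auto
    finally show ?thesis by (simp add: R_def)
  qed
  have D_meas[measurable]: "(\<lambda>\<omega>. D k \<omega> j (one k)) \<in> borel_measurable \<Omega>" for k
    unfolding D_def using measurable_I[OF one_joint] by measurable
  have I_meas[measurable]: "(\<lambda>\<omega>. I \<omega> i (one k)) \<in> borel_measurable \<Omega>" for i k
    using measurable_I(1)[OF one_joint] by simp
  have R_meas[measurable]: "R k \<in> borel_measurable \<Omega>" for k unfolding R_def[abs_def] by measurable
  have R_bd: "\<bar>R k \<omega>\<bar> \<le> 2 * real j + 3" for k \<omega>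
  proof -
    have "0 \<le> D k \<omega> j (one k)" by (rule D_nonneg[OF one_bh]) (simp add: one_def)
    moreover have "D k \<omega> j (one k) \<le> 2"
      using I_bound[OF one_bh, of \<omega> j k] Ik_bound[OF one_bh, of k \<omega> j k] by (simp add: D_def)
    moreover have "(\<Sum>i\<le>j. I \<omega> i (one k)) \<le> (\<Sum>i\<le>j. 1)" by (intro sum_mono one_I)
    then have "I \<omega> j (one k) * (\<Sum>i\<le>j. I \<omega> i (one k)) \<le> 1 * (real j + 1)"
      using one_I by (intro mult_mono) (auto intro!: sum_nonneg)
    moreover have "0 \<le> I \<omega> j (one k) * (\<Sum>i\<le>j. I \<omega> i (one k))"
      using one_I by (auto intro!: mult_nonneg_nonneg sum_nonneg)
    moreover have "0 \<le> real j" by simp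
    moreover have "\<bar>d + q\<bar> \<le> 2 * r + 3"
      if "0 \<le> d" "d \<le> 2" "q \<le> 1 * (r + 1)" "0 \<le> q" "0 \<le> r" for d q r :: real
    proof -
      have "\<bar>d + q\<bar> = d + q" using that(1,4) by simp
      also have "\<dots> \<le> 2 + 1 * (r + 1)" using that(2,3) by (rule add_mono)
      also have "\<dots> \<le> 2 * r + 3" using that(5) by simp
      finally show ?thesis .
    qed
    ultimately show ?thesis unfolding R_def by blast
  qed
  have sumR: "(\<Sum>k<N. R k \<omega>) \<le> (2 * real j + 1) * M \<omega>" for \<omega>
  proof -
    have M0: "0 \<le> M \<omega>"
      using M1[of "cell xb" \<omega>] one_I(1)[of \<omega> j "cell xb"] cell_less[OF xb] by linarith
    have "(\<Sum>k<N. I \<omega> j (one k) * (\<Sum>i\<le>j. I \<omega> i (one k))) \<le> (\<Sum>k<N. M \<omega> * (\<Sum>i\<le>j. I \<omega> i (one k)))"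
      using M1 one_I by (intro sum_mono mult_right_mono) (auto intro!: sum_nonneg)
    also have "\<dots> = M \<omega> * (\<Sum>i\<le>j. \<Sum>k<N. I \<omega> i (one k))"
      by (subst sum.swap) (simp add: sum_distrib_left)
    also have "\<dots> \<le> M \<omega> * (\<Sum>i\<le>j. 1)"
    proof (intro mult_left_mono sum_mono M0)
      fix i
      have "(\<Sum>k<N. I \<omega> i (one k)) = I \<omega> i (\<lambda>x. of_bool (x \<noteq> xb))"
        unfolding one_def[abs_def] by (rule sum_cells_I[OF bh_live])
      then show "(\<Sum>k<N. I \<omega> i (one k)) \<le> 1" using I_bound[OF bh_live, of \<omega> i] by simp
    qed
    finally show ?thesis using M2[of \<omega>] by (simp add: R_def sum.distrib algebra_simps)
  qed
  have "W.expectation (\<lambda>\<omega>. (Y \<omega>)\<^sup>2) = W.expectation (\<lambda>\<omega>. \<Sum>k<N. Y \<omega> * y k \<omega>)"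
    by (intro Bochner_Integration.integral_cong refl)
      (simp add: sum_distrib_left[symmetric] y_def sum_cells_I[OF g_bh] power2_eq_square, simp add: Y_def)
  also have "\<dots> = (\<Sum>k<N. W.expectation (\<lambda>\<omega>. Y \<omega> * y k \<omega>))"
    by (intro Bochner_Integration.integral_sum om_int[of _ 1]) (auto intro!: prod1 bd)
  also have "\<dots> \<le> (\<Sum>k<N. W.expectation (\<lambda>\<omega>. a k \<omega> * Z k \<omega> + R k \<omega>))"
  proof (intro sum_mono integral_mono)
    show "integrable \<Omega> (\<lambda>\<omega>. Y \<omega> * y k \<omega>)" for k by (rule om_int[of _ 1]) (auto intro!: prod1 bd)
    show "integrable \<Omega> (\<lambda>\<omega>. a k \<omega> * Z k \<omega> + R k \<omega>)" for k
      by (intro Bochner_Integration.integrable_add om_int[of _ 1] om_int[of _ "2 * real j + 3"]) (auto intro!: prod1 bd R_bd)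
  qed (rule pw)
  also have "\<dots> = (\<Sum>k<N. W.expectation (R k))"
  proof (rule sum.cong[OF refl])
    fix k assume "k \<in> {..<N}"
    have i1: "integrable \<Omega> (\<lambda>\<omega>. a k \<omega> * Z k \<omega>)" by (rule om_int[of _ 1]) (auto intro!: prod1 bd)
    have i2: "integrable \<Omega> (R k)" by (rule om_int[OF R_meas R_bd])
    show "W.expectation (\<lambda>\<omega>. a k \<omega> * Z k \<omega> + R k \<omega>) = W.expectation (R k)"
      using \<open>k \<in> {..<N}\<close> by (subst Bochner_Integration.integral_add[OF i1 i2]) (simp add: indep)
  qed
  also have "\<dots> = W.expectation (\<lambda>\<omega>. \<Sum>k<N. R k \<omega>)"
    by (intro Bochner_Integration.integral_sum[symmetric] om_int[OF R_meas R_bd])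
  also have "\<dots> \<le> W.expectation (\<lambda>\<omega>. (2 * real j + 1) * M \<omega>)"
    by (intro integral_mono sumR Bochner_Integration.integrable_sum Bochner_Integration.integrable_mult_right
        om_int[OF R_meas R_bd] om_int[OF M M_bound])
  finally show ?thesis by (simp add: Y_def g_def[abs_def])
qed

lemma I_one_0: "I \<omega> 0 (one k) = measure \<mu> {y\<in>live. cell y = k}"
proof -
  have s: "sets \<mu> = sets X" using \<mu> by (simp add: space_prob_algebra)
  have sp: "space \<mu> = space X" by (rule sets_eq_imp_space_eq[OF s])
  have "I \<omega> 0 (one k) = (\<integral>x. indicator {y\<in>live. cell y = k} x \<partial>\<mu>)"
    unfolding I_def m_def chain.simps one_def
    by (intro Bochner_Integration.integral_cong refl) (auto simp: indicator_def sp)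
  also have "\<dots> = measure \<mu> ({y\<in>live. cell y = k} \<inter> space \<mu>)" by simp
  also have "{y\<in>live. cell y = k} \<inter> space \<mu> = {y\<in>live. cell y = k}" by (auto simp: sp)
  finally show ?thesis .
qed

lemma T_one:
  assumes x: "x \<in> space X"
  shows "T \<omega> (one k) x = measure (K \<omega> x) {y\<in>live. cell y = k}"
proof -
  have s: "sets (K \<omega> x) = sets X" using K_prob[OF x] by (simp add: space_prob_algebra)
  have sp: "space (K \<omega> x) = space X" by (rule sets_eq_imp_space_eq[OF s])
  have "T \<omega> (one k) x = (\<integral>x. indicator {y\<in>live. cell y = k} x \<partial>K \<omega> x)"
    unfolding T_def one_def
    by (intro Bochner_Integration.integral_cong refl) (auto simp: indicator_def sp)
  also have "\<dots> = measure (K \<omega> x) ({y\<in>live. cell y = k} \<inter> space (K \<omega> x))" by simp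
  also have "{y\<in>live. cell y = k} \<inter> space (K \<omega> x) = {y\<in>live. cell y = k}" by (auto simp: sp)
  finally show ?thesis .
qed

lemma second_moment_0:
  assumes "G \<in> bfun 1" "\<And>a. G (xb, a) = 0"
    and "\<And>x. x \<in> space X \<Longrightarrow> (\<integral>u. G (x, c (x, u)) \<partial>unif) = 0"
    and M: "\<bar>M\<bar> \<le> 1" "\<And>k. k < N \<Longrightarrow> measure \<mu> {y\<in>live. cell y = k} \<le> M"
  shows "W.expectation (\<lambda>\<omega>. (I \<omega> 0 (\<lambda>x. G (x, \<phi> \<omega> x)))\<^sup>2) \<le> M"
  using second_moment[OF assms(1-3), of "\<lambda>_. M" 0] M by (simp add: I_one_0 D_0 W.prob_space)

text \<open>The next state falls into a given cell with probability at most \<open>\<kappa>\<close>,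
  evaluated at the current state and action.\<close>

lemma second_moment_Suc:
  assumes G: "G \<in> bfun 1" "\<And>a. G (xb, a) = 0"
    and centered: "\<And>x. x \<in> space X \<Longrightarrow> (\<integral>u. G (x, c (x, u)) \<partial>unif) = 0"
    and \<kappa>: "\<kappa> \<in> bfun 1" "\<And>a. \<kappa> (xb, a) = 0" "\<And>z. 0 \<le> \<kappa> z"
    and le: "\<And>x a k. x \<in> live \<Longrightarrow> a \<in> Act x \<Longrightarrow> k < N \<Longrightarrow> measure (p (x, a)) {y\<in>live. cell y = k} \<le> \<kappa> (x, a)"
  shows "W.expectation (\<lambda>\<omega>. (I \<omega> (Suc j) (\<lambda>x. G (x, \<phi> \<omega> x)))\<^sup>2) \<le>
    (2 * real j + 3) * W.expectation (\<lambda>\<omega>. I \<omega> j (\<lambda>x. \<kappa> (x, \<phi> \<omega> x)))"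
proof -
  note [measurable] = bfun_measurable[OF \<kappa>(1)]
  define h where "h \<omega> x = \<kappa> (x, \<phi> \<omega> x)" for \<omega> x
  have [measurable]: "h \<omega> \<in> borel_measurable X" for \<omega> unfolding h_def[abs_def] by measurable
  have h_bh: "h \<omega> \<in> bh 1" for \<omega>
    using bfun_bound[OF \<kappa>(1)] \<kappa>(2) \<phi>_Act Act_space by (auto simp: bh_def h_def)
  have h_joint: "(\<lambda>z. h (fst z) (snd z)) \<in> borel_measurable (\<Omega> \<Otimes>\<^sub>M X)"
    unfolding h_def by measurable
  have h0: "0 \<le> h \<omega> x" for \<omega> x by (simp add: h_def \<kappa>)
  have T_le: "T \<omega> (one k) x \<le> h \<omega> x" if "x \<in> space X" "k < N" for \<omega> k x
  proof (cases "x = xb")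
    case True
    then show ?thesis using T_bh[OF one_bh, of \<omega> k] h0[of \<omega> x] by (simp add: bh_def)
  next
    case False
    then show ?thesis using that le[of x "\<phi> \<omega> x" k] \<phi>_Act[of x \<omega>] by (simp add: T_one h_def K_def)
  qed
  note Tb = T_bh[OF one_bh]
  have "W.expectation (\<lambda>\<omega>. (I \<omega> (Suc j) (\<lambda>x. G (x, \<phi> \<omega> x)))\<^sup>2) \<le>
      (2 * real (Suc j) + 1) * W.expectation (\<lambda>\<omega>. I \<omega> j (h \<omega>))"
  proof (rule second_moment[OF G centered])
    show "(\<lambda>\<omega>. I \<omega> j (h \<omega>)) \<in> borel_measurable \<Omega>" by (rule measurable_I[OF h_joint])
    show "\<bar>I \<omega> j (h \<omega>)\<bar> \<le> 1" for \<omega> by (rule I_bound[OF h_bh])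
    show "I \<omega> (Suc j) (one k) \<le> I \<omega> j (h \<omega>)" if "k < N" for \<omega> k
      unfolding I_Suc[OF one_bh] using that by (intro I_mono[OF Tb h_bh] T_le)
    show "(\<Sum>k<N. D k \<omega> (Suc j) (one k)) \<le> real (Suc j) * I \<omega> j (h \<omega>)" for \<omega>
    proof -
      have "(\<Sum>k<N. D k \<omega> (Suc j) (one k)) \<le> (\<Sum>k<N. D k \<omega> j (h \<omega>) + I \<omega> j (\<lambda>x. of_bool (cell x = k) * h \<omega> x))"
      proof (rule sum_mono)
        fix k assume "k \<in> {..<N}"
        then have k: "k < N" by simp
        have "D k \<omega> j (\<lambda>x. of_bool (cell x \<noteq> k) * T \<omega> (one k) x) \<le> D k \<omega> j (h \<omega>)"
          using T_le[OF _ k] h0 by (intro D_mono[OF bh_restrict[OF Tb, of "\<lambda>i. i \<noteq> k"] h_bh]) auto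
        moreover have "I \<omega> j (\<lambda>x. of_bool (cell x = k) * T \<omega> (one k) x) \<le> I \<omega> j (\<lambda>x. of_bool (cell x = k) * h \<omega> x)"
          using T_le[OF _ k] h0
          by (intro I_mono[OF bh_restrict[OF Tb, of "\<lambda>i. i = k"] bh_restrict[OF h_bh, of "\<lambda>i. i = k"]]) auto
        ultimately show "D k \<omega> (Suc j) (one k) \<le> D k \<omega> j (h \<omega>) + I \<omega> j (\<lambda>x. of_bool (cell x = k) * h \<omega> x)"
          by (simp add: D_Suc[OF one_bh])
      qed
      also have "\<dots> \<le> real j * I \<omega> j (h \<omega>) + I \<omega> j (h \<omega>)"
        unfolding sum.distrib sum_cells_I[OF h_bh] using sum_D[OF h_bh h0] by simp
      finally show ?thesis by (simp add: algebra_simps)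
    qed
  qed
  moreover have "2 * real (Suc j) + 1 = 2 * real j + 3" by simp
  ultimately show ?thesis by (simp only: h_def[abs_def])
qed

end

section \<open>Purification in atomless models\<close>

context control_model begin

text \<open>A Borel coordinate in the unit interval; its dyadic intervals provide the cells.\<close>

definition \<theta> :: "'x \<Rightarrow> real" where
  "\<theta> = (SOME e. e \<in> borel_measurable X \<and> inj_on e (space X) \<and> (\<forall>x. e x \<in> {0<..<1}))"

lemma \<theta>: "\<theta> \<in> borel_measurable X" "inj_on \<theta> (space X)" "0 < \<theta> x" "\<theta> x < 1"
proof -
  obtain e d where "e \<in> borel_measurable X" "d \<in> borel \<rightarrow>\<^sub>M X"
    "\<And>x. x \<in> space X \<Longrightarrow> d (e x) = x" "\<And>x. e x \<in> {0<..<1::real}"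
    by (rule real_retract_unit_interval[OF X_retract that])
  then have "\<exists>e. e \<in> borel_measurable X \<and> inj_on e (space X) \<and> (\<forall>x. e x \<in> {0<..<1::real})"
    by (intro exI[of _ e] conjI inj_on_inverseI[where g=d]) auto
  then have *: "\<theta> \<in> borel_measurable X \<and> inj_on \<theta> (space X) \<and> (\<forall>x. \<theta> x \<in> {0<..<1})"
    unfolding \<theta>_def by (rule someI_ex)
  then show "\<theta> \<in> borel_measurable X" "inj_on \<theta> (space X)" by auto
  from * have "\<theta> x \<in> {0<..<1}" by blast
  then show "0 < \<theta> x" "\<theta> x < 1" by auto
qed

lemmas [measurable] = \<theta>(1)

definition cell :: "nat \<Rightarrow> 'x \<Rightarrow> nat" where
  "cell n x = nat \<lfloor>2 ^ n * \<theta> x\<rfloor>"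

lemma measurable_cell[measurable]: "cell n \<in> X \<rightarrow>\<^sub>M count_space UNIV"
  unfolding cell_def[abs_def] by measurable

lemma cell_less: "cell n x < 2 ^ n"
proof -
  have "2 ^ n * \<theta> x < 2 ^ n" using \<theta>(4)[of x] by simp
  then have "\<lfloor>2 ^ n * \<theta> x\<rfloor> < 2 ^ n" by (simp add: floor_less_iff)
  then show ?thesis by (simp add: cell_def nat_less_iff)
qed

lemma same_cell_close:
  assumes "cell n x = cell n y"
  shows "\<bar>\<theta> x - \<theta> y\<bar> < 1 / 2 ^ n"
proof -
  have "0 \<le> \<lfloor>2 ^ n * \<theta> x\<rfloor>" "0 \<le> \<lfloor>2 ^ n * \<theta> y\<rfloor>" using \<theta>(3)[of x] \<theta>(3)[of y] by auto
  then have "\<lfloor>2 ^ n * \<theta> x\<rfloor> = \<lfloor>2 ^ n * \<theta> y\<rfloor>" using assms unfolding cell_def by linarith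
  then have "\<bar>2 ^ n * \<theta> x - 2 ^ n * \<theta> y\<bar> < 1" by linarith
  then have "2 ^ n * \<bar>\<theta> x - \<theta> y\<bar> < 1" by (simp add: abs_mult right_diff_distrib[symmetric])
  then show ?thesis by (simp add: field_simps)
qed

lemma cells_cell: "c \<in> controls \<Longrightarrow> cells X A Act p \<mu> xb c (cell n) (2 ^ n)"
  by unfold_locales (auto simp: cell_less)

definition crowd :: "nat \<Rightarrow> 'x measure \<Rightarrow> real" where
  "crowd n P = (MAX k\<in>{..<2 ^ n}. measure P {y\<in>live. cell n y = k})"

lemma crowd_ge: "k < 2 ^ n \<Longrightarrow> measure P {y\<in>live. cell n y = k} \<le> crowd n P"
  unfolding crowd_def by (intro Max_ge) auto

lemma crowd_in: "\<exists>k<2 ^ n. crowd n P = measure P {y\<in>live. cell n y = k}"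
proof -
  have "crowd n P \<in> (\<lambda>k. measure P {y\<in>live. cell n y = k}) ` {..<2 ^ n}"
    unfolding crowd_def by (intro Max_in) (auto simp: lessThan_empty_iff)
  then show ?thesis by auto
qed

lemma crowd_nonneg: "0 \<le> crowd n P"
  using crowd_in[of n P] by auto

lemma crowd_le_1: "P \<in> space (prob_algebra X) \<Longrightarrow> crowd n P \<le> 1"
  using crowd_in[of n P] by (auto simp: space_prob_algebra prob_space.prob_le_1)

text \<open>The square of the probability of a cell is at most the probability that two independent points
  are \<open>2^-n\<close>-close, and this tends to the mass of the diagonal, which is zero for
  an atomless law.\<close>

lemma crowd_tendsto:
  assumes P: "P \<in> space (prob_algebra X)" and atomless: "\<And>y. y \<in> live \<Longrightarrow> emeasure P {y} = 0"
  shows "(\<lambda>n. crowd n P) \<longlonglongrightarrow> 0"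
proof -
  have s[measurable_cong]: "sets P = sets X" using P by (simp add: space_prob_algebra)
  interpret prob_space P using P by (simp add: space_prob_algebra)
  have sp: "space P = space X" by (rule sets_eq_imp_space_eq[OF s])
  \<comment> \<open>points of one cell are near to each other, and the sets shrink to a point\<close>
  define near where "near n y = {y'\<in>live. \<bar>\<theta> y' - \<theta> y\<bar> < 1 / 2 ^ n}" for n y
  have near_sets[measurable]: "near n y \<in> sets X" for n y
    unfolding near_def by measurable
  have near_meas: "(\<lambda>y. measure P (near n y)) \<in> borel_measurable X" for n
  proof (rule measure_measurable_subprob_algebra2[where N=X])
    have "(SIGMA y:space X. near n y) = {z\<in>space (X \<Otimes>\<^sub>M X). snd z \<in> live \<and> \<bar>\<theta> (snd z) - \<theta> (fst z)\<bar> < 1 / 2 ^ n}"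
      by (auto simp: near_def space_pair_measure)
    also have "\<dots> \<in> sets (X \<Otimes>\<^sub>M X)" by measurable
    finally show "(SIGMA y:space X. near n y) \<in> sets (X \<Otimes>\<^sub>M X)" .
    show "(\<lambda>_. P) \<in> X \<rightarrow>\<^sub>M subprob_algebra X"
      using P by (auto simp: space_subprob_algebra space_prob_algebra prob_space_imp_subprob_space)
  qed
  define g where "g n = (\<integral>y. indicator live y * measure P (near n y) \<partial>P)" for n
  have gm: "(\<lambda>y. indicator live y * measure P (near n y)) \<in> borel_measurable P" for n
    using near_meas[of n] by measurable
  have "g \<longlonglongrightarrow> (\<integral>y. 0 \<partial>P)"
    unfolding g_def[abs_def]
  proof (rule integral_dominated_convergence[where w="\<lambda>_. 1"])
    show "AE y in P. (\<lambda>n. indicator live y * measure P (near n y)) \<longlonglongrightarrow> 0"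
    proof (rule AE_I2)
      fix y assume y: "y \<in> space P"
      show "(\<lambda>n. indicator live y * measure P (near n y)) \<longlonglongrightarrow> 0"
      proof (cases "y \<in> live")
        case True
        have "decseq (\<lambda>n. near n y)"
          unfolding decseq_Suc_iff near_def by (auto simp: field_simps intro: less_le_trans)
        then have "(\<lambda>n. measure P (near n y)) \<longlonglongrightarrow> measure P (\<Inter>n. near n y)"
          by (intro finite_Lim_measure_decseq) (auto simp: s)
        also have "(\<Inter>n. near n y) = {y}"
        proof (intro equalityI subsetI)
          fix z assume z: "z \<in> (\<Inter>n. near n y)"
          then have zl: "z \<in> live" by (auto simp: near_def)
          have "\<bar>\<theta> z - \<theta> y\<bar> \<le> 0"
          proof (rule ccontr)
            assume "\<not> \<bar>\<theta> z - \<theta> y\<bar> \<le> 0"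
            then obtain n where "(1/2::real) ^ n < \<bar>\<theta> z - \<theta> y\<bar>" using real_arch_pow_inv[of "\<bar>\<theta> z - \<theta> y\<bar>" "1/2"] by auto
            moreover have "\<bar>\<theta> z - \<theta> y\<bar> < 1 / 2 ^ n" using z by (auto simp: near_def)
            ultimately show False by (simp add: power_divide)
          qed
          then have "z = y" using \<theta>(2) zl True by (auto dest: inj_onD)
          then show "z \<in> {y}" by simp
        qed (use True in \<open>auto simp: near_def\<close>)
        also have "measure P {y} = 0" using atomless[OF True] by (simp add: measure_def)
        finally show ?thesis by (intro tendsto_mult_right_zero)
      qed simp
    qed
    show "AE y in P. norm (indicator live y * measure P (near n y)) \<le> 1" for n
      by (intro AE_I2) (auto simp: indicator_def)
  qed (use gm in auto)
  then have "(\<lambda>n. sqrt (g n)) \<longlonglongrightarrow> sqrt 0" by (intro tendsto_real_sqrt) simp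
  moreover have "crowd n P \<le> sqrt (g n)" for n
  proof (rule real_le_rsqrt)
    obtain k where k: "k < 2 ^ n" "crowd n P = measure P {y\<in>live. cell n y = k}" using crowd_in by blast
    define C where "C = {y\<in>live. cell n y = k}"
    have C[measurable]: "C \<in> sets X" unfolding C_def by measurable
    have "(crowd n P)\<^sup>2 = (\<integral>y. indicator C y * measure P C \<partial>P)"
    proof -
      have "C \<inter> space P = C" using sets.sets_into_space[OF C] sp by auto
      then show ?thesis unfolding k(2) C_def[symmetric] by (simp add: power2_eq_square)
    qed
    also have "\<dots> \<le> g n"
      unfolding g_def
    proof (rule integral_mono)
      show "integrable P (\<lambda>y. indicator C y * measure P C)"
        by (intro integrable_const_bound[where B=1]) (auto simp: indicator_def)
      show "integrable P (\<lambda>y. indicator live y * measure P (near n y))"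
        using gm by (intro integrable_const_bound[where B=1]) (auto simp: indicator_def)
      fix y
      show "indicator C y * measure P C \<le> indicator live y * measure P (near n y)"
      proof (cases "y \<in> C")
        case True
        have "C \<subseteq> near n y"
        proof
          fix z assume "z \<in> C"
          then show "z \<in> near n y" using True same_cell_close[of n z y] by (auto simp: C_def near_def)
        qed
        then have "measure P C \<le> measure P (near n y)" by (intro finite_measure_mono) (auto simp: s)
        moreover have "y \<in> live" using True by (auto simp: C_def)
        ultimately show ?thesis using True by (auto simp: indicator_def)
      qed simp
    qed
    finally show "(crowd n P)\<^sup>2 \<le> g n" .
  qed
  ultimately show ?thesis
    using crowd_nonneg by (intro tendsto_sandwich[of "\<lambda>_. 0" "\<lambda>n. crowd n P" sequentially "\<lambda>n. sqrt (g n)"]) auto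
qed

definition \<kappa> :: "nat \<Rightarrow> 'x \<times> 'a \<Rightarrow> real" where
  "\<kappa> n z = of_bool (fst z \<noteq> xb) * crowd n (p z)"

lemma bfun_live: "g \<in> bfun B \<Longrightarrow> (\<lambda>z. of_bool (fst z \<noteq> xb) * g z) \<in> bfun B"
proof -
  assume g: "g \<in> bfun B"
  note [measurable] = bfun_measurable[OF g]
  have "(\<lambda>z. indicator (- {xb}) (fst z) * g z) \<in> borel_measurable (X \<Otimes>\<^sub>M A)" by measurable
  also have "(\<lambda>z. indicator (- {xb}) (fst z) * g z) = (\<lambda>z. of_bool (fst z \<noteq> xb) * g z)"
    by (auto simp: indicator_def)
  finally show ?thesis using bfun_bound'[OF g] bfun_nonneg[OF g] by (auto simp: bfun_def)
qed

lemma crowd_p_bfun: "(\<lambda>z. crowd n (p z)) \<in> bfun 1"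
proof -
  have "(\<lambda>z. crowd n (p z)) \<in> borel_measurable (X \<Otimes>\<^sub>M A)"
    unfolding crowd_def
    by (intro borel_measurable_Max measurable_compose[OF p measurable_measure_prob_algebra]) auto
  moreover have "p z \<in> space (prob_algebra X)" if "z \<in> space (X \<Otimes>\<^sub>M A)" for z
    using measurable_space[OF p that] .
  ultimately show ?thesis using crowd_nonneg crowd_le_1 by (auto simp: bfun_def)
qed

lemma \<kappa>_bfun: "\<kappa> n \<in> bfun 1"
  unfolding \<kappa>_def[abs_def] by (rule bfun_live[OF crowd_p_bfun])

definition avg :: "('x \<times> real \<Rightarrow> 'a) \<Rightarrow> ('x \<times> 'a \<Rightarrow> real) \<Rightarrow> 'x \<Rightarrow> real" where
  "avg c g x = (\<integral>u. g (x, c (x, u)) \<partial>unif)"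

lemma avg_measurable:
  assumes "c \<in> controls" "g \<in> bfun B"
  shows "avg c g \<in> borel_measurable X"
proof -
  note [measurable] = controls_measurable[OF assms(1)] bfun_measurable[OF assms(2)]
  have "(\<lambda>(x, u). g (x, c (x, u))) \<in> borel_measurable (X \<Otimes>\<^sub>M unif)" by measurable
  then show ?thesis unfolding avg_def[abs_def] by (rule unif.borel_measurable_lebesgue_integral)
qed

lemma avg_bound:
  assumes "c \<in> controls" "g \<in> bfun B" "x \<in> space X"
  shows "\<bar>avg c g x\<bar> \<le> B"
  unfolding avg_def using assms bfun_nonneg[OF assms(2)]
  by (intro integral_bound prob_space_unif bfun_bound[OF assms(2)]) (auto intro: Act_space controls_Act)

text \<open>Induction on the period \<open>j\<close>. Given the random selector, the reward at time \<open>j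
  + 1\<close> is close to its average over the seed, by the second moment bound. The average in
  turn is a function of the state at time \<open>j + 1\<close>, hence an expected reward at time
  \<open>j\<close>, to which the induction hypothesis applies. The bound \<open>d n\<close> does
  not depend on \<open>g\<close>; this uniformity is needed because \<open>g\<close> changes
  with the period.\<close>

lemma purify_term:
  assumes c: "c \<in> controls"
  shows "\<exists>d. d \<longlonglongrightarrow> 0 \<and> (\<forall>n. \<forall>g\<in>bfun 1. (\<forall>a. g (xb, a) = 0) \<longrightarrow>
    (\<integral>\<omega>. \<bar>cells.I p \<mu> c (cell n) \<omega> j (\<lambda>x. g (x, cells.\<phi> c (cell n) \<omega> x)) - (\<integral>x. avg c g x \<partial>law (\<lambda>_. c) j)\<bar>
      \<partial>cells.\<Omega> (2 ^ n)) \<le> d n)"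
proof -
  interpret C: cells X A Act p \<mu> xb c "cell n" "2 ^ n" for n by (rule cells_cell[OF c])
  have cp: "(\<lambda>_. c) \<in> plans" using c by simp
  note [measurable] = controls_measurable[OF c]
  \<comment> \<open>bound for one function from a second moment bound on its centred version\<close>
  have key: "(\<integral>\<omega>. \<bar>C.I n \<omega> j (\<lambda>x. g (x, C.\<phi> n \<omega> x)) - C.I n \<omega> j (avg c g)\<bar> \<partial>C.\<Omega> n) \<le> 2 * sqrt b"
    if g: "g \<in> bfun 1" "\<And>a. g (xb, a) = 0"
    and b: "\<And>G. G \<in> bfun 1 \<Longrightarrow> (\<And>a. G (xb, a) = 0) \<Longrightarrow> (\<And>x. x \<in> space X \<Longrightarrow> (\<integral>u. G (x, c (x, u)) \<partial>unif) = 0) \<Longrightarrow>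
      (\<integral>\<omega>. (C.I n \<omega> j (\<lambda>x. G (x, C.\<phi> n \<omega> x)))\<^sup>2 \<partial>C.\<Omega> n) \<le> b" for g n j b
  proof -
    note [measurable] = bfun_measurable[OF g(1)] avg_measurable[OF c g(1)]
    \<comment> \<open>centered in the seed; the factor 1/2 keeps it bounded by 1\<close>
    define G where "G z = (g z - avg c g (fst z)) / 2" for z
    have avg0: "avg c g xb = 0" by (simp add: avg_def g)
    have G: "G \<in> bfun 1"
    proof -
      have "G \<in> borel_measurable (X \<Otimes>\<^sub>M A)" unfolding G_def by measurable
      moreover have "\<bar>G z\<bar> \<le> 1" if "z \<in> space (X \<Otimes>\<^sub>M A)" for z
      proof -
        have "\<bar>g z\<bar> \<le> 1" "\<bar>avg c g (fst z)\<bar> \<le> 1"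
          using bfun_bound'[OF g(1) that] avg_bound[OF c g(1), of "fst z"] that by (auto simp: space_pair_measure)
        then show ?thesis by (simp add: G_def)
      qed
      ultimately show ?thesis by (simp add: bfun_def)
    qed
    have G0: "G (xb, a) = 0" for a by (simp add: G_def g avg0)
    have Gc: "(\<integral>u. G (x, c (x, u)) \<partial>unif) = 0" if x[measurable]: "x \<in> space X" for x
    proof -
      have "integrable unif (\<lambda>u. g (x, c (x, u)))"
        using bfun_bound[OF g(1) x] Act_space[OF x controls_Act[OF c x]]
        by (intro unif.integrable_const_bound[where B=1]) auto
      then show ?thesis using unif.prob_space by (simp add: G_def avg_def)
    qed
    have Gb: "(\<lambda>x. G (x, C.\<phi> n \<omega> x)) \<in> C.bh 1" for \<omega>
    proof -
      have [measurable]: "G \<in> borel_measurable (X \<Otimes>\<^sub>M A)" by (rule bfun_measurable[OF G])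
      have "(\<lambda>x. G (x, C.\<phi> n \<omega> x)) \<in> borel_measurable X" using C.\<phi>_measurable[of n \<omega>] by measurable
      then show ?thesis
        using bfun_bound[OF G] G0 Act_space[OF _ C.\<phi>_Act] by (auto simp: C.bh_def)
    qed
    have ab: "avg c g \<in> C.bh 1"
      using avg_bound[OF c g(1)] avg0 by (auto simp: C.bh_def)
    have gb: "(\<lambda>x. g (x, C.\<phi> n \<omega> x)) \<in> C.bh 1" for \<omega>
    proof -
      have "(\<lambda>x. g (x, C.\<phi> n \<omega> x)) \<in> borel_measurable X" using C.\<phi>_measurable[of n \<omega>] by measurable
      then show ?thesis
        using bfun_bound[OF g(1)] g(2) Act_space[OF _ C.\<phi>_Act] by (auto simp: C.bh_def)
    qed
    have eq: "C.I n \<omega> j (\<lambda>x. g (x, C.\<phi> n \<omega> x)) - C.I n \<omega> j (avg c g) = 2 * C.I n \<omega> j (\<lambda>x. G (x, C.\<phi> n \<omega> x))" for \<omega>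
    proof -
      have "C.I n \<omega> j (\<lambda>x. g (x, C.\<phi> n \<omega> x)) - C.I n \<omega> j (avg c g) = C.I n \<omega> j (\<lambda>x. g (x, C.\<phi> n \<omega> x) - avg c g x)"
        by (rule C.I_diff[OF gb ab, symmetric])
      also have "\<dots> = C.I n \<omega> j (\<lambda>x. 2 * G (x, C.\<phi> n \<omega> x))" by (intro C.I_cong) (simp add: G_def)
      finally show ?thesis by (simp add: C.I_def)
    qed
    have "(\<integral>\<omega>. \<bar>C.I n \<omega> j (\<lambda>x. G (x, C.\<phi> n \<omega> x))\<bar> \<partial>C.\<Omega> n) \<le> sqrt b"
    proof (rule C.W.expectation_abs_le_sqrt)
      have "(\<lambda>z. G (snd z, C.\<phi> n (fst z) (snd z))) \<in> borel_measurable (C.\<Omega> n \<Otimes>\<^sub>M X)"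
        using bfun_measurable[OF G] C.\<phi>_joint[of n] by measurable
      then show "(\<lambda>\<omega>. C.I n \<omega> j (\<lambda>x. G (x, C.\<phi> n \<omega> x))) \<in> borel_measurable (C.\<Omega> n)"
        by (rule C.measurable_I)
      show "\<bar>C.I n \<omega> j (\<lambda>x. G (x, C.\<phi> n \<omega> x))\<bar> \<le> 1" for \<omega> by (rule C.I_bound[OF Gb])
      show "(\<integral>\<omega>. (C.I n \<omega> j (\<lambda>x. G (x, C.\<phi> n \<omega> x)))\<^sup>2 \<partial>C.\<Omega> n) \<le> b" by (rule b[OF G G0 Gc])
    qed
    then show ?thesis unfolding eq by (simp add: abs_mult)
  qed
  show ?thesis
  proof (induction j)
    case 0
    have "(\<lambda>n. 2 * sqrt (crowd n \<mu>)) \<longlonglongrightarrow> 2 * sqrt 0"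
      by (intro tendsto_mult tendsto_const tendsto_real_sqrt crowd_tendsto \<mu> init_atomless)
    moreover have "(\<integral>\<omega>. \<bar>C.I n \<omega> 0 (\<lambda>x. g (x, C.\<phi> n \<omega> x)) - (\<integral>x. avg c g x \<partial>law (\<lambda>_. c) 0)\<bar> \<partial>C.\<Omega> n) \<le> 2 * sqrt (crowd n \<mu>)"
      if g: "g \<in> bfun 1" "\<And>a. g (xb, a) = 0" for n g
    proof -
      have "C.I n \<omega> 0 (avg c g) = (\<integral>x. avg c g x \<partial>law (\<lambda>_. c) 0)" for \<omega>
        by (simp add: C.I_def C.m_def)
      moreover have "(\<integral>\<omega>. \<bar>C.I n \<omega> 0 (\<lambda>x. g (x, C.\<phi> n \<omega> x)) - C.I n \<omega> 0 (avg c g)\<bar> \<partial>C.\<Omega> n) \<le> 2 * sqrt (crowd n \<mu>)"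
        using crowd_nonneg[of n \<mu>] crowd_le_1[OF \<mu>, of n]
        by (intro key[OF g] C.second_moment_0 crowd_ge) auto
      ultimately show ?thesis by simp
    qed
    ultimately show ?case by (intro exI[of _ "\<lambda>n. 2 * sqrt (crowd n \<mu>)"]) auto
  next
    case (Suc j)
    then obtain d where d: "d \<longlonglongrightarrow> 0" and dI: "\<And>n g. g \<in> bfun 1 \<Longrightarrow> (\<And>a. g (xb, a) = 0) \<Longrightarrow>
      (\<integral>\<omega>. \<bar>C.I n \<omega> j (\<lambda>x. g (x, C.\<phi> n \<omega> x)) - (\<integral>x. avg c g x \<partial>law (\<lambda>_. c) j)\<bar> \<partial>C.\<Omega> n) \<le> d n"
      by blast
    have P: "prob_space (law (\<lambda>_. c) j)" and s[measurable_cong]: "sets (law (\<lambda>_. c) j) = sets X"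
      by (rule law_prob_space[OF cp], rule sets_law[OF cp])
    interpret P: prob_space "law (\<lambda>_. c) j" by (rule P)
    define e where "e n = (\<integral>x. avg c (\<kappa> n) x \<partial>law (\<lambda>_. c) j)" for n
    have e: "e \<longlonglongrightarrow> (\<integral>x. 0 \<partial>law (\<lambda>_. c) j)"
      unfolding e_def[abs_def]
    proof (rule integral_dominated_convergence[where w="\<lambda>_. 1"])
      show "AE x in law (\<lambda>_. c) j. (\<lambda>n. avg c (\<kappa> n) x) \<longlonglongrightarrow> 0"
      proof (rule AE_I2)
        fix x assume "x \<in> space (law (\<lambda>_. c) j)"
        then have x[measurable]: "x \<in> space X" by (simp add: space_law[OF cp])
        have "(\<lambda>n. avg c (\<kappa> n) x) \<longlonglongrightarrow> (\<integral>u. 0 \<partial>unif)"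
          unfolding avg_def
        proof (rule integral_dominated_convergence[where w="\<lambda>_. 1"])
          show "(\<lambda>u. \<kappa> n (x, c (x, u))) \<in> borel_measurable unif" for n
            using bfun_measurable[OF \<kappa>_bfun[of n]] by measurable
          show "AE u in unif. (\<lambda>n. \<kappa> n (x, c (x, u))) \<longlonglongrightarrow> 0"
          proof (rule AE_I2)
            fix u
            show "(\<lambda>n. \<kappa> n (x, c (x, u))) \<longlonglongrightarrow> 0"
            proof (cases "x = xb")
              case False
              have a: "c (x, u) \<in> Act x" by (rule controls_Act[OF c x])
              have "(\<lambda>n. crowd n (p (x, c (x, u)))) \<longlonglongrightarrow> 0"
                using False x a by (intro crowd_tendsto p_prob Act_space[OF x a] step_atomless) auto
              then show ?thesis using False by (simp add: \<kappa>_def)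
            qed (simp add: \<kappa>_def)
          qed
          show "AE u in unif. norm (\<kappa> n (x, c (x, u))) \<le> 1" for n
            using bfun_bound[OF \<kappa>_bfun x Act_space[OF x controls_Act[OF c x]]] by simp
        qed simp_all
        then show "(\<lambda>n. avg c (\<kappa> n) x) \<longlonglongrightarrow> 0" by simp
      qed
      show "AE x in law (\<lambda>_. c) j. norm (avg c (\<kappa> n) x) \<le> 1" for n
        using avg_bound[OF c \<kappa>_bfun] by (intro AE_I2) (auto simp: space_law[OF cp])
      show "avg c (\<kappa> n) \<in> borel_measurable (law (\<lambda>_. c) j)" for n
        using avg_measurable[OF c \<kappa>_bfun[of n]] by measurable
    qed simp_all
    define b where "b n = (2 * real j + 3) * (e n + d n)" for n
    have b: "b \<longlonglongrightarrow> 0" using tendsto_mult[OF tendsto_const tendsto_add[OF e d], of "2 * real j + 3"] by (simp add: b_def[abs_def])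
    have "(\<lambda>n. 2 * sqrt (b n) + d n) \<longlonglongrightarrow> 2 * sqrt 0 + 0"
      by (intro tendsto_add tendsto_mult tendsto_const tendsto_real_sqrt b d)
    moreover have "(\<integral>\<omega>. \<bar>C.I n \<omega> (Suc j) (\<lambda>x. g (x, C.\<phi> n \<omega> x)) - (\<integral>x. avg c g x \<partial>law (\<lambda>_. c) (Suc j))\<bar> \<partial>C.\<Omega> n) \<le> 2 * sqrt (b n) + d n"
      if g: "g \<in> bfun 1" "\<And>a. g (xb, a) = 0" for n g
    proof -
      have meas: "(\<lambda>\<omega>. C.I n \<omega> i (\<lambda>x. f (x, C.\<phi> n \<omega> x))) \<in> borel_measurable (C.\<Omega> n)" if "f \<in> bfun 1" for f i
      proof -
        have "(\<lambda>z. f (snd z, C.\<phi> n (fst z) (snd z))) \<in> borel_measurable (C.\<Omega> n \<Otimes>\<^sub>M X)"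
          using bfun_measurable[OF that] C.\<phi>_joint[of n] by measurable
        then show ?thesis by (rule C.measurable_I)
      qed
      have fb: "(\<lambda>x. f (x, C.\<phi> n \<omega> x)) \<in> C.bh 1" if "f \<in> bfun 1" "\<And>a. f (xb, a) = 0" for f \<omega>
      proof -
        have "(\<lambda>x. f (x, C.\<phi> n \<omega> x)) \<in> borel_measurable X"
          using bfun_measurable[OF that(1)] C.\<phi>_measurable[of n \<omega>] by measurable
        then show ?thesis
          using bfun_bound[OF that(1)] that(2) Act_space[OF _ C.\<phi>_Act] by (auto simp: C.bh_def)
      qed
      have bd: "\<bar>C.I n \<omega> i (\<lambda>x. f (x, C.\<phi> n \<omega> x))\<bar> \<le> 1" if "f \<in> bfun 1" "\<And>a. f (xb, a) = 0" for f i \<omega>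
        by (rule C.I_bound[OF fb[OF that]])
      have \<kappa>0: "\<kappa> n (xb, a) = 0" for a by (simp add: \<kappa>_def)
      have "(\<integral>\<omega>. C.I n \<omega> j (\<lambda>x. \<kappa> n (x, C.\<phi> n \<omega> x)) \<partial>C.\<Omega> n) \<le> e n + d n"
      proof -
        have int: "integrable (C.\<Omega> n) (\<lambda>\<omega>. C.I n \<omega> j (\<lambda>x. \<kappa> n (x, C.\<phi> n \<omega> x)))"
          using bd[OF \<kappa>_bfun \<kappa>0] by (intro C.W.integrable_const_bound[where B=1] meas \<kappa>_bfun) auto
        have "(\<integral>\<omega>. C.I n \<omega> j (\<lambda>x. \<kappa> n (x, C.\<phi> n \<omega> x)) \<partial>C.\<Omega> n) - e n =
            (\<integral>\<omega>. C.I n \<omega> j (\<lambda>x. \<kappa> n (x, C.\<phi> n \<omega> x)) - e n \<partial>C.\<Omega> n)"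
          using int by (simp add: C.W.prob_space)
        also have "\<dots> \<le> (\<integral>\<omega>. \<bar>C.I n \<omega> j (\<lambda>x. \<kappa> n (x, C.\<phi> n \<omega> x)) - e n\<bar> \<partial>C.\<Omega> n)"
          using int by (intro integral_mono) auto
        also have "\<dots> \<le> d n" unfolding e_def by (rule dI[OF \<kappa>_bfun \<kappa>0])
        finally show ?thesis by simp
      qed
      then have Eb: "(2 * real j + 3) * (\<integral>\<omega>. C.I n \<omega> j (\<lambda>x. \<kappa> n (x, C.\<phi> n \<omega> x)) \<partial>C.\<Omega> n) \<le> b n"
        unfolding b_def by (intro mult_left_mono) auto
      have first: "(\<integral>\<omega>. \<bar>C.I n \<omega> (Suc j) (\<lambda>x. g (x, C.\<phi> n \<omega> x)) - C.I n \<omega> (Suc j) (avg c g)\<bar> \<partial>C.\<Omega> n) \<le> 2 * sqrt (b n)"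
      proof (rule key[OF g])
        fix G assume G: "G \<in> bfun 1" "\<And>a. G (xb, a) = 0" "\<And>x. x \<in> space X \<Longrightarrow> (\<integral>u. G (x, c (x, u)) \<partial>unif) = 0"
        have "(\<integral>\<omega>. (C.I n \<omega> (Suc j) (\<lambda>x. G (x, C.\<phi> n \<omega> x)))\<^sup>2 \<partial>C.\<Omega> n) \<le>
            (2 * real j + 3) * (\<integral>\<omega>. C.I n \<omega> j (\<lambda>x. \<kappa> n (x, C.\<phi> n \<omega> x)) \<partial>C.\<Omega> n)"
        proof (rule C.second_moment_Suc[OF G \<kappa>_bfun \<kappa>0])
          show "0 \<le> \<kappa> n z" for z by (simp add: \<kappa>_def crowd_nonneg)
          show "measure (p (x, a)) {y\<in>live. cell n y = k} \<le> \<kappa> n (x, a)" if "x \<in> live" "k < 2 ^ n" for x a k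
            using that crowd_ge[of k n "p (x, a)"] by (simp add: \<kappa>_def)
        qed
        then show "(\<integral>\<omega>. (C.I n \<omega> (Suc j) (\<lambda>x. G (x, C.\<phi> n \<omega> x)))\<^sup>2 \<partial>C.\<Omega> n) \<le> b n" using Eb by linarith
      qed
      \<comment> \<open>the averaged reward is a function of the state and moves one step back through the transition\<close>
      define h where "h = avg c g"
      have h_meas[measurable]: "h \<in> borel_measurable X" unfolding h_def by (rule avg_measurable[OF c g(1)])
      have h_bd: "\<bar>h x\<bar> \<le> 1" if "x \<in> space X" for x unfolding h_def by (rule avg_bound[OF c g(1) that])
      have h0: "h xb = 0" by (simp add: h_def avg_def g)
      have hb: "h \<in> C.bh 1" using h_bd h0 by (auto simp: C.bh_def)
      define H where "H z = of_bool (fst z \<noteq> xb) * (\<integral>y. h y \<partial>p z)" for z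
      have "(\<lambda>z. \<integral>y. h y \<partial>p z) \<in> bfun 1"
      proof -
        have "\<bar>\<integral>y. h y \<partial>p z\<bar> \<le> 1" if "z \<in> space (X \<Otimes>\<^sub>M A)" for z
          using measurable_space[OF p that] hb by (intro C.bh_bound)
        then show ?thesis by (auto simp: bfun_def)
      qed
      then have H: "H \<in> bfun 1" unfolding H_def[abs_def] by (rule bfun_live)
      have H0: "H (xb, a) = 0" for a by (simp add: H_def)
      have p0: "(\<integral>y. h y \<partial>p (xb, a)) = 0" if "a \<in> Act xb" for a
        by (rule integral_eq_zero_AE) (use AE_p_xb[OF that] h0 in \<open>auto elim!: eventually_mono\<close>)
      have I1: "C.I n \<omega> (Suc j) h = C.I n \<omega> j (\<lambda>x. H (x, C.\<phi> n \<omega> x))" for \<omega>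
        unfolding C.I_Suc[OF hb]
      proof (rule C.I_cong)
        fix x assume x: "x \<in> space X"
        show "C.T n \<omega> h x = H (x, C.\<phi> n \<omega> x)"
          using C.T_bh[OF hb, of n \<omega>] by (cases "x = xb") (auto simp: C.T_def C.K_def H_def C.bh_def)
      qed
      have I2: "(\<integral>x. h x \<partial>law (\<lambda>_. c) (Suc j)) = (\<integral>x. avg c H x \<partial>law (\<lambda>_. c) j)"
      proof -
        have "(\<integral>x. h x \<partial>law (\<lambda>_. c) (Suc j)) = (\<integral>x. \<integral>y. h y \<partial>step c x \<partial>law (\<lambda>_. c) j)"
          by (rule integral_law_Suc[OF cp h_meas h_bd])
        also have "\<dots> = (\<integral>x. avg c H x \<partial>law (\<lambda>_. c) j)"
        proof (intro Bochner_Integration.integral_cong refl)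
          fix x assume "x \<in> space (law (\<lambda>_. c) j)"
          then have x: "x \<in> space X" by (simp add: space_law[OF cp])
          have "(\<integral>y. h y \<partial>step c x) = (\<integral>u. \<integral>y. h y \<partial>p (x, c (x, u)) \<partial>unif)"
            using x h_bd by (intro integral_step[where B=1]) auto
          also have "\<dots> = avg c H x"
            unfolding avg_def
            using p0[OF controls_Act[OF c xb]]
            by (intro Bochner_Integration.integral_cong refl) (auto simp: H_def)
          finally show "(\<integral>y. h y \<partial>step c x) = avg c H x" .
        qed
        finally show ?thesis .
      qed
      have second: "(\<integral>\<omega>. \<bar>C.I n \<omega> (Suc j) h - (\<integral>x. h x \<partial>law (\<lambda>_. c) (Suc j))\<bar> \<partial>C.\<Omega> n) \<le> d n"
        unfolding I1 I2 by (rule dI[OF H H0])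
      let ?a = "\<lambda>\<omega>. C.I n \<omega> (Suc j) (\<lambda>x. g (x, C.\<phi> n \<omega> x))" and ?b = "\<lambda>\<omega>. C.I n \<omega> (Suc j) h"
        and ?c = "\<integral>x. h x \<partial>law (\<lambda>_. c) (Suc j)"
      have am: "?a \<in> borel_measurable (C.\<Omega> n)" by (rule meas[OF g(1)])
      have bm: "?b \<in> borel_measurable (C.\<Omega> n)" unfolding I1 by (rule meas[OF H])
      have ai: "integrable (C.\<Omega> n) ?a" using am bd[OF g] by (intro C.W.integrable_const_bound[where B=1]) auto
      have bi: "integrable (C.\<Omega> n) ?b" using bm bd[OF H H0] unfolding I1 by (intro C.W.integrable_const_bound[where B=1]) auto
      have "(\<integral>\<omega>. \<bar>?a \<omega> - ?c\<bar> \<partial>C.\<Omega> n) \<le> (\<integral>\<omega>. \<bar>?a \<omega> - ?b \<omega>\<bar> + \<bar>?b \<omega> - ?c\<bar> \<partial>C.\<Omega> n)"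
        using ai bi by (intro integral_mono) auto
      also have "\<dots> = (\<integral>\<omega>. \<bar>?a \<omega> - ?b \<omega>\<bar> \<partial>C.\<Omega> n) + (\<integral>\<omega>. \<bar>?b \<omega> - ?c\<bar> \<partial>C.\<Omega> n)"
        using ai bi by (intro Bochner_Integration.integral_add) auto
      also have "\<dots> \<le> 2 * sqrt (b n) + d n" using first second unfolding h_def by linarith
      finally show ?thesis by (simp add: h_def)
    qed
    ultimately show ?case by (intro exI[of _ "\<lambda>n. 2 * sqrt (b n) + d n"]) auto
  qed
qed

text \<open>Only finitely many periods matter up to a small tail, so the expected total error over finitely
  many rewards and periods is small for fine cells. Some realization of the cell seeds does at
  least as well as the expectation.\<close>

theorem purification:
  assumes c: "c \<in> controls" and \<G>: "finite \<G>" "\<G> \<subseteq> bfun B" and \<epsilon>: "0 < \<epsilon>"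
  shows "\<exists>\<phi>\<in>selectors. (\<forall>x\<in>space X. \<exists>u. \<phi> x = c (x, u)) \<and>
    (\<forall>g\<in>\<G>. \<bar>val (\<lambda>_. pure \<phi>) g - val (\<lambda>_. c) g\<bar> < \<epsilon>)"
proof -
  interpret C: cells X A Act p \<mu> xb c "cell n" "2 ^ n" for n by (rule cells_cell[OF c])
  have cp: "(\<lambda>_. c) \<in> plans" using c by simp
  \<comment> \<open>a strictly positive bound, to divide by\<close>
  define B' where "B' = max B 1"
  have B': "0 < B'" "\<G> \<subseteq> bfun B'" using \<G> by (auto simp: B'_def bfun_def max_def intro: order_trans)
  have "(\<lambda>n. B' * tail n) \<longlonglongrightarrow> B' * 0" by (intro tendsto_mult tail_lim tendsto_const)
  then have "\<forall>\<^sub>F n in sequentially. B' * tail n < \<epsilon> / 4"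
    using \<epsilon> by (intro order_tendstoD(2)) auto
  then obtain N where N: "B' * tail N < \<epsilon> / 4" by (auto simp: eventually_sequentially)
  define f where "f g z = of_bool (fst z \<noteq> xb) * (g z / B')" for g :: "'x \<times> 'a \<Rightarrow> real" and z
  have f: "f g \<in> bfun 1" if "g \<in> bfun B'" for g
    unfolding f_def[abs_def]
  proof (rule bfun_live)
    show "(\<lambda>z. g z / B') \<in> bfun 1" using that B'(1) by (auto simp: bfun_def)
  qed
  have f0: "f g (xb, a) = 0" for g a by (simp add: f_def)
  define err where "err n \<omega> g j = \<bar>C.I n \<omega> j (\<lambda>x. f g (x, C.\<phi> n \<omega> x)) - (\<integral>x. avg c (f g) x \<partial>law (\<lambda>_. c) j)\<bar>" for n \<omega> g j
  have "\<forall>j. \<exists>d. d \<longlonglongrightarrow> 0 \<and> (\<forall>n. \<forall>g\<in>bfun B'. (\<integral>\<omega>. err n \<omega> g j \<partial>C.\<Omega> n) \<le> d n)"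
    using purify_term[OF c] f f0 unfolding err_def by meson
  then obtain d where d: "\<And>j. d j \<longlonglongrightarrow> 0" and dle: "\<And>j n g. g \<in> bfun B' \<Longrightarrow> (\<integral>\<omega>. err n \<omega> g j \<partial>C.\<Omega> n) \<le> d j n"
    by metis
  have "(\<lambda>n. \<Sum>g\<in>\<G>. \<Sum>j<N. d j n) \<longlonglongrightarrow> (\<Sum>g\<in>\<G>. \<Sum>j<N. 0)" by (intro tendsto_sum d)
  then have "(\<lambda>n. \<Sum>g\<in>\<G>. \<Sum>j<N. d j n) \<longlonglongrightarrow> 0" by simp
  then have "\<forall>\<^sub>F n in sequentially. (\<Sum>g\<in>\<G>. \<Sum>j<N. d j n) < \<epsilon> / (4 * B')"
    using \<epsilon> B' by (intro order_tendstoD(2)) auto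
  then obtain n where n: "(\<Sum>g\<in>\<G>. \<Sum>j<N. d j n) < \<epsilon> / (4 * B')" by (auto simp: eventually_sequentially)
  have err_int: "integrable (C.\<Omega> n) (\<lambda>\<omega>. err n \<omega> g j)" if g: "g \<in> bfun B'" for g j
  proof -
    have "(\<lambda>z. f g (snd z, C.\<phi> n (fst z) (snd z))) \<in> borel_measurable (C.\<Omega> n \<Otimes>\<^sub>M X)"
      using bfun_measurable[OF f[OF g]] C.\<phi>_joint[of n] by measurable
    then have m: "(\<lambda>\<omega>. C.I n \<omega> j (\<lambda>x. f g (x, C.\<phi> n \<omega> x))) \<in> borel_measurable (C.\<Omega> n)"
      by (rule C.measurable_I)
    have "(\<lambda>x. f g (x, C.\<phi> n \<omega> x)) \<in> C.bh 1" for \<omega>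
    proof -
      have "(\<lambda>x. f g (x, C.\<phi> n \<omega> x)) \<in> borel_measurable X"
        using bfun_measurable[OF f[OF g]] C.\<phi>_measurable[of n \<omega>] by measurable
      then show ?thesis
        using bfun_bound[OF f[OF g]] f0 Act_space[OF _ C.\<phi>_Act] by (auto simp: C.bh_def)
    qed
    then have "\<bar>C.I n \<omega> j (\<lambda>x. f g (x, C.\<phi> n \<omega> x))\<bar> \<le> 1" for \<omega> by (rule C.I_bound)
    then have "integrable (C.\<Omega> n) (\<lambda>\<omega>. C.I n \<omega> j (\<lambda>x. f g (x, C.\<phi> n \<omega> x)))"
      using m by (intro C.W.integrable_const_bound[where B=1]) auto
    then show ?thesis unfolding err_def by auto
  qed
  have "\<exists>\<omega>. (\<Sum>g\<in>\<G>. \<Sum>j<N. err n \<omega> g j) < \<epsilon> / (4 * B')"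
  proof (rule ccontr)
    assume "\<not> ?thesis"
    then have "\<epsilon> / (4 * B') \<le> (\<Sum>g\<in>\<G>. \<Sum>j<N. err n \<omega> g j)" for \<omega> by (simp add: not_less)
    then have "(\<integral>\<omega>. \<epsilon> / (4 * B') \<partial>C.\<Omega> n) \<le> (\<integral>\<omega>. (\<Sum>g\<in>\<G>. \<Sum>j<N. err n \<omega> g j) \<partial>C.\<Omega> n)"
      using B' err_int by (intro integral_mono Bochner_Integration.integrable_sum) auto
    also have "\<dots> = (\<Sum>g\<in>\<G>. \<Sum>j<N. \<integral>\<omega>. err n \<omega> g j \<partial>C.\<Omega> n)"
      using B' err_int by (subst Bochner_Integration.integral_sum) (auto intro!: sum.cong Bochner_Integration.integral_sum)
    also have "\<dots> \<le> (\<Sum>g\<in>\<G>. \<Sum>j<N. d j n)" using B' by (intro sum_mono dle) auto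
    finally show False using n by (simp add: C.W.prob_space)
  qed
  then obtain \<omega> where \<omega>: "(\<Sum>g\<in>\<G>. \<Sum>j<N. err n \<omega> g j) < \<epsilon> / (4 * B')" by blast
  define \<phi> where "\<phi> = C.\<phi> n \<omega>"
  have \<phi>: "\<phi> \<in> selectors" unfolding \<phi>_def by (rule C.\<phi>_selector)
  have \<phi>p: "(\<lambda>_. pure \<phi>) \<in> plans" using pure_control[OF \<phi>] by simp
  have "\<bar>val (\<lambda>_. pure \<phi>) g - val (\<lambda>_. c) g\<bar> < \<epsilon>" if g\<G>: "g \<in> \<G>" for g
  proof -
    have g: "g \<in> bfun B'" using g\<G> B' by auto
    have r1: "rew (\<lambda>_. pure \<phi>) g j = B' * C.I n \<omega> j (\<lambda>x. f g (x, C.\<phi> n \<omega> x))" for j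
    proof -
      have "rew (\<lambda>_. pure \<phi>) g j = (\<integral>x. B' * f g (x, C.\<phi> n \<omega> x) \<partial>law (\<lambda>_. pure \<phi>) j)"
        unfolding rew_step[OF \<phi>p g] using B'(1) unif.prob_space
        by (intro Bochner_Integration.integral_cong refl) (auto simp: f_def \<phi>_def indicator_def)
      then show ?thesis by (simp add: C.I_def C.m_law \<phi>_def)
    qed
    have r2: "rew (\<lambda>_. c) g j = B' * (\<integral>x. avg c (f g) x \<partial>law (\<lambda>_. c) j)" for j
    proof -
      have "rew (\<lambda>_. c) g j = (\<integral>x. B' * avg c (f g) x \<partial>law (\<lambda>_. c) j)"
        unfolding rew_step[OF cp g] avg_def using B'(1)
        by (intro Bochner_Integration.integral_cong refl) (auto simp: f_def indicator_def)
      then show ?thesis by simp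
    qed
    have "\<bar>(\<Sum>j<N. rew (\<lambda>_. pure \<phi>) g j) - (\<Sum>j<N. rew (\<lambda>_. c) g j)\<bar> = \<bar>\<Sum>j<N. B' * (C.I n \<omega> j (\<lambda>x. f g (x, C.\<phi> n \<omega> x)) - (\<integral>x. avg c (f g) x \<partial>law (\<lambda>_. c) j))\<bar>"
      by (simp add: sum_subtractf[symmetric] r1 r2 right_diff_distrib)
    also have "\<dots> \<le> (\<Sum>j<N. B' * err n \<omega> g j)"
      using B'(1) by (intro order_trans[OF sum_abs] sum_mono) (simp add: err_def abs_mult)
    also have "\<dots> = B' * (\<Sum>j<N. err n \<omega> g j)" by (simp add: sum_distrib_left)
    also have "\<dots> \<le> B' * (\<Sum>g\<in>\<G>. \<Sum>j<N. err n \<omega> g j)"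
      using B'(1) \<G> g\<G> by (intro mult_left_mono member_le_sum[of g \<G> "\<lambda>g. \<Sum>j<N. err n \<omega> g j"]) (auto simp: err_def intro!: sum_nonneg)
    also have "\<dots> < \<epsilon> / 4" using \<omega> B'(1) by (simp add: field_simps)
    finally have "\<bar>(\<Sum>j<N. rew (\<lambda>_. pure \<phi>) g j) - (\<Sum>j<N. rew (\<lambda>_. c) g j)\<bar> < \<epsilon> / 4" .
    then show ?thesis
      using val_tail[OF \<phi>p g, of N] val_tail[OF cp g, of N] N by linarith
  qed
  moreover have "\<forall>x\<in>space X. \<exists>u. \<phi> x = c (x, u)" by (auto simp: \<phi>_def C.\<phi>_def)
  ultimately show ?thesis using \<phi> by blast
qed

end

section \<open>Limits of selectors that change less and less\<close>

context control_base begin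

text \<open>Equality of two measurable maps is a measurable condition because points of \<open>A\<close> are
  coded injectively by reals.\<close>

lemma sets_eq_maps:
  assumes "f \<in> M \<rightarrow>\<^sub>M A" "g \<in> M \<rightarrow>\<^sub>M A"
  shows "Measurable.pred M (\<lambda>x. f x = g x)"
proof -
  obtain e d where [measurable]: "e \<in> A \<rightarrow>\<^sub>M (borel :: real measure)" "d \<in> borel \<rightarrow>\<^sub>M A"
    and de: "\<And>a. a \<in> space A \<Longrightarrow> d (e a) = a"
    by (rule real_retractE[OF A_retract that])
  have [measurable]: "f \<in> M \<rightarrow>\<^sub>M A" "g \<in> M \<rightarrow>\<^sub>M A" by fact+
  have "Measurable.pred M (\<lambda>x. e (f x) = e (g x))" by measurable
  moreover have "e (f x) = e (g x) \<longleftrightarrow> f x = g x" if "x \<in> space M" for x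
    using de measurable_space[OF assms(1) that] measurable_space[OF assms(2) that] by metis
  ultimately show ?thesis
    by (subst measurable_cong[where g="\<lambda>x. e (f x) = e (g x)"]) auto
qed

lemma measurable_section_measure:
  assumes "Measurable.pred (N \<Otimes>\<^sub>M borel) P"
  shows "(\<lambda>x. measure unif {u. P (x, u)}) \<in> borel_measurable N"
proof (rule measure_measurable_subprob_algebra2[where N=unif])
  have "(SIGMA x:space N. {u. P (x, u)}) = {z \<in> space (N \<Otimes>\<^sub>M borel). P z}" by (auto simp: space_pair_measure)
  also have "\<dots> \<in> sets (N \<Otimes>\<^sub>M borel)" using assms by (simp add: pred_def)
  also have "sets (N \<Otimes>\<^sub>M borel) = sets (N \<Otimes>\<^sub>M unif)" by (rule sets_pair_measure_cong) simp_all
  finally show "(SIGMA x:space N. {u. P (x, u)}) \<in> sets (N \<Otimes>\<^sub>M unif)" .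
  show "(\<lambda>_. unif) \<in> N \<rightarrow>\<^sub>M subprob_algebra unif" by (simp add: unif.M_in_subprob)
qed

lemma measurable_section:
  assumes "Measurable.pred (N \<Otimes>\<^sub>M borel) P" "x \<in> space N"
  shows "{u. P (x, u)} \<in> sets unif"
proof -
  have "{u. P (x, u)} = Pair x -` {z \<in> space (N \<Otimes>\<^sub>M borel). P z}" using assms(2) by (auto simp: space_pair_measure)
  also have "\<dots> \<in> sets borel" using assms(1) by (intro sets_Pair1) (simp add: pred_def)
  finally show ?thesis by simp
qed

text \<open>As a reward, this counts how often the action differs from the one prescribed by
  \<open>\<phi>\<close>.\<close>

definition mismatch :: "('x \<Rightarrow> 'a) \<Rightarrow> 'x \<times> 'a \<Rightarrow> real" where
  "mismatch \<phi> z = of_bool (snd z \<noteq> \<phi> (fst z))"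

lemma mismatch_bfun: "\<phi> \<in> selectors \<Longrightarrow> mismatch \<phi> \<in> bfun 1"
proof -
  assume \<phi>: "\<phi> \<in> selectors"
  note [measurable] = selectors_measurable[OF \<phi>]
  have [measurable]: "Measurable.pred (X \<Otimes>\<^sub>M A) (\<lambda>z. snd z = \<phi> (fst z))" by (rule sets_eq_maps) measurable
  show ?thesis unfolding bfun_def mismatch_def[abs_def] by auto
qed

lemma rew_pure:
  assumes \<phi>: "\<phi> \<in> selectors" and g: "g \<in> bfun B"
  shows "rew (\<lambda>_. pure \<phi>) g t = (\<integral>x. of_bool (x \<noteq> xb) * g (x, \<phi> x) \<partial>law (\<lambda>_. pure \<phi>) t)"
proof -
  have p: "(\<lambda>_. pure \<phi>) \<in> plans" using pure_control[OF \<phi>] by simp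
  show ?thesis
    unfolding rew_step[OF p g] using unif.prob_space
    by (intro Bochner_Integration.integral_cong refl) (auto simp: indicator_def)
qed

lemma integral_law_pure_Suc:
  fixes h :: "'x \<Rightarrow> real"
  assumes \<phi>: "\<phi> \<in> selectors" and h: "h \<in> borel_measurable X" "\<And>y. y \<in> space X \<Longrightarrow> \<bar>h y\<bar> \<le> B"
  shows "(\<integral>x. h x \<partial>law (\<lambda>_. pure \<phi>) (Suc t)) = (\<integral>x. \<integral>y. h y \<partial>p (x, \<phi> x) \<partial>law (\<lambda>_. pure \<phi>) t)"
proof -
  have p: "(\<lambda>_. pure \<phi>) \<in> plans" using pure_control[OF \<phi>] by simp
  have "step (pure \<phi>) x = p (x, \<phi> x)" if "x \<in> space X" for x
    using \<phi> that by (intro step_pure) (auto simp: selectors_def intro: Act_space)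
  then have "(\<integral>x. \<integral>y. h y \<partial>step (pure \<phi>) x \<partial>law (\<lambda>_. pure \<phi>) t) = (\<integral>x. \<integral>y. h y \<partial>p (x, \<phi> x) \<partial>law (\<lambda>_. pure \<phi>) t)"
    by (intro Bochner_Integration.integral_cong refl) (simp add: space_law[OF p])
  moreover have "(\<integral>x. h x \<partial>law (\<lambda>_. pure \<phi>) (Suc t)) = (\<integral>x. \<integral>y. h y \<partial>step (pure \<phi>) x \<partial>law (\<lambda>_. pure \<phi>) t)"
    using integral_law_Suc[OF p h(1), of B t] h(2) by simp
  ultimately show ?thesis by simp
qed

end

context control_model begin

text \<open>A Borel-Cantelli argument: the sets where consecutive selectors differ have summable visit
  probabilities, so the sequence is eventually constant in almost every visited state. The laws
  of the limit are compared with those of \<open>\<phi>s n\<close> period by period, with errors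
  of order \<open>2^-n\<close> whose constants depend on the period only.\<close>

lemma selectors_limit:
  assumes \<phi>s: "\<And>n. \<phi>s n \<in> selectors"
    and small: "\<And>n. val (\<lambda>_. pure (\<phi>s (Suc n))) (mismatch (\<phi>s n)) \<le> M * (1 / 2) ^ n"
  shows "\<exists>\<phi>\<in>selectors. \<forall>B. \<forall>g\<in>bfun B. (\<lambda>n. val (\<lambda>_. pure (\<phi>s n)) g) \<longlonglongrightarrow> val (\<lambda>_. pure \<phi>) g"
proof -
  note [measurable] = selectors_measurable[OF \<phi>s]
  have ps: "(\<lambda>_. pure (\<phi>s n)) \<in> plans" for n using pure_control[OF \<phi>s] by simp
  define stable where "stable x N \<longleftrightarrow> (\<forall>n. n \<ge> N \<longrightarrow> \<phi>s n x = \<phi>s N x)" for x N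
  have [measurable]: "Measurable.pred X (\<lambda>x. \<phi>s n x = \<phi>s m x)" for n m by (rule sets_eq_maps) measurable
  have [measurable]: "Measurable.pred X (\<lambda>x. stable x N)" for N unfolding stable_def by measurable
  \<comment> \<open>the default value 0 concerns only states in which the sequence does not settle\<close>
  define Nx where "Nx x = (if \<exists>N. stable x N then LEAST N. stable x N else 0)" for x
  have Nx: "Nx \<in> X \<rightarrow>\<^sub>M count_space UNIV" unfolding Nx_def[abs_def] by measurable
  define \<phi> where "\<phi> x = \<phi>s (Nx x) x" for x
  have \<phi>_meas: "\<phi> \<in> X \<rightarrow>\<^sub>M A"
    unfolding \<phi>_def[abs_def] by (rule measurable_compose_countable[OF _ Nx]) measurable
  have \<phi>: "\<phi> \<in> selectors"
    using \<phi>_meas \<phi>s by (auto simp: selectors_def \<phi>_def)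
  note [measurable] = \<phi>_meas
  have p: "(\<lambda>_. pure \<phi>) \<in> plans" using pure_control[OF \<phi>] by simp
  have diff: "\<exists>k\<ge>n. \<phi>s (Suc k) x \<noteq> \<phi>s k x" if ne: "\<phi> x \<noteq> \<phi>s n x" for x n
  proof (rule ccontr)
    assume "\<not> ?thesis"
    then have eq: "\<And>k. n \<le> k \<Longrightarrow> \<phi>s (Suc k) x = \<phi>s k x" by auto
    have "\<phi>s m x = \<phi>s n x" if "n \<le> m" for m using that
    proof (induction m rule: dec_induct)
      case (step m)
      then show ?case using eq[of m] by simp
    qed simp
    then have st: "stable x n" unfolding stable_def by blast
    then have Nx_eq: "Nx x = (LEAST N. stable x N)" unfolding Nx_def by (subst if_P) (rule exI, assumption, rule refl)
    have "stable x (Nx x)" unfolding Nx_eq using st by (rule LeastI)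
    moreover have "Nx x \<le> n" unfolding Nx_eq using st by (rule Least_le)
    ultimately have "\<phi>s n x = \<phi> x" unfolding stable_def \<phi>_def by blast
    then show False using ne by simp
  qed
  define L where "L n t = law (\<lambda>_. pure (\<phi>s n)) t" for n t
  define L' where "L' t = law (\<lambda>_. pure \<phi>) t" for t
  have prL: "prob_space (L n t)" and sL[measurable_cong]: "sets (L n t) = sets X" and spL: "space (L n t) = space X" for n t
    unfolding L_def by (rule law_prob_space[OF ps], rule sets_law[OF ps], rule space_law[OF ps])
  have prL': "prob_space (L' t)" and sL'[measurable_cong]: "sets (L' t) = sets X" and spL': "space (L' t) = space X" for t
    unfolding L'_def by (rule law_prob_space[OF p], rule sets_law[OF p], rule space_law[OF p])
  define Bk where "Bk k = {x\<in>live. \<phi>s (Suc k) x \<noteq> \<phi>s k x}" for k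
  have Bk[measurable]: "Bk k \<in> sets X" for k unfolding Bk_def by measurable
  have val_Bk: "measure (L (Suc k) t) (Bk k) \<le> M * (1 / 2) ^ k" for k t
  proof -
    have r0: "0 \<le> rew (\<lambda>_. pure (\<phi>s (Suc k))) (mismatch (\<phi>s k)) i" for i
      unfolding rew_def by (intro integral_nonneg_AE AE_I2) (auto simp: mismatch_def)
    have "measure (L (Suc k) t) (Bk k) = measure (L (Suc k) t) (Bk k \<inter> space (L (Suc k) t))"
      using sets.sets_into_space[OF Bk] by (simp add: spL Int_absorb2)
    also have "\<dots> = (\<integral>x. indicator (Bk k) x \<partial>L (Suc k) t)" by simp
    also have "\<dots> = rew (\<lambda>_. pure (\<phi>s (Suc k))) (mismatch (\<phi>s k)) t"
      unfolding rew_pure[OF \<phi>s mismatch_bfun[OF \<phi>s]] L_def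
      by (intro Bochner_Integration.integral_cong refl) (auto simp: indicator_def Bk_def mismatch_def space_law[OF ps])
    also have "\<dots> \<le> val (\<lambda>_. pure (\<phi>s (Suc k))) (mismatch (\<phi>s k))"
      unfolding val_def using sum_le_suminf[OF summable_rew[OF ps mismatch_bfun[OF \<phi>s]], of "{t}" "Suc k" k] r0 by auto
    finally show ?thesis using small[of k] by linarith
  qed
  have M0: "0 \<le> M" using order_trans[OF measure_nonneg val_Bk[of 0 0]] by simp
  define Dn where "Dn n = {x\<in>live. \<phi> x \<noteq> \<phi>s n x}" for n
  have [measurable]: "Measurable.pred X (\<lambda>x. \<phi> x = \<phi>s n x)" for n by (rule sets_eq_maps) measurable
  have Dn[measurable]: "Dn n \<in> sets X" for n unfolding Dn_def by measurable
  \<comment> \<open>an exponential rate of convergence at time \<open>t\<close>, in total variation outside \<open>xb\<close>\<close>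
  define good where "good t C \<longleftrightarrow> 0 \<le> C \<and> (\<forall>n. \<forall>h :: 'x \<Rightarrow> real. h \<in> borel_measurable X \<longrightarrow> h xb = 0 \<longrightarrow> (\<forall>x\<in>space X. \<bar>h x\<bar> \<le> 1) \<longrightarrow>
     \<bar>(\<integral>x. h x \<partial>L' t) - (\<integral>x. h x \<partial>L n t)\<bar> \<le> C * (1 / 2) ^ n)" for t and C :: real
  have goodD: "\<bar>(\<integral>x. h x \<partial>L' t) - (\<integral>x. h x \<partial>L n t)\<bar> \<le> C * (1 / 2) ^ n"
    if "good t C" "h \<in> borel_measurable X" "h xb = 0" "\<And>x. x \<in> space X \<Longrightarrow> \<bar>h x\<bar> \<le> 1"
    for t C n and h :: "'x \<Rightarrow> real"
    using that unfolding good_def by blast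
  have Dn_small: "measure (L' t) (Dn n) \<le> 2 * (M + C) * (1 / 2) ^ n" if C: "good t C" for t C n
  proof -
    interpret P: prob_space "L' t" by (rule prL')
    have le: "measure (L' t) (Bk k) \<le> (M + C) * (1 / 2) ^ k" for k
    proof -
      have "\<bar>(\<integral>x. indicator (Bk k) x \<partial>L' t) - (\<integral>x. indicator (Bk k) x \<partial>L (Suc k) t)\<bar> \<le> C * (1 / 2) ^ Suc k"
        by (rule goodD[OF C]) (auto simp: Bk_def indicator_def)
      also have "\<dots> \<le> C * (1 / 2) ^ k" using C by (auto simp: good_def intro!: mult_left_mono power_decreasing)
      finally have "\<bar>measure (L' t) (Bk k) - measure (L (Suc k) t) (Bk k)\<bar> \<le> C * (1 / 2) ^ k"
        using sets.sets_into_space[OF Bk] by (simp add: spL spL' Int_absorb2)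
      then show ?thesis using val_Bk[of k t] by (simp add: distrib_right)
    qed
    have sm: "summable (\<lambda>k. (M + C) * (1 / 2) ^ (k + n))"
      by (intro summable_mult summable_ignore_initial_segment summable_geometric) simp
    have sB: "summable (\<lambda>k. measure (L' t) (Bk (k + n)))"
      by (rule summable_comparison_test'[OF sm, of 0]) (use le in auto)
    have "Dn n \<subseteq> (\<Union>k. Bk (k + n))"
    proof
      fix x assume x: "x \<in> Dn n"
      then obtain k where "k \<ge> n" "\<phi>s (Suc k) x \<noteq> \<phi>s k x" using diff[of x n] by (auto simp: Dn_def)
      then show "x \<in> (\<Union>k. Bk (k + n))" using x by (auto simp: Dn_def Bk_def intro!: exI[of _ "k - n"])
    qed
    then have "measure (L' t) (Dn n) \<le> measure (L' t) (\<Union>k. Bk (k + n))"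
      by (intro P.finite_measure_mono) (auto simp: sL')
    also have "\<dots> \<le> (\<Sum>k. measure (L' t) (Bk (k + n)))"
      by (rule P.finite_measure_subadditive_countably[OF _ sB]) (auto simp: sL')
    also have "\<dots> \<le> (\<Sum>k. (M + C) * (1 / 2) ^ (k + n))"
      by (intro suminf_le le sB sm)
    also have "\<dots> = (\<Sum>k. ((M + C) * (1 / 2) ^ n) * (1 / 2) ^ k)"
      by (simp add: power_add mult_ac)
    also have "\<dots> = 2 * (M + C) * (1 / 2) ^ n"
      using suminf_mult[OF summable_geometric[of "1/2::real"], of "(M + C) * (1 / 2) ^ n"] suminf_geometric[of "1/2::real"]
      by (simp add: mult_ac)
    finally show ?thesis .
  qed
  have close: "\<bar>(\<integral>x. f1 x \<partial>L' t) - (\<integral>x. f2 x \<partial>L n t)\<bar> \<le> (4 * B * (M + C) + B * C) * (1 / 2) ^ n"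
    if C: "good t C" and B: "0 \<le> B"
    and f[measurable]: "f1 \<in> borel_measurable X" "f2 \<in> borel_measurable X" "f2 xb = 0"
    and bd: "\<And>x. x \<in> space X \<Longrightarrow> \<bar>f1 x\<bar> \<le> B" "\<And>x. x \<in> space X \<Longrightarrow> \<bar>f2 x\<bar> \<le> B"
    and eq: "\<And>x. x \<in> space X \<Longrightarrow> x \<notin> Dn n \<Longrightarrow> f1 x = f2 x" for t C B f1 f2 n
  proof -
    interpret P: prob_space "L' t" by (rule prL')
    have i: "integrable (L' t) f1" "integrable (L' t) f2"
      using bd by (intro P.integrable_const_bound[where B=B]; auto simp: spL')+
    have "\<bar>(\<integral>x. f1 x \<partial>L' t) - (\<integral>x. f2 x \<partial>L' t)\<bar> = \<bar>\<integral>x. f1 x - f2 x \<partial>L' t\<bar>" using i by simp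
    also have "\<dots> \<le> (\<integral>x. \<bar>f1 x - f2 x\<bar> \<partial>L' t)" by (rule integral_abs_bound)
    also have "\<dots> \<le> (\<integral>x. 2 * B * indicator (Dn n) x \<partial>L' t)"
    proof (rule integral_mono)
      show "integrable (L' t) (\<lambda>x. \<bar>f1 x - f2 x\<bar>)" using i by auto
      show "integrable (L' t) (\<lambda>x. 2 * B * indicator (Dn n) x)"
        using B by (intro P.integrable_const_bound[where B="2 * B"]) (auto simp: indicator_def)
      show "\<bar>f1 x - f2 x\<bar> \<le> 2 * B * indicator (Dn n) x" if "x \<in> space (L' t)" for x
        using that bd[of x] eq[of x] by (auto simp: spL' indicator_def)
    qed
    also have "\<dots> = 2 * B * measure (L' t) (Dn n)"
      using sets.sets_into_space[OF Dn] by (simp add: spL' Int_absorb2)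
    also have "\<dots> \<le> 2 * B * (2 * (M + C) * (1 / 2) ^ n)" using B by (intro mult_left_mono Dn_small[OF C]) auto
    finally have 1: "\<bar>(\<integral>x. f1 x \<partial>L' t) - (\<integral>x. f2 x \<partial>L' t)\<bar> \<le> 2 * B * (2 * (M + C) * (1 / 2) ^ n)" .
    have 2: "\<bar>(\<integral>x. f2 x \<partial>L' t) - (\<integral>x. f2 x \<partial>L n t)\<bar> \<le> B * (C * (1 / 2) ^ n)"
    proof (cases "B = 0")
      case True
      have "(\<integral>x. f2 x \<partial>L' t) = (\<integral>x. 0 \<partial>L' t)" "(\<integral>x. f2 x \<partial>L n t) = (\<integral>x. 0 \<partial>L n t)"
        by (intro Bochner_Integration.integral_cong refl; use bd(2) True in \<open>auto simp: spL spL'\<close>)+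
      then show ?thesis using True by simp
    next
      case False
      then have "0 < B" using B by simp
      have "\<bar>(\<integral>x. f2 x / B \<partial>L' t) - (\<integral>x. f2 x / B \<partial>L n t)\<bar> \<le> C * (1 / 2) ^ n"
        using f(3) bd(2) \<open>0 < B\<close> by (intro goodD[OF C]) (auto simp: divide_le_eq)
      then have "\<bar>(\<integral>x. f2 x \<partial>L' t) - (\<integral>x. f2 x \<partial>L n t)\<bar> / B \<le> C * (1 / 2) ^ n"
        using \<open>0 < B\<close> by (simp add: diff_divide_distrib[symmetric])
      then show ?thesis using \<open>0 < B\<close> by (simp add: divide_le_eq mult.commute)
    qed
    have "\<bar>(\<integral>x. f1 x \<partial>L' t) - (\<integral>x. f2 x \<partial>L n t)\<bar> \<le> 2 * B * (2 * (M + C) * (1 / 2) ^ n) + B * (C * (1 / 2) ^ n)"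
      using 1 2 by linarith
    also have "\<dots> = (4 * B * (M + C) + B * C) * (1 / 2) ^ n" by (simp add: algebra_simps)
    finally show ?thesis .
  qed
  have "\<exists>C. good t C" for t
  proof (induction t)
    case 0
    show ?case by (intro exI[of _ 0]) (auto simp: good_def L_def L'_def)
  next
    case (Suc t)
    then obtain C where C: "good t C" by blast
    have C0: "0 \<le> C" using C by (simp add: good_def)
    have "good (Suc t) (4 * 1 * (M + C) + 1 * C)"
      unfolding good_def
    proof (intro conjI allI impI)
      show "0 \<le> 4 * 1 * (M + C) + 1 * C" using M0 C0 by simp
      fix n and h :: "'x \<Rightarrow> real"
      assume h[measurable]: "h \<in> borel_measurable X" and h0: "h xb = 0" and h1: "\<forall>x\<in>space X. \<bar>h x\<bar> \<le> 1"
      have pp: "p (x, a) \<in> space (prob_algebra X)" if "x \<in> space X" "a \<in> Act x" for x a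
        using that by (intro p_prob) (auto intro: Act_space)
      have bd: "\<bar>\<integral>y. h y \<partial>p (x, a)\<bar> \<le> 1" if "x \<in> space X" "a \<in> Act x" for x a
        using pp[OF that] h1 by (intro integral_bound) (auto simp: space_prob_algebra dest: sets_eq_imp_space_eq)
      have p0: "(\<integral>y. h y \<partial>p (xb, a)) = 0" if "a \<in> Act xb" for a
        by (rule integral_eq_zero_AE) (use AE_p_xb[OF that] h0 in \<open>auto elim!: eventually_mono\<close>)
      have act: "\<phi> x \<in> Act x" "\<phi>s n x \<in> Act x" if "x \<in> space X" for x
        using \<phi> \<phi>s that by (auto simp: selectors_def)
      have "\<bar>(\<integral>x. \<integral>y. h y \<partial>p (x, \<phi> x) \<partial>L' t) - (\<integral>x. \<integral>y. h y \<partial>p (x, \<phi>s n x) \<partial>L n t)\<bar>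
          \<le> (4 * 1 * (M + C) + 1 * C) * (1 / 2) ^ n"
      proof (rule close[OF C])
        show "(\<lambda>x. \<integral>y. h y \<partial>p (x, \<phi> x)) \<in> borel_measurable X"
          using measurable_compose[OF _ measurable_integral_p[OF h], of "\<lambda>x. (x, \<phi> x)" X] by simp
        show "(\<lambda>x. \<integral>y. h y \<partial>p (x, \<phi>s n x)) \<in> borel_measurable X"
          using measurable_compose[OF _ measurable_integral_p[OF h], of "\<lambda>x. (x, \<phi>s n x)" X] by simp
        show "(\<integral>y. h y \<partial>p (x, \<phi> x)) = (\<integral>y. h y \<partial>p (x, \<phi>s n x))" if "x \<in> space X" "x \<notin> Dn n" for x
          using that p0 act by (cases "x = xb") (auto simp: Dn_def)
      qed (use bd act p0 in auto)
      then show "\<bar>(\<integral>x. h x \<partial>L' (Suc t)) - (\<integral>x. h x \<partial>L n (Suc t))\<bar> \<le> (4 * 1 * (M + C) + 1 * C) * (1 / 2) ^ n"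
        unfolding L_def L'_def using h1
        by (subst (1 2) integral_law_pure_Suc[where B=1]) (auto simp: \<phi> \<phi>s)
    qed
    then show ?case by blast
  qed
  then obtain C where C: "\<And>t. good t (C t)" by metis
  have "(\<lambda>n. val (\<lambda>_. pure (\<phi>s n)) g) \<longlonglongrightarrow> val (\<lambda>_. pure \<phi>) g" if g: "g \<in> bfun B" for g B
  proof (rule val_tendsto[OF ps p g])
    fix t
    note [measurable] = bfun_measurable[OF g]
    have B0: "0 \<le> B" by (rule bfun_nonneg[OF g])
    define K where "K = 4 * B * (M + C t) + B * C t"
    have [measurable]: "(\<lambda>x. of_bool (x \<noteq> xb) :: real) \<in> borel_measurable X"
    proof -
      have "(\<lambda>x. of_bool (x \<noteq> xb) :: real) \<in> borel_measurable X \<longleftrightarrow> (indicator live :: _ \<Rightarrow> real) \<in> borel_measurable X"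
        by (intro measurable_cong) (auto simp: indicator_def)
      then show ?thesis by simp
    qed
    have bd: "\<bar>of_bool (x \<noteq> xb) * g (x, \<psi> x)\<bar> \<le> B" if "x \<in> space X" "\<psi> \<in> selectors" for x \<psi>
    proof -
      have "\<psi> x \<in> space A" using that by (auto simp: selectors_def intro: Act_space)
      then show ?thesis using bfun_bound[OF g that(1)] B0 by auto
    qed
    have le: "\<bar>rew (\<lambda>_. pure \<phi>) g t - rew (\<lambda>_. pure (\<phi>s n)) g t\<bar> \<le> K * (1 / 2) ^ n" for n
      unfolding rew_pure[OF \<phi> g] rew_pure[OF \<phi>s g] K_def L_def[symmetric] L'_def[symmetric]
    proof (rule close[OF C B0])
      show "(\<lambda>x. of_bool (x \<noteq> xb) * g (x, \<phi> x)) \<in> borel_measurable X"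
        "(\<lambda>x. of_bool (x \<noteq> xb) * g (x, \<phi>s n x)) \<in> borel_measurable X" by measurable
      show "of_bool (x \<noteq> xb) * g (x, \<phi> x) = of_bool (x \<noteq> xb) * g (x, \<phi>s n x)" if "x \<in> space X" "x \<notin> Dn n" for x
        using that by (cases "x = xb") (auto simp: Dn_def)
    qed (use bd \<phi> \<phi>s in auto)
    have "(\<lambda>n. K * (1 / 2) ^ n) \<longlonglongrightarrow> K * 0" by (intro tendsto_mult tendsto_const LIMSEQ_power_zero) simp
    then have lim: "(\<lambda>n. K * (1 / 2) ^ n) \<longlonglongrightarrow> 0" by simp
    have "\<forall>\<^sub>F n in sequentially. norm (rew (\<lambda>_. pure (\<phi>s n)) g t - rew (\<lambda>_. pure \<phi>) g t) \<le> K * (1 / 2) ^ n"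
      using le by (intro always_eventually allI) (simp add: abs_minus_commute)
    from Lim_null_comparison[OF this lim]
    have "(\<lambda>n. rew (\<lambda>_. pure (\<phi>s n)) g t - rew (\<lambda>_. pure \<phi>) g t) \<longlonglongrightarrow> 0" .
    then show "(\<lambda>n. rew (\<lambda>_. pure (\<phi>s n)) g t) \<longlonglongrightarrow> rew (\<lambda>_. pure \<phi>) g t"
      by (rule LIM_zero_cancel)
  qed
  then show ?thesis using \<phi> by blast
qed

end

section \<open>Flows relative to an atomic control\<close>

lemma nn_integral_density_mix:
  fixes F1 F2 :: "'b \<Rightarrow> real"
  assumes [measurable_cong]: "sets R = sets M"
    and [measurable]: "F1 \<in> borel_measurable M" "F2 \<in> borel_measurable M" "f \<in> borel_measurable M"
    and pos: "\<And>z. 0 \<le> F1 z" "\<And>z. 0 \<le> F2 z" and ab: "0 \<le> a" "0 \<le> b"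
  shows "(\<integral>\<^sup>+z. f z \<partial>density R (\<lambda>z. ennreal (a * F1 z + b * F2 z))) =
      ennreal a * (\<integral>\<^sup>+z. f z \<partial>density R (\<lambda>z. ennreal (F1 z))) + ennreal b * (\<integral>\<^sup>+z. f z \<partial>density R (\<lambda>z. ennreal (F2 z)))"
proof -
  have "(\<integral>\<^sup>+z. f z \<partial>density R (\<lambda>z. ennreal (a * F1 z + b * F2 z))) = (\<integral>\<^sup>+z. ennreal (a * F1 z + b * F2 z) * f z \<partial>R)"
    by (rule nn_integral_density) measurable
  also have "\<dots> = (\<integral>\<^sup>+z. ennreal a * (ennreal (F1 z) * f z) + ennreal b * (ennreal (F2 z) * f z) \<partial>R)"
    using ab pos by (intro nn_integral_cong) (simp add: ennreal_plus ennreal_mult distrib_right mult.assoc)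
  also have "\<dots> = ennreal a * (\<integral>\<^sup>+z. ennreal (F1 z) * f z \<partial>R) + ennreal b * (\<integral>\<^sup>+z. ennreal (F2 z) * f z \<partial>R)"
    by (subst nn_integral_add) (auto simp: nn_integral_cmult)
  also have "(\<integral>\<^sup>+z. ennreal (F1 z) * f z \<partial>R) = (\<integral>\<^sup>+z. f z \<partial>density R (\<lambda>z. ennreal (F1 z)))"
    by (rule nn_integral_density[symmetric]) measurable
  also have "(\<integral>\<^sup>+z. ennreal (F2 z) * f z \<partial>R) = (\<integral>\<^sup>+z. f z \<partial>density R (\<lambda>z. ennreal (F2 z)))"
    by (rule nn_integral_density[symmetric]) measurable
  finally show ?thesis .
qed

context control_model begin

lemma transient_absolutely_continuous:
  assumes "transient q" "absolutely_continuous q q'" "sets q' = sets q"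
  shows "transient q'"
  using assms absolutely_continuous_AE[of q' q] unfolding transient_def by auto

lemma balanced_mix:
  fixes F1 F2 :: "'x \<times> 'a \<Rightarrow> real"
  assumes sets_R[measurable_cong]: "sets R = sets (X \<Otimes>\<^sub>M A)"
    and F[measurable]: "F1 \<in> borel_measurable (X \<Otimes>\<^sub>M A)" "F2 \<in> borel_measurable (X \<Otimes>\<^sub>M A)"
    and pos: "\<And>z. 0 \<le> F1 z" "\<And>z. 0 \<le> F2 z"
    and bal: "balanced (density R (\<lambda>z. ennreal (F1 z)))" "balanced (density R (\<lambda>z. ennreal (F2 z)))"
    and ab: "0 \<le> a" "0 \<le> b" "a + b = 1"
  shows "balanced (density R (\<lambda>z. ennreal (a * F1 z + b * F2 z)))"
  unfolding balanced_def
proof (intro ballI impI)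
  fix h :: "'x \<Rightarrow> ennreal" assume h[measurable]: "h \<in> borel_measurable X" and h0: "h xb = 0" and h1: "\<forall>x\<in>space X. h x \<le> 1"
  note dens = nn_integral_density_mix[OF sets_R F _ pos ab(1,2)]
  have m1: "(\<lambda>z. h (fst z)) \<in> borel_measurable (X \<Otimes>\<^sub>M A)" by measurable
  have m2: "(\<lambda>z. \<integral>\<^sup>+y. h y \<partial>p z) \<in> borel_measurable (X \<Otimes>\<^sub>M A)" by (rule measurable_nn_integral_p[OF h])
  have b: "(\<integral>\<^sup>+z. h (fst z) \<partial>density R (\<lambda>z. ennreal (F z))) = (\<integral>\<^sup>+x. h x \<partial>\<mu>) + (\<integral>\<^sup>+z. \<integral>\<^sup>+y. h y \<partial>p z \<partial>density R (\<lambda>z. ennreal (F z)))"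
    if "balanced (density R (\<lambda>z. ennreal (F z)))" for F :: "'x \<times> 'a \<Rightarrow> real"
    using that h h0 h1 by (simp add: balanced_def)
  have ab1: "ennreal a + ennreal b = 1" using ab by (simp add: ennreal_plus[symmetric] del: ennreal_plus)
  show "(\<integral>\<^sup>+z. h (fst z) \<partial>density R (\<lambda>z. ennreal (a * F1 z + b * F2 z))) =
      (\<integral>\<^sup>+x. h x \<partial>\<mu>) + (\<integral>\<^sup>+z. \<integral>\<^sup>+y. h y \<partial>p z \<partial>density R (\<lambda>z. ennreal (a * F1 z + b * F2 z)))"
    unfolding dens[OF m1] dens[OF m2] b[OF bal(1)] b[OF bal(2)] distrib_left
    using arg_cong[OF ab1, of "\<lambda>s. s * (\<integral>\<^sup>+x. h x \<partial>\<mu>)"] by (simp add: distrib_right add_ac)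
qed

text \<open>The balance equation is linear in the density, so it passes from a mixture and one of its two
  parts to the other part. Cancellation needs finite integrals, whence the hypothesis on
  \<open>F1\<close>.\<close>

lemma balanced_unmix:
  fixes F1 F2 :: "'x \<times> 'a \<Rightarrow> real"
  assumes sets_R[measurable_cong]: "sets R = sets (X \<Otimes>\<^sub>M A)"
    and F[measurable]: "F1 \<in> borel_measurable (X \<Otimes>\<^sub>M A)" "F2 \<in> borel_measurable (X \<Otimes>\<^sub>M A)"
    and pos: "\<And>z. 0 \<le> F1 z" "\<And>z. 0 \<le> F2 z" and F1_fin: "(\<integral>\<^sup>+z. ennreal (F1 z) \<partial>R) < \<infinity>"
    and bal: "balanced (density R (\<lambda>z. ennreal (F1 z)))" "balanced (density R (\<lambda>z. ennreal (a * F1 z + b * F2 z)))"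
    and ab: "0 \<le> a" "0 < b" "a + b = 1"
  shows "balanced (density R (\<lambda>z. ennreal (F2 z)))"
  unfolding balanced_def
proof (intro ballI impI)
  fix h :: "'x \<Rightarrow> ennreal" assume h[measurable]: "h \<in> borel_measurable X" and h0: "h xb = 0" and h1: "\<forall>x\<in>space X. h x \<le> 1"
  note dens = nn_integral_density_mix[OF sets_R F _ pos ab(1) less_imp_le[OF ab(2)]]
  have m1: "(\<lambda>z. h (fst z)) \<in> borel_measurable (X \<Otimes>\<^sub>M A)" by measurable
  have m2: "(\<lambda>z. \<integral>\<^sup>+y. h y \<partial>p z) \<in> borel_measurable (X \<Otimes>\<^sub>M A)" by (rule measurable_nn_integral_p[OF h])
  have spR: "space R = space (X \<Otimes>\<^sub>M A)" by (rule sets_eq_imp_space_eq[OF sets_R])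
  define I where "I F f = (\<integral>\<^sup>+z. f z \<partial>density R (\<lambda>z. ennreal (F z)))" for F :: "'x \<times> 'a \<Rightarrow> real" and f :: "'x \<times> 'a \<Rightarrow> ennreal"
  define m where "m = (\<integral>\<^sup>+x. h x \<partial>\<mu>)"
  let ?h = "\<lambda>z. h (fst z)" and ?ph = "\<lambda>z. \<integral>\<^sup>+y. h y \<partial>p z"
  have 1: "I F1 ?h = m + I F1 ?ph" using bal(1) h h0 h1 by (simp add: balanced_def I_def m_def)
  have 2: "I (\<lambda>z. a * F1 z + b * F2 z) ?h = m + I (\<lambda>z. a * F1 z + b * F2 z) ?ph"
    using bal(2) h h0 h1 by (simp add: balanced_def I_def m_def)
  have 3: "I (\<lambda>z. a * F1 z + b * F2 z) f = ennreal a * I F1 f + ennreal b * I F2 f"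
    if "f \<in> borel_measurable (X \<Otimes>\<^sub>M A)" for f
    unfolding I_def by (rule dens[OF that])
  have m_fin: "m \<noteq> \<top>"
  proof -
    interpret prob_space \<mu> using \<mu> by (simp add: space_prob_algebra)
    have "space \<mu> = space X" using \<mu> by (auto simp: space_prob_algebra dest: sets_eq_imp_space_eq)
    then have "m \<le> 1" unfolding m_def using h1 by (intro nn_integral_le_const AE_I2) auto
    then show ?thesis using neq_top_trans[of 1 m] by simp
  qed
  have I_fin: "I F1 ?ph \<noteq> \<top>"
  proof -
    have "I F1 ?ph = (\<integral>\<^sup>+z. ennreal (F1 z) * ?ph z \<partial>R)"
      unfolding I_def using m2 by (intro nn_integral_density) auto
    also have "\<dots> \<le> (\<integral>\<^sup>+z. ennreal (F1 z) * 1 \<partial>R)"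
    proof (intro nn_integral_mono mult_left_mono)
      fix z assume "z \<in> space R"
      then have P: "p z \<in> space (prob_algebra X)" using measurable_space[OF p] by (simp add: spR)
      then interpret P: prob_space "p z" by (simp add: space_prob_algebra)
      have "space (p z) = space X" using P by (auto simp: space_prob_algebra dest: sets_eq_imp_space_eq)
      then show "?ph z \<le> 1" using h1 by (intro P.nn_integral_le_const AE_I2) auto
    qed simp
    also have "\<dots> < \<infinity>" using F1_fin by simp
    finally show ?thesis by simp
  qed
  have m_split: "m = ennreal a * m + ennreal b * m"
    using ab by (simp add: distrib_right[symmetric] ennreal_plus[symmetric] del: ennreal_plus)
  have "ennreal a * m + ennreal a * I F1 ?ph + ennreal b * I F2 ?h =
      ennreal a * m + ennreal b * m + (ennreal a * I F1 ?ph + ennreal b * I F2 ?ph)"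
    using 2 unfolding 3[OF m1] 3[OF m2] 1 m_split[symmetric] by (simp add: distrib_left)
  then have "(ennreal a * m + ennreal a * I F1 ?ph) + ennreal b * I F2 ?h =
      (ennreal a * m + ennreal a * I F1 ?ph) + ennreal b * (m + I F2 ?ph)"
    by (simp add: distrib_left add_ac)
  then have "ennreal b * I F2 ?h = ennreal b * (m + I F2 ?ph)"
    using m_fin I_fin by (subst (asm) ennreal_add_left_cancel) (auto simp: ennreal_mult_eq_top_iff)
  then have "I F2 ?h = m + I F2 ?ph"
    using ab by (subst (asm) ennreal_mult_cancel_left) auto
  then show "(\<integral>\<^sup>+z. h (fst z) \<partial>density R (\<lambda>z. ennreal (F2 z))) =
      (\<integral>\<^sup>+x. h x \<partial>\<mu>) + (\<integral>\<^sup>+z. \<integral>\<^sup>+y. h y \<partial>p z \<partial>density R (\<lambda>z. ennreal (F2 z)))"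
    by (simp add: I_def m_def)
qed

end

text \<open>Every available action has positive probability under \<open>\<sigma>\<close>. This can be
  arranged by declaring all other actions unavailable.\<close>

locale atomic_model = control_model X A Act p \<mu> xb tail
  for X :: "'x measure" and A :: "'a measure" and Act p \<mu> and xb :: 'x and tail +
  fixes \<sigma> :: "'x \<times> real \<Rightarrow> 'a"
  assumes \<sigma>: "\<sigma> \<in> controls"
    and atom: "\<And>x a. x \<in> space X \<Longrightarrow> a \<in> Act x \<Longrightarrow> 0 < measure unif {u. \<sigma> (x, u) = a}"
begin

lemmas \<sigma>_measurable[measurable] = controls_measurable[OF \<sigma>]

lemma \<sigma>_plan: "(\<lambda>_. \<sigma>) \<in> plans" using \<sigma> by simp

definition R :: "('x \<times> 'a) measure" where "R = occ (\<lambda>_. \<sigma>)"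

lemma sets_R[measurable_cong, simp]: "sets R = sets (X \<Otimes>\<^sub>M A)"
  unfolding R_def by (rule sets_occ[OF \<sigma>_plan])

lemma space_R: "space R = space (X \<Otimes>\<^sub>M A)"
  by (rule sets_eq_imp_space_eq[OF sets_R])

sublocale R: finite_measure R
  unfolding R_def by (rule finite_measure_occ[OF \<sigma>_plan])

text \<open>A flow is a density, with respect to the occupation measure \<open>R\<close> of
  \<open>\<sigma>\<close>, that satisfies the balance equation. Flows are exactly the densities
  of occupation measures of stationary controls that are absolutely continuous with respect to
  \<open>R\<close>.\<close>

definition flow :: "('x \<times> 'a \<Rightarrow> real) \<Rightarrow> bool" where
  "flow F \<longleftrightarrow> F \<in> borel_measurable (X \<Otimes>\<^sub>M A) \<and> (\<forall>z. 0 \<le> F z) \<and> integrable R F \<and>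
     balanced (density R (\<lambda>z. ennreal (F z)))"

lemma flowD:
  assumes "flow F"
  shows "F \<in> borel_measurable (X \<Otimes>\<^sub>M A)" "\<And>z. 0 \<le> F z" "integrable R F" "balanced (density R (\<lambda>z. ennreal (F z)))"
  using assms by (auto simp: flow_def)

lemma flow_mix:
  assumes "flow F1" "flow F2" "0 \<le> a" "0 \<le> b" "a + b = 1"
  shows "flow (\<lambda>z. a * F1 z + b * F2 z)"
proof -
  note F1 = flowD[OF assms(1)] and F2 = flowD[OF assms(2)]
  have "balanced (density R (\<lambda>z. ennreal (a * F1 z + b * F2 z)))"
    by (rule balanced_mix[OF sets_R F1(1) F2(1) F1(2) F2(2) F1(4) F2(4) assms(3-5)])
  then show ?thesis
    unfolding flow_def using F1(1-3) F2(1-3) assms(3,4) by auto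
qed

lemma flow_1: "flow (\<lambda>_. 1)"
proof -
  have "density R (\<lambda>_. ennreal 1) = R" by (simp add: density_1)
  then show ?thesis
    unfolding flow_def using balanced_occ[OF \<sigma>_plan] by (simp add: R_def[symmetric])
qed

lemma flow_val_integrable:
  assumes F: "flow F" and g: "g \<in> bfun B"
  shows "integrable R (\<lambda>z. F z * g z)"
proof (rule Bochner_Integration.integrable_bound)
  note [measurable] = flowD(1)[OF F] bfun_measurable[OF g]
  show "integrable R (\<lambda>z. B * F z)" using flowD(3)[OF F] by simp
  show "(\<lambda>z. F z * g z) \<in> borel_measurable R" by measurable
  show "AE z in R. norm (F z * g z) \<le> norm (B * F z)"
  proof (rule AE_I2)
    fix z assume "z \<in> space R"
    then have "\<bar>g z\<bar> \<le> B" using bfun_bound'[OF g] by (simp add: space_R)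
    then have "\<bar>g z\<bar> * F z \<le> B * F z" using flowD(2)[OF F, of z] by (rule mult_right_mono)
    then show "norm (F z * g z) \<le> norm (B * F z)"
      using flowD(2)[OF F, of z] bfun_nonneg[OF g] by (simp add: abs_mult mult.commute)
  qed
qed

text \<open>The measure with density \<open>F\<close> is absolutely continuous with respect to
  \<open>R\<close>, from which it inherits the graph, the absence of \<open>xb\<close> and
  transience.\<close>

lemma realize_flow:
  assumes F: "flow F"
  shows "\<exists>c\<in>controls. occ (\<lambda>_. c) = density R (\<lambda>z. ennreal (F z))"
proof -
  note [measurable] = flowD(1)[OF F]
  let ?D = "density R (\<lambda>z. ennreal (F z))"
  have fin: "finite_measure ?D"
  proof
    have "emeasure ?D (space ?D) = (\<integral>\<^sup>+z. ennreal (F z) \<partial>R)"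
    proof -
      have "emeasure ?D (space R) = (\<integral>\<^sup>+z. ennreal (F z) * indicator (space R) z \<partial>R)"
        by (rule emeasure_density[OF _ sets.top]) measurable
      also have "\<dots> = (\<integral>\<^sup>+z. ennreal (F z) \<partial>R)" by (intro nn_integral_cong) simp
      finally show ?thesis by simp
    qed
    also have "\<dots> = ennreal (\<integral>z. F z \<partial>R)" using flowD[OF F] by (intro nn_integral_eq_integral) auto
    finally show "emeasure ?D (space ?D) \<noteq> \<infinity>" by simp
  qed
  have AE_D: "AE z in ?D. P z" if "AE z in R. P z" for P
    using that by (subst AE_density) (auto elim!: eventually_mono)
  have "transient (distr ?D X fst)"
  proof (rule transient_absolutely_continuous)
    show "transient (distr R X fst)" unfolding R_def by (rule transient_occ[OF \<sigma>_plan])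
    show "absolutely_continuous (distr R X fst) (distr ?D X fst)"
      unfolding absolutely_continuous_def null_sets_def
    proof (clarsimp)
      fix E assume E[measurable]: "E \<in> sets X" and "emeasure (distr R X fst) E = 0"
      then have "emeasure R (fst -` E \<inter> space R) = 0" by (simp add: emeasure_distr)
      moreover have "fst -` E \<inter> space R \<in> sets R" by measurable
      ultimately have "AE z in R. z \<notin> fst -` E \<inter> space R" by (intro AE_not_in) (auto simp: null_sets_def)
      then have "AE z in ?D. z \<notin> fst -` E \<inter> space R" by (rule AE_D)
      then have "emeasure ?D (fst -` E \<inter> space R) = 0"
        using \<open>fst -` E \<inter> space R \<in> sets R\<close>
        by (subst (asm) AE_iff_null_sets[symmetric]) (auto simp: null_sets_def)
      then show "emeasure (distr ?D X fst) E = 0" by (simp add: emeasure_distr)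
    qed
  qed simp
  then have "\<exists>c\<in>controls. act_law X A (distr ?D X fst) c = ?D \<and> occ (\<lambda>_. c) = ?D"
    using AE_occ_graph[OF \<sigma>_plan, folded R_def] flowD(4)[OF F]
    by (intro realize_balanced fin AE_D) auto
  then show ?thesis by blast
qed

lemma val_flow:
  assumes F: "flow F" and c: "c \<in> plans" "occ c = density R (\<lambda>z. ennreal (F z))" and g: "g \<in> bfun B"
  shows "val c g = (\<integral>z. F z * g z \<partial>R)"
proof -
  note [measurable] = flowD(1)[OF F] bfun_measurable[OF g]
  have "val c g = (\<integral>z. g z \<partial>density R (\<lambda>z. ennreal (F z)))"
    by (simp add: val_eq_integral_occ[OF c(1) g] c(2))
  also have "\<dots> = (\<integral>z. F z * g z \<partial>R)"
    using flowD(2)[OF F] by (subst integral_density) auto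
  finally show ?thesis .
qed

lemma flow_mass:
  assumes F: "flow F"
  shows "(\<integral>z. F z \<partial>R) \<le> tail 0"
proof -
  obtain c where c: "c \<in> controls" and oc: "occ (\<lambda>_. c) = density R (\<lambda>z. ennreal (F z))"
    using realize_flow[OF F] by blast
  have cp: "(\<lambda>_. c) \<in> plans" using c by simp
  have one: "(\<lambda>_. 1) \<in> bfun 1" by (simp add: bfun_def)
  have "(\<integral>z. F z \<partial>R) = val (\<lambda>_. c) (\<lambda>_. 1)" using val_flow[OF F cp oc one] by simp
  also have "\<dots> = measure (occ (\<lambda>_. c)) (space (occ (\<lambda>_. c)))"
    unfolding val_eq_integral_occ[OF cp one] by simp
  also have "\<dots> \<le> tail 0" by (rule measure_occ_space[OF cp])
  finally show ?thesis .
qed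

lemma flow_of_dominated:
  assumes c: "c \<in> plans" and dom: "\<And>E. E \<in> sets (X \<Otimes>\<^sub>M A) \<Longrightarrow> emeasure (occ c) E \<le> ennreal K * emeasure R E" and K: "0 \<le> K"
  shows "\<exists>F. flow F \<and> (\<forall>z. F z \<le> K) \<and> occ c = density R (\<lambda>z. ennreal (F z))"
proof -
  have ac: "absolutely_continuous R (occ c)"
    unfolding absolutely_continuous_def null_sets_def using dom sets_occ[OF c] by auto (metis le_zero_eq mult_zero_right)
  define f where "f = RN_deriv R (occ c)"
  have f[measurable]: "f \<in> borel_measurable (X \<Otimes>\<^sub>M A)" unfolding f_def using borel_measurable_RN_deriv[of R "occ c"] by simp
  have df: "density R f = occ c"
    unfolding f_def by (rule R.density_RN_deriv[OF ac]) (simp add: sets_occ[OF c])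
  have fK: "AE z in R. f z \<le> ennreal K"
  proof (rule AE_le_of_nn_integral_le)
    show "(\<integral>\<^sup>+z. ennreal K \<partial>R) \<noteq> \<infinity>" by (simp add: ennreal_mult_eq_top_iff)
    fix E assume E: "E \<in> sets R"
    have "(\<integral>\<^sup>+z. f z * indicator E z \<partial>R) = emeasure (density R f) E"
      using E by (intro emeasure_density[symmetric]) auto
    also have "\<dots> \<le> ennreal K * emeasure R E" unfolding df using dom E by simp
    finally show "(\<integral>\<^sup>+z. f z * indicator E z \<partial>R) \<le> (\<integral>\<^sup>+z. ennreal K * indicator E z \<partial>R)"
      using E by (simp add: nn_integral_cmult_indicator)
  qed auto
  define F where "F z = min (enn2real (f z)) K" for z
  have F: "F \<in> borel_measurable (X \<Otimes>\<^sub>M A)" unfolding F_def[abs_def] by measurable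
  have F0: "0 \<le> F z" "F z \<le> K" for z using K by (auto simp: F_def)
  have "AE z in R. f z = ennreal (F z)"
    using fK
  proof eventually_elim
    case (elim z)
    then show ?case using K by (cases "f z") (auto simp: F_def min_def top_unique)
  qed
  then have dF: "density R (\<lambda>z. ennreal (F z)) = occ c"
    unfolding df[symmetric] using F by (intro density_cong) (auto elim!: eventually_mono)
  have "integrable R F" using F F0 by (intro R.integrable_const_bound[where B=K]) auto
  then have "flow F" unfolding flow_def dF using F F0 balanced_occ[OF c] by auto
  then show ?thesis using F0 dF by auto
qed

definition w :: "('x \<Rightarrow> 'a) \<Rightarrow> 'x \<Rightarrow> real" where
  "w \<phi> x = measure unif {u. \<sigma> (x, u) = \<phi> x}"

lemma w_measurable:
  assumes "\<phi> \<in> selectors"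
  shows "w \<phi> \<in> borel_measurable X"
proof -
  note [measurable] = selectors_measurable[OF assms]
  have "Measurable.pred (X \<Otimes>\<^sub>M borel) (\<lambda>z. \<sigma> z = \<phi> (fst z))"
    by (rule sets_eq_maps) measurable
  from measurable_section_measure[OF this] show ?thesis by (simp add: w_def[abs_def])
qed

text \<open>Follow \<open>\<phi>\<close> only before time \<open>n\<close> and only where its action has
  probability at least \<open>1/(n+1)\<close> under \<open>\<sigma>\<close>. Then each of at
  most \<open>n\<close> changed steps costs at most a factor \<open>n + 1\<close> against
  \<open>\<sigma>\<close>, so the density with respect to \<open>R\<close> is bounded. As all
  probabilities \<open>w \<phi> x\<close> are positive, these plans converge to
  \<open>\<phi>\<close>.\<close>

definition approx :: "('x \<Rightarrow> 'a) \<Rightarrow> nat \<Rightarrow> nat \<Rightarrow> 'x \<times> real \<Rightarrow> 'a" where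
  "approx \<phi> n t z = (if t < n \<and> 1 / real (Suc n) \<le> w \<phi> (fst z) then \<phi> (fst z) else \<sigma> z)"

lemma approx_plan:
  assumes \<phi>: "\<phi> \<in> selectors"
  shows "approx \<phi> n \<in> plans"
proof (rule plansI)
  fix t
  note [measurable] = selectors_measurable[OF \<phi>] w_measurable[OF \<phi>]
  have "approx \<phi> n t \<in> X \<Otimes>\<^sub>M borel \<rightarrow>\<^sub>M A" unfolding approx_def[abs_def] by measurable
  then show "approx \<phi> n t \<in> controls"
    using \<phi> controls_Act[OF \<sigma>] by (auto simp: controls_def approx_def selectors_def)
qed

lemma approx_step:
  assumes \<phi>: "\<phi> \<in> selectors" and [measurable]: "f \<in> borel_measurable A" and x[measurable]: "x \<in> space X"
  shows "(\<integral>\<^sup>+u. f (approx \<phi> n t (x, u)) \<partial>unif) \<le> ennreal (if t < n then real (Suc n) else 1) * (\<integral>\<^sup>+u. f (\<sigma> (x, u)) \<partial>unif)"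
proof (cases "t < n \<and> 1 / real (Suc n) \<le> w \<phi> x")
  case True
  have pa: "\<phi> x \<in> space A" using \<phi> x by (auto simp: selectors_def intro: Act_space)
  have prd: "Measurable.pred unif (\<lambda>u. \<sigma> (x, u) = \<phi> x)"
    by (rule sets_eq_maps) (measurable, simp add: pa)
  have eq: "{u. \<sigma> (x, u) = \<phi> x} = {u \<in> space unif. \<sigma> (x, u) = \<phi> x}" by simp
  have S: "{u. \<sigma> (x, u) = \<phi> x} \<in> sets unif"
    unfolding eq by (rule pred_def[THEN iffD1, OF prd])
  have "f (\<phi> x) * ennreal (w \<phi> x) = (\<integral>\<^sup>+u. f (\<phi> x) * indicator {u. \<sigma> (x, u) = \<phi> x} u \<partial>unif)"
    by (simp only: nn_integral_cmult_indicator[OF S] w_def unif.emeasure_eq_measure)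
  also have "\<dots> \<le> (\<integral>\<^sup>+u. f (\<sigma> (x, u)) \<partial>unif)"
    by (intro nn_integral_mono) (auto simp: indicator_def)
  finally have 1: "f (\<phi> x) * ennreal (w \<phi> x) \<le> (\<integral>\<^sup>+u. f (\<sigma> (x, u)) \<partial>unif)" .
  have "1 \<le> ennreal (real (Suc n)) * ennreal (w \<phi> x)"
  proof -
    have "1 \<le> real (Suc n) * w \<phi> x" using True by (simp add: field_simps)
    then have "ennreal 1 \<le> ennreal (real (Suc n) * w \<phi> x)" by (intro ennreal_leI)
    then show ?thesis by (subst ennreal_mult[symmetric]) (auto simp: w_def)
  qed
  then have "f (\<phi> x) * 1 \<le> f (\<phi> x) * (ennreal (real (Suc n)) * ennreal (w \<phi> x))"
    by (intro mult_left_mono) auto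
  also have "\<dots> = ennreal (real (Suc n)) * (f (\<phi> x) * ennreal (w \<phi> x))" by (simp add: mult_ac)
  also have "\<dots> \<le> ennreal (real (Suc n)) * (\<integral>\<^sup>+u. f (\<sigma> (x, u)) \<partial>unif)" using 1 by (intro mult_left_mono) auto
  finally have "f (\<phi> x) \<le> ennreal (real (Suc n)) * (\<integral>\<^sup>+u. f (\<sigma> (x, u)) \<partial>unif)" by simp
  moreover have "(\<integral>\<^sup>+u. f (approx \<phi> n t (x, u)) \<partial>unif) = f (\<phi> x)"
    using True unif.emeasure_space_1 by (simp add: approx_def)
  ultimately show ?thesis using True by simp
next
  case False
  then have "(\<integral>\<^sup>+u. f (approx \<phi> n t (x, u)) \<partial>unif) = 1 * (\<integral>\<^sup>+u. f (\<sigma> (x, u)) \<partial>unif)"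
    by (auto simp: approx_def)
  also have "\<dots> \<le> ennreal (if t < n then real (Suc n) else 1) * (\<integral>\<^sup>+u. f (\<sigma> (x, u)) \<partial>unif)"
    by (intro mult_right_mono) (auto simp flip: ennreal_1 intro!: ennreal_leI)
  finally show ?thesis .
qed

lemma approx_law:
  assumes \<phi>: "\<phi> \<in> selectors" and h[measurable]: "h \<in> borel_measurable X"
  shows "(\<integral>\<^sup>+x. h x \<partial>law (approx \<phi> n) t) \<le> ennreal (real (Suc n)) ^ n * (\<integral>\<^sup>+x. h x \<partial>law (\<lambda>_. \<sigma>) t)"
proof -
  note ap = approx_plan[OF \<phi>, of n]
  have step: "(\<integral>\<^sup>+x. h x \<partial>law (approx \<phi> n) t) \<le> ennreal (real (Suc n)) ^ min t n * (\<integral>\<^sup>+x. h x \<partial>law (\<lambda>_. \<sigma>) t)"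
    using h
  proof (induction t arbitrary: h)
    case (Suc t)
    note [measurable] = Suc.prems
    have s1: "(\<integral>\<^sup>+x. h x \<partial>law c (Suc t)) = (\<integral>\<^sup>+x. \<integral>\<^sup>+y. h y \<partial>step (c t) x \<partial>law c t)" if c: "c \<in> plans" for c
      unfolding law_Suc
      by (rule nn_integral_bind_prob[where X=X])
         (auto simp: measurable_cong_sets[OF sets_law[OF c] refl] intro!: measurable_step plans_measurable[OF c])
    let ?k = "ennreal (if t < n then real (Suc n) else 1)"
    have m: "(\<lambda>x. \<integral>\<^sup>+y. h y \<partial>step \<sigma> x) \<in> borel_measurable X"
      by (rule measurable_compose[OF measurable_prob_algebraD[OF measurable_step] nn_integral_measurable_subprob_algebra]) auto
    have "(\<integral>\<^sup>+x. h x \<partial>law (approx \<phi> n) (Suc t)) = (\<integral>\<^sup>+x. \<integral>\<^sup>+y. h y \<partial>step (approx \<phi> n t) x \<partial>law (approx \<phi> n) t)"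
      by (rule s1[OF ap])
    also have "\<dots> \<le> (\<integral>\<^sup>+x. ?k * (\<integral>\<^sup>+y. h y \<partial>step \<sigma> x) \<partial>law (approx \<phi> n) t)"
    proof (rule nn_integral_mono)
      fix x assume "x \<in> space (law (approx \<phi> n) t)"
      then have x: "x \<in> space X" by (simp add: space_law[OF ap])
      have "(\<lambda>a. \<integral>\<^sup>+y. h y \<partial>p (x, a)) \<in> borel_measurable A"
        using x by (intro measurable_compose[OF _ measurable_nn_integral_p[OF Suc.prems], of "\<lambda>a. (x, a)"]) auto
      from approx_step[OF \<phi> this x, of n t]
      show "(\<integral>\<^sup>+y. h y \<partial>step (approx \<phi> n t) x) \<le> ?k * (\<integral>\<^sup>+y. h y \<partial>step \<sigma> x)"
        using x plans_measurable[OF ap, of t] by (simp add: nn_integral_step Suc.prems)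
    qed
    also have "\<dots> = ?k * (\<integral>\<^sup>+x. \<integral>\<^sup>+y. h y \<partial>step \<sigma> x \<partial>law (approx \<phi> n) t)"
      using m by (intro nn_integral_cmult) (simp add: measurable_cong_sets[OF sets_law[OF ap] refl])
    also have "\<dots> \<le> ?k * (ennreal (real (Suc n)) ^ min t n * (\<integral>\<^sup>+x. \<integral>\<^sup>+y. h y \<partial>step \<sigma> x \<partial>law (\<lambda>_. \<sigma>) t))"
      by (intro mult_left_mono Suc.IH m) auto
    also have "(\<integral>\<^sup>+x. \<integral>\<^sup>+y. h y \<partial>step \<sigma> x \<partial>law (\<lambda>_. \<sigma>) t) = (\<integral>\<^sup>+x. h x \<partial>law (\<lambda>_. \<sigma>) (Suc t))"
      by (rule s1[OF \<sigma>_plan, symmetric])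
    also have "?k * (ennreal (real (Suc n)) ^ min t n * (\<integral>\<^sup>+x. h x \<partial>law (\<lambda>_. \<sigma>) (Suc t))) =
        ennreal (real (Suc n)) ^ min (Suc t) n * (\<integral>\<^sup>+x. h x \<partial>law (\<lambda>_. \<sigma>) (Suc t))"
      by (cases "t < n") (auto simp: min_def mult.assoc Suc_le_eq le_antisym simp del: of_nat_Suc)
    finally show ?case .
  qed simp
  have "ennreal (real (Suc n)) ^ min t n \<le> ennreal (real (Suc n)) ^ n"
    by (intro power_increasing) (auto simp flip: ennreal_1 intro!: ennreal_leI)
  then show ?thesis by (intro order_trans[OF step] mult_right_mono) auto
qed

lemma approx_dominated:
  assumes \<phi>: "\<phi> \<in> selectors" and E[measurable]: "E \<in> sets (X \<Otimes>\<^sub>M A)"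
  shows "emeasure (occ (approx \<phi> n)) E \<le> ennreal (real (Suc n) ^ Suc n) * emeasure R E"
proof -
  note ap = approx_plan[OF \<phi>, of n]
  note [measurable] = plans_measurable[OF ap]
  let ?K = "ennreal (real (Suc n))"
  define k where "k x = indicator (- {xb}) x * (\<integral>\<^sup>+u. indicator E (x, \<sigma> (x, u)) \<partial>unif)" for x :: 'x
  have k[measurable]: "k \<in> borel_measurable X"
  proof -
    have "(\<lambda>x. indicator live x * (\<integral>\<^sup>+u. indicator E (x, \<sigma> (x, u)) \<partial>unif)) \<in> borel_measurable X" by measurable
    then show ?thesis by (rule measurable_cong[THEN iffD1, rotated]) (auto simp: k_def indicator_def)
  qed
  have "emeasure (occ (approx \<phi> n)) E = (\<integral>\<^sup>+z. indicator E z \<partial>occ (approx \<phi> n))"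
    by (simp add: sets_occ[OF ap])
  also have "\<dots> = (\<Sum>t. \<integral>\<^sup>+x. indicator (- {xb}) x * (\<integral>\<^sup>+u. indicator E (x, approx \<phi> n t (x, u)) \<partial>unif) \<partial>law (approx \<phi> n) t)"
    by (rule nn_integral_occ_step[OF ap]) measurable
  also have "\<dots> \<le> (\<Sum>t. ?K ^ Suc n * (\<integral>\<^sup>+x. k x \<partial>law (\<lambda>_. \<sigma>) t))"
  proof (intro suminf_le)
    fix t
    have "(\<integral>\<^sup>+x. indicator (- {xb}) x * (\<integral>\<^sup>+u. indicator E (x, approx \<phi> n t (x, u)) \<partial>unif) \<partial>law (approx \<phi> n) t)
        \<le> (\<integral>\<^sup>+x. ?K * k x \<partial>law (approx \<phi> n) t)"
    proof (rule nn_integral_mono)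
      fix x assume "x \<in> space (law (approx \<phi> n) t)"
      then have x[measurable]: "x \<in> space X" by (simp add: space_law[OF ap])
      have "(\<lambda>a. indicator E (x, a)) \<in> borel_measurable A" by measurable
      from approx_step[OF \<phi> this x, of n t]
      have "(\<integral>\<^sup>+u. indicator E (x, approx \<phi> n t (x, u)) \<partial>unif) \<le> ennreal (if t < n then real (Suc n) else 1) * (\<integral>\<^sup>+u. indicator E (x, \<sigma> (x, u)) \<partial>unif)" .
      also have "\<dots> \<le> ?K * (\<integral>\<^sup>+u. indicator E (x, \<sigma> (x, u)) \<partial>unif)"
        by (intro mult_right_mono ennreal_leI) auto
      finally show "indicator (- {xb}) x * (\<integral>\<^sup>+u. indicator E (x, approx \<phi> n t (x, u)) \<partial>unif) \<le> ?K * k x"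
        by (auto simp: k_def indicator_def)
    qed
    also have "\<dots> = ?K * (\<integral>\<^sup>+x. k x \<partial>law (approx \<phi> n) t)"
      by (intro nn_integral_cmult) (simp add: measurable_cong_sets[OF sets_law[OF ap] refl])
    also have "\<dots> \<le> ?K * (?K ^ n * (\<integral>\<^sup>+x. k x \<partial>law (\<lambda>_. \<sigma>) t))"
      by (intro mult_left_mono approx_law[OF \<phi> k]) auto
    finally show "(\<integral>\<^sup>+x. indicator (- {xb}) x * (\<integral>\<^sup>+u. indicator E (x, approx \<phi> n t (x, u)) \<partial>unif) \<partial>law (approx \<phi> n) t)
        \<le> ?K ^ Suc n * (\<integral>\<^sup>+x. k x \<partial>law (\<lambda>_. \<sigma>) t)" by (simp add: mult.assoc)
  qed auto
  also have "\<dots> = ?K ^ Suc n * (\<Sum>t. \<integral>\<^sup>+x. k x \<partial>law (\<lambda>_. \<sigma>) t)" by simp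
  also have "(\<Sum>t. \<integral>\<^sup>+x. k x \<partial>law (\<lambda>_. \<sigma>) t) = (\<integral>\<^sup>+z. indicator E z \<partial>R)"
    unfolding R_def k_def by (rule nn_integral_occ_step[OF \<sigma>_plan, symmetric]) measurable
  also have "\<dots> = emeasure R E" by simp
  also have "?K ^ Suc n = ennreal (real (Suc n) ^ Suc n)" by (rule ennreal_power) simp
  finally show ?thesis .
qed

lemma approx_flow:
  assumes \<phi>: "\<phi> \<in> selectors"
  shows "\<exists>F K. flow F \<and> (\<forall>z. F z \<le> K) \<and> occ (approx \<phi> n) = density R (\<lambda>z. ennreal (F z))"
  using flow_of_dominated[OF approx_plan[OF \<phi>] approx_dominated[OF \<phi>], of n] by force

lemma approx_tendsto:
  assumes \<phi>: "\<phi> \<in> selectors" and g: "g \<in> bfun B"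
  shows "(\<lambda>n. val (approx \<phi> n) g) \<longlonglongrightarrow> val (\<lambda>_. pure \<phi>) g"
proof (rule val_eventually_equal[OF approx_plan[OF \<phi>] _ _ g])
  show "(\<lambda>_. pure \<phi>) \<in> plans" using pure_control[OF \<phi>] by simp
  fix t x u assume x: "x \<in> space X"
  have w: "0 < w \<phi> x" unfolding w_def using \<phi> x by (intro atom) (auto simp: selectors_def)
  obtain n0 where n0: "inverse (real (Suc n0)) < w \<phi> x" using reals_Archimedean[OF w] by blast
  show "\<forall>\<^sub>F n in sequentially. approx \<phi> n t (x, u) = pure \<phi> (x, u)"
    unfolding eventually_sequentially
  proof (intro exI allI impI)
    fix n assume n: "max n0 (Suc t) \<le> n"
    then have "1 / real (Suc n) \<le> 1 / real (Suc n0)" by (intro divide_left_mono) auto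
    then have "1 / real (Suc n) \<le> w \<phi> x" using n0 by (simp add: inverse_eq_divide)
    then show "approx \<phi> n t (x, u) = pure \<phi> (x, u)" using n by (simp add: approx_def)
  qed
qed

text \<open>A null set of \<open>R\<close> is never visited by the approximating plans, hence not by their
  limit either.\<close>

lemma pure_flow:
  assumes \<phi>: "\<phi> \<in> selectors"
  shows "\<exists>F. flow F \<and> occ (\<lambda>_. pure \<phi>) = density R (\<lambda>z. ennreal (F z))"
proof -
  have p: "(\<lambda>_. pure \<phi>) \<in> plans" using pure_control[OF \<phi>] by simp
  interpret P: finite_measure "occ (\<lambda>_. pure \<phi>)" by (rule finite_measure_occ[OF p])
  have ac: "absolutely_continuous R (occ (\<lambda>_. pure \<phi>))"
    unfolding absolutely_continuous_def
  proof
    fix E assume "E \<in> null_sets R"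
    then have E[measurable]: "E \<in> sets (X \<Otimes>\<^sub>M A)" and E0: "emeasure R E = 0" by (auto simp: null_sets_def)
    have g: "(indicator E :: _ \<Rightarrow> real) \<in> bfun 1" by (auto simp: bfun_def indicator_def)
    have "val (approx \<phi> n) (indicator E) = 0" for n
    proof -
      have "emeasure (occ (approx \<phi> n)) E = 0" using approx_dominated[OF \<phi> E, of n] E0 by simp
      then show ?thesis
        unfolding val_eq_integral_occ[OF approx_plan[OF \<phi>] g]
        using sets.sets_into_space[OF E] sets_eq_imp_space_eq[OF sets_occ[OF approx_plan[OF \<phi>]]]
        by (simp add: measure_def Int_absorb2)
    qed
    then have "val (\<lambda>_. pure \<phi>) (indicator E) = 0"
      using approx_tendsto[OF \<phi> g] by (simp add: LIMSEQ_const_iff)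
    then have "measure (occ (\<lambda>_. pure \<phi>)) E = 0"
      unfolding val_eq_integral_occ[OF p g]
      using sets.sets_into_space[OF E] sets_eq_imp_space_eq[OF sets_occ[OF p]] by (simp add: Int_absorb2)
    then show "E \<in> null_sets (occ (\<lambda>_. pure \<phi>))"
      by (auto simp: null_sets_def sets_occ[OF p] P.emeasure_eq_measure)
  qed
  define f where "f = RN_deriv R (occ (\<lambda>_. pure \<phi>))"
  have f[measurable]: "f \<in> borel_measurable (X \<Otimes>\<^sub>M A)"
    unfolding f_def using borel_measurable_RN_deriv[of R "occ (\<lambda>_. pure \<phi>)"] by simp
  have s: "sets (occ (\<lambda>_. pure \<phi>)) = sets R" by (simp add: sets_occ[OF p])
  have df: "density R f = occ (\<lambda>_. pure \<phi>)"
    unfolding f_def by (rule R.density_RN_deriv[OF ac s])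
  have fin: "AE z in R. f z \<noteq> \<infinity>"
    unfolding f_def using R.RN_deriv_finite[OF _ ac s] P.sigma_finite_measure_axioms by blast
  define F where "F z = enn2real (f z)" for z
  have F[measurable]: "F \<in> borel_measurable (X \<Otimes>\<^sub>M A)" unfolding F_def[abs_def] by measurable
  have fF: "AE z in R. f z = ennreal (F z)"
    using fin by eventually_elim (simp add: F_def less_top)
  have dF: "density R (\<lambda>z. ennreal (F z)) = occ (\<lambda>_. pure \<phi>)"
    unfolding df[symmetric] using fF by (intro density_cong) (auto elim!: eventually_mono)
  have F0: "0 \<le> F z" for z by (simp add: F_def)
  have "(\<integral>\<^sup>+z. ennreal (F z) \<partial>R) = emeasure (occ (\<lambda>_. pure \<phi>)) (space R)"
  proof -
    have "emeasure (density R (\<lambda>z. ennreal (F z))) (space R) = (\<integral>\<^sup>+z. ennreal (F z) * indicator (space R) z \<partial>R)"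
      by (rule emeasure_density[OF _ sets.top]) measurable
    also have "\<dots> = (\<integral>\<^sup>+z. ennreal (F z) \<partial>R)" by (intro nn_integral_cong) simp
    finally show ?thesis by (simp add: dF)
  qed
  then have "(\<integral>\<^sup>+z. ennreal (F z) \<partial>R) < \<infinity>" by (simp add: less_top[symmetric])
  then have "integrable R F" using F0 by (intro integrableI_nonneg) auto
  then have "flow F" unfolding flow_def dF using F F0 balanced_occ[OF p] by auto
  then show ?thesis using dF by metis
qed

end

section \<open>Exact attainment for an atomic control\<close>

context atomic_model begin

text \<open>A bounded flow \<open>F\<close> can be extrapolated through the constant flow 1: a small
  multiple of \<open>F\<close> may be removed from 1 and the rest rescaled.\<close>

lemma flow_extrapolate:
  assumes F: "flow F" and K: "\<And>z. F z \<le> K" and e: "0 < e" "e < 1" "e * K \<le> 1"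
  shows "flow (\<lambda>z. (1 - e * F z) / (1 - e))"
proof -
  note F' = flowD[OF F]
  note [measurable] = F'(1)
  let ?G = "\<lambda>z. (1 - e * F z) / (1 - e)"
  have pos: "0 \<le> ?G z" for z
  proof -
    have "e * F z \<le> e * K" using K e by (intro mult_left_mono) auto
    then show ?thesis using e by (intro divide_nonneg_nonneg) linarith+
  qed
  have one: "e * F z + (1 - e) * ?G z = 1" for z using e by simp
  have "(\<integral>\<^sup>+z. ennreal (F z) \<partial>R) < \<infinity>"
    using F'(2,3) by (subst nn_integral_eq_integral) auto
  then have "balanced (density R (\<lambda>z. ennreal (?G z)))"
    using balanced_unmix[OF sets_R F'(1) _ F'(2) pos _ F'(4), where a=e and b="1 - e"] flowD(4)[OF flow_1] e
    unfolding one by simp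
  moreover have "integrable R ?G" using F'(3) by simp
  ultimately show ?thesis unfolding flow_def using pos by auto
qed

definition V :: "('k::finite \<Rightarrow> 'x \<times> 'a \<Rightarrow> real) \<Rightarrow> (nat \<Rightarrow> 'x \<times> real \<Rightarrow> 'a) \<Rightarrow> real ^ 'k" where
  "V g c = (\<chi> k. val c (g k))"

definition W :: "('k::finite \<Rightarrow> 'x \<times> 'a \<Rightarrow> real) \<Rightarrow> ('x \<times> 'a \<Rightarrow> real) \<Rightarrow> real ^ 'k" where
  "W g F = (\<chi> k. \<integral>z. F z * g k z \<partial>R)"

definition C :: "('k::finite \<Rightarrow> 'x \<times> 'a \<Rightarrow> real) \<Rightarrow> (real ^ 'k) set" where
  "C g = {W g F | F. flow F \<and> (\<exists>K. \<forall>z. F z \<le> K)}"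

lemma integral_flow_mix:
  assumes F: "flow F1" "flow F2" and g: "g \<in> bfun B"
  shows "(\<integral>z. (a * F1 z + b * F2 z) * g z \<partial>R) = a * (\<integral>z. F1 z * g z \<partial>R) + b * (\<integral>z. F2 z * g z \<partial>R)"
  using flow_val_integrable[OF F(1) g] flow_val_integrable[OF F(2) g]
  by (simp add: distrib_right mult.assoc)

lemma W_mix:
  assumes "flow F1" "flow F2" and g: "range g \<subseteq> bfun B"
  shows "W g (\<lambda>z. a * F1 z + b * F2 z) = a *\<^sub>R W g F1 + b *\<^sub>R W g F2"
proof -
  have gk: "g k \<in> bfun B" for k using g by auto
  show ?thesis by (simp add: vec_eq_iff W_def integral_flow_mix[OF assms(1,2) gk])
qed

lemma V_flow:
  assumes "flow F" "c \<in> plans" "occ c = density R (\<lambda>z. ennreal (F z))" and g: "range g \<subseteq> bfun B"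
  shows "V g c = W g F"
proof -
  have gk: "g k \<in> bfun B" for k using g by auto
  show ?thesis by (simp add: vec_eq_iff V_def W_def val_flow[OF assms(1-3) gk])
qed

lemma V_\<sigma>:
  assumes g: "range g \<subseteq> bfun B"
  shows "V g (\<lambda>_. \<sigma>) = W g (\<lambda>_. 1)"
proof (rule V_flow[OF flow_1 \<sigma>_plan _ g])
  show "occ (\<lambda>_. \<sigma>) = density R (\<lambda>z. ennreal 1)" by (simp add: density_1 R_def)
qed

lemma convex_C:
  assumes g: "range g \<subseteq> bfun B"
  shows "convex (C g)"
proof (rule convexI)
  fix x y and a b :: real assume xy: "x \<in> C g" "y \<in> C g" and ab: "0 \<le> a" "0 \<le> b" "a + b = 1"
  obtain F1 K1 where F1: "x = W g F1" "flow F1" "\<And>z. F1 z \<le> K1" using xy by (auto simp: C_def)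
  obtain F2 K2 where F2: "y = W g F2" "flow F2" "\<And>z. F2 z \<le> K2" using xy by (auto simp: C_def)
  have "a * F1 z + b * F2 z \<le> a * K1 + b * K2" for z
    using F1 F2 ab by (intro add_mono mult_left_mono) auto
  then show "a *\<^sub>R x + b *\<^sub>R y \<in> C g"
    unfolding F1(1) F2(1) W_mix[OF F1(2) F2(2) g, symmetric] C_def
    using flow_mix[OF F1(2) F2(2) ab] by blast
qed

text \<open>A point of a convex set is in the relative interior if every segment of the set that ends there
  can be prolonged beyond it. The bounded flows make this possible.\<close>

lemma V_\<sigma>_rel_interior:
  assumes g: "range g \<subseteq> bfun B"
  shows "V g (\<lambda>_. \<sigma>) \<in> rel_interior (C g)"
proof -
  have 1: "W g (\<lambda>_. 1) \<in> C g" using flow_1 by (auto simp: C_def)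
  have "\<exists>m>1. (1 - m) *\<^sub>R x + m *\<^sub>R W g (\<lambda>_. 1) \<in> C g" if "x \<in> C g" for x
  proof -
    obtain F K where F: "x = W g F" "flow F" and K: "\<And>z. F z \<le> K" using \<open>x \<in> C g\<close> by (auto simp: C_def)
    \<comment> \<open>any \<open>e\<close> strictly between 0 and 1 with \<open>e * K \<le> 1\<close>\<close>
    define e where "e = 1 / (\<bar>K\<bar> + 2)"
    have e: "0 < e" "e < 1" "e * K \<le> 1" by (auto simp: e_def field_simps)
    let ?G = "\<lambda>z. (1 - e * F z) / (1 - e)"
    have fG: "flow ?G" by (rule flow_extrapolate[OF F(2) K e])
    have "?G z \<le> 1 / (1 - e)" for z
      using flowD(2)[OF F(2), of z] e by (intro divide_right_mono) auto
    with fG have WG: "W g ?G \<in> C g" unfolding C_def by blast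
    have "W g (\<lambda>z. (- (e / (1 - e))) * F z + (1 / (1 - e)) * 1) = (- (e / (1 - e))) *\<^sub>R W g F + (1 / (1 - e)) *\<^sub>R W g (\<lambda>_. 1)"
      by (rule W_mix[OF F(2) flow_1 g])
    moreover have "(\<lambda>z. (- (e / (1 - e))) * F z + (1 / (1 - e)) * 1) = ?G"
      by (rule ext) (simp add: diff_divide_distrib)
    moreover have "- (e / (1 - e)) = 1 - 1 / (1 - e)" using e by (simp add: field_simps)
    ultimately have "(1 - 1 / (1 - e)) *\<^sub>R x + (1 / (1 - e)) *\<^sub>R W g (\<lambda>_. 1) \<in> C g"
      using WG F(1) by simp
    moreover have "1 < 1 / (1 - e)" using e by simp
    ultimately show ?thesis by blast
  qed
  then show ?thesis
    unfolding V_\<sigma>[OF g] using 1 convex_rel_interior_iff[OF convex_C[OF g]] by blast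
qed

text \<open>Limits of points of \<open>C\<close> stay in the affine hull, because affine subspaces of a
  finite-dimensional space are closed.\<close>

lemma V_pure_affine_hull:
  assumes \<phi>: "\<phi> \<in> selectors" and g: "range g \<subseteq> bfun B"
  shows "V g (\<lambda>_. pure \<phi>) \<in> affine hull (C g)"
proof -
  have gk: "g k \<in> bfun B" for k using g by auto
  have "(\<lambda>n. V g (approx \<phi> n)) \<longlonglongrightarrow> V g (\<lambda>_. pure \<phi>)"
    unfolding V_def by (intro tendsto_vec_lambda approx_tendsto[OF \<phi> gk])
  moreover have "V g (approx \<phi> n) \<in> affine hull (C g)" for n
  proof -
    obtain F K where F: "flow F" "\<forall>z. F z \<le> K" and oc: "occ (approx \<phi> n) = density R (\<lambda>z. ennreal (F z))"
      using approx_flow[OF \<phi>] by blast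
    have "W g F \<in> C g" unfolding C_def using F by blast
    then show ?thesis using V_flow[OF F(1) approx_plan[OF \<phi>] oc g] by (simp add: hull_inc)
  qed
  ultimately show ?thesis by (rule closed_sequentially[OF closed_affine_hull, rotated]) 
qed

lemma purify_vector:
  fixes g :: "'k::finite \<Rightarrow> 'x \<times> 'a \<Rightarrow> real"
  assumes c: "c \<in> controls" and g: "range g \<subseteq> bfun B" and f: "f \<in> bfun B" and \<epsilon>: "0 < \<epsilon>"
  shows "\<exists>\<phi>\<in>selectors. norm (V g (\<lambda>_. pure \<phi>) - V g (\<lambda>_. c)) < \<epsilon> \<and> \<bar>val (\<lambda>_. pure \<phi>) f - val (\<lambda>_. c) f\<bar> < \<epsilon>"
proof -
  define \<delta> where "\<delta> = \<epsilon> / real (CARD('k) + 1)"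
  have \<delta>: "0 < \<delta>" "\<delta> \<le> \<epsilon>" "real CARD('k) * \<delta> < \<epsilon>" using \<epsilon> by (auto simp: \<delta>_def field_simps)
  have "finite (insert f (range g))" "insert f (range g) \<subseteq> bfun B" using f g by auto
  from purification[OF c this \<delta>(1)] obtain \<phi> where \<phi>: "\<phi> \<in> selectors"
    and near: "\<And>h. h \<in> insert f (range g) \<Longrightarrow> \<bar>val (\<lambda>_. pure \<phi>) h - val (\<lambda>_. c) h\<bar> < \<delta>" by blast
  have "norm (V g (\<lambda>_. pure \<phi>) - V g (\<lambda>_. c)) \<le> (\<Sum>k\<in>UNIV. \<bar>val (\<lambda>_. pure \<phi>) (g k) - val (\<lambda>_. c) (g k)\<bar>)"
    using norm_le_l1_cart[of "V g (\<lambda>_. pure \<phi>) - V g (\<lambda>_. c)"] by (simp add: V_def)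
  also have "\<dots> \<le> (\<Sum>k\<in>(UNIV::'k set). \<delta>)" by (rule sum_mono, rule less_imp_le, rule near) simp
  also have "\<dots> < \<epsilon>" using \<delta> by simp
  finally show ?thesis using \<phi> near[of f] \<delta> by auto
qed

lemma val_mism_self: "\<phi> \<in> selectors \<Longrightarrow> val (\<lambda>_. pure \<phi>) (mismatch \<phi>) = 0"
proof -
  assume \<phi>: "\<phi> \<in> selectors"
  have "rew (\<lambda>_. pure \<phi>) (mismatch \<phi>) t = 0" for t
    unfolding rew_pure[OF \<phi> mismatch_bfun[OF \<phi>]] by (simp add: mismatch_def)
  then show ?thesis by (simp add: val_def)
qed

text \<open>Prolong the segment from the vector of \<open>\<phi>\<close> through the target \<open>v\<close>
  to a point \<open>y\<close> of \<open>C\<close>. The mixture of the flows of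
  \<open>\<phi>\<close> and \<open>y\<close> with weights \<open>1 - l\<close> and
  \<open>l\<close> has the vector \<open>v\<close>, and it deviates from \<open>\<phi>\<close>
  only in its second part, whose mass is at most \<open>l * tail 0\<close>.\<close>

lemma improve_selector:
  assumes g: "range g \<subseteq> bfun B" and \<rho>: "0 < \<rho>" "ball (V g (\<lambda>_. \<sigma>)) \<rho> \<inter> affine hull (C g) \<subseteq> C g"
    and \<phi>: "\<phi> \<in> selectors" and l: "0 < l" "l < 1"
    and near: "norm (V g (\<lambda>_. pure \<phi>) - V g (\<lambda>_. \<sigma>)) < l * \<rho>" and \<epsilon>: "0 < \<epsilon>"
  shows "\<exists>\<phi>'\<in>selectors. norm (V g (\<lambda>_. pure \<phi>') - V g (\<lambda>_. \<sigma>)) < \<epsilon> \<and>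
    val (\<lambda>_. pure \<phi>') (mismatch \<phi>) < l * tail 0 + \<epsilon>"
proof -
  define v where "v = V g (\<lambda>_. \<sigma>)"
  define v\<phi> where "v\<phi> = V g (\<lambda>_. pure \<phi>)"
  define t where "t = (1 - l) / l"
  \<comment> \<open>chosen so that \<open>v = (1 - l) *\<^sub>R v\<phi> + l *\<^sub>R y\<close>\<close>
  define y where "y = (1 + t) *\<^sub>R v + (- t) *\<^sub>R v\<phi>"
  have t0: "0 < t" using l by (simp add: t_def)
  have aff: "v \<in> affine hull (C g)" "v\<phi> \<in> affine hull (C g)"
    using V_\<sigma>_rel_interior[OF g] rel_interior_subset[of "C g"] V_pure_affine_hull[OF \<phi> g]
    by (auto simp: v_def v\<phi>_def intro: hull_inc)
  have "y \<in> affine hull (C g)"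
    unfolding y_def by (rule mem_affine[OF affine_affine_hull aff]) simp
  moreover have "dist v y < \<rho>"
  proof -
    have "v - y = t *\<^sub>R (v\<phi> - v)" by (simp add: y_def algebra_simps)
    then have "dist v y = t * norm (v\<phi> - v)" using t0 by (simp add: dist_norm)
    also have "\<dots> < t * (l * \<rho>)" using near t0 by (intro mult_strict_left_mono) (auto simp: v_def v\<phi>_def)
    also have "\<dots> = (1 - l) * \<rho>" using l by (simp add: t_def)
    also have "\<dots> \<le> \<rho>" using l \<rho>(1) by (simp add: algebra_simps)
    finally show ?thesis .
  qed
  ultimately have "y \<in> C g" using \<rho>(2) by (auto simp: v_def)
  then obtain Fy where Fy: "flow Fy" "y = W g Fy" by (auto simp: C_def)
  obtain F\<phi> where F\<phi>: "flow F\<phi>" and oc\<phi>: "occ (\<lambda>_. pure \<phi>) = density R (\<lambda>z. ennreal (F\<phi> z))"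
    using pure_flow[OF \<phi>] by blast
  have p\<phi>: "(\<lambda>_. pure \<phi>) \<in> plans" using pure_control[OF \<phi>] by simp
  let ?G = "\<lambda>z. (1 - l) * F\<phi> z + l * Fy z"
  have G: "flow ?G" using l by (intro flow_mix[OF F\<phi> Fy(1)]) auto
  obtain c where c: "c \<in> controls" and oc: "occ (\<lambda>_. c) = density R (\<lambda>z. ennreal (?G z))"
    using realize_flow[OF G] by blast
  have cp: "(\<lambda>_. c) \<in> plans" using c by simp
  have "V g (\<lambda>_. c) = (1 - l) *\<^sub>R v\<phi> + l *\<^sub>R y"
    unfolding V_flow[OF G cp oc g] W_mix[OF F\<phi> Fy(1) g] v\<phi>_def V_flow[OF F\<phi> p\<phi> oc\<phi> g] Fy(2) ..
  also have "\<dots> = (l * (1 + t)) *\<^sub>R v + ((1 - l) - l * t) *\<^sub>R v\<phi>" by (simp add: y_def algebra_simps)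
  also have "l * (1 + t) = 1" using l by (auto simp: t_def field_simps)
  also have "(1 - l) - l * t = 0" using l by (auto simp: t_def field_simps)
  finally have Vc: "V g (\<lambda>_. c) = v" by simp
  have mb: "mismatch \<phi> \<in> bfun 1" by (rule mismatch_bfun[OF \<phi>])
  have "val (\<lambda>_. c) (mismatch \<phi>) = (1 - l) * val (\<lambda>_. pure \<phi>) (mismatch \<phi>) + l * (\<integral>z. Fy z * mismatch \<phi> z \<partial>R)"
    unfolding val_flow[OF G cp oc mb] integral_flow_mix[OF F\<phi> Fy(1) mb] val_flow[OF F\<phi> p\<phi> oc\<phi> mb] ..
  also have "\<dots> = l * (\<integral>z. Fy z * mismatch \<phi> z \<partial>R)" by (simp add: val_mism_self[OF \<phi>])
  also have "\<dots> \<le> l * (\<integral>z. Fy z \<partial>R)"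
    using l flowD(2,3)[OF Fy(1)] flow_val_integrable[OF Fy(1) mb]
    by (intro mult_left_mono integral_mono) (auto simp: mismatch_def)
  also have "\<dots> \<le> l * tail 0" using l flow_mass[OF Fy(1)] by (intro mult_left_mono) auto
  finally have small: "val (\<lambda>_. c) (mismatch \<phi>) \<le> l * tail 0" .
  have g': "range g \<subseteq> bfun (max B 1)" "mismatch \<phi> \<in> bfun (max B 1)"
    using g mb by (auto simp: bfun_def image_subset_iff intro: order_trans[OF _ max.cobounded1] order_trans[OF _ max.cobounded2])
  from purify_vector[OF c g'(1) g'(2) \<epsilon>] obtain \<phi>' where "\<phi>' \<in> selectors"
    "norm (V g (\<lambda>_. pure \<phi>') - V g (\<lambda>_. c)) < \<epsilon>" "\<bar>val (\<lambda>_. pure \<phi>') (mismatch \<phi>) - val (\<lambda>_. c) (mismatch \<phi>)\<bar> < \<epsilon>" by blast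
  then show ?thesis using small unfolding Vc v_def by (intro bexI[of _ \<phi>']) auto
qed

text \<open>Improve repeatedly with \<open>l = 2^-(n+1)\<close>: the distances to the target tend to zero
  and the deviations between consecutive selectors are summable.\<close>

theorem atomic_attained:
  fixes g :: "'k::finite \<Rightarrow> 'x \<times> 'a \<Rightarrow> real"
  assumes g: "range g \<subseteq> bfun B"
  shows "\<exists>\<phi>\<in>selectors. \<forall>k. val (\<lambda>_. pure \<phi>) (g k) = val (\<lambda>_. \<sigma>) (g k)"
proof -
  have gk: "g k \<in> bfun B" for k using g by auto
  define v where "v = V g (\<lambda>_. \<sigma>)"
  obtain \<rho> where \<rho>: "0 < \<rho>" "ball (V g (\<lambda>_. \<sigma>)) \<rho> \<inter> affine hull (C g) \<subseteq> C g"
    using V_\<sigma>_rel_interior[OF g] unfolding mem_rel_interior_ball by blast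
  define P where "P n \<phi> \<longleftrightarrow> \<phi> \<in> selectors \<and> norm (V g (\<lambda>_. pure \<phi>) - v) < (1 / 2) ^ Suc n * \<rho>" for n :: nat and \<phi>
  define Q where "Q n \<phi> \<phi>' \<longleftrightarrow> val (\<lambda>_. pure \<phi>') (mismatch \<phi>) \<le> (tail 0 + 1) * (1 / 2) ^ n" for n :: nat and \<phi> \<phi>'
  have tail0: "0 \<le> tail 0"
    using flow_mass[OF flow_1] by (rule order_trans[rotated]) simp
  have "\<exists>\<phi>s. \<forall>n. P n (\<phi>s n) \<and> Q n (\<phi>s n) (\<phi>s (Suc n))"
  proof (rule dependent_nat_choice)
    show "\<exists>\<phi>. P 0 \<phi>"
      using purify_vector[OF \<sigma> g gk, of "1 / 2 * \<rho>"] \<rho>(1) by (auto simp: P_def v_def)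
    fix \<phi> n assume P: "P n \<phi>"
    define l :: real where "l = (1 / 2) ^ Suc n"
    have l: "0 < l" "l < 1" unfolding l_def by (simp, rule power_Suc_less_one) simp_all
    \<comment> \<open>the first bound prepares the next round, the second controls the deviation in this round\<close>
    define \<epsilon> where "\<epsilon> = min (l / 2 * \<rho>) l"
    have \<epsilon>: "0 < \<epsilon>" "\<epsilon> \<le> l / 2 * \<rho>" "\<epsilon> \<le> l" using l \<rho>(1) by (auto simp: \<epsilon>_def)
    from P have "\<phi> \<in> selectors" "norm (V g (\<lambda>_. pure \<phi>) - V g (\<lambda>_. \<sigma>)) < l * \<rho>"
      unfolding P_def v_def l_def by simp_all
    from improve_selector[OF g \<rho> this(1) l this(2) \<epsilon>(1)] obtain \<phi>' where
      \<phi>': "\<phi>' \<in> selectors" "norm (V g (\<lambda>_. pure \<phi>') - v) < \<epsilon>"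
      "val (\<lambda>_. pure \<phi>') (mismatch \<phi>) < l * tail 0 + \<epsilon>" unfolding v_def by blast
    have "P (Suc n) \<phi>'" using \<phi>'(1,2) \<epsilon>(2) by (auto simp: P_def l_def)
    moreover have "Q n \<phi> \<phi>'"
    proof -
      have "val (\<lambda>_. pure \<phi>') (mismatch \<phi>) \<le> (tail 0 + 1) * l" using \<phi>'(3) \<epsilon>(3) by (simp add: algebra_simps)
      also have "\<dots> \<le> (tail 0 + 1) * (1 / 2) ^ n" using tail0 by (intro mult_left_mono) (auto simp: l_def)
      finally show ?thesis by (simp add: Q_def)
    qed
    ultimately show "\<exists>\<phi>'. P (Suc n) \<phi>' \<and> Q n \<phi> \<phi>'" by blast
  qed
  then obtain \<phi>s where \<phi>s: "\<And>n. P n (\<phi>s n)" "\<And>n. Q n (\<phi>s n) (\<phi>s (Suc n))" by blast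
  have sel: "\<phi>s n \<in> selectors" for n using \<phi>s(1)[of n] by (simp add: P_def)
  have small: "val (\<lambda>_. pure (\<phi>s (Suc n))) (mismatch (\<phi>s n)) \<le> (tail 0 + 1) * (1 / 2) ^ n" for n
    using \<phi>s(2)[of n] by (simp add: Q_def)
  obtain \<phi> where \<phi>: "\<phi> \<in> selectors"
    and lim: "\<And>B g. g \<in> bfun B \<Longrightarrow> (\<lambda>n. val (\<lambda>_. pure (\<phi>s n)) g) \<longlonglongrightarrow> val (\<lambda>_. pure \<phi>) g"
    using selectors_limit[OF sel small] by blast
  have "val (\<lambda>_. pure \<phi>) (g k) = val (\<lambda>_. \<sigma>) (g k)" for k
  proof -
    have "(\<lambda>n. val (\<lambda>_. pure (\<phi>s n)) (g k) - v $ k) \<longlonglongrightarrow> 0"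
    proof (rule Lim_null_comparison[OF always_eventually])
      show "\<forall>n. norm (val (\<lambda>_. pure (\<phi>s n)) (g k) - v $ k) \<le> (1 / 2) ^ Suc n * \<rho>"
      proof
        fix n
        have "norm (val (\<lambda>_. pure (\<phi>s n)) (g k) - v $ k) \<le> norm (V g (\<lambda>_. pure (\<phi>s n)) - v)"
          using component_le_norm_cart[of "V g (\<lambda>_. pure (\<phi>s n)) - v" k] by (simp add: V_def)
        then show "norm (val (\<lambda>_. pure (\<phi>s n)) (g k) - v $ k) \<le> (1 / 2) ^ Suc n * \<rho>"
          using \<phi>s(1)[of n] by (simp add: P_def)
      qed
      have "(\<lambda>n. (1 / 2) ^ Suc n * \<rho>) \<longlonglongrightarrow> 0 * \<rho>"
        by (intro tendsto_mult tendsto_const LIMSEQ_Suc LIMSEQ_power_zero) simp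
      then show "(\<lambda>n. (1 / 2) ^ Suc n * \<rho>) \<longlonglongrightarrow> 0" by simp
    qed
    then have "(\<lambda>n. val (\<lambda>_. pure (\<phi>s n)) (g k)) \<longlonglongrightarrow> v $ k" by (simp add: LIM_zero_iff)
    then have "val (\<lambda>_. pure \<phi>) (g k) = v $ k" by (rule LIMSEQ_unique[OF lim[OF gk]])
    then show ?thesis by (simp add: v_def V_def)
  qed
  then show ?thesis using \<phi> by blast
qed

end

section \<open>Seeds drawn in advance\<close>

context control_base begin

lemma measurable_seed: "(\<lambda>\<omega>. \<omega> t) \<in> borel_measurable seeds"
  using measurable_component_singleton[of t UNIV "\<lambda>_. unif"] by (simp add: measurable_cong_sets[OF refl sets_unif])

lemma measurable_freeze_integral:
  assumes c: "c \<in> plans" and \<nu>: "\<nu> \<in> space (prob_algebra X)" and k[measurable]: "k \<in> borel_measurable (X \<Otimes>\<^sub>M borel)"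
  shows "(\<lambda>\<omega>. \<integral>\<^sup>+x. k (x, \<omega> s) \<partial>chain \<nu> (\<lambda>t. step (freeze c \<omega> t)) t) \<in> borel_measurable seeds"
proof (rule nn_integral_measurable_subprob_algebra2[where N=X])
  note [measurable] = measurable_seed
  show "(\<lambda>(\<omega>, x). k (x, \<omega> s)) \<in> borel_measurable (seeds \<Otimes>\<^sub>M X)" by measurable
  show "(\<lambda>\<omega>. chain \<nu> (\<lambda>t. step (freeze c \<omega> t)) t) \<in> seeds \<rightarrow>\<^sub>M subprob_algebra X"
    using measurable_chain_freeze[where c=c and \<nu>="\<lambda>_. \<nu>" and s="\<lambda>\<omega>. \<omega>" and M=seeds and t=t] c \<nu>
    by (intro measurable_prob_algebraD) auto
qed

text \<open>Induction on time: split off the first seed and apply the induction hypothesis to the chain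
  started from the law of the second state. The seed of time \<open>t\<close> appears next to
  the state because the state at time \<open>t\<close> depends on earlier seeds only.\<close>

lemma chain_seeds_pair:
  assumes c: "c \<in> plans" and \<nu>: "\<nu> \<in> space (prob_algebra X)" and k[measurable]: "k \<in> borel_measurable (X \<Otimes>\<^sub>M borel)"
  shows "(\<integral>\<^sup>+x. \<integral>\<^sup>+u. k (x, u) \<partial>unif \<partial>chain \<nu> (\<lambda>t. step (c t)) t) =
    (\<integral>\<^sup>+\<omega>. \<integral>\<^sup>+x. k (x, \<omega> t) \<partial>chain \<nu> (\<lambda>t. step (freeze c \<omega> t)) t \<partial>seeds)"
  using c \<nu>
proof (induction t arbitrary: \<nu> c)
  case 0
  interpret S: sequence_space unif ..
  have \<nu>_sets[measurable_cong]: "sets \<nu> = sets X" and "prob_space \<nu>"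
    using 0(2) by (auto simp: space_prob_algebra)
  interpret \<nu>: prob_space \<nu> by fact
  interpret \<nu>U: pair_prob_space \<nu> unif ..
  have "(\<integral>\<^sup>+\<omega>. \<integral>\<^sup>+x. k (x, \<omega> 0) \<partial>chain \<nu> (\<lambda>t. step (freeze c \<omega> t)) 0 \<partial>seeds) = (\<integral>\<^sup>+u. \<integral>\<^sup>+x. k (x, u) \<partial>\<nu> \<partial>unif)"
    using measurable_freeze_integral[OF 0 k, of 0 0]
    by (subst nn_integral_seeds) (simp_all add: S.P.emeasure_space_1)
  also have "\<dots> = (\<integral>\<^sup>+x. \<integral>\<^sup>+u. k (x, u) \<partial>unif \<partial>\<nu>)" by (rule \<nu>U.Fubini) measurable
  finally show ?case by simp
next
  case (Suc t)
  let ?c = "\<lambda>n. c (Suc n)"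
  have c': "?c \<in> plans" using Suc.prems(1) by (simp add: plans_def)
  note [measurable] = plans_measurable[OF Suc.prems(1)]
  have \<nu>_sets[measurable_cong]: "sets \<nu> = sets X" and "prob_space \<nu>"
    using Suc.prems(2) by (auto simp: space_prob_algebra)
  interpret \<nu>: prob_space \<nu> by fact
  interpret \<nu>U: pair_prob_space \<nu> unif ..
  define h where "h x = (\<integral>\<^sup>+u. k (x, u) \<partial>unif)" for x
  have h[measurable]: "h \<in> borel_measurable X" unfolding h_def[abs_def] by measurable
  define \<nu>1 where "\<nu>1 u = \<nu> \<bind> (\<lambda>x. p (x, c 0 (x, u)))" for u
  have \<nu>1[measurable]: "\<nu>1 \<in> borel \<rightarrow>\<^sub>M prob_algebra X"
    unfolding \<nu>1_def by (rule measurable_bind_prob_space2[where N=X]) (use Suc.prems in \<open>auto, measurable\<close>)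
  have eq1: "chain \<nu> (\<lambda>t. step (freeze c (case_nat u \<omega>) t)) (Suc t) = chain (\<nu>1 u) (\<lambda>t. step (freeze ?c \<omega> t)) t"
    for u \<omega>
  proof -
    have "\<nu> \<bind> step (freeze c (case_nat u \<omega>) 0) = \<nu>1 u"
      unfolding \<nu>1_def
      by (intro bind_cong refl) (simp add: step_freeze Suc.prems sets_eq_imp_space_eq[OF \<nu>_sets])
    then show ?thesis
      unfolding chain_shift by (simp add: freeze_def)
  qed
  have "(\<integral>\<^sup>+\<omega>. \<integral>\<^sup>+x. k (x, \<omega> (Suc t)) \<partial>chain \<nu> (\<lambda>t. step (freeze c \<omega> t)) (Suc t) \<partial>seeds) =
    (\<integral>\<^sup>+u. \<integral>\<^sup>+\<omega>. \<integral>\<^sup>+x. k (x, \<omega> t) \<partial>chain (\<nu>1 u) (\<lambda>t. step (freeze ?c \<omega> t)) t \<partial>seeds \<partial>unif)"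
    by (subst nn_integral_seeds[OF measurable_freeze_integral[OF Suc.prems k]]) (simp add: eq1 del: chain.simps)
  also have "\<dots> = (\<integral>\<^sup>+u. \<integral>\<^sup>+x. h x \<partial>chain (\<nu>1 u) (\<lambda>t. step (?c t)) t \<partial>unif)"
    unfolding h_def using measurable_space[OF \<nu>1] by (subst Suc.IH[OF c', symmetric]) auto
  also have "\<dots> = (\<integral>\<^sup>+x. h x \<partial>(unif \<bind> (\<lambda>u. chain (\<nu>1 u) (\<lambda>t. step (?c t)) t)))"
  proof (rule nn_integral_bind_prob[OF h, symmetric])
    show "(\<lambda>u. chain (\<nu>1 u) (\<lambda>t. step (?c t)) t) \<in> unif \<rightarrow>\<^sub>M prob_algebra X"
      by (rule measurable_chain) (auto simp: split_beta' intro: measurable_compose[OF measurable_snd])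
  qed
  also have "unif \<bind> (\<lambda>u. chain (\<nu>1 u) (\<lambda>t. step (?c t)) t) = chain (unif \<bind> \<nu>1) (\<lambda>t. step (?c t)) t"
    by (rule chain_bind[where X=X, symmetric]) auto
  also have "unif \<bind> \<nu>1 = \<nu> \<bind> step (c 0)"
    unfolding \<nu>1_def step_def
    by (rule \<nu>U.bind_rotate[symmetric, where N=X]) (rule measurable_prob_algebraD, measurable)
  finally show ?case unfolding chain_shift h_def by simp
qed

lemma pair_law_seeds:
  assumes c: "c \<in> plans" and [measurable]: "g \<in> borel_measurable (X \<Otimes>\<^sub>M A)"
  shows "(\<lambda>\<omega>. \<integral>\<^sup>+z. g z \<partial>pair_law (freeze c \<omega>) t) \<in> borel_measurable seeds"
    and "(\<integral>\<^sup>+z. g z \<partial>pair_law c t) = (\<integral>\<^sup>+\<omega>. \<integral>\<^sup>+z. g z \<partial>pair_law (freeze c \<omega>) t \<partial>seeds)"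
proof -
  note [measurable] = plans_measurable[OF c]
  define k where "k z = g (fst z, c t z)" for z
  have k: "k \<in> borel_measurable (X \<Otimes>\<^sub>M borel)" unfolding k_def[abs_def] by measurable
  have eq: "(\<integral>\<^sup>+z. g z \<partial>pair_law (freeze c \<omega>) t) = (\<integral>\<^sup>+x. k (x, \<omega> t) \<partial>chain \<mu> (\<lambda>t. step (freeze c \<omega> t)) t)" for \<omega>
    using unif.emeasure_space_1
    by (simp add: nn_integral_pair_law[OF freeze_controls[OF c]] k_def law_def freeze_def)
  show "(\<lambda>\<omega>. \<integral>\<^sup>+z. g z \<partial>pair_law (freeze c \<omega>) t) \<in> borel_measurable seeds"
    unfolding eq by (rule measurable_freeze_integral[OF c \<mu> k])
  have "(\<integral>\<^sup>+z. g z \<partial>pair_law c t) = (\<integral>\<^sup>+x. \<integral>\<^sup>+u. k (x, u) \<partial>unif \<partial>chain \<mu> (\<lambda>t. step (c t)) t)"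
    by (simp add: nn_integral_pair_law[OF c] k_def law_def)
  then show "(\<integral>\<^sup>+z. g z \<partial>pair_law c t) = (\<integral>\<^sup>+\<omega>. \<integral>\<^sup>+z. g z \<partial>pair_law (freeze c \<omega>) t \<partial>seeds)"
    unfolding eq chain_seeds_pair[OF c \<mu> k] .
qed

definition pure_plans :: "(nat \<Rightarrow> 'x \<times> real \<Rightarrow> 'a) set" where
  "pure_plans = {d. \<forall>t. \<exists>\<psi>\<in>selectors. d t = pure \<psi>}"

lemma pure_plans_subset: "pure_plans \<subseteq> plans"
proof
  fix d assume d: "d \<in> pure_plans"
  have "d t \<in> controls" for t
  proof -
    obtain \<psi> where "\<psi> \<in> selectors" "d t = pure \<psi>" using d unfolding pure_plans_def by blast
    then show ?thesis using pure_control[of \<psi>] by simp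
  qed
  then show "d \<in> plans" by (rule plansI)
qed

lemma freeze_pure:
  assumes c: "c \<in> plans"
  shows "freeze c \<omega> \<in> pure_plans"
proof -
  note [measurable] = plans_measurable[OF c]
  have "(\<lambda>x. c t (x, \<omega> t)) \<in> selectors" for t
    using plans_Act[OF c] by (auto simp: selectors_def)
  then show ?thesis
    unfolding pure_plans_def freeze_def by (intro CollectI allI) (rule bexI[of _ "\<lambda>x. c t (x, \<omega> t)" for t], rule refl)
qed

text \<open>Nonrandomized plans control all plans, since a plan is a mixture of nonrandomized ones.\<close>

lemma alive_tail_from_pure:
  assumes c: "c \<in> plans" and le: "\<And>d. d \<in> pure_plans \<Longrightarrow> (\<Sum>t\<in>I. alive d t) \<le> T"
  shows "(\<Sum>t\<in>I. alive c t) \<le> T"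
proof -
  interpret S: sequence_space unif ..
  have al0: "0 \<le> alive d t" for d t by (simp add: alive_def)
  have T0: "0 \<le> T" using le[OF freeze_pure[OF c]] sum_nonneg[of I "alive (freeze c undefined)"] al0 order_trans by blast
  have m: "(\<lambda>z. indicator (- {xb}) (fst z)) \<in> borel_measurable (X \<Otimes>\<^sub>M A)" by measurable
  have "ennreal (\<Sum>t\<in>I. alive c t) = (\<Sum>t\<in>I. \<integral>\<^sup>+\<omega>. ennreal (alive (freeze c \<omega>) t) \<partial>seeds)"
    using al0 by (simp add: sum_ennreal[symmetric] ennreal_alive[OF c] ennreal_alive[OF freeze_controls[OF c]] pair_law_seeds(2)[OF c m])
  also have "\<dots> = (\<integral>\<^sup>+\<omega>. (\<Sum>t\<in>I. ennreal (alive (freeze c \<omega>) t)) \<partial>seeds)"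
    by (rule nn_integral_sum[symmetric]) (simp add: ennreal_alive[OF freeze_controls[OF c]] pair_law_seeds(1)[OF c m])
  also have "\<dots> \<le> (\<integral>\<^sup>+\<omega>. ennreal T \<partial>seeds)"
    using al0 le[OF freeze_pure[OF c]] by (intro nn_integral_mono) (simp add: sum_ennreal ennreal_leI)
  also have "\<dots> = ennreal T" by (simp add: S.P.emeasure_space_1)
  finally show ?thesis using T0 by simp
qed

end

context control_model begin

lemma val_shift:
  assumes c: "c \<in> plans" and g: "g \<in> bfun B"
  shows "val c g = val c (\<lambda>z. g z + B) - val c (\<lambda>_. B)" "\<bar>val c g\<bar> \<le> B * tail 0"
    "(\<lambda>z. g z + B) \<in> bfun (2 * B)" "(\<lambda>_. B) \<in> bfun (2 * B)" "\<And>z. z \<in> space (X \<Otimes>\<^sub>M A) \<Longrightarrow> 0 \<le> g z + B"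
proof -
  show g1: "(\<lambda>z. g z + B) \<in> bfun (2 * B)" using g by (force simp: bfun_def)
  show g2: "(\<lambda>_. B) \<in> bfun (2 * B)" using bfun_nonneg[OF g] by (auto simp: bfun_def)
  show "0 \<le> g z + B" if "z \<in> space (X \<Otimes>\<^sub>M A)" for z using bfun_bound'[OF g that] by auto
  show "val c g = val c (\<lambda>z. g z + B) - val c (\<lambda>_. B)"
    unfolding val_eq_integral_occ[OF c g] val_eq_integral_occ[OF c g1] val_eq_integral_occ[OF c g2]
    using integrable_occ[OF c g] integrable_occ[OF c g2] by simp
  show "\<bar>val c g\<bar> \<le> B * tail 0" using val_tail[OF c g, of 0] by simp
qed

lemma ennreal_val:
  assumes c: "c \<in> plans" and g: "g \<in> bfun B" and pos: "\<And>z. z \<in> space (X \<Otimes>\<^sub>M A) \<Longrightarrow> 0 \<le> g z"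
  shows "ennreal (val c g) = (\<integral>\<^sup>+z. ennreal (g z) \<partial>occ c)" "0 \<le> val c g"
proof -
  have sp: "space (occ c) = space (X \<Otimes>\<^sub>M A)" by (rule sets_eq_imp_space_eq[OF sets_occ[OF c]])
  show "ennreal (val c g) = (\<integral>\<^sup>+z. ennreal (g z) \<partial>occ c)"
    unfolding val_eq_integral_occ[OF c g]
    by (rule nn_integral_eq_integral[symmetric, OF integrable_occ[OF c g]]) (auto simp: sp pos)
  show "0 \<le> val c g" unfolding val_eq_integral_occ[OF c g] by (intro integral_nonneg_AE AE_I2) (auto simp: sp pos)
qed

lemma val_seeds:
  assumes c: "c \<in> plans" and g: "g \<in> bfun B"
  shows "(\<lambda>\<omega>. val (freeze c \<omega>) g) \<in> borel_measurable seeds"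
    and "val c g = (\<integral>\<omega>. val (freeze c \<omega>) g \<partial>seeds)"
proof -
  interpret S: sequence_space unif ..
  note fc = freeze_controls[OF c]
  have *: "(\<lambda>\<omega>. val (freeze c \<omega>) f) \<in> borel_measurable seeds \<and> val c f = (\<integral>\<omega>. val (freeze c \<omega>) f \<partial>seeds)"
    if f: "f \<in> bfun D" and pos: "\<And>z. z \<in> space (X \<Otimes>\<^sub>M A) \<Longrightarrow> 0 \<le> f z" for f D
  proof
    note [measurable] = bfun_measurable[OF f]
    have m: "(\<lambda>z. indicator (- {xb}) (fst z) * ennreal (f z)) \<in> borel_measurable (X \<Otimes>\<^sub>M A)" by measurable
    have ev: "ennreal (val d f) = (\<integral>\<^sup>+z. ennreal (f z) \<partial>occ d)" and ev0: "0 \<le> val d f" if "d \<in> plans" for d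
      using ennreal_val[OF that f pos] by auto
    have ef: "ennreal (val (freeze c \<omega>) f) = (\<Sum>t. \<integral>\<^sup>+z. indicator (- {xb}) (fst z) * ennreal (f z) \<partial>pair_law (freeze c \<omega>) t)" for \<omega>
      unfolding ev[OF fc] by (rule nn_integral_occ[OF fc]) measurable
    have "(\<lambda>\<omega>. ennreal (val (freeze c \<omega>) f)) \<in> borel_measurable seeds"
      unfolding ef by (intro borel_measurable_suminf_order pair_law_seeds(1)[OF c m])
    then have "(\<lambda>\<omega>. enn2real (ennreal (val (freeze c \<omega>) f))) \<in> borel_measurable seeds" by (rule borel_measurable_enn2real)
    then show meas: "(\<lambda>\<omega>. val (freeze c \<omega>) f) \<in> borel_measurable seeds"
      by (simp add: ev0[OF fc])
    have "ennreal (val c f) = (\<Sum>t. \<integral>\<^sup>+z. indicator (- {xb}) (fst z) * ennreal (f z) \<partial>pair_law c t)"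
      unfolding ev[OF c] by (rule nn_integral_occ[OF c]) measurable
    also have "\<dots> = (\<integral>\<^sup>+\<omega>. ennreal (val (freeze c \<omega>) f) \<partial>seeds)"
      unfolding ef pair_law_seeds(2)[OF c m] by (rule nn_integral_suminf[symmetric]) (rule pair_law_seeds(1)[OF c m])
    finally have ec: "ennreal (val c f) = (\<integral>\<^sup>+\<omega>. ennreal (val (freeze c \<omega>) f) \<partial>seeds)" .
    show "val c f = (\<integral>\<omega>. val (freeze c \<omega>) f \<partial>seeds)"
      using meas ev0[OF fc] ev0[OF c]
      by (subst integral_eq_nn_integral) (auto simp: ec[symmetric])
  qed
  note s = val_shift[OF c g]
  have p1: "(\<lambda>\<omega>. val (freeze c \<omega>) (\<lambda>z. g z + B)) \<in> borel_measurable seeds"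
    "val c (\<lambda>z. g z + B) = (\<integral>\<omega>. val (freeze c \<omega>) (\<lambda>z. g z + B) \<partial>seeds)"
    using *[OF s(3) s(5)] by auto
  have p2: "(\<lambda>\<omega>. val (freeze c \<omega>) (\<lambda>_. B)) \<in> borel_measurable seeds"
    "val c (\<lambda>_. B) = (\<integral>\<omega>. val (freeze c \<omega>) (\<lambda>_. B) \<partial>seeds)"
    using *[OF s(4)] bfun_nonneg[OF g] by auto
  have v: "val (freeze c \<omega>) g = val (freeze c \<omega>) (\<lambda>z. g z + B) - val (freeze c \<omega>) (\<lambda>_. B)" for \<omega>
    by (rule val_shift(1)[OF fc g])
  show "(\<lambda>\<omega>. val (freeze c \<omega>) g) \<in> borel_measurable seeds" unfolding v using p1 p2 by simp
  have i1: "integrable seeds (\<lambda>\<omega>. val (freeze c \<omega>) (\<lambda>z. g z + B))"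
    by (rule S.P.integrable_const_bound[where B="2 * B * tail 0"]) (use val_shift(2)[OF fc s(3)] p1 in auto)
  have i2: "integrable seeds (\<lambda>\<omega>. val (freeze c \<omega>) (\<lambda>_. B))"
    by (rule S.P.integrable_const_bound[where B="2 * B * tail 0"]) (use val_shift(2)[OF fc s(4)] p2 in auto)
  show "val c g = (\<integral>\<omega>. val (freeze c \<omega>) g \<partial>seeds)"
    unfolding v s(1) p1(2) p2(2) by (rule Bochner_Integration.integral_diff[OF i1 i2, symmetric])
qed

lemma val_in_convex_hull_pure:
  fixes g :: "'k::finite \<Rightarrow> 'x \<times> 'a \<Rightarrow> real"
  assumes c: "c \<in> plans" and g: "range g \<subseteq> bfun B"
  shows "(\<chi> k. val c (g k)) \<in> convex hull ((\<lambda>d. \<chi> k. val d (g k)) ` pure_plans)"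
proof -
  interpret S: sequence_space unif ..
  note fc = freeze_controls[OF c]
  have gk: "g k \<in> bfun B" for k using g by auto
  let ?f = "\<lambda>\<omega>. \<chi> k. val (freeze c \<omega>) (g k)"
  have int: "integrable seeds (\<lambda>\<omega>. val (freeze c \<omega>) (g k))" for k
    by (rule S.P.integrable_const_bound[where B="B * tail 0"])
      (use val_shift(2)[OF fc gk] val_seeds(1)[OF c gk] in auto)
  have sum: "?f = (\<lambda>\<omega>. \<Sum>k\<in>UNIV. val (freeze c \<omega>) (g k) *\<^sub>R axis k 1)"
    by (auto simp: fun_eq_iff vec_eq_iff axis_def if_distrib sum.If_cases cong: if_cong)
  have "integrable seeds ?f" unfolding sum using int by (intro Bochner_Integration.integrable_sum integrable_scaleR_left) auto
  moreover have "AE \<omega> in seeds. ?f \<omega> \<in> (\<lambda>d. \<chi> k. val d (g k)) ` pure_plans"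
    using freeze_pure[OF c] by (intro AE_I2 imageI)
  ultimately have "(\<integral>\<omega>. ?f \<omega> \<partial>seeds) \<in> convex hull ((\<lambda>d. \<chi> k. val d (g k)) ` pure_plans)"
    by (intro integral_in_convex_hull S.P.prob_space_axioms)
  moreover have "(\<integral>\<omega>. ?f \<omega> \<partial>seeds) = (\<Sum>k\<in>UNIV. val c (g k) *\<^sub>R axis k 1)"
    unfolding sum using int by (simp add: Bochner_Integration.integral_sum val_seeds(2)[OF c gk])
  moreover have "\<dots> = (\<chi> k. val c (g k))"
    by (auto simp: vec_eq_iff axis_def if_distrib sum.If_cases cong: if_cong)
  ultimately show ?thesis by simp
qed

end

section \<open>From plans to selectors\<close>

text \<open>The summands are rescaled to subprobability measures in order to mix them with the Giry monad.\<close>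

lemma finite_mixture_exists:
  fixes M :: "'k \<Rightarrow> 'b measure" and w :: "'k \<Rightarrow> real"
  assumes K: "finite K" and M: "\<And>k. k \<in> K \<Longrightarrow> finite_measure (M k)" "\<And>k. k \<in> K \<Longrightarrow> sets (M k) = sets N"
    and N: "space N \<noteq> {}"
  obtains Q where "sets Q = sets N"
    "\<And>f. f \<in> borel_measurable N \<Longrightarrow> (\<integral>\<^sup>+z. f z \<partial>Q) = (\<Sum>k\<in>K. ennreal (w k) * (\<integral>\<^sup>+z. f z \<partial>M k))"
proof (cases "K = {}")
  case True
  then show ?thesis by (intro that[of "null_measure N"]) (simp_all add: nn_integral_null_measure)
next
  case False
  \<comment> \<open>a positive number that bounds all total masses\<close>
  define T where "T = 1 + (\<Sum>k\<in>K. measure (M k) (space (M k)))"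
  have T: "0 < T" by (auto simp: T_def intro!: add_pos_nonneg sum_nonneg)
  have Tle: "measure (M k) (space (M k)) \<le> T" if "k \<in> K" for k
    using member_le_sum[OF that _ K, of "\<lambda>k. measure (M k) (space (M k))"] by (simp add: T_def)
  define L where "L k = scale_measure (ennreal (1 / T)) (M k)" for k
  have L: "L \<in> count_space K \<rightarrow>\<^sub>M subprob_algebra N"
  proof (rule measurable_count_space_eq1[THEN iffD2], rule Pi_I)
    fix k assume k: "k \<in> K"
    interpret finite_measure "M k" by (rule M(1)[OF k])
    have sp: "space (M k) = space N" by (rule sets_eq_imp_space_eq[OF M(2)[OF k]])
    have "emeasure (L k) (space (L k)) = ennreal (1 / T * measure (M k) (space (M k)))"
      using T by (simp only: L_def space_scale_measure emeasure_scale_measure emeasure_eq_measure) (simp only: ennreal_mult''[OF measure_nonneg])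
    also have "\<dots> \<le> ennreal 1" using Tle[OF k] T by (intro ennreal_leI) (simp add: field_simps)
    finally have le: "emeasure (L k) (space (L k)) \<le> 1" by simp
    then have "subprob_space (L k)" using N by (intro subprob_spaceI) (auto simp: L_def space_scale_measure sp)
    then show "L k \<in> space (subprob_algebra N)" by (simp add: space_subprob_algebra L_def M(2)[OF k])
  qed
  let ?D = "density (count_space K) (\<lambda>k. ennreal (T * w k))"
  have LD: "L \<in> ?D \<rightarrow>\<^sub>M subprob_algebra N" using L by (simp add: measurable_cong_sets[OF sets_density refl])
  show ?thesis
  proof (rule that)
    show "sets (?D \<bind> L) = sets N" using False by (intro sets_bind_measurable[OF LD]) simp
    fix f :: "'b \<Rightarrow> ennreal" assume f: "f \<in> borel_measurable N"
    have fL: "(\<lambda>k. \<integral>\<^sup>+z. f z \<partial>L k) \<in> borel_measurable (count_space K)" by simp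
    have "(\<integral>\<^sup>+z. f z \<partial>(?D \<bind> L)) = (\<integral>\<^sup>+k. \<integral>\<^sup>+z. f z \<partial>L k \<partial>?D)" by (rule nn_integral_bind[OF f LD])
    also have "\<dots> = (\<integral>\<^sup>+k. ennreal (T * w k) * (\<integral>\<^sup>+z. f z \<partial>L k) \<partial>count_space K)" by (intro nn_integral_density) auto
    also have "\<dots> = (\<Sum>k\<in>K. ennreal (T * w k) * (\<integral>\<^sup>+z. f z \<partial>L k))" using K by (rule nn_integral_count_space_finite)
    also have "\<dots> = (\<Sum>k\<in>K. ennreal (w k) * (\<integral>\<^sup>+z. f z \<partial>M k))"
    proof (rule sum.cong[OF refl])
      fix k assume k: "k \<in> K"
      have "f \<in> borel_measurable (M k)" using f by (simp add: measurable_cong_sets[OF M(2)[OF k] refl])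
      then have "(\<integral>\<^sup>+z. f z \<partial>L k) = ennreal (1 / T) * (\<integral>\<^sup>+z. f z \<partial>M k)"
        unfolding L_def by (rule nn_integral_scale_measure)
      moreover have "ennreal (T * w k) * ennreal (1 / T) = ennreal (w k)"
        using T by (subst ennreal_mult''[symmetric]) auto
      ultimately show "ennreal (T * w k) * (\<integral>\<^sup>+z. f z \<partial>L k) = ennreal (w k) * (\<integral>\<^sup>+z. f z \<partial>M k)"
        by (simp add: mult.assoc[symmetric])
    qed
    finally show "(\<integral>\<^sup>+z. f z \<partial>(?D \<bind> L)) = (\<Sum>k\<in>K. ennreal (w k) * (\<integral>\<^sup>+z. f z \<partial>M k))" .
  qed
qed

context control_base begin

text \<open>In almost every state the countably many actions \<open>\<psi> n x\<close> carry the whole law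
  of the action, so those of positive probability do as well. Every other outcome is replaced by
  the first action of positive probability, and in exceptional states by a fixed action.\<close>

lemma atomic_version:
  assumes Q: "finite_measure Q" "sets Q = sets (X \<Otimes>\<^sub>M A)" and c: "c \<in> controls"
    and cQ: "act_law X A (distr Q X fst) c = Q"
    and \<psi>: "\<And>n::nat. \<psi> n \<in> selectors" and ae: "AE z in Q. \<exists>n. snd z = \<psi> n (fst z)"
  shows "\<exists>\<sigma>\<in>controls. act_law X A (distr Q X fst) \<sigma> = Q \<and>
    (\<forall>x\<in>space X. \<forall>u. 0 < measure unif {u'. \<sigma> (x, u') = \<sigma> (x, u)})"
proof -
  interpret Q: finite_measure Q by fact
  note [measurable_cong] = Q(2)
  have "\<exists>s. s \<in> selectors" using selector by (simp add: selectors_def Bex_def)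
  then obtain s where s: "s \<in> selectors" by blast
  note [measurable] = controls_measurable[OF c] selectors_measurable[OF \<psi>] selectors_measurable[OF s]
  define q where "q = distr Q X fst"
  have sets_q[measurable_cong]: "sets q = sets X" and space_q: "space q = space X" by (simp_all add: q_def)
  interpret q: finite_measure q unfolding q_def by (rule Q.finite_measure_distr) measurable
  interpret qU: pair_sigma_finite q unif ..
  have ceq: "Measurable.pred (X \<Otimes>\<^sub>M borel) (\<lambda>z. c z = \<psi> n (fst z))" for n by (rule sets_eq_maps) measurable
  define pos where "pos n x \<longleftrightarrow> 0 < measure unif {u. c (x, u) = \<psi> n x}" for n x
  have pos[measurable]: "Measurable.pred X (pos n)" for n
  proof -
    have [measurable]: "(\<lambda>x. measure unif {u. c (x, u) = \<psi> n x}) \<in> borel_measurable X"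
      using measurable_section_measure[OF ceq] by simp
    show ?thesis unfolding pos_def[abs_def] by measurable
  qed
  define hit where "hit z \<longleftrightarrow> (\<exists>n. pos n (fst z) \<and> c z = \<psi> n (fst z))" for z
  have hit[measurable]: "Measurable.pred (X \<Otimes>\<^sub>M borel) hit"
  proof -
    have "Measurable.pred (X \<Otimes>\<^sub>M borel) (\<lambda>z. pos n (fst z))" for n
      by (rule measurable_compose[OF measurable_fst pos])
    then show ?thesis
      unfolding hit_def[abs_def] by (intro pred_intros_countable pred_intros_logic ceq)
  qed
  define good where "good x \<longleftrightarrow> measure unif {u. hit (x, u)} = 1" for x
  have good[measurable]: "Measurable.pred X good"
  proof -
    have [measurable]: "(\<lambda>x. measure unif {u. hit (x, u)}) \<in> borel_measurable X"
      by (rule measurable_section_measure[OF hit])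
    show ?thesis unfolding good_def[abs_def] by measurable
  qed
  have good_iff: "good x \<longleftrightarrow> (AE u in unif. hit (x, u))" if "x \<in> space X" for x
    using unif.AE_in_set_eq_1[OF measurable_section[OF hit that]] by (simp add: good_def)
  have AE_good: "AE x in q. good x"
  proof -
    have eqm: "Measurable.pred (X \<Otimes>\<^sub>M A) (\<lambda>z. snd z = \<psi> n (fst z))" for n by (rule sets_eq_maps) measurable
    have "AE z in act_law X A q c. \<exists>n. snd z = \<psi> n (fst z)" using ae unfolding q_def cQ .
    then have "AE z in q \<Otimes>\<^sub>M unif. \<exists>n. c z = \<psi> n (fst z)"
      unfolding act_law_def using eqm by (subst (asm) AE_distr_iff) (simp_all, measurable)
    then have "AE x in q. AE u in unif. \<exists>n. c (x, u) = \<psi> n x" by (auto dest!: qU.AE_pair)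
    then show ?thesis using AE_space
    proof eventually_elim
      case (elim x)
      then have x: "x \<in> space X" by (simp add: space_q)
      have "AE u in unif. c (x, u) = \<psi> n x \<longrightarrow> pos n x" for n
      proof (cases "pos n x")
        case False
        then have "measure unif {u. c (x, u) = \<psi> n x} = 0" unfolding pos_def using measure_nonneg[of unif] by (simp add: not_less order_antisym)
        then have "{u. c (x, u) = \<psi> n x} \<in> null_sets unif"
          using measurable_section[OF ceq x] by (simp add: null_sets_def unif.emeasure_eq_measure)
        from AE_not_in[OF this] have "AE u in unif. c (x, u) \<noteq> \<psi> n x" by simp
        then show ?thesis by eventually_elim simp
      qed simp
      then have "AE u in unif. \<forall>n. c (x, u) = \<psi> n x \<longrightarrow> pos n x" by (simp add: AE_all_countable)
      with elim(1) have "AE u in unif. hit (x, u)" by eventually_elim (auto simp: hit_def)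
      then show ?case by (simp add: good_iff[OF x])
    qed
  qed
  \<comment> \<open>the first atom, as a replacement action that is an atom as well\<close>
  define fb where "fb x = (if \<exists>n. pos n x then \<psi> (LEAST n. pos n x) x else s x)" for x
  have fb[measurable]: "fb \<in> X \<rightarrow>\<^sub>M A"
  proof -
    have "(\<lambda>x. LEAST n. pos n x) \<in> X \<rightarrow>\<^sub>M count_space UNIV" by measurable
    then have [measurable]: "(\<lambda>x. \<psi> (LEAST n. pos n x) x) \<in> X \<rightarrow>\<^sub>M A"
      by (rule measurable_compose_countable[rotated]) measurable
    show ?thesis unfolding fb_def[abs_def] by measurable
  qed
  define \<sigma> where "\<sigma> z = (if good (fst z) then if hit z then c z else fb (fst z) else s (fst z))" for z
  have \<sigma>_meas[measurable]: "\<sigma> \<in> X \<Otimes>\<^sub>M borel \<rightarrow>\<^sub>M A" unfolding \<sigma>_def[abs_def] by measurable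
  have \<sigma>: "\<sigma> \<in> controls"
    using controls_Act[OF c] \<psi> s by (auto simp: controls_def \<sigma>_def fb_def selectors_def)
  have "0 < measure unif {u'. \<sigma> (x, u') = \<sigma> (x, u)}" if x: "x \<in> space X" for x u
  proof (cases "good x")
    case True
    then have "{u. hit (x, u)} \<noteq> {}" unfolding good_def by (intro notI) simp
    then have ex: "\<exists>n. pos n x" by (auto simp: hit_def)
    obtain n where n: "pos n x" "\<sigma> (x, u) = \<psi> n x"
    proof (cases "hit (x, u)")
      case True
      then obtain m where "pos m x" "c (x, u) = \<psi> m x" by (auto simp: hit_def)
      with True \<open>good x\<close> show ?thesis by (intro that[of m]) (auto simp: \<sigma>_def)
    next
      case False
      with \<open>good x\<close> ex show ?thesis
        by (intro that[of "LEAST n. pos n x"]) (auto simp: \<sigma>_def fb_def intro: LeastI)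
    qed
    have \<sigma>eq: "Measurable.pred (X \<Otimes>\<^sub>M borel) (\<lambda>z. \<sigma> z = \<psi> n (fst z))" by (rule sets_eq_maps) measurable
    have "measure unif {u'. \<sigma> (x, u') = \<psi> n x} = measure unif {u'. c (x, u') = \<psi> n x}"
    proof (rule unif.finite_measure_eq_AE)
      have "AE u in unif. hit (x, u)" using True by (simp add: good_iff[OF x])
      then show "AE u' in unif. u' \<in> {u'. \<sigma> (x, u') = \<psi> n x} \<longleftrightarrow> u' \<in> {u'. c (x, u') = \<psi> n x}"
        by eventually_elim (use True in \<open>simp add: \<sigma>_def\<close>)
    qed (use measurable_section[OF \<sigma>eq x] measurable_section[OF ceq x] in auto)
    then show ?thesis using n by (simp add: pos_def)
  next
    case False
    then have "{u'. \<sigma> (x, u') = \<sigma> (x, u)} = UNIV" by (auto simp: \<sigma>_def)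
    then show ?thesis using unif.prob_space by simp
  qed
  moreover have "act_law X A q \<sigma> = Q"
  proof -
    have e: "Measurable.pred (q \<Otimes>\<^sub>M unif) (\<lambda>z. \<sigma> z = c z)" by (rule sets_eq_maps) measurable
    have "AE x in q. AE u in unif. \<sigma> (x, u) = c (x, u)"
      using AE_good AE_space
    proof eventually_elim
      case (elim x)
      then have "AE u in unif. hit (x, u)" using good_iff by (simp add: space_q)
      then show ?case by eventually_elim (use elim(1) in \<open>simp add: \<sigma>_def\<close>)
    qed
    then have "AE z in q \<Otimes>\<^sub>M unif. \<sigma> z = c z"
      using e by (intro qU.AE_pair_measure) (auto simp: pred_def)
    then have "act_law X A q \<sigma> = act_law X A q c"
      unfolding act_law_def by (intro distr_cong_AE refl) (auto elim!: eventually_mono)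
    then show ?thesis using cQ by (simp add: q_def)
  qed
  ultimately show ?thesis using \<sigma> unfolding q_def by blast
qed

end

context control_model begin

text \<open>The mixture of the occupation measures inherits the balance equation and transience. It is
  carried by the countably many selectors that occur in the given plans, and so it comes from an
  atomic control. Restricting the available actions to its atoms yields an atomic model in which
  a selector attains the same values.\<close>

lemma mixture_attained:
  fixes g :: "'k::finite \<Rightarrow> 'x \<times> 'a \<Rightarrow> real" and d :: "'i \<Rightarrow> nat \<Rightarrow> 'x \<times> real \<Rightarrow> 'a"
  assumes K: "finite K" and d: "\<And>k. k \<in> K \<Longrightarrow> d k \<in> pure_plans"
    and w: "\<And>k. k \<in> K \<Longrightarrow> 0 \<le> w k" "(\<Sum>k\<in>K. w k) = 1" and g: "range g \<subseteq> bfun B"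
  shows "\<exists>\<phi>\<in>selectors. \<forall>j. val (\<lambda>_. pure \<phi>) (g j) = (\<Sum>k\<in>K. w k * val (d k) (g j))"
proof -
  have gj: "g j \<in> bfun B" for j using g by auto
  have dp: "d k \<in> plans" if "k \<in> K" for k using d[OF that] pure_plans_subset by blast
  obtain s where "\<forall>x\<in>space X. s x \<in> Act x" using selector by blast
  then have "s xb \<in> space A" using xb Act_space by blast
  then have ne: "space (X \<Otimes>\<^sub>M A) \<noteq> {}" using xb by (auto simp: space_pair_measure)
  obtain Q where sets_Q[measurable_cong]: "sets Q = sets (X \<Otimes>\<^sub>M A)"
    and nnQ: "\<And>f. f \<in> borel_measurable (X \<Otimes>\<^sub>M A) \<Longrightarrow> (\<integral>\<^sup>+z. f z \<partial>Q) = (\<Sum>k\<in>K. ennreal (w k) * (\<integral>\<^sup>+z. f z \<partial>occ (d k)))"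
    by (rule finite_mixture_exists[where w=w and M="\<lambda>k. occ (d k)", OF K finite_measure_occ[OF dp] sets_occ[OF dp] ne that])
  have sp: "space Q = space (X \<Otimes>\<^sub>M A)" by (rule sets_eq_imp_space_eq[OF sets_Q])
  have sum_w: "(\<Sum>k\<in>K. ennreal (w k)) = 1" using w by (simp add: sum_ennreal)
  have fin: "finite_measure Q"
  proof (rule finite_measureI)
    have "emeasure Q (space Q) = (\<integral>\<^sup>+z. 1 \<partial>Q)" by simp
    also have "\<dots> = (\<Sum>k\<in>K. ennreal (w k) * (\<integral>\<^sup>+z. 1 \<partial>occ (d k)))" by (rule nnQ) simp
    also have "\<dots> \<noteq> \<infinity>"
      using finite_measure.emeasure_finite[OF finite_measure_occ[OF dp]] K by (auto simp: ennreal_mult_eq_top_iff)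
    finally show "emeasure Q (space Q) \<noteq> \<infinity>" .
  qed
  have AE_Q: "AE z in Q. P z" if P: "Measurable.pred (X \<Otimes>\<^sub>M A) P" and "\<And>k. k \<in> K \<Longrightarrow> AE z in occ (d k). P z" for P
  proof -
    let ?N = "{z\<in>space (X \<Otimes>\<^sub>M A). \<not> P z}"
    have N: "?N \<in> sets (X \<Otimes>\<^sub>M A)" using P by measurable
    have "emeasure Q ?N = (\<integral>\<^sup>+z. indicator ?N z \<partial>Q)" using N by (simp add: sets_Q)
    also have "\<dots> = (\<Sum>k\<in>K. ennreal (w k) * (\<integral>\<^sup>+z. indicator ?N z \<partial>occ (d k)))" using N by (intro nnQ) simp
    also have "\<dots> = 0"
    proof (intro sum.neutral ballI)
      fix k assume k: "k \<in> K"
      have "(\<integral>\<^sup>+z. indicator ?N z \<partial>occ (d k)) = 0"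
        using N that(2)[OF k]
        by (subst nn_integral_0_iff_AE)
           (auto simp: measurable_cong_sets[OF sets_occ[OF dp[OF k]] refl] indicator_def elim!: eventually_mono)
      then show "ennreal (w k) * (\<integral>\<^sup>+z. indicator ?N z \<partial>occ (d k)) = 0" by simp
    qed
    finally show ?thesis using N by (intro AE_I[where N="?N"]) (auto simp: sp sets_Q)
  qed
  have graph_Q: "AE z in Q. z \<in> Gr" by (rule AE_Q) (measurable, rule AE_occ_graph(1)[OF dp])
  have live_Q: "AE z in Q. fst z \<noteq> xb"
  proof (rule AE_Q)
    have "Measurable.pred (X \<Otimes>\<^sub>M A) (\<lambda>z. fst z \<notin> {xb})" by measurable
    then show "Measurable.pred (X \<Otimes>\<^sub>M A) (\<lambda>z. fst z \<noteq> xb)" by simp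
  qed (rule AE_occ_graph(2)[OF dp])
  have bal: "balanced Q"
    unfolding balanced_def
  proof (intro ballI impI)
    fix h :: "'x \<Rightarrow> ennreal" assume h[measurable]: "h \<in> borel_measurable X" and h0: "h xb = 0" "\<forall>x\<in>space X. h x \<le> 1"
    let ?m = "\<integral>\<^sup>+x. h x \<partial>\<mu>"
    have "(\<integral>\<^sup>+z. h (fst z) \<partial>Q) = (\<Sum>k\<in>K. ennreal (w k) * (\<integral>\<^sup>+z. h (fst z) \<partial>occ (d k)))" by (rule nnQ) measurable
    also have "\<dots> = (\<Sum>k\<in>K. ennreal (w k) * ?m + ennreal (w k) * (\<integral>\<^sup>+z. \<integral>\<^sup>+y. h y \<partial>p z \<partial>occ (d k)))"
      using balanced_occ[OF dp] h h0 by (intro sum.cong refl) (simp add: balanced_def distrib_left)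
    also have "\<dots> = ?m + (\<Sum>k\<in>K. ennreal (w k) * (\<integral>\<^sup>+z. \<integral>\<^sup>+y. h y \<partial>p z \<partial>occ (d k)))"
      by (simp add: sum.distrib sum_distrib_right[symmetric] sum_w)
    also have "(\<Sum>k\<in>K. ennreal (w k) * (\<integral>\<^sup>+z. \<integral>\<^sup>+y. h y \<partial>p z \<partial>occ (d k))) = (\<integral>\<^sup>+z. \<integral>\<^sup>+y. h y \<partial>p z \<partial>Q)"
      by (rule nnQ[symmetric]) measurable
    finally show "(\<integral>\<^sup>+z. h (fst z) \<partial>Q) = ?m + (\<integral>\<^sup>+z. \<integral>\<^sup>+y. h y \<partial>p z \<partial>Q)" .
  qed
  have trans: "transient (distr Q X fst)"
    unfolding transient_def
  proof
    fix c assume c: "c \<in> controls"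
    note [measurable] = measurable_stay[OF c]
    have "AE z in Q. (\<Sum>n. stay c n (fst z)) < \<infinity>"
    proof (rule AE_Q)
      fix k assume k: "k \<in> K"
      have "AE x in distr (occ (d k)) X fst. (\<Sum>n. stay c n x) < \<infinity>"
        using transient_occ[OF dp[OF k]] c by (simp add: transient_def)
      moreover have "fst \<in> occ (d k) \<rightarrow>\<^sub>M X" by (simp add: measurable_cong_sets[OF sets_occ[OF dp[OF k]] refl])
      ultimately show "AE z in occ (d k). (\<Sum>n. stay c n (fst z)) < \<infinity>"
        by (subst (asm) AE_distr_iff) auto
    qed measurable
    then show "AE x in distr Q X fst. (\<Sum>n. stay c n x) < \<infinity>" by (subst AE_distr_iff) auto
  qed
  obtain c where c: "c \<in> controls" "act_law X A (distr Q X fst) c = Q"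
    using realize_balanced[OF fin sets_Q graph_Q live_Q bal trans] by blast
  have "\<exists>\<psi>. \<forall>k\<in>K. \<forall>t. \<psi> k t \<in> selectors \<and> d k t = pure (\<psi> k t)"
    using d unfolding pure_plans_def by (intro bchoice) (auto intro!: choice)
  then obtain \<psi> where \<psi>: "\<And>k t. k \<in> K \<Longrightarrow> \<psi> k t \<in> selectors" "\<And>k t. k \<in> K \<Longrightarrow> d k t = pure (\<psi> k t)" by blast
  define S where "S = (\<lambda>(k, t). \<psi> k t) ` (K \<times> (UNIV :: nat set))"
  have S: "countable S" unfolding S_def by (intro countable_image countable_SIGMA countable_finite[OF K]) simp
  have S': "S \<noteq> {}" "S \<subseteq> selectors" using w(2) \<psi>(1) by (auto simp: S_def)
  define \<psi>s where "\<psi>s = from_nat_into S"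
  have \<psi>s: "\<psi>s n \<in> selectors" for n using S'(2) from_nat_into[OF S'(1), of n] by (auto simp: \<psi>s_def)
  note [measurable] = selectors_measurable[OF \<psi>s]
  have eqm: "Measurable.pred (X \<Otimes>\<^sub>M A) (\<lambda>z. snd z = \<psi>s n (fst z))" for n by (rule sets_eq_maps) measurable
  have "AE z in Q. \<exists>n. snd z = \<psi>s n (fst z)"
  proof (rule AE_Q)
    fix k assume k: "k \<in> K"
    show "AE z in occ (d k). \<exists>n. snd z = \<psi>s n (fst z)"
    proof (rule AE_occI[OF dp[OF k]])
      fix t
      have "\<psi> k t \<in> S" using k by (auto simp: S_def)
      then obtain n where n: "\<psi>s n = \<psi> k t" using from_nat_into_surj[OF S] unfolding \<psi>s_def by blast
      note [measurable] = plans_measurable[OF dp[OF k]]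
      note [measurable_cong] = sets_law[OF dp[OF k]]
      have m: "(\<lambda>z. (fst z, d k t z)) \<in> law (d k) t \<Otimes>\<^sub>M unif \<rightarrow>\<^sub>M X \<Otimes>\<^sub>M A" by measurable
      have P: "{z \<in> space (X \<Otimes>\<^sub>M A). \<exists>n. snd z = \<psi>s n (fst z)} \<in> sets (X \<Otimes>\<^sub>M A)"
        by (rule pred_def[THEN iffD1]) (intro pred_intros_countable eqm)
      have "snd (fst z, d k t z) = \<psi>s n (fst (fst z, d k t z))" for z by (simp add: n \<psi>(2)[OF k])
      then have "AE z in law (d k) t \<Otimes>\<^sub>M unif. \<exists>n. snd (fst z, d k t z) = \<psi>s n (fst (fst z, d k t z))"
        by (intro AE_I2 exI)
      then have "AE z in pair_law (d k) t. \<exists>n. snd z = \<psi>s n (fst z)"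
        unfolding pair_law_def act_law_def by (subst AE_distr_iff[OF m P])
      then show "AE z in pair_law (d k) t. fst z \<noteq> xb \<longrightarrow> (\<exists>n. snd z = \<psi>s n (fst z))" by (auto elim!: eventually_mono)
    qed (use eqm in measurable)
  qed (use eqm in measurable)
  from atomic_version[OF fin sets_Q c \<psi>s this] obtain \<sigma> where \<sigma>: "\<sigma> \<in> controls"
    and \<sigma>Q: "act_law X A (distr Q X fst) \<sigma> = Q"
    and pos: "\<And>x u. x \<in> space X \<Longrightarrow> 0 < measure unif {u'. \<sigma> (x, u') = \<sigma> (x, u)}" by blast
  have \<sigma>p: "(\<lambda>_. \<sigma>) \<in> plans" using \<sigma> by simp
  have occ\<sigma>: "occ (\<lambda>_. \<sigma>) = Q" by (rule occ_eq_if_balanced[OF fin sets_Q live_Q bal trans \<sigma> \<sigma>Q])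
  \<comment> \<open>only the atoms of \<open>\<sigma>\<close> remain available\<close>
  define Act' where "Act' x = {a \<in> Act x. 0 < measure unif {u. \<sigma> (x, u) = a}}" for x
  note [measurable] = controls_measurable[OF \<sigma>]
  have Act'_graph: "{(x, a). x \<in> space X \<and> a \<in> Act' x} \<in> sets (X \<Otimes>\<^sub>M A)"
  proof -
    have "Measurable.pred ((X \<Otimes>\<^sub>M A) \<Otimes>\<^sub>M borel) (\<lambda>y. \<sigma> (fst (fst y), snd y) = snd (fst y))" by (rule sets_eq_maps) measurable
    from measurable_section_measure[OF this]
    have [measurable]: "(\<lambda>z. measure unif {u. \<sigma> (fst z, u) = snd z}) \<in> borel_measurable (X \<Otimes>\<^sub>M A)" by simp
    have "{(x, a). x \<in> space X \<and> a \<in> Act' x} = Gr \<inter> {z \<in> space (X \<Otimes>\<^sub>M A). 0 < measure unif {u. \<sigma> (fst z, u) = snd z}}"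
      using Act_space by (auto simp: Gr_def Act'_def space_pair_measure)
    also have "\<dots> \<in> sets (X \<Otimes>\<^sub>M A)" by measurable
    finally show ?thesis .
  qed
  have \<sigma>_Act': "\<sigma> (x, u) \<in> Act' x" if "x \<in> space X" for x u
    using controls_Act[OF \<sigma> that] pos[OF that] by (simp add: Act'_def)
  interpret C: control_base X A Act' p \<mu> xb
  proof
    show "\<exists>s\<in>X \<rightarrow>\<^sub>M A. \<forall>x\<in>space X. s x \<in> Act' x"
    proof (rule bexI)
      show "\<forall>x\<in>space X. \<sigma> (x, 0) \<in> Act' x" using \<sigma>_Act' by blast
    qed measurable
  qed (use X_retract A_retract Act'_graph absorb in \<open>auto simp: Act'_def\<close>)
  have C_controls: "C.controls \<subseteq> controls" by (auto simp: C.controls_def controls_def Act'_def)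
  have C_plans: "C.plans \<subseteq> plans" using C_controls by (auto simp: C.plans_def plans_def)
  interpret C: atomic_model X A Act' p \<mu> xb tail \<sigma>
  proof
    show "tail \<longlonglongrightarrow> 0" by (rule tail_lim)
    show "(\<Sum>t\<in>{n..<N}. C.alive c t) \<le> tail n" if "c \<in> C.plans" for c n N
      using tail_bound that C_plans by blast
    show "\<sigma> \<in> C.controls" using \<sigma>_Act' by (simp add: C.controls_def)
  qed (use init_atomless step_atomless in \<open>auto simp: Act'_def\<close>)
  obtain \<phi> where \<phi>: "\<phi> \<in> C.selectors" and eq: "\<And>j. val (\<lambda>_. pure \<phi>) (g j) = val (\<lambda>_. \<sigma>) (g j)"
    using C.atomic_attained[OF g] by blast
  have val_mix: "val (\<lambda>_. \<sigma>) f = (\<Sum>k\<in>K. w k * val (d k) f)" if f: "f \<in> bfun D" "\<And>z. z \<in> space (X \<Otimes>\<^sub>M A) \<Longrightarrow> 0 \<le> f z" for f D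
  proof -
    note [measurable] = bfun_measurable[OF f(1)]
    have v0: "0 \<le> val (d k) f" if "k \<in> K" for k using ennreal_val(2)[OF dp[OF that] f] .
    have "ennreal (val (\<lambda>_. \<sigma>) f) = (\<integral>\<^sup>+z. ennreal (f z) \<partial>Q)" using ennreal_val(1)[OF \<sigma>p f] by (simp add: occ\<sigma>)
    also have "\<dots> = (\<Sum>k\<in>K. ennreal (w k) * (\<integral>\<^sup>+z. ennreal (f z) \<partial>occ (d k)))" by (rule nnQ) measurable
    also have "\<dots> = (\<Sum>k\<in>K. ennreal (w k * val (d k) f))"
      using ennreal_val(1)[OF dp f] v0 w(1) by (intro sum.cong refl) (simp add: ennreal_mult)
    also have "\<dots> = ennreal (\<Sum>k\<in>K. w k * val (d k) f)" using v0 w(1) by (intro sum_ennreal) auto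
    finally show ?thesis
      using ennreal_val(2)[OF \<sigma>p f] v0 w(1) by (subst (asm) ennreal_inj) (auto intro!: sum_nonneg)
  qed
  have "val (\<lambda>_. \<sigma>) (g j) = (\<Sum>k\<in>K. w k * val (d k) (g j))" for j
  proof -
    have "val (\<lambda>_. \<sigma>) (g j) = (\<Sum>k\<in>K. w k * val (d k) (\<lambda>z. g j z + B)) - (\<Sum>k\<in>K. w k * val (d k) (\<lambda>_. B))"
      unfolding val_shift(1)[OF \<sigma>p gj]
      using val_mix[OF val_shift(3,5)[OF \<sigma>p gj]] val_mix[OF val_shift(4)[OF \<sigma>p gj]] bfun_nonneg[OF gj] by simp
    also have "\<dots> = (\<Sum>k\<in>K. w k * val (d k) (g j))"
      unfolding sum_subtractf[symmetric] using val_shift(1)[OF dp gj]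
      by (intro sum.cong refl) (simp add: right_diff_distrib)
    finally show ?thesis .
  qed
  moreover have "\<phi> \<in> selectors" using \<phi> by (auto simp: C.selectors_def selectors_def Act'_def)
  ultimately show ?thesis using eq by auto
qed

text \<open>The value vector of a plan is a finite convex combination of value vectors of nonrandomized
  Markov plans.\<close>

theorem plan_attained_by_selector:
  fixes g :: "'k::finite \<Rightarrow> 'x \<times> 'a \<Rightarrow> real"
  assumes c: "c \<in> plans" and g: "range g \<subseteq> bfun B"
  shows "\<exists>\<phi>\<in>selectors. \<forall>j. val (\<lambda>_. pure \<phi>) (g j) = val c (g j)"
proof -
  let ?V = "\<lambda>d. \<chi> k. val d (g k)"
  obtain S w where S: "finite S" "S \<subseteq> ?V ` pure_plans" "\<forall>v\<in>S. 0 \<le> w v" "sum w S = 1"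
    and v: "(\<Sum>v\<in>S. w v *\<^sub>R v) = ?V c"
    using val_in_convex_hull_pure[OF c g] unfolding convex_hull_explicit by blast
  have "\<exists>d. \<forall>v\<in>S. d v \<in> pure_plans \<and> ?V (d v) = v" using S(2) by (intro bchoice) blast
  then obtain d where d: "\<And>v. v \<in> S \<Longrightarrow> d v \<in> pure_plans" "\<And>v. v \<in> S \<Longrightarrow> ?V (d v) = v" by blast
  obtain \<phi> where \<phi>: "\<phi> \<in> selectors" "\<And>j. val (\<lambda>_. pure \<phi>) (g j) = (\<Sum>v\<in>S. w v * val (d v) (g j))"
    using mixture_attained[OF S(1), of d w, OF d(1) _ S(4) g] S(3) by blast
  have "(\<Sum>v\<in>S. w v * val (d v) (g j)) = val c (g j)" for j
  proof -
    have "(\<Sum>v\<in>S. w v * val (d v) (g j)) = (\<Sum>v\<in>S. w v * ?V (d v) $ j)" by simp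
    also have "\<dots> = (\<Sum>v\<in>S. w v *\<^sub>R v) $ j" using d(2) by simp
    also have "\<dots> = val c (g j)" by (simp add: v)
    finally show ?thesis .
  qed
  then show ?thesis using \<phi> by auto
qed

end

section \<open>Laws of state-action pairs under a policy\<close>

context mdp begin

definition history_law :: "(nat \<Rightarrow> (nat \<Rightarrow> 'x \<times> 'a) \<times> 'x \<Rightarrow> 'a measure) \<Rightarrow> nat \<Rightarrow> (nat \<Rightarrow> 'x \<times> 'a) measure" where
  "history_law \<pi> n = Ionescu_Tulcea.C (step_kernel \<pi>) (\<lambda>_. X \<Otimes>\<^sub>M A) 0 n (\<lambda>_. undefined)"

definition coord_law :: "(nat \<Rightarrow> (nat \<Rightarrow> 'x \<times> 'a) \<times> 'x \<Rightarrow> 'a measure) \<Rightarrow> nat \<Rightarrow> ('x \<times> 'a) measure" where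
  "coord_law \<pi> t = distr (trajectory_law \<pi>) (X \<Otimes>\<^sub>M A) (\<lambda>\<omega>. \<omega> t)"

context
  fixes \<pi> assumes \<pi>: "\<pi> \<in> policies"
begin

interpretation IT: Ionescu_Tulcea "step_kernel \<pi>" "\<lambda>_. X \<Otimes>\<^sub>M A"
  by (rule Ionescu_Tulcea_step_kernel[OF \<pi>])

lemma sets_trajectory_law[measurable_cong]: "sets (trajectory_law \<pi>) = sets (PiM UNIV (\<lambda>_. X \<Otimes>\<^sub>M A))"
  unfolding trajectory_law_def by (rule IT.PF.sets_lim)

lemma policy_kernel: "\<pi> t \<in> (\<Pi>\<^sub>M i\<in>{0..<t}. X \<Otimes>\<^sub>M A) \<Otimes>\<^sub>M X \<rightarrow>\<^sub>M prob_algebra A"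
  using \<pi> by (auto simp: policies_def histories_def)

lemma distr_trajectory_history:
  "distr (trajectory_law \<pi>) (PiM {0..<n} (\<lambda>_. X \<Otimes>\<^sub>M A)) (\<lambda>\<omega>. restrict \<omega> {0..<n}) = history_law \<pi> n"
proof -
  have "n \<le> IT.up_to {0..<n}" using IT.up_to[of "{0..<n}"] by (cases n) (auto simp: subset_iff)
  from IT.distr_C[OF this, of "\<lambda>_. undefined" 0]
  have "IT.CI {0..<n} = history_law \<pi> n" unfolding IT.CI_def history_law_def by simp
  then show ?thesis unfolding trajectory_law_def by (simp add: IT.distr_lim)
qed

lemma nn_integral_trajectory_history:
  assumes [measurable]: "F \<in> borel_measurable (PiM {0..<n} (\<lambda>_. X \<Otimes>\<^sub>M A))"
  shows "(\<integral>\<^sup>+\<omega>. F (restrict \<omega> {0..<n}) \<partial>trajectory_law \<pi>) = (\<integral>\<^sup>+h. F h \<partial>history_law \<pi> n)"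
proof -
  have m: "(\<lambda>\<omega>. restrict \<omega> {0..<n}) \<in> trajectory_law \<pi> \<rightarrow>\<^sub>M PiM {0..<n} (\<lambda>_. X \<Otimes>\<^sub>M A)"
    unfolding measurable_cong_sets[OF sets_trajectory_law refl] by (rule measurable_restrict_subset) simp
  show ?thesis
    unfolding distr_trajectory_history[symmetric] using m assms by (subst nn_integral_distr) simp_all
qed

lemma prob_space_trajectory_law: "prob_space (trajectory_law \<pi>)"
proof (rule prob_spaceI)
  have "emeasure (trajectory_law \<pi>) (space (trajectory_law \<pi>)) = (\<integral>\<^sup>+\<omega>. 1 \<partial>trajectory_law \<pi>)" by simp
  also have "\<dots> = (\<integral>\<^sup>+h. 1 \<partial>history_law \<pi> 0)" by (rule nn_integral_trajectory_history) simp
  also have "\<dots> = 1"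
  proof -
    have "prob_space (history_law \<pi> 0)" unfolding history_law_def by (rule IT.prob_space_C) simp
    then show ?thesis by (simp add: prob_space.emeasure_space_1)
  qed
  finally show "emeasure (trajectory_law \<pi>) (space (trajectory_law \<pi>)) = 1" .
qed

lemma space_history_law: "space (history_law \<pi> n) = space (PiM {0..<n} (\<lambda>_. X \<Otimes>\<^sub>M A))"
  unfolding history_law_def by (subst IT.space_C) simp_all

lemma nn_integral_history_Suc:
  assumes F: "F \<in> borel_measurable (PiM {0..<Suc n} (\<lambda>_. X \<Otimes>\<^sub>M A))"
  shows "(\<integral>\<^sup>+h. F h \<partial>history_law \<pi> (Suc n)) = (\<integral>\<^sup>+h. \<integral>\<^sup>+z. F (fun_upd h n z) \<partial>step_kernel \<pi> n h \<partial>history_law \<pi> n)"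
proof -
  have m: "IT.eP n \<in> history_law \<pi> n \<rightarrow>\<^sub>M subprob_algebra (PiM {0..<Suc n} (\<lambda>_. X \<Otimes>\<^sub>M A))"
    unfolding history_law_def using IT.measurable_eP[of n]
    by (subst measurable_cong_sets[OF IT.sets_C refl]) simp_all
  have "(\<integral>\<^sup>+h. F h \<partial>history_law \<pi> (Suc n)) = (\<integral>\<^sup>+h. F h \<partial>(history_law \<pi> n \<bind> IT.eP n))"
    by (simp add: history_law_def)
  also have "\<dots> = (\<integral>\<^sup>+h. \<integral>\<^sup>+h'. F h' \<partial>IT.eP n h \<partial>history_law \<pi> n)" by (rule nn_integral_bind[OF F m])
  also have "\<dots> = (\<integral>\<^sup>+h. \<integral>\<^sup>+z. F (fun_upd h n z) \<partial>step_kernel \<pi> n h \<partial>history_law \<pi> n)"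
    by (intro nn_integral_cong IT.nn_integral_eP F) (simp add: space_history_law)
  finally show ?thesis .
qed

lemma nn_integral_step_kernel:
  assumes h: "h \<in> space (PiM {0..<n} (\<lambda>_. X \<Otimes>\<^sub>M A))" and f[measurable]: "f \<in> borel_measurable (X \<Otimes>\<^sub>M A)"
  shows "(\<integral>\<^sup>+z. f z \<partial>step_kernel \<pi> n h) =
    (\<integral>\<^sup>+x. \<integral>\<^sup>+a. f (x, a) \<partial>\<pi> n (h, x) \<partial>(if n = 0 then \<mu> else p (h (n - 1))))"
proof -
  note [measurable] = policy_kernel transition
  let ?\<nu> = "if n = 0 then \<mu> else p (h (n - 1))"
  have "?\<nu> \<in> space (prob_algebra X)"
  proof (cases "n = 0")
    case False
    then have "h (n - 1) \<in> space (X \<Otimes>\<^sub>M A)" using h by (auto simp: space_PiM PiE_iff)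
    then show ?thesis using False measurable_space[OF transition] by simp
  qed (simp add: initial)
  then have sets_\<nu>[measurable_cong]: "sets ?\<nu> = sets X" by (simp add: space_prob_algebra)
  have sp: "space ?\<nu> = space X" by (rule sets_eq_imp_space_eq[OF sets_\<nu>])
  note [measurable] = h
  have K: "(\<lambda>x. \<pi> n (h, x) \<bind> (\<lambda>a. return (X \<Otimes>\<^sub>M A) (x, a))) \<in> ?\<nu> \<rightarrow>\<^sub>M subprob_algebra (X \<Otimes>\<^sub>M A)"
  proof (rule measurable_prob_algebraD, rule measurable_bind_prob_space2[where N=A])
    have "(\<lambda>x. \<pi> n (h, x)) \<in> X \<rightarrow>\<^sub>M prob_algebra A" by measurable
    then show "(\<lambda>x. \<pi> n (h, x)) \<in> ?\<nu> \<rightarrow>\<^sub>M prob_algebra A" by (simp only: measurable_cong_sets[OF sets_\<nu> refl])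
    have "(\<lambda>(x, a). return (X \<Otimes>\<^sub>M A) (x, a)) \<in> X \<Otimes>\<^sub>M A \<rightarrow>\<^sub>M prob_algebra (X \<Otimes>\<^sub>M A)" by measurable
    then show "(\<lambda>(x, a). return (X \<Otimes>\<^sub>M A) (x, a)) \<in> ?\<nu> \<Otimes>\<^sub>M A \<rightarrow>\<^sub>M prob_algebra (X \<Otimes>\<^sub>M A)"
      by (simp only: measurable_cong_sets[OF sets_pair_measure_cong[OF sets_\<nu> refl] refl])
  qed
  have "(\<integral>\<^sup>+z. f z \<partial>step_kernel \<pi> n h) = (\<integral>\<^sup>+x. \<integral>\<^sup>+z. f z \<partial>(\<pi> n (h, x) \<bind> (\<lambda>a. return (X \<Otimes>\<^sub>M A) (x, a))) \<partial>?\<nu>)"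
    unfolding step_kernel_def by (rule nn_integral_bind[OF f K])
  also have "\<dots> = (\<integral>\<^sup>+x. \<integral>\<^sup>+a. f (x, a) \<partial>\<pi> n (h, x) \<partial>?\<nu>)"
  proof (rule nn_integral_cong)
    fix x assume "x \<in> space ?\<nu>"
    then have x[measurable]: "x \<in> space X" unfolding sp .
    have "(h, x) \<in> space ((\<Pi>\<^sub>M i\<in>{0..<n}. X \<Otimes>\<^sub>M A) \<Otimes>\<^sub>M X)" using h x by (simp add: space_pair_measure)
    then have "\<pi> n (h, x) \<in> space (prob_algebra A)" by (rule measurable_space[OF policy_kernel])
    then have s[measurable_cong]: "sets (\<pi> n (h, x)) = sets A" by (simp add: space_prob_algebra)
    have spA: "space (\<pi> n (h, x)) = space A" by (rule sets_eq_imp_space_eq[OF s])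
    have r: "(\<lambda>a. return (X \<Otimes>\<^sub>M A) (x, a)) \<in> \<pi> n (h, x) \<rightarrow>\<^sub>M subprob_algebra (X \<Otimes>\<^sub>M A)" by measurable
    show "(\<integral>\<^sup>+z. f z \<partial>(\<pi> n (h, x) \<bind> (\<lambda>a. return (X \<Otimes>\<^sub>M A) (x, a)))) = (\<integral>\<^sup>+a. f (x, a) \<partial>\<pi> n (h, x))"
      unfolding nn_integral_bind[OF f r] using x
      by (intro nn_integral_cong nn_integral_return) (auto simp: space_pair_measure spA)
  qed
  finally show ?thesis .
qed

lemma coord_measurable: "(\<lambda>\<omega>. \<omega> t) \<in> trajectory_law \<pi> \<rightarrow>\<^sub>M X \<Otimes>\<^sub>M A"
  unfolding measurable_cong_sets[OF sets_trajectory_law refl] by (rule measurable_component_singleton) simp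

lemma nn_integral_coord:
  assumes [measurable]: "f \<in> borel_measurable (X \<Otimes>\<^sub>M A)"
  shows "(\<integral>\<^sup>+z. f z \<partial>coord_law \<pi> t) = (\<integral>\<^sup>+\<omega>. f (\<omega> t) \<partial>trajectory_law \<pi>)"
  unfolding coord_law_def using coord_measurable[of t] by (subst nn_integral_distr) simp_all

lemma nn_integral_coord_kernel:
  assumes [measurable]: "f \<in> borel_measurable (X \<Otimes>\<^sub>M A)"
  shows "(\<integral>\<^sup>+z. f z \<partial>coord_law \<pi> t) = (\<integral>\<^sup>+h. \<integral>\<^sup>+z. f z \<partial>step_kernel \<pi> t h \<partial>history_law \<pi> t)"
proof -
  have m: "(\<lambda>h. f (h t)) \<in> borel_measurable (PiM {0..<Suc t} (\<lambda>_. X \<Otimes>\<^sub>M A))" by measurable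
  show ?thesis
    using nn_integral_trajectory_history[OF m] nn_integral_history_Suc[OF m] by (simp add: nn_integral_coord)
qed

lemma nn_integral_coord_history:
  assumes f: "f \<in> borel_measurable (X \<Otimes>\<^sub>M A)"
  shows "(\<integral>\<^sup>+z. f z \<partial>coord_law \<pi> t) = (\<integral>\<^sup>+h. f (h t) \<partial>history_law \<pi> (Suc t))"
proof -
  note [measurable] = f
  have m: "(\<lambda>h. f (h t)) \<in> borel_measurable (PiM {0..<Suc t} (\<lambda>_. X \<Otimes>\<^sub>M A))" by measurable
  show ?thesis using nn_integral_trajectory_history[OF m] by (simp add: nn_integral_coord[OF f])
qed

lemma nn_integral_policy_const:
  assumes "h \<in> space (PiM {0..<n} (\<lambda>_. X \<Otimes>\<^sub>M A))" "x \<in> space X"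
  shows "(\<integral>\<^sup>+a. k \<partial>\<pi> n (h, x)) = (k :: ennreal)"
proof -
  have "(h, x) \<in> space ((\<Pi>\<^sub>M i\<in>{0..<n}. X \<Otimes>\<^sub>M A) \<Otimes>\<^sub>M X)" using assms by (simp add: space_pair_measure)
  then have "\<pi> n (h, x) \<in> space (prob_algebra A)" by (rule measurable_space[OF policy_kernel])
  then interpret prob_space "\<pi> n (h, x)" by (simp add: space_prob_algebra)
  show ?thesis by (simp add: emeasure_space_1)
qed

lemma nn_integral_coord_initial:
  assumes [measurable]: "g \<in> borel_measurable X"
  shows "(\<integral>\<^sup>+z. g (fst z) \<partial>coord_law \<pi> 0) = (\<integral>\<^sup>+x. g x \<partial>\<mu>)"
proof -
  have sp: "space \<mu> = space X" using initial by (auto simp: space_prob_algebra dest: sets_eq_imp_space_eq)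
  have pr: "prob_space (history_law \<pi> 0)" unfolding history_law_def by (rule IT.prob_space_C) simp
  have "(\<integral>\<^sup>+z. g (fst z) \<partial>coord_law \<pi> 0) = (\<integral>\<^sup>+h. \<integral>\<^sup>+x. g x \<partial>\<mu> \<partial>history_law \<pi> 0)"
    by (subst nn_integral_coord_kernel)
       (auto intro!: nn_integral_cong simp: nn_integral_step_kernel space_history_law nn_integral_policy_const sp simp del: nn_integral_const)
  then show ?thesis using prob_space.emeasure_space_1[OF pr] by simp
qed

text \<open>The Markov property of the states: given the pair at time \<open>t\<close>, the next state has
  law \<open>p\<close>, whatever the earlier history and the policy.\<close>

lemma nn_integral_coord_transition:
  assumes k[measurable]: "k \<in> borel_measurable ((X \<Otimes>\<^sub>M A) \<Otimes>\<^sub>M X)"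
  shows "(\<integral>\<^sup>+\<omega>. k (\<omega> t, fst (\<omega> (Suc t))) \<partial>trajectory_law \<pi>) = (\<integral>\<^sup>+z. \<integral>\<^sup>+y. k (z, y) \<partial>p z \<partial>coord_law \<pi> t)"
proof -
  have m: "(\<lambda>h. k (h t, fst (h (Suc t)))) \<in> borel_measurable (PiM {0..<Suc (Suc t)} (\<lambda>_. X \<Otimes>\<^sub>M A))" by measurable
  have m2: "(\<lambda>z. \<integral>\<^sup>+y. k (z, y) \<partial>p z) \<in> borel_measurable (X \<Otimes>\<^sub>M A)"
    using k measurable_prob_algebraD[OF transition] by (intro nn_integral_measurable_subprob_algebra2) auto
  have "(\<integral>\<^sup>+\<omega>. k (\<omega> t, fst (\<omega> (Suc t))) \<partial>trajectory_law \<pi>) =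
      (\<integral>\<^sup>+h. \<integral>\<^sup>+z. k (h t, fst z) \<partial>step_kernel \<pi> (Suc t) h \<partial>history_law \<pi> (Suc t))"
    using nn_integral_trajectory_history[OF m] nn_integral_history_Suc[OF m] by simp
  also have "\<dots> = (\<integral>\<^sup>+h. \<integral>\<^sup>+y. k (h t, y) \<partial>p (h t) \<partial>history_law \<pi> (Suc t))"
  proof (rule nn_integral_cong)
    fix h assume "h \<in> space (history_law \<pi> (Suc t))"
    then have h: "h \<in> space (PiM {0..<Suc t} (\<lambda>_. X \<Otimes>\<^sub>M A))" by (simp add: space_history_law)
    then have ht[measurable]: "h t \<in> space (X \<Otimes>\<^sub>M A)" by (auto simp: space_PiM PiE_iff)
    have "p (h t) \<in> space (prob_algebra X)" by (rule measurable_space[OF transition ht])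
    then have sp: "space (p (h t)) = space X" by (auto simp: space_prob_algebra dest: sets_eq_imp_space_eq)
    have "(\<lambda>z. k (h t, fst z)) \<in> borel_measurable (X \<Otimes>\<^sub>M A)" by measurable
    from nn_integral_step_kernel[OF h this]
    have "(\<integral>\<^sup>+z. k (h t, fst z) \<partial>step_kernel \<pi> (Suc t) h) = (\<integral>\<^sup>+x. \<integral>\<^sup>+a. k (h t, x) \<partial>\<pi> (Suc t) (h, x) \<partial>p (h t))"
      by simp
    also have "\<dots> = (\<integral>\<^sup>+y. k (h t, y) \<partial>p (h t))"
      by (intro nn_integral_cong nn_integral_policy_const h) (simp add: sp)
    finally show "(\<integral>\<^sup>+z. k (h t, fst z) \<partial>step_kernel \<pi> (Suc t) h) = (\<integral>\<^sup>+y. k (h t, y) \<partial>p (h t))" .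
  qed
  also have "\<dots> = (\<integral>\<^sup>+z. \<integral>\<^sup>+y. k (z, y) \<partial>p z \<partial>coord_law \<pi> t)"
    by (rule nn_integral_coord_history[OF m2, symmetric])
  finally show ?thesis .
qed

text \<open>If the conditional expectation of \<open>f\<close> given history and state depends on the state
  only, the history integrates out.\<close>

lemma nn_integral_coord_disintegrate:
  assumes f: "f \<in> borel_measurable (X \<Otimes>\<^sub>M A)" and k: "k \<in> borel_measurable X"
    and eq: "\<And>h x. h \<in> space (PiM {0..<t} (\<lambda>_. X \<Otimes>\<^sub>M A)) \<Longrightarrow> x \<in> space X \<Longrightarrow> (\<integral>\<^sup>+a. f (x, a) \<partial>\<pi> t (h, x)) = k x"
  shows "(\<integral>\<^sup>+z. f z \<partial>coord_law \<pi> t) = (\<integral>\<^sup>+z. k (fst z) \<partial>coord_law \<pi> t)"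
proof -
  have k': "(\<lambda>z. k (fst z)) \<in> borel_measurable (X \<Otimes>\<^sub>M A)" using k by measurable
  show ?thesis
    unfolding nn_integral_coord_kernel[OF f] nn_integral_coord_kernel[OF k']
  proof (rule nn_integral_cong)
    fix h assume "h \<in> space (history_law \<pi> t)"
    then have h: "h \<in> space (PiM {0..<t} (\<lambda>_. X \<Otimes>\<^sub>M A))" by (simp add: space_history_law)
    have sp: "space (if t = 0 then \<mu> else p (h (t - 1))) = space X"
    proof (cases "t = 0")
      case False
      then have "h (t - 1) \<in> space (X \<Otimes>\<^sub>M A)" using h by (auto simp: space_PiM PiE_iff)
      then have "p (h (t - 1)) \<in> space (prob_algebra X)" by (rule measurable_space[OF transition])
      with False show ?thesis by (auto simp: space_prob_algebra dest: sets_eq_imp_space_eq)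
    qed (use initial in \<open>auto simp: space_prob_algebra dest: sets_eq_imp_space_eq\<close>)
    show "(\<integral>\<^sup>+z. f z \<partial>step_kernel \<pi> t h) = (\<integral>\<^sup>+z. k (fst z) \<partial>step_kernel \<pi> t h)"
      unfolding nn_integral_step_kernel[OF h f] nn_integral_step_kernel[OF h k']
    proof (rule nn_integral_cong)
      fix x assume "x \<in> space (if t = 0 then \<mu> else p (h (t - 1)))"
      then have x: "x \<in> space X" unfolding sp .
      show "(\<integral>\<^sup>+a. f (x, a) \<partial>\<pi> t (h, x)) = (\<integral>\<^sup>+a. k (fst (x, a)) \<partial>\<pi> t (h, x))"
        unfolding eq[OF h x] fst_conv nn_integral_policy_const[OF h x] ..
    qed
  qed
qed

lemma AE_coord_graph: "AE z in coord_law \<pi> t. z \<in> {(x, a). x \<in> space X \<and> a \<in> Act x}"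
proof -
  let ?G = "{(x, a). x \<in> space X \<and> a \<in> Act x}"
  have N[measurable]: "space (X \<Otimes>\<^sub>M A) - ?G \<in> sets (X \<Otimes>\<^sub>M A)" using Act_graph by measurable
  have "(\<integral>\<^sup>+z. indicator (space (X \<Otimes>\<^sub>M A) - ?G) z \<partial>coord_law \<pi> t) = (\<integral>\<^sup>+z. (\<lambda>_. 0) (fst z) \<partial>coord_law \<pi> t)"
  proof (rule nn_integral_coord_disintegrate)
    fix h x assume h: "h \<in> space (PiM {0..<t} (\<lambda>_. X \<Otimes>\<^sub>M A))" and x: "x \<in> space X"
    have hx: "(h, x) \<in> space (histories t)" using h x by (simp add: histories_def space_pair_measure)
    then have "\<pi> t (h, x) \<in> space (prob_algebra A)" using policy_kernel[of t] by (auto simp: histories_def dest: measurable_space)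
    then have s: "sets (\<pi> t (h, x)) = sets A" and "prob_space (\<pi> t (h, x))" by (auto simp: space_prob_algebra)
    then interpret P: prob_space "\<pi> t (h, x)" by simp
    have "P.prob (Act x) = 1" using \<pi> hx by (auto simp: policies_def)
    then have "AE a in \<pi> t (h, x). a \<in> Act x"
      using Act_sets[OF x] s by (subst P.AE_in_set_eq_1) auto
    then have "(\<integral>\<^sup>+a. indicator (space (X \<Otimes>\<^sub>M A) - ?G) (x, a) \<partial>\<pi> t (h, x)) = (\<integral>\<^sup>+a. 0 \<partial>\<pi> t (h, x))"
      using x by (intro nn_integral_cong_AE) (auto simp: indicator_def elim!: eventually_mono)
    then show "(\<integral>\<^sup>+a. indicator (space (X \<Otimes>\<^sub>M A) - ?G) (x, a) \<partial>\<pi> t (h, x)) = 0" by simp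
  qed (use N in simp_all)
  then have "emeasure (coord_law \<pi> t) (space (X \<Otimes>\<^sub>M A) - ?G) = 0" by (simp add: coord_law_def)
  then show ?thesis by (intro AE_I[where N="space (X \<Otimes>\<^sub>M A) - ?G"]) (auto simp: coord_law_def)
qed

end

end

section \<open>Policies and plans\<close>

lemma measure_eqI_nn_integral:
  assumes "sets M = sets L" "sets N = sets L"
    and "\<And>f. f \<in> borel_measurable L \<Longrightarrow> (\<integral>\<^sup>+x. f x \<partial>M) = (\<integral>\<^sup>+x. f x \<partial>N)"
  shows "M = N"
proof (rule measure_eqI)
  fix E assume "E \<in> sets M"
  then show "emeasure M E = emeasure N E" using assms(3)[of "indicator E"] assms(1,2) by simp
qed (use assms in simp)

sublocale absorbing_mdp \<subseteq> cb: control_base X A Act p \<mu> xbar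
proof
  obtain abar where abar: "abar \<in> space A" "Act xbar = {abar}" "measure (p (xbar, abar)) {xbar} = 1"
    using absorbing by blast
  show "real_retract X" using xbar_state by (intro real_retract_standard_borel standard_borel_states) auto
  show "real_retract A" using abar(1) by (intro real_retract_standard_borel standard_borel_actions) auto
  show "emeasure (p (xbar, a)) {xbar} = 1" if "a \<in> Act xbar" for a
  proof -
    have "p (xbar, abar) \<in> space (prob_algebra X)"
      using abar(1) xbar_state by (intro measurable_space[OF transition]) (simp add: space_pair_measure)
    then interpret prob_space "p (xbar, abar)" by (simp add: space_prob_algebra)
    show ?thesis using that abar by (simp add: emeasure_eq_measure)
  qed
qed (use Act_graph selector_exists transition initial xbar_state in auto)

lemma less_hitting_time_iff: "enat t < hitting_time y \<omega> \<longleftrightarrow> (\<forall>s\<le>t. fst (\<omega> s) \<noteq> y)"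
proof
  assume less: "enat t < hitting_time y \<omega>"
  show "\<forall>s\<le>t. fst (\<omega> s) \<noteq> y"
  proof (intro allI impI notI)
    fix s assume "s \<le> t" "fst (\<omega> s) = y"
    then have "hitting_time y \<omega> \<le> enat s" unfolding hitting_time_def by (intro Inf_lower) blast
    also have "\<dots> \<le> enat t" using \<open>s \<le> t\<close> by simp
    finally show False using less by simp
  qed
next
  assume *: "\<forall>s\<le>t. fst (\<omega> s) \<noteq> y"
  have "enat (Suc t) \<le> hitting_time y \<omega>"
    unfolding hitting_time_def
  proof (rule Inf_greatest)
    fix z assume "z \<in> {enat s |s. fst (\<omega> s) = y}"
    then obtain s where s: "z = enat s" "fst (\<omega> s) = y" by blast
    then have "\<not> s \<le> t" using * by blast
    then show "enat (Suc t) \<le> z" using s(1) by simp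
  qed
  moreover have "enat t < enat (Suc t)" by simp
  ultimately show "enat t < hitting_time y \<omega>" by (rule order.strict_trans2[rotated])
qed

context absorbing_mdp begin

lemma coord_law_space [simp]: "sets (coord_law \<pi> t) = sets (X \<Otimes>\<^sub>M A)" "space (coord_law \<pi> t) = space (X \<Otimes>\<^sub>M A)"
  by (simp_all add: coord_law_def)

text \<open>The seeds are integrated out; the history is ignored.\<close>

definition policy_of :: "(nat \<Rightarrow> 'x \<times> real \<Rightarrow> 'a) \<Rightarrow> nat \<Rightarrow> (nat \<Rightarrow> 'x \<times> 'a) \<times> 'x \<Rightarrow> 'a measure" where
  "policy_of c t hx = distr unif A (\<lambda>u. c t (snd hx, u))"

lemma plan_section: "c \<in> cb.plans \<Longrightarrow> x \<in> space X \<Longrightarrow> (\<lambda>u. c t (x, u)) \<in> unif \<rightarrow>\<^sub>M A"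
proof -
  assume c: "c \<in> cb.plans" and x[measurable]: "x \<in> space X"
  note [measurable] = cb.plans_measurable[OF c]
  show ?thesis by measurable
qed

lemma policy_of_policies:
  assumes c: "c \<in> cb.plans"
  shows "policy_of c \<in> policies"
proof -
  note [measurable] = cb.plans_measurable[OF c]
  have "policy_of c t \<in> histories t \<rightarrow>\<^sub>M prob_algebra A" for t
    unfolding policy_of_def[abs_def]
  proof (rule measurable_distr_prob_space2[where M=borel])
    show "(\<lambda>_. unif) \<in> histories t \<rightarrow>\<^sub>M prob_algebra borel" by simp
    show "(\<lambda>(hx, u). c t (snd hx, u)) \<in> histories t \<Otimes>\<^sub>M borel \<rightarrow>\<^sub>M A" unfolding histories_def by measurable
  qed
  moreover have "measure (policy_of c t (h, x)) (Act x) = 1" if "(h, x) \<in> space (histories t)" for t h x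
  proof -
    have x: "x \<in> space X" using that by (simp add: histories_def space_pair_measure)
    have "(\<lambda>u. c t (x, u)) -` Act x \<inter> space unif = UNIV" using cb.plans_Act[OF c x] by auto
    then show ?thesis
      using unif.prob_space by (simp add: policy_of_def measure_distr[OF plan_section[OF c x] Act_sets[OF x]])
  qed
  ultimately show ?thesis by (auto simp: policies_def)
qed

lemma singleton_action: "a \<in> space A \<Longrightarrow> {a} \<in> sets A"
proof -
  assume a: "a \<in> space A"
  have "Measurable.pred A (\<lambda>b. b = a)" using a by (intro cb.sets_eq_maps) auto
  then have "{b \<in> space A. b = a} \<in> sets A" by (simp add: pred_def)
  moreover have "{b \<in> space A. b = a} = {a}" using a by auto
  ultimately show ?thesis by simp
qed

lemma policy_of_pure:
  assumes d: "d \<in> cb.pure_plans"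
  shows "policy_of d \<in> nonrandomized_markov_policies"
proof -
  have dp: "d \<in> cb.plans" using d cb.pure_plans_subset by blast
  have "\<exists>a\<in>space A. measure (policy_of d t hx) {a} = 1" if hx: "hx \<in> space (histories t)" for t hx
  proof -
    obtain \<psi> where \<psi>: "\<psi> \<in> cb.selectors" "d t = cb.pure \<psi>" using d by (auto simp: cb.pure_plans_def)
    have x: "snd hx \<in> space X" using hx by (auto simp: histories_def space_pair_measure)
    have a: "\<psi> (snd hx) \<in> space A" using \<psi>(1) x by (auto simp: cb.selectors_def intro: measurable_space)
    have "measure (policy_of d t hx) {\<psi> (snd hx)} = 1"
      using measure_distr[OF plan_section[OF dp x, of t] singleton_action[OF a]] unif.prob_space
      by (simp add: policy_of_def \<psi>(2))
    then show ?thesis using a by blast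
  qed
  then show ?thesis
    using policy_of_policies[OF dp] by (auto simp: nonrandomized_markov_policies_def nonrandomized_def markov_def policy_of_def)
qed

lemma policy_of_selector:
  assumes \<phi>: "\<phi> \<in> cb.selectors"
  shows "policy_of (\<lambda>_. cb.pure \<phi>) \<in> deterministic_policies"
proof -
  have "(\<lambda>_. cb.pure \<phi>) \<in> cb.pure_plans" using \<phi> by (auto simp: cb.pure_plans_def)
  from policy_of_pure[OF this] show ?thesis
    by (auto simp: nonrandomized_markov_policies_def deterministic_policies_def stationary_def policy_of_def)
qed

text \<open>The state law and the pair law are identified together, by induction on time: the state law at
  time \<open>t + 1\<close> is determined by the pair law at time \<open>t\<close>.\<close>

lemma coord_law_policy_of:
  assumes c: "c \<in> cb.plans"
  shows "coord_law (policy_of c) t = cb.pair_law c t"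
proof -
  note \<pi> = policy_of_policies[OF c]
  note [measurable] = cb.plans_measurable[OF c]
  have "(\<forall>g\<in>borel_measurable X. (\<integral>\<^sup>+z. g (fst z) \<partial>coord_law (policy_of c) t) = (\<integral>\<^sup>+x. g x \<partial>cb.law c t)) \<and>
    coord_law (policy_of c) t = cb.pair_law c t"
  proof (induction t)
    have joint: "coord_law (policy_of c) t = cb.pair_law c t"
      if marg: "\<forall>g\<in>borel_measurable X. (\<integral>\<^sup>+z. g (fst z) \<partial>coord_law (policy_of c) t) = (\<integral>\<^sup>+x. g x \<partial>cb.law c t)" for t
    proof (rule measure_eqI_nn_integral[where L="X \<Otimes>\<^sub>M A"])
      fix f :: "'x \<times> 'a \<Rightarrow> ennreal" assume f[measurable]: "f \<in> borel_measurable (X \<Otimes>\<^sub>M A)"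
      define k where "k x = (\<integral>\<^sup>+u. f (x, c t (x, u)) \<partial>unif)" for x
      have k: "k \<in> borel_measurable X" unfolding k_def[abs_def] by measurable
      have "(\<integral>\<^sup>+z. f z \<partial>coord_law (policy_of c) t) = (\<integral>\<^sup>+z. k (fst z) \<partial>coord_law (policy_of c) t)"
      proof (rule nn_integral_coord_disintegrate[OF \<pi> f k])
        fix h x assume x: "x \<in> space X"
        have "(\<lambda>a. f (x, a)) \<in> borel_measurable A" using x by measurable
        then show "(\<integral>\<^sup>+a. f (x, a) \<partial>policy_of c t (h, x)) = k x"
          unfolding policy_of_def k_def using plan_section[OF c x, of t] by (subst nn_integral_distr) simp_all
      qed
      also have "\<dots> = (\<integral>\<^sup>+x. k x \<partial>cb.law c t)" using marg k by blast
      also have "\<dots> = (\<integral>\<^sup>+z. f z \<partial>cb.pair_law c t)" by (simp add: cb.nn_integral_pair_law[OF c f] k_def)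
      finally show "(\<integral>\<^sup>+z. f z \<partial>coord_law (policy_of c) t) = (\<integral>\<^sup>+z. f z \<partial>cb.pair_law c t)" .
    qed simp_all
    {
      case 0
      show ?case using joint[of 0] nn_integral_coord_initial[OF \<pi>] by simp
    next
      case (Suc t)
      have "(\<integral>\<^sup>+z. g (fst z) \<partial>coord_law (policy_of c) (Suc t)) = (\<integral>\<^sup>+x. g x \<partial>cb.law c (Suc t))"
        if g[measurable]: "g \<in> borel_measurable X" for g
      proof -
        have g': "(\<lambda>z. g (fst z)) \<in> borel_measurable (X \<Otimes>\<^sub>M A)" by measurable
        have "(\<integral>\<^sup>+z. g (fst z) \<partial>coord_law (policy_of c) (Suc t)) = (\<integral>\<^sup>+z. \<integral>\<^sup>+y. g y \<partial>p z \<partial>coord_law (policy_of c) t)"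
          unfolding nn_integral_coord[OF \<pi> g'] using nn_integral_coord_transition[OF \<pi>, of "\<lambda>z. g (snd z)" t] by simp
        also have "\<dots> = (\<integral>\<^sup>+x. g x \<partial>(cb.pair_law c t \<bind> p))"
          using Suc by (simp add: nn_integral_bind_prob[OF g] measurable_cong_sets[OF cb.sets_pair_law refl] transition)
        finally show ?thesis by (simp add: cb.law_Suc_pair_law[OF c])
      qed
      then show ?case using joint[of "Suc t"] by simp
    }
  qed
  then show ?thesis by simp
qed

text \<open>The disintegrated actions depend on the current state only, yet the laws agree at every time,
  because the state law at time \<open>t + 1\<close> is a function of the pair law at time
  \<open>t\<close>.\<close>

lemma plan_of_policy:
  assumes \<pi>: "\<pi> \<in> policies"
  shows "\<exists>c\<in>cb.plans. \<forall>t. cb.pair_law c t = coord_law \<pi> t"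
proof -
  obtain s where s: "s \<in> X \<rightarrow>\<^sub>M A" "\<forall>x\<in>space X. s x \<in> Act x" using selector_exists by blast
  interpret T: prob_space "trajectory_law \<pi>" by (rule prob_space_trajectory_law[OF \<pi>])
  have prob: "prob_space (coord_law \<pi> t)" for t
    unfolding coord_law_def by (rule T.prob_space_distr[OF coord_measurable[OF \<pi>]])
  have "\<exists>c\<in>cb.controls. act_law X A (distr (coord_law \<pi> t) X fst) c = coord_law \<pi> t" for t
  proof -
    interpret Q: prob_space "coord_law \<pi> t" by (rule prob)
    have "\<exists>c \<in> X \<Otimes>\<^sub>M borel \<rightarrow>\<^sub>M A. (\<forall>x\<in>space X. \<forall>u. (x, c (x, u)) \<in> cb.Gr) \<and> act_law X A (distr (coord_law \<pi> t) X fst) c = coord_law \<pi> t"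
    proof (rule disintegration[OF Q.finite_measure_axioms coord_law_space(1) cb.A_retract cb.Gr_sets _ s(1)])
      show "AE z in coord_law \<pi> t. z \<in> cb.Gr" unfolding cb.Gr_def by (rule AE_coord_graph[OF \<pi>])
      show "(x, s x) \<in> cb.Gr" if "x \<in> space X" for x using s(2) that by (simp add: cb.Gr_def)
    qed
    then show ?thesis by (auto simp: cb.controls_def cb.Gr_def)
  qed
  then obtain c where c: "\<And>t. c t \<in> cb.controls" "\<And>t. act_law X A (distr (coord_law \<pi> t) X fst) (c t) = coord_law \<pi> t" by metis
  have cp: "c \<in> cb.plans" using c(1) by (rule cb.plansI)
  have fst_m: "fst \<in> coord_law \<pi> t \<rightarrow>\<^sub>M X" for t by (simp add: measurable_cong_sets[OF coord_law_space(1) refl])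
  have law: "cb.law c t = distr (coord_law \<pi> t) X fst" for t
  proof (induction t)
    case 0
    show ?case
      using initial
      by (intro measure_eqI_nn_integral[where L=X])
         (auto simp: space_prob_algebra nn_integral_distr[OF fst_m] nn_integral_coord_initial[OF \<pi>])
  next
    case (Suc t)
    then have pl: "cb.pair_law c t = coord_law \<pi> t" by (simp add: cb.pair_law_def c(2))
    show ?case
    proof (rule measure_eqI_nn_integral[where L=X])
      show "sets (cb.law c (Suc t)) = sets X" by (rule cb.sets_law[OF cp])
      fix g :: "'x \<Rightarrow> ennreal" assume g[measurable]: "g \<in> borel_measurable X"
      have g': "(\<lambda>z. g (fst z)) \<in> borel_measurable (X \<Otimes>\<^sub>M A)" by measurable
      have "(\<integral>\<^sup>+x. g x \<partial>cb.law c (Suc t)) = (\<integral>\<^sup>+z. \<integral>\<^sup>+y. g y \<partial>p z \<partial>coord_law \<pi> t)"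
        by (simp add: cb.law_Suc_pair_law[OF cp] pl nn_integral_bind_prob[OF g] measurable_cong_sets[OF coord_law_space(1) refl] transition)
      also have "\<dots> = (\<integral>\<^sup>+x. g x \<partial>distr (coord_law \<pi> (Suc t)) X fst)"
        using nn_integral_coord_transition[OF \<pi>, of "\<lambda>z. g (snd z)" t]
        by (simp add: nn_integral_distr[OF fst_m] nn_integral_coord[OF \<pi> g'])
      finally show "(\<integral>\<^sup>+x. g x \<partial>cb.law c (Suc t)) = (\<integral>\<^sup>+x. g x \<partial>distr (coord_law \<pi> (Suc t)) X fst)" .
    qed simp
  qed
  have "cb.pair_law c t = coord_law \<pi> t" for t unfolding cb.pair_law_def law c(2) ..
  then show ?thesis using cp by blast
qed

text \<open>The absorbing state is almost surely never left, so at time \<open>t\<close> it has not been hit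
  before if and only if it is not occupied now.\<close>

lemma AE_absorbed:
  assumes \<pi>: "\<pi> \<in> policies"
  shows "AE \<omega> in trajectory_law \<pi>. \<forall>t. enat t < hitting_time xbar \<omega> \<longleftrightarrow> fst (\<omega> t) \<noteq> xbar"
proof -
  note [measurable] = cb.singleton_xb
  have "AE \<omega> in trajectory_law \<pi>. fst (\<omega> t) = xbar \<longrightarrow> fst (\<omega> (Suc t)) = xbar" for t
  proof -
    define k :: "('x \<times> 'a) \<times> 'x \<Rightarrow> ennreal" where "k z = indicator {xbar} (fst (fst z)) * indicator (space X - {xbar}) (snd z)" for z
    have k: "k \<in> borel_measurable ((X \<Otimes>\<^sub>M A) \<Otimes>\<^sub>M X)" unfolding k_def[abs_def] by measurable
    have m: "(\<lambda>\<omega>. (\<omega> t, fst (\<omega> (Suc t)))) \<in> trajectory_law \<pi> \<rightarrow>\<^sub>M (X \<Otimes>\<^sub>M A) \<Otimes>\<^sub>M X"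
      using coord_measurable[OF \<pi>, of t] coord_measurable[OF \<pi>, of "Suc t"]
      by (intro measurable_Pair measurable_compose[OF _ measurable_fst])
    have "(\<integral>\<^sup>+\<omega>. k (\<omega> t, fst (\<omega> (Suc t))) \<partial>trajectory_law \<pi>) = (\<integral>\<^sup>+z. \<integral>\<^sup>+y. k (z, y) \<partial>p z \<partial>coord_law \<pi> t)"
      by (rule nn_integral_coord_transition[OF \<pi> k])
    also have "\<dots> = (\<integral>\<^sup>+z. 0 \<partial>coord_law \<pi> t)"
      using AE_coord_graph[OF \<pi>, of t]
    proof (intro nn_integral_cong_AE, eventually_elim)
      case (elim z)
      show "(\<integral>\<^sup>+y. k (z, y) \<partial>p z) = 0"
      proof (cases "fst z = xbar")
        case True
        then have z: "z = (xbar, snd z)" by (cases z) simp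
        have "snd z \<in> Act xbar" using elim True by (cases z) auto
        then have "AE y in p (xbar, snd z). y = xbar" by (rule cb.AE_p_xb)
        then have "AE y in p z. y = xbar" by (subst z)
        then have "AE y in p z. k (z, y) = 0" by eventually_elim (simp add: k_def)
        from nn_integral_cong_AE[OF this] have "(\<integral>\<^sup>+y. k (z, y) \<partial>p z) = (\<integral>\<^sup>+y. 0 \<partial>p z)" .
        then show ?thesis by simp
      qed (simp add: k_def)
    qed
    finally have "(\<integral>\<^sup>+\<omega>. k (\<omega> t, fst (\<omega> (Suc t))) \<partial>trajectory_law \<pi>) = 0" by simp
    then have "AE \<omega> in trajectory_law \<pi>. k (\<omega> t, fst (\<omega> (Suc t))) = 0"
      using measurable_compose[OF m k] by (subst (asm) nn_integral_0_iff_AE) auto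
    then show ?thesis using AE_space
    proof eventually_elim
      case (elim \<omega>)
      then have "fst (\<omega> (Suc t)) \<in> space X"
        using measurable_space[OF m elim(2)] by (auto simp: space_pair_measure)
      then show ?case using elim(1) by (auto simp: k_def indicator_def split: if_splits)
    qed
  qed
  then have "AE \<omega> in trajectory_law \<pi>. \<forall>t. fst (\<omega> t) = xbar \<longrightarrow> fst (\<omega> (Suc t)) = xbar"
    by (simp add: AE_all_countable)
  then show ?thesis
  proof eventually_elim
    case (elim \<omega>)
    have "fst (\<omega> (s + n)) = xbar" if "fst (\<omega> s) = xbar" for s n
      using that elim by (induction n) auto
    then have "fst (\<omega> t) = xbar" if "fst (\<omega> s) = xbar" "s \<le> t" for s t
      using that by (metis le_add_diff_inverse)
    then show ?case by (auto simp: less_hitting_time_iff)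
  qed
qed

lemma expected_lifetime_after:
  assumes \<pi>: "\<pi> \<in> policies" and c: "c \<in> cb.plans" "\<And>t. cb.pair_law c t = coord_law \<pi> t"
  shows "(\<integral>\<^sup>+\<omega>. (\<Sum>t. if n \<le> t \<and> enat t < hitting_time xbar \<omega> then 1 else 0) \<partial>trajectory_law \<pi>) =
    (\<Sum>t. if n \<le> t then ennreal (cb.alive c t) else 0)"
proof -
  let ?i = "\<lambda>z :: 'x \<times> 'a. indicator (- {xbar}) (fst z) :: ennreal"
  have i: "?i \<in> borel_measurable (X \<Otimes>\<^sub>M A)" by measurable
  have "(\<integral>\<^sup>+\<omega>. (\<Sum>t. if n \<le> t \<and> enat t < hitting_time xbar \<omega> then 1 else 0) \<partial>trajectory_law \<pi>) =
      (\<integral>\<^sup>+\<omega>. (\<Sum>t. if n \<le> t then ?i (\<omega> t) else 0) \<partial>trajectory_law \<pi>)"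
    using AE_absorbed[OF \<pi>]
    by (intro nn_integral_cong_AE, eventually_elim) (auto simp: indicator_def intro!: suminf_cong)
  also have "\<dots> = (\<Sum>t. \<integral>\<^sup>+\<omega>. (if n \<le> t then ?i (\<omega> t) else 0) \<partial>trajectory_law \<pi>)"
    using measurable_compose[OF coord_measurable[OF \<pi>] i] by (intro nn_integral_suminf) (simp split: if_split)
  also have "\<dots> = (\<Sum>t. if n \<le> t then ennreal (cb.alive c t) else 0)"
    by (intro suminf_cong) (simp add: cb.ennreal_alive[OF c(1)] c(2) nn_integral_coord[OF \<pi> i])
  finally show ?thesis .
qed

lemma performance_eq_val:
  assumes \<pi>: "\<pi> \<in> policies" and c: "c \<in> cb.plans" "\<And>t. cb.pair_law c t = coord_law \<pi> t"
    and sum: "summable (cb.alive c)"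
  shows "performance \<pi> $ k = cb.val c (\<lambda>z. r z $ k)"
proof -
  interpret T: prob_space "trajectory_law \<pi>" by (rule prob_space_trajectory_law[OF \<pi>])
  note [measurable] = coord_measurable[OF \<pi>] reward_measurable cb.singleton_xb
  obtain B where B: "\<And>z. z \<in> space (X \<Otimes>\<^sub>M A) \<Longrightarrow> norm (r z) \<le> B"
    using reward_bounded by (auto simp: space_pair_measure)
  have i: "(\<lambda>z. indicator (- {xbar}) (fst z) :: real) \<in> borel_measurable (X \<Otimes>\<^sub>M A)" by measurable
  define f where "f t \<omega> = indicator (- {xbar}) (fst (\<omega> t)) *\<^sub>R r (\<omega> t)" for t and \<omega> :: "nat \<Rightarrow> 'x \<times> 'a"
  have rm: "(\<lambda>z. indicator (- {xbar}) (fst z) *\<^sub>R r z) \<in> borel_measurable (X \<Otimes>\<^sub>M A)" using i by measurable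
  have f_meas: "f t \<in> borel_measurable (trajectory_law \<pi>)" for t
    unfolding f_def[abs_def] by (rule measurable_compose[OF coord_measurable[OF \<pi>] rm])
  have f_bound: "norm (f t \<omega>) \<le> \<bar>B\<bar> * indicator (- {xbar}) (fst (\<omega> t))" if "\<omega> \<in> space (trajectory_law \<pi>)" for t \<omega>
    using B[OF measurable_space[OF coord_measurable[OF \<pi>] that]] by (auto simp: f_def indicator_def intro: order_trans[OF _ abs_ge_self])
  have f_int: "integrable (trajectory_law \<pi>) (f t)" for t
  proof (rule T.integrable_const_bound[where B="\<bar>B\<bar>"])
    show "AE \<omega> in trajectory_law \<pi>. norm (f t \<omega>) \<le> \<bar>B\<bar>"
    proof (rule AE_I2)
      fix \<omega> assume "\<omega> \<in> space (trajectory_law \<pi>)"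
      from f_bound[OF this, of t] show "norm (f t \<omega>) \<le> \<bar>B\<bar>" by (cases "fst (\<omega> t) = xbar") simp_all
    qed
  qed (rule f_meas)
  have im: "(\<lambda>\<omega>. indicator (- {xbar}) (fst (\<omega> t)) :: real) \<in> borel_measurable (trajectory_law \<pi>)" for t
    by (rule measurable_compose[OF coord_measurable[OF \<pi>] i])
  have i_int: "integrable (trajectory_law \<pi>) (\<lambda>\<omega>. indicator (- {xbar}) (fst (\<omega> t)) :: real)" for t
    using im by (intro T.integrable_const_bound[where B=1]) (auto simp: indicator_def)
  have i_alive: "(\<integral>\<omega>. indicator (- {xbar}) (fst (\<omega> t)) \<partial>trajectory_law \<pi>) = cb.alive c t" for t
    unfolding cb.alive_eq[OF c(1)] c(2) coord_law_def using i
    by (subst integral_distr[OF coord_measurable[OF \<pi>]]) simp_all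
  have f_norm: "(\<integral>\<omega>. norm (f t \<omega>) \<partial>trajectory_law \<pi>) \<le> \<bar>B\<bar> * cb.alive c t" for t
  proof -
    have "(\<integral>\<omega>. norm (f t \<omega>) \<partial>trajectory_law \<pi>) \<le> (\<integral>\<omega>. \<bar>B\<bar> * indicator (- {xbar}) (fst (\<omega> t)) \<partial>trajectory_law \<pi>)"
      using f_int i_int f_bound by (intro integral_mono) auto
    then show ?thesis by (simp add: i_alive)
  qed
  have summ: "summable (\<lambda>t. \<integral>\<omega>. norm (f t \<omega>) \<partial>trajectory_law \<pi>)"
    by (rule summable_comparison_test'[where g="\<lambda>t. \<bar>B\<bar> * cb.alive c t" and N=0])
       (use f_norm summable_mult[OF sum, of "\<bar>B\<bar>"] in auto)
  have ae: "AE \<omega> in trajectory_law \<pi>. summable (\<lambda>t. norm (f t \<omega>))"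
  proof -
    have "(\<integral>\<^sup>+\<omega>. (\<Sum>t. ennreal (norm (f t \<omega>))) \<partial>trajectory_law \<pi>) = (\<Sum>t. \<integral>\<^sup>+\<omega>. ennreal (norm (f t \<omega>)) \<partial>trajectory_law \<pi>)"
      using f_meas by (intro nn_integral_suminf) auto
    also have "\<dots> = (\<Sum>t. ennreal (\<integral>\<omega>. norm (f t \<omega>) \<partial>trajectory_law \<pi>))"
      using f_int by (intro suminf_cong nn_integral_eq_integral) auto
    also have "\<dots> = ennreal (\<Sum>t. \<integral>\<omega>. norm (f t \<omega>) \<partial>trajectory_law \<pi>)"
      by (intro suminf_ennreal2 summ) simp
    finally have "(\<integral>\<^sup>+\<omega>. (\<Sum>t. ennreal (norm (f t \<omega>))) \<partial>trajectory_law \<pi>) \<noteq> \<infinity>" by simp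
    then have "AE \<omega> in trajectory_law \<pi>. (\<Sum>t. ennreal (norm (f t \<omega>))) \<noteq> \<infinity>"
      using f_meas by (intro nn_integral_PInf_AE) auto
    then show ?thesis by eventually_elim (auto intro: summable_suminf_not_top)
  qed
  have "performance \<pi> = (\<integral>\<omega>. (\<Sum>t. f t \<omega>) \<partial>trajectory_law \<pi>)"
  proof -
    have fl: "(\<lambda>\<omega>. \<Sum>t. f t \<omega>) \<in> borel_measurable (trajectory_law \<pi>)"
      using borel_measurable_integrable[OF integrable_suminf[OF f_int ae summ]] .
    have "(\<lambda>\<omega>. \<Sum>t. if enat t < hitting_time xbar \<omega> then r (\<omega> t) else 0) \<in> borel_measurable (trajectory_law \<pi>)"
    proof (intro borel_measurable_suminf)
      fix t
      have "Measurable.pred (trajectory_law \<pi>) (\<lambda>\<omega>. fst (\<omega> s) \<in> {xbar})" for s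
        by (rule measurable_compose[OF coord_measurable[OF \<pi>]]) measurable
      then have "Measurable.pred (trajectory_law \<pi>) (\<lambda>\<omega>. enat t < hitting_time xbar \<omega>)"
        unfolding less_hitting_time_iff by (intro pred_intros_countable pred_intros_logic) simp_all
      then show "(\<lambda>\<omega>. if enat t < hitting_time xbar \<omega> then r (\<omega> t) else 0) \<in> borel_measurable (trajectory_law \<pi>)"
        using measurable_compose[OF coord_measurable[OF \<pi>] reward_measurable] by (intro measurable_If) (auto simp: pred_def)
    qed
    then show ?thesis
      unfolding performance_def using AE_absorbed[OF \<pi>]
      by (intro integral_cong_AE fl) (auto simp: f_def indicator_def elim!: eventually_mono intro!: suminf_cong)
  qed
  then have "(\<lambda>t. \<integral>\<omega>. f t \<omega> \<partial>trajectory_law \<pi>) sums performance \<pi>"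
    using sums_integral[OF f_int ae summ] by simp
  then have s: "(\<lambda>t. (\<integral>\<omega>. f t \<omega> \<partial>trajectory_law \<pi>) $ k) sums (performance \<pi> $ k)"
    by (rule bounded_linear.sums[OF bounded_linear_vec_nth])
  have "(\<integral>\<omega>. f t \<omega> \<partial>trajectory_law \<pi>) $ k = cb.rew c (\<lambda>z. r z $ k) t" for t
  proof -
    have "(\<lambda>z. (indicator (- {xbar}) (fst z) *\<^sub>R r z) $ k) \<in> borel_measurable (X \<Otimes>\<^sub>M A)"
      using rm by (rule measurable_compose) (intro borel_measurable_continuous_onI continuous_intros)
    then have km: "(\<lambda>z. indicator (- {xbar}) (fst z) * r z $ k) \<in> borel_measurable (X \<Otimes>\<^sub>M A)" by simp
    have "(\<integral>\<omega>. f t \<omega> \<partial>trajectory_law \<pi>) $ k = (\<integral>\<omega>. f t \<omega> $ k \<partial>trajectory_law \<pi>)"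
      by (rule integral_bounded_linear[OF bounded_linear_vec_nth f_int, symmetric])
    also have "\<dots> = (\<integral>z. indicator (- {xbar}) (fst z) * r z $ k \<partial>coord_law \<pi> t)"
      unfolding coord_law_def using km by (subst integral_distr[OF coord_measurable[OF \<pi>]]) (simp_all add: f_def)
    finally show ?thesis by (simp add: cb.rew_def c(2))
  qed
  then show ?thesis using s by (simp add: cb.val_def sums_iff)
qed

end

theorem theorem3p8:
  fixes X :: "'x measure" and A :: "'a measure" and Act :: "'x \<Rightarrow> 'a set"
    and p :: "'x \<times> 'a \<Rightarrow> 'x measure" and \<mu> :: "'x measure"
    and r :: "'x \<times> 'a \<Rightarrow> real ^ 'n" and xbar :: 'x
  assumes "uniformly_absorbing_mdp X A Act p \<mu> r xbar"
    and "atomless_mdp X A Act p \<mu> r xbar"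
  shows "absorbing_mdp.performance_set X A p \<mu> r xbar (mdp.deterministic_policies X A Act) =
         absorbing_mdp.performance_set X A p \<mu> r xbar (mdp.policies X A Act)"
proof -
  interpret U: uniformly_absorbing_mdp X A Act p \<mu> r xbar by fact
  interpret At: atomless_mdp X A Act p \<mu> r xbar by fact
  define S where "S n = (SUP \<pi>\<in>U.nonrandomized_markov_policies.
    \<integral>\<^sup>+ \<omega>. (\<Sum>t. if n \<le> t \<and> enat t < hitting_time xbar \<omega> then 1 else 0) \<partial>U.trajectory_law \<pi>)" for n
  have S_lim: "S \<longlonglongrightarrow> 0" unfolding S_def[abs_def] by (rule U.uniformly_absorbing)
  then have "\<forall>\<^sub>F n in sequentially. S n < 1" by (rule order_tendstoD(2)) simp
  then obtain N0 where N0: "\<And>n. N0 \<le> n \<Longrightarrow> S n < 1" by (auto simp: eventually_sequentially)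
  have alive0: "0 \<le> U.cb.alive d t" for d t by (simp add: U.cb.alive_def)
  have pure_tail: "(\<Sum>t\<in>{m..<N}. U.cb.alive d t) \<le> enn2real (S m)" if d: "d \<in> U.cb.pure_plans" and m: "N0 \<le> m" for d m N
  proof -
    have dp: "d \<in> U.cb.plans" using d U.cb.pure_plans_subset by blast
    have "ennreal (\<Sum>t\<in>{m..<N}. U.cb.alive d t) = (\<Sum>t\<in>{m..<N}. ennreal (U.cb.alive d t))"
      by (rule sum_ennreal[symmetric]) (rule alive0)
    also have "\<dots> = (\<Sum>t\<in>{m..<N}. if m \<le> t then ennreal (U.cb.alive d t) else 0)"
      by (rule sum.cong) auto
    also have "\<dots> \<le> (\<Sum>t. if m \<le> t then ennreal (U.cb.alive d t) else 0)"
      by (rule sum_le_suminf) auto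
    also have "\<dots> = (\<integral>\<^sup>+ \<omega>. (\<Sum>t. if m \<le> t \<and> enat t < hitting_time xbar \<omega> then 1 else 0) \<partial>U.trajectory_law (U.policy_of d))"
      by (rule U.expected_lifetime_after[OF U.policy_of_policies[OF dp] dp U.coord_law_policy_of[OF dp, symmetric], symmetric])
    also have "\<dots> \<le> S m" unfolding S_def by (rule SUP_upper[OF U.policy_of_pure[OF d]])
    finally have le: "ennreal (\<Sum>t\<in>{m..<N}. U.cb.alive d t) \<le> S m" .
    have "S m < \<top>" using N0[OF m] less_le_trans[of "S m" 1 \<top>] by simp
    from enn2real_mono[OF le this] show ?thesis using alive0 by (simp add: sum_nonneg)
  qed
  \<comment> \<open>the supremum is known to be finite only from \<open>N0\<close> on; each earlier period costs at most 1\<close>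
  define tail where "tail n = (if n < N0 then real N0 else 0) + enn2real (S (max n N0))" for n
  have tail_pure: "(\<Sum>t\<in>{n..<N}. U.cb.alive d t) \<le> tail n" if d: "d \<in> U.cb.pure_plans" for d n N
  proof -
    have dp: "d \<in> U.cb.plans" using d U.cb.pure_plans_subset by blast
    have alive1: "U.cb.alive d t \<le> 1" for t
      unfolding U.cb.alive_def by (intro prob_space.prob_le_1 U.cb.law_prob_space[OF dp])
    have "(\<Sum>t\<in>{n..<N}. U.cb.alive d t) \<le> (\<Sum>t\<in>{n..<N0} \<union> {max n N0..<N}. U.cb.alive d t)"
      by (rule sum_mono2) (auto simp: alive0)
    also have "\<dots> \<le> (\<Sum>t\<in>{n..<N0}. U.cb.alive d t) + (\<Sum>t\<in>{max n N0..<N}. U.cb.alive d t)"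
      by (subst sum.union_disjoint) auto
    also have "(\<Sum>t\<in>{n..<N0}. U.cb.alive d t) \<le> real (card {n..<N0}) * 1"
      using alive1 by (intro sum_bounded_above)
    also have "\<dots> \<le> (if n < N0 then real N0 else 0)" by auto
    also have "(\<Sum>t\<in>{max n N0..<N}. U.cb.alive d t) \<le> enn2real (S (max n N0))"
      by (rule pure_tail[OF d]) simp
    finally show ?thesis by (simp add: tail_def)
  qed
  interpret C: control_model X A Act p \<mu> xbar tail
  proof
    have "(\<lambda>n. enn2real (S n)) \<longlonglongrightarrow> 0" using S_lim by (intro tendsto_enn2real) auto
    moreover have "\<forall>\<^sub>F n in sequentially. enn2real (S n) = tail n"
      unfolding eventually_sequentially by (rule exI[of _ N0]) (auto simp: tail_def max_def)
    ultimately show "tail \<longlonglongrightarrow> 0" by (rule Lim_transform_eventually)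
    show "(\<Sum>t\<in>{n..<N}. U.cb.alive c t) \<le> tail n" if "c \<in> U.cb.plans" for c n N
      using that tail_pure by (rule U.cb.alive_tail_from_pure)
    show "emeasure \<mu> {x} = 0" if "x \<in> U.cb.live" for x
    proof -
      interpret prob_space \<mu> using U.initial by (simp add: space_prob_algebra)
      show ?thesis using At.initial_atomless[OF that] by (simp add: emeasure_eq_measure)
    qed
    show "emeasure (p (x, a)) {y} = 0" if "x \<in> U.cb.live" "y \<in> U.cb.live" "a \<in> Act x" for x y a
    proof -
      have "p (x, a) \<in> space (prob_algebra X)" using that U.cb.Act_space by (intro U.cb.p_prob) auto
      then interpret prob_space "p (x, a)" by (simp add: space_prob_algebra)
      show ?thesis using At.transition_atomless[OF that] by (simp add: emeasure_eq_measure)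
    qed
  qed
  obtain B where B: "\<And>z. z \<in> space (X \<Otimes>\<^sub>M A) \<Longrightarrow> norm (r z) \<le> B"
    using U.reward_bounded by (auto simp: space_pair_measure)
  have bounded: "range (\<lambda>k z. r z $ k) \<subseteq> U.cb.bfun B"
  proof (rule image_subsetI)
    fix k
    have "(\<lambda>z. r z $ k) \<in> borel_measurable (X \<Otimes>\<^sub>M A)"
      using U.reward_measurable by (rule measurable_compose) (intro borel_measurable_continuous_onI continuous_intros)
    then show "(\<lambda>z. r z $ k) \<in> U.cb.bfun B"
      using B component_le_norm_cart order_trans by (fastforce simp: U.cb.bfun_def)
  qed
  have attained: "\<exists>\<pi>'\<in>U.deterministic_policies. U.performance \<pi>' = U.performance \<pi>" if \<pi>: "\<pi> \<in> U.policies" for \<pi>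
  proof -
    obtain c where c: "c \<in> U.cb.plans" "\<And>t. U.cb.pair_law c t = U.coord_law \<pi> t"
      using U.plan_of_policy[OF \<pi>] by blast
    obtain \<phi> where \<phi>: "\<phi> \<in> U.cb.selectors"
      and eq: "\<And>k. U.cb.val (\<lambda>_. U.cb.pure \<phi>) (\<lambda>z. r z $ k) = U.cb.val c (\<lambda>z. r z $ k)"
      using C.plan_attained_by_selector[OF c(1) bounded] by blast
    let ?c = "\<lambda>_::nat. U.cb.pure \<phi>"
    have cp: "?c \<in> U.cb.plans" using U.cb.pure_control[OF \<phi>] by simp
    have "U.performance (U.policy_of ?c) $ k = U.performance \<pi> $ k" for k
      using U.performance_eq_val[OF \<pi> c C.summable_alive[OF c(1)]] eq
        U.performance_eq_val[OF U.policy_of_policies[OF cp] cp U.coord_law_policy_of[OF cp, symmetric] C.summable_alive[OF cp]]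
      by simp
    then have "U.performance (U.policy_of ?c) = U.performance \<pi>" by (simp add: vec_eq_iff)
    then show ?thesis using U.policy_of_selector[OF \<phi>] by blast
  qed
  show ?thesis
  proof
    show "U.performance_set U.deterministic_policies \<subseteq> U.performance_set U.policies"
      by (auto simp: U.performance_set_def U.deterministic_policies_def)
    show "U.performance_set U.policies \<subseteq> U.performance_set U.deterministic_policies"
    proof
      fix v assume "v \<in> U.performance_set U.policies"
      then obtain \<pi> where \<pi>: "\<pi> \<in> U.policies" "v = U.performance \<pi>"
        unfolding U.performance_set_def by blast
      from attained[OF \<pi>(1)] obtain \<pi>' where "\<pi>' \<in> U.deterministic_policies" "v = U.performance \<pi>'"
        unfolding \<pi>(2) by metis
      then show "v \<in> U.performance_set U.deterministic_policies" unfolding U.performance_set_def by blast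
    qed
  qed
qed

end
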